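(* Let $\mathcal M$ be an internal $P^*$-algebra. Then the nonstandard hull $\widehat{\mathcal M}$ is a von Neumann algebra if and only if $\widehat{\mathcal M}$ is finite dimensional.
   Context: Work in a nonstandard universe (in the sense of Robinson's nonstandard analysis) that is $\kappa$-saturated for a sufficiently large uncountable cardinal $\kappa$. All $C^*$-algebras are unital. For $r,s\in{}^*\mathbb R$, $r\approx s$ means $|r-s|<1/n$ for all standard $n\ge1$; $r$ is finite if $|r|<n$ for some standard $n$; ${}^\circ r$ is the standard part of a finite $r$. For an internal $C^*$-algebra $\mathcal M$ (not necessarily given as an algebra of operators), $\mathrm{Fin}(\mathcal M)=\{a\in\mathcal M:\|a\|\text{ finite}\}$, $a\approx b$ means $\|a-b\|\approx0$, $\widehat a=\{x\in\mathcal M:x\approx a\}$, and the nonstandard hull is $\widehat{\mathcal M}=\{\widehat a:a\in\mathrm{Fin}(\mathcal M)\}$, with operations (including the adjoint) induced from representatives and norm $\|\widehat a\|={}^\circ\|a\|$; it is an ordinary $C^*$-algebra. "Von Neumann algebra" has its usual meaning (a unital $C^*$-algebra of operators on a Hilbert space that is closed in the weak, equivalently strong, operator topology). In the case where $\mathcal M\subseteq\mathcal B(\mathcal H)$ for an internal complex Hilbert space $\mathcal H$, the hull $\widehat{\mathcal M}$ is regarded as a $C^*$-subalgebra of $\mathcal B(\widehat{\mathcal H})$ via $\widehat a(\widehat x)=\widehat{a(x)}$, where $\widehat{\mathcal H}$ is the analogously defined nonstandard hull of $\mathcal H$, an ordinary Hilbert space. A (standard) $C^*$-algebra is a $P^*$-algebra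 if each of its self-adjoint elements is a norm limit of elements of the form $\sum_{i=0}^N\alpha_ip_i$, where $N\in\mathbb N$, $\alpha_i\in\mathbb C$ and the $p_i$ are projections of the algebra with $p_ip_j=0$ whenever $i\ne j$. An internal $P^*$-algebra is an internal $C^*$-algebra satisfying the transferred definition (with $N\in{}^*\mathbb N$, $\alpha_i\in{}^*\mathbb C$ and internal families of projections). *)

theory Defs
  imports "HOL-Analysis.Analysis" "HOL-Algebra.Module"
begin

section \<open>C*-algebras and P*-algebras\<close>

definition CC :: "complex ring" where
  "CC = \<lparr>carrier = UNIV, mult = (*), one = 1, zero = 0, add = (+)\<rparr>"

record 'a cstar = "(complex, 'a) module" +
  adj :: "'a \<Rightarrow> 'a"
  nrm :: "'a \<Rightarrow> real"

text \<open>The zero algebra is admitted.\<close>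

definition cstar_algebra :: "'a cstar \<Rightarrow> bool" where
  "cstar_algebra A \<longleftrightarrow>
     ring A \<and> Module.module CC A \<and>
     (\<forall>c. \<forall>x\<in>carrier A. \<forall>y\<in>carrier A.
        c \<odot>\<^bsub>A\<^esub> (x \<otimes>\<^bsub>A\<^esub> y) = (c \<odot>\<^bsub>A\<^esub> x) \<otimes>\<^bsub>A\<^esub> y \<and>
        c \<odot>\<^bsub>A\<^esub> (x \<otimes>\<^bsub>A\<^esub> y) = x \<otimes>\<^bsub>A\<^esub> (c \<odot>\<^bsub>A\<^esub> y)) \<and>
     (\<forall>x\<in>carrier A. adj A x \<in> carrier A \<and> adj A (adj A x) = x) \<and>
     (\<forall>x\<in>carrier A. \<forall>y\<in>carrier A.
        adj A (x \<oplus>\<^bsub>A\<^esub> y) = adj A x \<oplus>\<^bsub>A\<^esub> adj A y \<and>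
        adj A (x \<otimes>\<^bsub>A\<^esub> y) = adj A y \<otimes>\<^bsub>A\<^esub> adj A x) \<and>
     (\<forall>c. \<forall>x\<in>carrier A. adj A (c \<odot>\<^bsub>A\<^esub> x) = cnj c \<odot>\<^bsub>A\<^esub> adj A x) \<and>
     (\<forall>x\<in>carrier A. 0 \<le> nrm A x \<and> (nrm A x = 0 \<longleftrightarrow> x = \<zero>\<^bsub>A\<^esub>)) \<and>
     (\<forall>c. \<forall>x\<in>carrier A. nrm A (c \<odot>\<^bsub>A\<^esub> x) = cmod c * nrm A x) \<and>
     (\<forall>x\<in>carrier A. \<forall>y\<in>carrier A.
        nrm A (x \<oplus>\<^bsub>A\<^esub> y) \<le> nrm A x + nrm A y \<and>
        nrm A (x \<otimes>\<^bsub>A\<^esub> y) \<le> nrm A x * nrm A y) \<and>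
     (\<forall>x\<in>carrier A. nrm A (adj A x \<otimes>\<^bsub>A\<^esub> x) = (nrm A x)\<^sup>2) \<and>
     (\<forall>s :: nat \<Rightarrow> 'a. range s \<subseteq> carrier A \<longrightarrow>
        (\<forall>e>0. \<exists>N. \<forall>m\<ge>N. \<forall>n\<ge>N. nrm A (s m \<ominus>\<^bsub>A\<^esub> s n) < e) \<longrightarrow>
        (\<exists>l\<in>carrier A. (\<lambda>n. nrm A (s n \<ominus>\<^bsub>A\<^esub> l)) \<longlonglongrightarrow> 0))"

definition projections :: "'a cstar \<Rightarrow> 'a set" where
  "projections A = {p \<in> carrier A. adj A p = p \<and> p \<otimes>\<^bsub>A\<^esub> p = p}"

definition projection_combinations :: "'a cstar \<Rightarrow> 'a set" where
  "projection_combinations A =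
     {\<Oplus>\<^bsub>A\<^esub>i\<in>{..N}. \<alpha> i \<odot>\<^bsub>A\<^esub> p i | (N :: nat) (\<alpha> :: nat \<Rightarrow> complex) p.
        (\<forall>i\<le>N. p i \<in> projections A) \<and>
        (\<forall>i\<le>N. \<forall>j\<le>N. i \<noteq> j \<longrightarrow> p i \<otimes>\<^bsub>A\<^esub> p j = \<zero>\<^bsub>A\<^esub>)}"

definition P_star_algebra :: "'a cstar \<Rightarrow> bool" where
  "P_star_algebra A \<longleftrightarrow>
     cstar_algebra A \<and>
     (\<forall>a\<in>carrier A. adj A a = a \<longrightarrow>
        (\<exists>s :: nat \<Rightarrow> 'a. range s \<subseteq> projection_combinations A \<and>
           (\<lambda>n. nrm A (s n \<ominus>\<^bsub>A\<^esub> a)) \<longlonglongrightarrow> 0))"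

definition finite_dimensional :: "(complex, 'a, 'm) module_scheme \<Rightarrow> bool" where
  "finite_dimensional V \<longleftrightarrow>
     (\<exists>B. finite B \<and> B \<subseteq> carrier V \<and>
        (\<forall>x\<in>carrier V. \<exists>c :: 'a \<Rightarrow> complex. x = (\<Oplus>\<^bsub>V\<^esub>b\<in>B. c b \<odot>\<^bsub>V\<^esub> b)))"


section \<open>Hilbert spaces and von Neumann algebras\<close>

text \<open>The fields \<open>mult\<close> and \<open>one\<close> inherited from \<open>module\<close> carry no meaning
  for Hilbert spaces. The inner product \<open>ip\<close> is linear in its first argument.\<close>

record 'h hilb = "(complex, 'h) module" +
  ip :: "'h \<Rightarrow> 'h \<Rightarrow> complex"

definition hnorm :: "'h hilb \<Rightarrow> 'h \<Rightarrow> real" where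
  "hnorm K x = sqrt (Re (ip K x x))"

definition hilbert_space :: "'h hilb \<Rightarrow> bool" where
  "hilbert_space K \<longleftrightarrow>
     Module.module CC K \<and>
     (\<forall>x\<in>carrier K. \<forall>y\<in>carrier K. \<forall>z\<in>carrier K.
        ip K (x \<oplus>\<^bsub>K\<^esub> y) z = ip K x z + ip K y z) \<and>
     (\<forall>c. \<forall>x\<in>carrier K. \<forall>y\<in>carrier K. ip K (c \<odot>\<^bsub>K\<^esub> x) y = c * ip K x y) \<and>
     (\<forall>x\<in>carrier K. \<forall>y\<in>carrier K. ip K y x = cnj (ip K x y)) \<and>
     (\<forall>x\<in>carrier K. 0 \<le> Re (ip K x x) \<and> (ip K x x = 0 \<longleftrightarrow> x = \<zero>\<^bsub>K\<^esub>)) \<and>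
     (\<forall>s :: nat \<Rightarrow> 'h. range s \<subseteq> carrier K \<longrightarrow>
        (\<forall>e>0. \<exists>N. \<forall>m\<ge>N. \<forall>n\<ge>N. hnorm K (s m \<ominus>\<^bsub>K\<^esub> s n) < e) \<longrightarrow>
        (\<exists>l\<in>carrier K. (\<lambda>n. hnorm K (s n \<ominus>\<^bsub>K\<^esub> l)) \<longlonglongrightarrow> 0))"

definition bounded_ops :: "'h hilb \<Rightarrow> (complex, 'h \<Rightarrow> 'h) module" where
  "bounded_ops K =
     \<lparr> carrier = {T \<in> extensional (carrier K).
         T ` carrier K \<subseteq> carrier K \<and>
         (\<forall>x\<in>carrier K. \<forall>y\<in>carrier K. T (x \<oplus>\<^bsub>K\<^esub> y) = T x \<oplus>\<^bsub>K\<^esub> T y) \<and>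
         (\<forall>c. \<forall>x\<in>carrier K. T (c \<odot>\<^bsub>K\<^esub> x) = c \<odot>\<^bsub>K\<^esub> T x) \<and>
         (\<exists>b. \<forall>x\<in>carrier K. hnorm K (T x) \<le> b * hnorm K x)},
       mult = compose (carrier K),
       one = (\<lambda>x\<in>carrier K. x),
       zero = (\<lambda>x\<in>carrier K. \<zero>\<^bsub>K\<^esub>),
       add = (\<lambda>S T. \<lambda>x\<in>carrier K. S x \<oplus>\<^bsub>K\<^esub> T x),
       smult = (\<lambda>c T. \<lambda>x\<in>carrier K. c \<odot>\<^bsub>K\<^esub> T x) \<rparr>"

definition op_norm :: "'h hilb \<Rightarrow> ('h \<Rightarrow> 'h) \<Rightarrow> real" where
  "op_norm K T = Sup {hnorm K (T x) | x. x \<in> carrier K \<and> hnorm K x \<le> 1}"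

definition is_adjoint :: "'h hilb \<Rightarrow> ('h \<Rightarrow> 'h) \<Rightarrow> ('h \<Rightarrow> 'h) \<Rightarrow> bool" where
  "is_adjoint K T S \<longleftrightarrow>
     (\<forall>x\<in>carrier K. \<forall>y\<in>carrier K. ip K (T x) y = ip K x (S y))"

text \<open>The weak operator topology: the initial topology of the functionals
  \<open>T \<mapsto> \<langle>T x, y\<rangle>\<close> on the bounded operators.\<close>

definition weak_operator_topology :: "'h hilb \<Rightarrow> ('h \<Rightarrow> 'h) topology" where
  "weak_operator_topology K =
     pullback_topology (carrier (bounded_ops K))
       (\<lambda>T. \<lambda>(x, y)\<in>carrier K \<times> carrier K. ip K (T x) y)
       (product_topology (\<lambda>_. euclidean) (carrier K \<times> carrier K))"

definition von_neumann_on :: "'h hilb \<Rightarrow> ('h \<Rightarrow> 'h) set \<Rightarrow> bool" where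
  "von_neumann_on K N \<longleftrightarrow>
     hilbert_space K \<and>
     N \<subseteq> carrier (bounded_ops K) \<and>
     \<one>\<^bsub>bounded_ops K\<^esub> \<in> N \<and>
     (\<forall>S\<in>N. \<forall>T\<in>N. S \<oplus>\<^bsub>bounded_ops K\<^esub> T \<in> N \<and> S \<otimes>\<^bsub>bounded_ops K\<^esub> T \<in> N) \<and>
     (\<forall>c. \<forall>T\<in>N. c \<odot>\<^bsub>bounded_ops K\<^esub> T \<in> N) \<and>
     (\<forall>T\<in>N. \<exists>S\<in>N. is_adjoint K T S) \<and>
     closedin (weak_operator_topology K) N"

definition star_representation :: "'a cstar \<Rightarrow> 'h hilb \<Rightarrow> ('a \<Rightarrow> 'h \<Rightarrow> 'h) \<Rightarrow> bool" where
  "star_representation A K \<pi> \<longleftrightarrow>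
     \<pi> \<in> ring_hom A (bounded_ops K) \<and>
     (\<forall>c. \<forall>a\<in>carrier A. \<pi> (c \<odot>\<^bsub>A\<^esub> a) = c \<odot>\<^bsub>bounded_ops K\<^esub> \<pi> a) \<and>
     (\<forall>a\<in>carrier A. is_adjoint K (\<pi> a) (\<pi> (adj A a)))"

text \<open>An abstract C*-algebra is a von Neumann algebra if it is *-isomorphic to a
  von Neumann algebra of operators on some Hilbert space. HOL cannot quantify over
  all Hilbert spaces, so the type of the space is a parameter: its carrier is any
  subset of \<open>'c \<Rightarrow> complex\<close>. Every Hilbert space is isomorphic to some
  \<open>\<ell>\<^sup>2(S)\<close> and hence available for a large enough \<open>'c\<close>.\<close>

definition von_neumann_algebra :: "'c itself \<Rightarrow> 'a cstar \<Rightarrow> bool" where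
  "von_neumann_algebra T A \<longleftrightarrow>
     (\<exists>(K :: ('c \<Rightarrow> complex) hilb) \<pi>.
        star_representation A K \<pi> \<and> inj_on \<pi> (carrier A) \<and>
        von_neumann_on K (\<pi> ` carrier A))"

text \<open>A C*-subalgebra \<open>A \<subseteq> B(K)\<close> is rendered by its inclusion \<open>\<pi>\<close>.\<close>

definition operator_algebra :: "'a cstar \<Rightarrow> 'h hilb \<Rightarrow> ('a \<Rightarrow> 'h \<Rightarrow> 'h) \<Rightarrow> bool" where
  "operator_algebra A K \<pi> \<longleftrightarrow>
     cstar_algebra A \<and> hilbert_space K \<and> star_representation A K \<pi> \<and>
     (\<forall>a\<in>carrier A. op_norm K (\<pi> a) = nrm A a)"


section \<open>Nonstandard universes\<close>

text \<open>First-order formulas whose atoms are relation symbols \<open>'r\<close> applied to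
  variables.\<close>

datatype 'r fm =
    Atom 'r "nat list"
  | Eq nat nat
  | Neg "'r fm"
  | Conj "'r fm" "'r fm"
  | Ex nat "'r fm"

primrec sat :: "('r \<Rightarrow> 'u list set) \<Rightarrow> (nat \<Rightarrow> 'u) \<Rightarrow> 'r fm \<Rightarrow> bool" where
  "sat I e (Atom r ns) \<longleftrightarrow> map e ns \<in> I r"
| "sat I e (Eq m n) \<longleftrightarrow> e m = e n"
| "sat I e (Neg \<phi>) \<longleftrightarrow> \<not> sat I e \<phi>"
| "sat I e (Conj \<phi> \<psi>) \<longleftrightarrow> sat I e \<phi> \<and> sat I e \<psi>"
| "sat I e (Ex n \<phi>) \<longleftrightarrow> (\<exists>u. sat I (e(n := u)) \<phi>)"

text \<open>The standard universe is the type \<open>'v\<close>, its nonstandard extension the type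
  \<open>'s\<close>. Every relation \<open>R\<close> on \<open>'v\<close> (a set of tuples) has a *-extension
  \<open>ext U R\<close>, every standard object \<open>v\<close> a copy \<open>std U v\<close>. All relations on
  \<open>'v\<close> are available as symbols in the transfer principle.\<close>

record ('v, 's) ns_universe =
  ext :: "'v list set \<Rightarrow> 's list set"
  std :: "'v \<Rightarrow> 's"

definition transfer_principle :: "('v, 's) ns_universe \<Rightarrow> bool" where
  "transfer_principle U \<longleftrightarrow>
     (\<forall>(\<phi> :: 'v list set fm) e. sat (\<lambda>R. R) e \<phi> \<longleftrightarrow> sat (ext U) (std U \<circ> e) \<phi>)"

definition internal_sets :: "('v, 's) ns_universe \<Rightarrow> 's set set" where
  "internal_sets U = {{x. x # ps \<in> ext U R} | R ps. True}"

definition saturated :: "'k rel \<Rightarrow> ('v, 's) ns_universe \<Rightarrow> bool" where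
  "saturated \<kappa> U \<longleftrightarrow>
     (\<forall>F \<subseteq> internal_sets U. (card_of F, \<kappa>) \<in> ordLess \<longrightarrow>
        (\<forall>G \<subseteq> F. finite G \<longrightarrow> \<Inter>G \<noteq> {}) \<longrightarrow> \<Inter>F \<noteq> {})"

definition nonstandard_universe :: "'k rel \<Rightarrow> ('v, 's) ns_universe \<Rightarrow> bool" where
  "nonstandard_universe \<kappa> U \<longleftrightarrow>
     transfer_principle U \<and>
     Card_order \<kappa> \<and> (natLeq, \<kappa>) \<in> ordLess \<and> saturated \<kappa> U"

text \<open>The *-extension of a standard function \<open>F\<close>, applied to the tuple \<open>xs\<close>.\<close>

definition ext_fun :: "('v, 's) ns_universe \<Rightarrow> ('v list \<Rightarrow> 'v) \<Rightarrow> 's list \<Rightarrow> 's" where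
  "ext_fun U F xs = (THE y. xs @ [y] \<in> ext U {us @ [F us] | us. True})"


section \<open>Standard objects\<close>

text \<open>\<open>Alg\<close>, \<open>Hilb\<close> and \<open>Act\<close> make C*-algebras, Hilbert spaces and maps
  from algebra elements to operators into objects of the universe, so that the internal
  ones are elements of *-extensions. \<open>'w\<close> is an arbitrary type of further objects.\<close>

datatype ('a, 'h, 'w) obj =
    Real real
  | Cplx complex
  | Elem 'a
  | Vec 'h
  | Alg "'a cstar"
  | Hilb "'h hilb"
  | Act "'a \<Rightarrow> 'h \<Rightarrow> 'h"
  | Other 'w

definition obj_mem :: "('a, 'h, 'w) obj list set" where
  "obj_mem = {[Alg A, Elem x] | A x. x \<in> carrier A} \<union>
             {[Hilb K, Vec x] | K x. x \<in> carrier K}"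

text \<open>These functions are irrelevant outside the listed arguments.\<close>

definition obj_zero :: "('a, 'h, 'w) obj list \<Rightarrow> ('a, 'h, 'w) obj" where
  "obj_zero us =
     (case us of
         [Alg A] \<Rightarrow> Elem \<zero>\<^bsub>A\<^esub>
       | [Hilb K] \<Rightarrow> Vec \<zero>\<^bsub>K\<^esub>
       | _ \<Rightarrow> undefined)"

definition obj_one :: "('a, 'h, 'w) obj list \<Rightarrow> ('a, 'h, 'w) obj" where
  "obj_one us =
     (case us of
         [Alg A] \<Rightarrow> Elem \<one>\<^bsub>A\<^esub>
       | _ \<Rightarrow> undefined)"

definition obj_add :: "('a, 'h, 'w) obj list \<Rightarrow> ('a, 'h, 'w) obj" where
  "obj_add us =
     (case us of
         [Alg A, Elem x, Elem y] \<Rightarrow> Elem (x \<oplus>\<^bsub>A\<^esub> y)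
       | [Hilb K, Vec x, Vec y] \<Rightarrow> Vec (x \<oplus>\<^bsub>K\<^esub> y)
       | _ \<Rightarrow> undefined)"

definition obj_minus :: "('a, 'h, 'w) obj list \<Rightarrow> ('a, 'h, 'w) obj" where
  "obj_minus us =
     (case us of
         [Alg A, Elem x, Elem y] \<Rightarrow> Elem (x \<ominus>\<^bsub>A\<^esub> y)
       | [Hilb K, Vec x, Vec y] \<Rightarrow> Vec (x \<ominus>\<^bsub>K\<^esub> y)
       | _ \<Rightarrow> undefined)"

definition obj_smult :: "('a, 'h, 'w) obj list \<Rightarrow> ('a, 'h, 'w) obj" where
  "obj_smult us =
     (case us of
         [Alg A, Cplx c, Elem x] \<Rightarrow> Elem (c \<odot>\<^bsub>A\<^esub> x)
       | [Hilb K, Cplx c, Vec x] \<Rightarrow> Vec (c \<odot>\<^bsub>K\<^esub> x)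
       | _ \<Rightarrow> undefined)"

definition obj_mult :: "('a, 'h, 'w) obj list \<Rightarrow> ('a, 'h, 'w) obj" where
  "obj_mult us =
     (case us of
         [Alg A, Elem x, Elem y] \<Rightarrow> Elem (x \<otimes>\<^bsub>A\<^esub> y)
       | _ \<Rightarrow> undefined)"

definition obj_adj :: "('a, 'h, 'w) obj list \<Rightarrow> ('a, 'h, 'w) obj" where
  "obj_adj us =
     (case us of
         [Alg A, Elem x] \<Rightarrow> Elem (adj A x)
       | _ \<Rightarrow> undefined)"

definition obj_norm :: "('a, 'h, 'w) obj list \<Rightarrow> ('a, 'h, 'w) obj" where
  "obj_norm us =
     (case us of
         [Alg A, Elem x] \<Rightarrow> Real (nrm A x)
       | [Hilb K, Vec x] \<Rightarrow> Real (hnorm K x)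
       | _ \<Rightarrow> undefined)"

definition obj_ip :: "('a, 'h, 'w) obj list \<Rightarrow> ('a, 'h, 'w) obj" where
  "obj_ip us =
     (case us of
         [Hilb K, Vec x, Vec y] \<Rightarrow> Cplx (ip K x y)
       | _ \<Rightarrow> undefined)"

definition obj_act :: "('a, 'h, 'w) obj list \<Rightarrow> ('a, 'h, 'w) obj" where
  "obj_act us =
     (case us of
         [Act \<pi>, Elem a, Vec x] \<Rightarrow> Vec (\<pi> a x)
       | _ \<Rightarrow> undefined)"

text \<open>The *-extension of the set of all P*-algebras is the set of all objects that satisfy
  the transferred definition of a P*-algebra.\<close>

definition internal_P_star_algebra ::
    "(('a, 'h, 'w) obj, 's) ns_universe \<Rightarrow> 's \<Rightarrow> bool" where
  "internal_P_star_algebra U M \<longleftrightarrow> [M] \<in> ext U {[Alg A] | A. P_star_algebra A}"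

definition internal_operator_algebra ::
    "(('a, 'h, 'w) obj, 's) ns_universe \<Rightarrow> 's \<Rightarrow> 's \<Rightarrow> 's \<Rightarrow> bool" where
  "internal_operator_algebra U M H \<rho> \<longleftrightarrow>
     [M, H, \<rho>] \<in> ext U {[Alg A, Hilb K, Act \<pi>] | A K \<pi>. operator_algebra A K \<pi>}"


section \<open>Nonstandard hulls\<close>

definition approx :: "(('a, 'h, 'w) obj, 's) ns_universe \<Rightarrow> 's \<Rightarrow> 's \<Rightarrow> bool" where
  "approx U r s \<longleftrightarrow>
     (\<forall>n::nat. n \<ge> 1 \<longrightarrow> [r, s] \<in> ext U {[Real a, Real b] | a b. \<bar>a - b\<bar> < 1 / real n})"

definition approx_cplx :: "(('a, 'h, 'w) obj, 's) ns_universe \<Rightarrow> 's \<Rightarrow> 's \<Rightarrow> bool" where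
  "approx_cplx U r s \<longleftrightarrow>
     (\<forall>n::nat. n \<ge> 1 \<longrightarrow> [r, s] \<in> ext U {[Cplx a, Cplx b] | a b. cmod (a - b) < 1 / real n})"

definition finite_hyperreal :: "(('a, 'h, 'w) obj, 's) ns_universe \<Rightarrow> 's \<Rightarrow> bool" where
  "finite_hyperreal U r \<longleftrightarrow> (\<exists>n::nat. [r] \<in> ext U {[Real a] | a. \<bar>a\<bar> < real n})"

definition std_part :: "(('a, 'h, 'w) obj, 's) ns_universe \<Rightarrow> 's \<Rightarrow> real" where
  "std_part U r = (THE t. approx U r (std U (Real t)))"

definition std_part_cplx :: "(('a, 'h, 'w) obj, 's) ns_universe \<Rightarrow> 's \<Rightarrow> complex" where
  "std_part_cplx U r = (THE t. approx_cplx U r (std U (Cplx t)))"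

text \<open>In the following, \<open>Z\<close> is an internal C*-algebra or an internal Hilbert space;
  \<open>halo U Z x\<close> is the class of \<open>x\<close> in the hull.\<close>

definition members :: "(('a, 'h, 'w) obj, 's) ns_universe \<Rightarrow> 's \<Rightarrow> 's set" where
  "members U Z = {x. [Z, x] \<in> ext U obj_mem}"

definition Fin :: "(('a, 'h, 'w) obj, 's) ns_universe \<Rightarrow> 's \<Rightarrow> 's set" where
  "Fin U Z = {x \<in> members U Z. finite_hyperreal U (ext_fun U obj_norm [Z, x])}"

definition halo :: "(('a, 'h, 'w) obj, 's) ns_universe \<Rightarrow> 's \<Rightarrow> 's \<Rightarrow> 's set" where
  "halo U Z x =
     {y \<in> members U Z.
        approx U (ext_fun U obj_norm [Z, ext_fun U obj_minus [Z, y, x]]) (std U (Real 0))}"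

definition hull_carrier :: "(('a, 'h, 'w) obj, 's) ns_universe \<Rightarrow> 's \<Rightarrow> 's set set" where
  "hull_carrier U Z = halo U Z ` Fin U Z"

definition hull_add ::
    "(('a, 'h, 'w) obj, 's) ns_universe \<Rightarrow> 's \<Rightarrow> 's set \<Rightarrow> 's set \<Rightarrow> 's set" where
  "hull_add U Z S T = (\<Union>x\<in>S. \<Union>y\<in>T. halo U Z (ext_fun U obj_add [Z, x, y]))"

definition hull_smult ::
    "(('a, 'h, 'w) obj, 's) ns_universe \<Rightarrow> 's \<Rightarrow> complex \<Rightarrow> 's set \<Rightarrow> 's set" where
  "hull_smult U Z c S = (\<Union>x\<in>S. halo U Z (ext_fun U obj_smult [Z, std U (Cplx c), x]))"

definition ns_hull :: "(('a, 'h, 'w) obj, 's) ns_universe \<Rightarrow> 's \<Rightarrow> 's set cstar" where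
  "ns_hull U M =
     \<lparr> carrier = hull_carrier U M,
       mult = (\<lambda>S T. \<Union>x\<in>S. \<Union>y\<in>T. halo U M (ext_fun U obj_mult [M, x, y])),
       one = halo U M (ext_fun U obj_one [M]),
       zero = halo U M (ext_fun U obj_zero [M]),
       add = hull_add U M,
       smult = hull_smult U M,
       adj = (\<lambda>S. \<Union>x\<in>S. halo U M (ext_fun U obj_adj [M, x])),
       nrm = (\<lambda>S. the_elem ((\<lambda>x. std_part U (ext_fun U obj_norm [M, x])) ` S)) \<rparr>"

definition hilbert_hull :: "(('a, 'h, 'w) obj, 's) ns_universe \<Rightarrow> 's \<Rightarrow> 's set hilb" where
  "hilbert_hull U H =
     \<lparr> carrier = hull_carrier U H,
       mult = undefined,
       one = undefined,
       zero = halo U H (ext_fun U obj_zero [H]),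
       add = hull_add U H,
       smult = hull_smult U H,
       ip = (\<lambda>S T. the_elem
         {std_part_cplx U (ext_fun U obj_ip [H, x, y]) | x y. x \<in> S \<and> y \<in> T}) \<rparr>"

definition hull_act ::
    "(('a, 'h, 'w) obj, 's) ns_universe \<Rightarrow> 's \<Rightarrow> 's \<Rightarrow> 's set \<Rightarrow> 's set \<Rightarrow> 's set" where
  "hull_act U H \<rho> S =
     (\<lambda>T\<in>carrier (hilbert_hull U H).
        \<Union>a\<in>S. \<Union>x\<in>T. halo U H (ext_fun U obj_act [\<rho>, a, x]))"

end

theory Submission
  imports Defs
begin

text \<open>If the internal algebra has at least \<open>n\<close> orthogonal nonzero projections for every standard
  \<open>n\<close>, saturation produces an infinite orthogonal sequence \<open>p\<close> of nonzero projections in the hull,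
  and below every \<open>q\<close> with \<open>p j q = p j\<close> for all \<open>j\<close> a nonzero projection orthogonal to all
  \<open>p j\<close>. So \<open>p\<close> has no supremum, whereas in a von Neumann algebra the supremum is the strong limit of
  the partial sums. Otherwise the number of orthogonal projections is bounded by a standard number, and
  every self-adjoint element of the hull is a combination of boundedly many orthogonal projections.
  A maximal orthogonal family \<open>P\<close> in the hull then consists of minimal projections with
  \<open>e y e\<close> a multiple of \<open>e\<close>, which makes the hull finite-dimensional, and a faithful positive
  functional built from these multiples represents it on itself. Finite-dimensional
  *-algebras of operators are closed in the weak operator topology.\<close>

section \<open>Transfer and saturation\<close>

text \<open>The universe has no objects for sequences, so an internal family of projections must be
  coded by a single algebra element. The code is chosen so that \<open>many_projections A n\<close>
  is a property of standard algebras for a standard n: M satisfies its transfer for every n, or it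
  fails for some n, and then the failure is itself a transferred property of M. Nonstandard elements
  are handled as values at a finite tuple, that is, as points of an ultrapower. Finitely many of
  them can be put over one tuple, after which identities hold pointwise and norms are limits;
  statements about infinitely many elements go through saturation. In the bounded case the
  approximating combinations have at most n terms and bounded scalars, so one that is infinitely
  close to a given element becomes an exact combination in the hull. Spectra, corners and signs of
  squares are then computed by induction on the length, in place of functional calculus. Being a
  supremum is expressed by two product relations in the algebra, so that it makes sense without an
  ambient Hilbert space.\<close>

primrec close_fm :: "nat \<Rightarrow> 'r fm \<Rightarrow> 'r fm" where
  "close_fm 0 \<phi> = \<phi>"
| "close_fm (Suc n) \<phi> = close_fm n (Neg (Ex n (Neg \<phi>)))"

text \<open>Transfer is available only at assignments of the form \<open>std U \<circ> e\<close>.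
  Closing a formula universally in its first n variables makes it available at arbitrary nonstandard
  tuples of length n.\<close>

lemma sat_close_fm:
  "sat I e (close_fm n \<phi>) \<longleftrightarrow> (\<forall>f. (\<forall>i\<ge>n. f i = e i) \<longrightarrow> sat I f \<phi>)"
proof (induction n arbitrary: \<phi>)
  case 0
  then show ?case by (auto simp: fun_eq_iff[symmetric])
next
  case (Suc n)
  have "(\<forall>f. (\<forall>i\<ge>n. f i = e i) \<longrightarrow> (\<forall>u. sat I (f(n := u)) \<phi>)) \<longleftrightarrow>
        (\<forall>f. (\<forall>i\<ge>Suc n. f i = e i) \<longrightarrow> sat I f \<phi>)" (is "?L \<longleftrightarrow> ?R")
  proof
    assume L: ?L
    show ?R
    proof (intro allI impI)
      fix f assume f: "\<forall>i\<ge>Suc n. f i = e i"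
      have "(f(n := e n)) i = e i" if "i \<ge> n" for i using f that by (cases "i = n") auto
      then have "\<forall>i\<ge>n. (f(n := e n)) i = e i" by blast
      then have "sat I ((f(n := e n))(n := f n)) \<phi>" using L by blast
      then show "sat I f \<phi>" by simp
    qed
  next
    assume ?R then show ?L by simp
  qed
  then show ?case by (simp add: Suc.IH)
qed

locale ns_transfer =
  fixes U :: "('v, 's) ns_universe"
  assumes transfer: "transfer_principle U"
begin

text \<open>Positions beyond the list hold the standard object that the assignment in
  \<open>sat_ext\<close> takes there, so that closing the first \<open>length xs\<close> variables
  is enough.\<close>

definition env :: "'s list \<Rightarrow> nat \<Rightarrow> 's" where
  "env xs i = (if i < length xs then xs ! i else std U undefined)"

lemma map_env [simp]: "set is \<subseteq> {..<length xs} \<Longrightarrow> map (env xs) is = map ((!) xs) is"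
  by (auto simp: env_def)

lemma map_env_upt [simp]: "map (env xs) [0..<length xs] = xs"
  by (rule nth_equalityI) (auto simp: env_def)

lemma sat_ext:
  assumes "\<And>e. sat (\<lambda>R. R) e \<phi>"
  shows "sat (ext U) (env xs) \<phi>"
proof -
  have "sat (\<lambda>R. R) (\<lambda>_. undefined) (close_fm (length xs) \<phi>)"
    using assms by (simp add: sat_close_fm)
  then have "sat (ext U) (std U \<circ> (\<lambda>_. undefined)) (close_fm (length xs) \<phi>)"
    using transfer by (simp add: transfer_principle_def)
  then show ?thesis by (simp add: sat_close_fm env_def)
qed

text \<open>The ultrafilter of the relations that hold of \<open>xs\<close>. With \<open>val xs f\<close>, the extension of \<open>f\<close> at
  \<open>xs\<close>, transfer takes the form of the theorem of Los for ultrapowers, and standard parts are limits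
  along \<open>dir xs\<close>.\<close>

definition dir :: "'s list \<Rightarrow> 'v list filter" where
  "dir xs = Abs_filter (\<lambda>P. xs \<in> ext U (Collect P))"

text \<open>The atoms are applied to exactly \<open>length xs\<close> variables, so only standard
  tuples of that length occur in the transferred implication.\<close>

lemma ext_mono:
  assumes "xs \<in> ext U R" and "\<And>us. length us = length xs \<Longrightarrow> us \<in> R \<Longrightarrow> us \<in> S"
  shows "xs \<in> ext U S"
proof -
  let ?a = "\<lambda>R. Atom R [0..<length xs] :: 'v list set fm"
  have "sat (ext U) (env xs) (Neg (Conj (?a R) (Neg (?a S))))"
    by (rule sat_ext) (use assms(2) in auto)
  then show ?thesis using assms(1) by simp
qed

lemma ext_Int: "xs \<in> ext U (R \<inter> S) \<longleftrightarrow> xs \<in> ext U R \<and> xs \<in> ext U S"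
proof -
  let ?a = "\<lambda>R. Atom R [0..<length xs] :: 'v list set fm"
  have "sat (ext U) (env xs) (Neg (Conj (Conj (?a R) (?a S)) (Neg (?a (R \<inter> S)))))"
    by (rule sat_ext) auto
  then show ?thesis using ext_mono by auto
qed

lemma ext_Compl: "xs \<in> ext U (- R) \<longleftrightarrow> xs \<notin> ext U R"
proof -
  let ?a = "\<lambda>R. Atom R [0..<length xs] :: 'v list set fm"
  have "sat (ext U) (env xs) (Neg (Conj (Neg (?a R)) (Neg (?a (- R)))))"
       "sat (ext U) (env xs) (Neg (Conj (?a R) (?a (- R))))"
    by (rule sat_ext; auto)+
  then show ?thesis by auto
qed

lemma ext_UNIV: "xs \<in> ext U UNIV"
  using ext_Compl[of xs UNIV] ext_mono[of xs "- UNIV" UNIV] by auto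

lemma eventually_dir: "eventually P (dir xs) \<longleftrightarrow> xs \<in> ext U (Collect P)"
  unfolding dir_def
proof (rule eventually_Abs_filter, rule is_filter.intro)
  show "xs \<in> ext U (Collect (\<lambda>x. True))" by (simp add: ext_UNIV)
  show "\<And>P Q. xs \<in> ext U (Collect P) \<Longrightarrow> xs \<in> ext U (Collect Q) \<Longrightarrow> xs \<in> ext U {x. P x \<and> Q x}"
    by (simp add: ext_Int Collect_conj_eq)
  show "\<And>P Q. \<forall>x. P x \<longrightarrow> Q x \<Longrightarrow> xs \<in> ext U (Collect P) \<Longrightarrow> xs \<in> ext U (Collect Q)"
    by (rule ext_mono) auto
qed

lemma ext_iff_eventually: "xs \<in> ext U R \<longleftrightarrow> eventually (\<lambda>us. us \<in> R) (dir xs)"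
  by (simp add: eventually_dir)

lemma eventually_dir_not: "eventually (\<lambda>us. \<not> P us) (dir xs) \<longleftrightarrow> \<not> eventually P (dir xs)"
  using ext_Compl[of xs "Collect P"] by (simp add: eventually_dir Collect_neg_eq)

lemma dir_neq_bot [simp]: "dir xs \<noteq> bot"
  using eventually_dir_not[of "\<lambda>_. True" xs] by auto

lemma eventually_dir_length: "eventually (\<lambda>us. length us = length xs) (dir xs)"
  unfolding eventually_dir by (rule ext_mono[OF ext_UNIV]) simp

text \<open>The ultrafilter of a subtuple is the image of the ultrafilter of the tuple under the
  coordinate projection. All changes of tuple rest on this.\<close>

lemma eventually_dir_proj:
  assumes "set is \<subseteq> {..<length xs}"
  shows "eventually (\<lambda>us. map ((!) us) is \<in> R) (dir xs) \<longleftrightarrow> map ((!) xs) is \<in> ext U R"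
proof -
  let ?R = "{us. map ((!) us) is \<in> R}"
  let ?a = "Atom ?R [0..<length xs] :: 'v list set fm" and ?b = "Atom R is"
  have eq: "map ((!) (map e [0..<length xs])) is = map e is" for e :: "nat \<Rightarrow> 'v"
    using assms by (auto simp: subset_iff)
  have "sat (ext U) (env xs) (Neg (Conj ?a (Neg ?b)))"
       "sat (ext U) (env xs) (Neg (Conj (Neg ?a) ?b))"
    by (rule sat_ext; simp add: eq)+
  moreover have "sat (ext U) (env xs) ?a \<longleftrightarrow> xs \<in> ext U ?R" by simp
  moreover have "sat (ext U) (env xs) ?b \<longleftrightarrow> map ((!) xs) is \<in> ext U R" using assms by simp
  ultimately show ?thesis unfolding eventually_dir by auto
qed

text \<open>The witness is bound to the variable just after those of \<open>xs\<close>. The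
  existential quantifier of the language ranges over standard objects in one universe and over all
  nonstandard ones in the other.\<close>

lemma ext_Ex: "(\<exists>y. xs @ [y] \<in> ext U R) \<longleftrightarrow> xs \<in> ext U {us. \<exists>u. us @ [u] \<in> R}"
proof -
  let ?n = "length xs"
  let ?a = "Atom {us. \<exists>u. us @ [u] \<in> R} [0..<?n] :: 'v list set fm" and ?b = "Ex ?n (Atom R [0..<Suc ?n])"
  have eq: "map (e(?n := u)) [0..<Suc ?n] = map e [0..<?n] @ [u]" for e :: "nat \<Rightarrow> 'x" and u
    by auto
  have "sat (ext U) (env xs) (Neg (Conj ?a (Neg ?b)))"
       "sat (ext U) (env xs) (Neg (Conj (Neg ?a) ?b))"
    by (rule sat_ext; simp only: sat.simps eq; auto)+
  moreover have "sat (ext U) (env xs) ?a \<longleftrightarrow> xs \<in> ext U {us. \<exists>u. us @ [u] \<in> R}" by simp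
  moreover have "sat (ext U) (env xs) ?b \<longleftrightarrow> (\<exists>y. xs @ [y] \<in> ext U R)"
    by (simp only: sat.simps eq) simp
  ultimately show ?thesis by auto
qed

text \<open>Equality is a logical symbol of the language, so the extension of the diagonal is
  genuine equality.\<close>

lemma ext_diag: "[x, y] \<in> ext U {[u, u] | u. True} \<longleftrightarrow> x = y"
proof -
  let ?a = "Atom {[u, u] | u. True} [0, 1] :: 'v list set fm" and ?b = "Eq 0 1"
  have "sat (ext U) (env [x, y]) (Neg (Conj ?a (Neg ?b)))"
       "sat (ext U) (env [x, y]) (Neg (Conj (Neg ?a) ?b))"
    by (rule sat_ext; auto)+
  then show ?thesis by (auto simp: env_def)
qed

lemma ext_std: "[std U c] \<in> ext U {[c]}"
proof -
  have "sat (\<lambda>R. R) (\<lambda>_. c) (Atom {[c]} [0])" by simp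
  then have "sat (ext U) (std U \<circ> (\<lambda>_. c)) (Atom {[c]} [0])"
    using transfer unfolding transfer_principle_def by blast
  then show ?thesis by simp
qed

section \<open>Values of standard functions at a nonstandard tuple\<close>

abbreviation val :: "'s list \<Rightarrow> ('v list \<Rightarrow> 'v) \<Rightarrow> 's" where
  "val xs f \<equiv> ext_fun U f xs"

lemma graph_unique:
  assumes "xs @ [y] \<in> ext U {us @ [f us] | us. True}" "xs @ [y'] \<in> ext U {us @ [f us] | us. True}"
  shows "y = y'"
proof -
  \<comment> \<open>Both candidates are put into one tuple \<open>?z\<close>, where eventually each
    of them is the same function of the first coordinates.\<close>
  let ?n = "length xs" and ?G = "{us @ [f us] | us. True}" and ?z = "xs @ [y, y']"
  have l: "map ((!) ?z) [0..<?n] = xs" by (rule nth_equalityI) (auto simp: nth_append)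
  have 1: "eventually (\<lambda>us. map ((!) us) ([0..<?n] @ [?n]) \<in> ?G) (dir ?z)"
    by (subst eventually_dir_proj) (use assms l in \<open>auto simp: nth_append\<close>)
  have 2: "eventually (\<lambda>us. map ((!) us) ([0..<?n] @ [Suc ?n]) \<in> ?G) (dir ?z)"
    by (subst eventually_dir_proj) (use assms l in \<open>auto simp: nth_append\<close>)
  from 1 2 have "eventually (\<lambda>us. map ((!) us) [?n, Suc ?n] \<in> {[u, u] | u. True}) (dir ?z)"
    by eventually_elim auto
  then have "[y, y'] \<in> ext U {[u, u] | u. True}"
    by (subst (asm) eventually_dir_proj) (auto simp: nth_append)
  then show ?thesis using ext_diag by blast
qed

lemma val_graph: "xs @ [val xs f] \<in> ext U {us @ [f us] | us. True}"
proof -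
  have "\<exists>y. xs @ [y] \<in> ext U {us @ [f us] | us. True}"
    unfolding ext_Ex by (rule ext_mono[OF ext_UNIV]) auto
  then have "\<exists>!y. xs @ [y] \<in> ext U {us @ [f us] | us. True}" using graph_unique by blast
  then show ?thesis unfolding ext_fun_def by (rule theI')
qed

lemma val_eqI: "xs @ [y] \<in> ext U {us @ [f us] | us. True} \<Longrightarrow> val xs f = y"
  using graph_unique val_graph by blast

text \<open>In the tuple extended by the values, each new coordinate is eventually the function of
  the old ones whose value it is, since it lies on the extended graph. Substitution turns a relation
  between values into an eventual relation between functions.\<close>

lemma ext_map_val:
  "map (val xs) fs \<in> ext U R \<longleftrightarrow> eventually (\<lambda>us. map (\<lambda>f. f us) fs \<in> R) (dir xs)"
proof -
  let ?n = "length xs" and ?m = "length fs" and ?z = "xs @ map (val xs) fs"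
  have l: "map ((!) ?z) [0..<?n] = xs" by (rule nth_equalityI) (auto simp: nth_append)
  have l': "map ((!) ?z) [?n..<?n + ?m] = map (val xs) fs"
    by (rule nth_equalityI) (auto simp: nth_append)
  have ev: "eventually (\<lambda>us. us ! (?n + j) = (fs ! j) (map ((!) us) [0..<?n])) (dir ?z)" if "j < ?m" for j
  proof -
    have "eventually (\<lambda>us. map ((!) us) ([0..<?n] @ [?n + j]) \<in> {us @ [(fs ! j) us] | us. True}) (dir ?z)"
      by (subst eventually_dir_proj) (use that val_graph l in \<open>auto simp: nth_append\<close>)
    then show ?thesis by eventually_elim auto
  qed
  have "eventually (\<lambda>us. \<forall>j\<in>{..<?m}. us ! (?n + j) = (fs ! j) (map ((!) us) [0..<?n])) (dir ?z)"
    by (rule eventually_ball_finite) (use ev in auto)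
  then have eq: "eventually (\<lambda>us. map ((!) us) [?n..<?n + ?m] = map (\<lambda>f. f (map ((!) us) [0..<?n])) fs) (dir ?z)"
    by eventually_elim (auto intro!: nth_equalityI)
  have "map (val xs) fs \<in> ext U R \<longleftrightarrow> eventually (\<lambda>us. map ((!) us) [?n..<?n + ?m] \<in> R) (dir ?z)"
    using eventually_dir_proj[of "[?n..<?n + ?m]" ?z R, unfolded l'] by (auto simp: subset_iff)
  also have "\<dots> \<longleftrightarrow> eventually (\<lambda>us. map ((!) us) [0..<?n] \<in> {us. map (\<lambda>f. f us) fs \<in> R}) (dir ?z)"
    using eq by (intro eventually_subst) (auto elim: eventually_mono)
  also have "\<dots> \<longleftrightarrow> eventually (\<lambda>us. map (\<lambda>f. f us) fs \<in> R) (dir xs)"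
    by (subst eventually_dir_proj) (auto simp: l eventually_dir)
  finally show ?thesis .
qed

lemma val_nth: "i < length xs \<Longrightarrow> val xs (\<lambda>us. us ! i) = xs ! i"
proof (rule val_eqI)
  assume i: "i < length xs"
  have l: "map ((!) xs) ([0..<length xs] @ [i]) = xs @ [xs ! i]"
    by (simp add: map_nth)
  have "eventually (\<lambda>us. map ((!) us) ([0..<length xs] @ [i]) \<in> {us @ [us ! i] | us. True}) (dir xs)"
    using eventually_dir_length[of xs]
  proof eventually_elim
    case (elim us)
    then have "map ((!) us) [0..<length xs] = us" by (metis map_nth)
    then show ?case by auto
  qed
  then show "xs @ [xs ! i] \<in> ext U {us @ [us ! i] | us. True}"
    by (subst (asm) eventually_dir_proj) (use i l in auto)
qed

lemma val_const: "val xs (\<lambda>_. c) = std U c"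
proof (rule val_eqI)
  let ?z = "xs @ [std U c]"
  have "eventually (\<lambda>us. map ((!) us) [length xs] \<in> {[c]}) (dir ?z)"
    by (subst eventually_dir_proj) (auto simp: ext_std)
  then have "eventually (\<lambda>us. us \<in> {us @ [c] | us. True}) (dir ?z)"
    using eventually_dir_length[of ?z]
    by eventually_elim (auto simp: length_Suc_conv_rev nth_append)
  then show "?z \<in> ext U {us @ [c] | us. True}" by (simp add: ext_iff_eventually)
qed

text \<open>Nested extensions of functions collapse to one pointwise composite; every operation of
  the hull is evaluated in this way.\<close>

lemma val_comp: "ext_fun U F (map (val xs) fs) = val xs (\<lambda>us. F (map (\<lambda>f. f us) fs))"
proof (rule val_eqI)
  show "map (val xs) fs @ [val xs (\<lambda>us. F (map (\<lambda>f. f us) fs))] \<in> ext U {us @ [F us] | us. True}"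
    using ext_map_val[of xs "fs @ [\<lambda>us. F (map (\<lambda>f. f us) fs)]"] by simp
qed

lemma val_eq_iff: "val xs f = val xs g \<longleftrightarrow> eventually (\<lambda>us. f us = g us) (dir xs)"
  using ext_map_val[of xs "[f, g]" "{[u, u] | u. True}"] ext_diag[of "val xs f" "val xs g"]
  by (simp add: eq_commute[of "g _"])

lemma skolem: "(\<exists>y. xs @ [y] \<in> ext U R) \<longleftrightarrow> eventually (\<lambda>us. \<exists>u. us @ [u] \<in> R) (dir xs)"
  unfolding ext_Ex eventually_dir by simp

text \<open>An ultrafilter on a compact set converges: a cluster point exists by compactness, and a
  neighbourhood that is not eventually entered would be eventually avoided. These limits are the
  standard parts.\<close>

lemma dir_tendsto:
  fixes r :: "'v list \<Rightarrow> 'b::heine_borel"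
  assumes "eventually (\<lambda>us. r us \<in> C) (dir xs)" "compact C"
  shows "\<exists>l\<in>C. (r \<longlongrightarrow> l) (dir xs)"
proof -
  let ?F = "filtermap r (dir xs)"
  have "?F \<noteq> bot" by (simp add: filtermap_bot_iff)
  moreover have "eventually (\<lambda>x. x \<in> C) ?F" using assms by (simp add: eventually_filtermap)
  ultimately obtain l where l: "l \<in> C" "inf (nhds l) ?F \<noteq> bot"
    using assms(2)[unfolded compact_filter, rule_format, of ?F] by auto
  have "(r \<longlongrightarrow> l) (dir xs)"
  proof (rule topological_tendstoI, rule ccontr)
    fix S assume S: "open S" "l \<in> S" "\<not> eventually (\<lambda>us. r us \<in> S) (dir xs)"
    then have "eventually (\<lambda>x. x \<notin> S) ?F" by (simp add: eventually_filtermap eventually_dir_not)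
    moreover have "eventually (\<lambda>x. x \<in> S) (nhds l)" using S by (simp add: eventually_nhds_in_open)
    ultimately have "eventually (\<lambda>_. False) (inf (nhds l) ?F)"
      unfolding eventually_inf by (intro exI conjI) auto
    with l show False by (simp add: trivial_limit_def)
  qed
  with l show ?thesis by blast
qed

end

locale ns_saturated = ns_transfer +
  assumes countably_saturated:
    "\<And>F. F \<subseteq> internal_sets U \<Longrightarrow> countable F \<Longrightarrow>
      (\<And>G. G \<subseteq> F \<Longrightarrow> finite G \<Longrightarrow> \<Inter>G \<noteq> {}) \<Longrightarrow> \<Inter>F \<noteq> {}"

text \<open>A countable family has at most the cardinality of the natural numbers, which is strictly
  below \<kappa>.\<close>

lemma ns_saturatedI:
  fixes U :: "('v, 's) ns_universe" and \<kappa> :: "'k rel"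
  assumes "nonstandard_universe \<kappa> U"
  shows "ns_saturated U"
proof unfold_locales
  show "transfer_principle U" using assms by (simp add: nonstandard_universe_def)
  fix F assume F: "F \<subseteq> internal_sets U" "countable F" "\<And>G. G \<subseteq> F \<Longrightarrow> finite G \<Longrightarrow> \<Inter>G \<noteq> {}"
  have "(card_of F, card_of (UNIV :: nat set)) \<in> ordLeq"
    using F(2) unfolding countable_def card_of_ordLeq[symmetric] by auto
  then have "(card_of F, natLeq) \<in> ordLeq"
    using card_of_nat by (rule ordLeq_ordIso_trans)
  then have "(card_of F, \<kappa>) \<in> ordLess"
    using assms unfolding nonstandard_universe_def by (auto intro: ordLeq_ordLess_trans)
  then show "\<Inter>F \<noteq> {}" using assms F(1,3) unfolding nonstandard_universe_def saturated_def by simp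
qed

section \<open>Complex modules and pre-C*-algebras\<close>

lemma CC_simps [simp]:
  "carrier CC = UNIV" "a \<otimes>\<^bsub>CC\<^esub> b = a * b" "a \<oplus>\<^bsub>CC\<^esub> b = a + b" "\<one>\<^bsub>CC\<^esub> = 1" "\<zero>\<^bsub>CC\<^esub> = 0"
  by (simp_all add: CC_def)

lemma cring_CC: "cring CC"
proof (intro cringI abelian_groupI comm_monoidI)
  fix x :: complex
  show "\<exists>y\<in>carrier CC. y \<oplus>\<^bsub>CC\<^esub> x = \<zero>\<^bsub>CC\<^esub>" by (rule bexI[of _ "- x"]) auto
qed (auto simp: algebra_simps)

text \<open>The carrier of \<open>CC\<close> is everything and its operations are those of the
  complex numbers. The locale restates the module laws with ordinary arithmetic and without
  membership conditions on scalars.\<close>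

locale cmodule = M?: module CC V for V :: "(complex, 'a, 'm) module_scheme" (structure)
begin

lemma smult_cl [simp, intro]: "x \<in> carrier V \<Longrightarrow> c \<odot> x \<in> carrier V" by simp
lemma smult_add_left: "x \<in> carrier V \<Longrightarrow> (a + b) \<odot> x = a \<odot> x \<oplus> b \<odot> x"
  using smult_l_distr[of a b x] by simp
lemma smult_add_right: "x \<in> carrier V \<Longrightarrow> y \<in> carrier V \<Longrightarrow> c \<odot> (x \<oplus> y) = c \<odot> x \<oplus> c \<odot> y"
  using smult_r_distr[of c x y] by simp
lemma smult_smult [simp]: "x \<in> carrier V \<Longrightarrow> a \<odot> (b \<odot> x) = (a * b) \<odot> x"
  using smult_assoc1[of a b x] by simp
lemma smult_1 [simp]: "x \<in> carrier V \<Longrightarrow> 1 \<odot> x = x" using smult_one[of x] by simp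
lemma smult_0 [simp]: "x \<in> carrier V \<Longrightarrow> 0 \<odot> x = \<zero>" using smult_l_null[of x] by simp
lemma smult_zero [simp]: "c \<odot> \<zero> = \<zero>" using smult_r_null[of c] by simp
lemma uminus_eq_smult: "x \<in> carrier V \<Longrightarrow> \<ominus> x = (-1) \<odot> x"
proof -
  assume x: "x \<in> carrier V"
  have "(-1) \<odot> x \<oplus> x = ((-1) + 1) \<odot> x" using x by (subst smult_add_left) auto
  then have "(-1) \<odot> x \<oplus> x = \<zero>" using x by simp
  then show ?thesis using x by (metis M.minus_equality smult_cl)
qed
lemma minus_eq_smult: "x \<in> carrier V \<Longrightarrow> y \<in> carrier V \<Longrightarrow> x \<ominus> y = x \<oplus> (-1) \<odot> y"
  by (simp add: M.minus_eq uminus_eq_smult)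
lemma minus_eq_zero_iff: "x \<in> carrier V \<Longrightarrow> y \<in> carrier V \<Longrightarrow> x \<ominus> y = \<zero> \<longleftrightarrow> x = y"
  by (metis M.add.inv_solve_right M.l_zero M.minus_eq M.zero_closed M.r_neg)
lemma smult_eq_zero: "x \<in> carrier V \<Longrightarrow> c \<odot> x = \<zero> \<longleftrightarrow> c = 0 \<or> x = \<zero>"
proof
  assume x: "x \<in> carrier V" and 0: "c \<odot> x = \<zero>"
  show "c = 0 \<or> x = \<zero>"
  proof (rule ccontr)
    assume "\<not> ?thesis"
    moreover have "inverse c \<odot> (c \<odot> x) = \<zero>" using 0 by simp
    ultimately show False using x by simp
  qed
qed auto
lemma smult_cancel: "x \<in> carrier V \<Longrightarrow> x \<noteq> \<zero> \<Longrightarrow> a \<odot> x = b \<odot> x \<longleftrightarrow> a = b"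
proof
  assume x: "x \<in> carrier V" "x \<noteq> \<zero>" "a \<odot> x = b \<odot> x"
  have "(a - b) \<odot> x = a \<odot> x \<oplus> (- b) \<odot> x" using smult_add_left[of x a "- b"] x by simp
  also have "\<dots> = b \<odot> x \<oplus> (- b) \<odot> x" using x by simp
  also have "\<dots> = \<zero>" using smult_add_left[of x b "- b"] x by simp
  finally show "a = b" using smult_eq_zero[of x "a - b"] x by simp
qed simp

definition lspan :: "'a set \<Rightarrow> 'a set" where
  "lspan B = {\<Oplus>b\<in>B. c b \<odot> b | c. True}"

context
  fixes B assumes B: "finite B" "B \<subseteq> carrier V"
begin

lemma lspan_add: "x \<in> lspan B \<Longrightarrow> y \<in> lspan B \<Longrightarrow> x \<oplus> y \<in> lspan B"
proof -
  assume "x \<in> lspan B" "y \<in> lspan B"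
  then obtain c d where "x = (\<Oplus>b\<in>B. c b \<odot> b)" "y = (\<Oplus>b\<in>B. d b \<odot> b)" by (auto simp: lspan_def)
  moreover have "(\<Oplus>b\<in>B. c b \<odot> b \<oplus> d b \<odot> b) = (\<Oplus>b\<in>B. (c b + d b) \<odot> b)"
    using B by (intro M.finsum_cong') (auto simp: smult_add_left)
  moreover have "(\<Oplus>b\<in>B. c b \<odot> b \<oplus> d b \<odot> b) = (\<Oplus>b\<in>B. c b \<odot> b) \<oplus> (\<Oplus>b\<in>B. d b \<odot> b)"
    using B by (intro M.finsum_addf) auto
  ultimately have "x \<oplus> y = (\<Oplus>b\<in>B. (c b + d b) \<odot> b)" by simp
  then show ?thesis unfolding lspan_def mem_Collect_eq by (intro exI[of _ "\<lambda>b. c b + d b"]) simp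
qed

lemma lspan_smult: "x \<in> lspan B \<Longrightarrow> a \<odot> x \<in> lspan B"
proof -
  assume "x \<in> lspan B"
  then obtain c where c: "x = (\<Oplus>b\<in>B. c b \<odot> b)" by (auto simp: lspan_def)
  have "a \<odot> x = (\<Oplus>b\<in>B. a \<odot> (c b \<odot> b))"
    unfolding c using B by (intro finsum_smult_ldistr) auto
  also have "\<dots> = (\<Oplus>b\<in>B. (a * c b) \<odot> b)" using B by (intro M.finsum_cong') auto
  finally show ?thesis unfolding lspan_def mem_Collect_eq by (intro exI[of _ "\<lambda>b. a * c b"]) simp
qed

lemma lspan_gen: "x \<in> B \<Longrightarrow> x \<in> lspan B"
proof -
  assume x: "x \<in> B"
  have "(\<Oplus>b\<in>B. (if x = b then 1 else 0) \<odot> b) = (\<Oplus>b\<in>B. if x = b then b else \<zero>)"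
    using B by (intro M.finsum_cong') auto
  also have "\<dots> = x" using B x by (subst M.finsum_singleton) auto
  finally show ?thesis unfolding lspan_def mem_Collect_eq by metis
qed

lemma lspan_zero: "\<zero> \<in> lspan B"
proof -
  have "(\<Oplus>b\<in>B. 0 \<odot> b) = (\<Oplus>b\<in>B. \<zero>)" using B by (intro M.finsum_cong') auto
  then show ?thesis unfolding lspan_def mem_Collect_eq by (intro exI[of _ "\<lambda>_. 0"]) simp
qed

lemma lspan_finsum:
  assumes "finite I" "\<And>i. i \<in> I \<Longrightarrow> f i \<in> lspan B" "f \<in> I \<rightarrow> carrier V"
  shows "(\<Oplus>i\<in>I. f i) \<in> lspan B"
  using assms
proof (induction I rule: finite_induct)
  case empty then show ?case by (simp add: lspan_zero)
next
  case (insert i I)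
  then have "(\<Oplus>i\<in>insert i I. f i) = f i \<oplus> (\<Oplus>i\<in>I. f i)" by (intro M.finsum_insert) auto
  then show ?case using insert by (auto intro: lspan_add)
qed

end

lemma finite_dimensional_iff:
  "finite_dimensional V \<longleftrightarrow> (\<exists>B. finite B \<and> B \<subseteq> carrier V \<and> carrier V \<subseteq> lspan B)"
proof -
  have "carrier V \<subseteq> lspan B \<longleftrightarrow> (\<forall>x\<in>carrier V. \<exists>c. x = (\<Oplus>b\<in>B. c b \<odot> b))" for B
    by (auto simp: lspan_def)
  then show ?thesis unfolding finite_dimensional_def by simp
qed

end

text \<open>The new projection is asked to annihilate the whole remaining sum, not each of its
  terms. So no list of projections is carried along, and inductions peel off one projection at a
  time.\<close>

primrec combs :: "'a cstar \<Rightarrow> nat \<Rightarrow> 'a set" where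
  "combs A 0 = {\<zero>\<^bsub>A\<^esub>}"
| "combs A (Suc n) = {\<alpha> \<odot>\<^bsub>A\<^esub> p \<oplus>\<^bsub>A\<^esub> s | \<alpha> p s. p \<in> projections A \<and> s \<in> combs A n \<and>
     p \<otimes>\<^bsub>A\<^esub> s = \<zero>\<^bsub>A\<^esub> \<and> s \<otimes>\<^bsub>A\<^esub> p = \<zero>\<^bsub>A\<^esub>}"

text \<open>Eigenprojections of a self-adjoint element for distinct eigenvalues are orthogonal, so
  a single element \<open>a\<close> encodes \<open>n\<close> orthogonal nonzero projections.\<close>

definition many_projections :: "'a cstar \<Rightarrow> nat \<Rightarrow> bool" where
  "many_projections A n \<longleftrightarrow> (\<exists>a\<in>carrier A. adj A a = a \<and>
     (\<forall>k<n. \<exists>p\<in>projections A. p \<noteq> \<zero>\<^bsub>A\<^esub> \<and> a \<otimes>\<^bsub>A\<^esub> p = of_nat k \<odot>\<^bsub>A\<^esub> p))"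

text \<open>The axioms of a C*-algebra apart from completeness. They are identities and norm
  relations, hence pass to the hull by taking limits of norms.\<close>

locale pre_cstar = cmodule A + ring A for A :: "'a cstar" (structure) +
  assumes smult_mult_left: "\<And>c x y. x \<in> carrier A \<Longrightarrow> y \<in> carrier A \<Longrightarrow> (c \<odot> x) \<otimes> y = c \<odot> (x \<otimes> y)"
    and smult_mult_right: "\<And>c x y. x \<in> carrier A \<Longrightarrow> y \<in> carrier A \<Longrightarrow> x \<otimes> (c \<odot> y) = c \<odot> (x \<otimes> y)"
    and adj_closed [simp, intro]: "\<And>x. x \<in> carrier A \<Longrightarrow> adj A x \<in> carrier A"
    and adj_adj [simp]: "\<And>x. x \<in> carrier A \<Longrightarrow> adj A (adj A x) = x"
    and adj_add: "\<And>x y. x \<in> carrier A \<Longrightarrow> y \<in> carrier A \<Longrightarrow> adj A (x \<oplus> y) = adj A x \<oplus> adj A y"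
    and adj_mult: "\<And>x y. x \<in> carrier A \<Longrightarrow> y \<in> carrier A \<Longrightarrow> adj A (x \<otimes> y) = adj A y \<otimes> adj A x"
    and adj_smult: "\<And>c x. x \<in> carrier A \<Longrightarrow> adj A (c \<odot> x) = cnj c \<odot> adj A x"
    and nrm_nonneg [simp]: "\<And>x. x \<in> carrier A \<Longrightarrow> 0 \<le> nrm A x"
    and nrm_eq_0: "\<And>x. x \<in> carrier A \<Longrightarrow> nrm A x = 0 \<longleftrightarrow> x = \<zero>"
    and nrm_smult: "\<And>c x. x \<in> carrier A \<Longrightarrow> nrm A (c \<odot> x) = cmod c * nrm A x"
    and nrm_add: "\<And>x y. x \<in> carrier A \<Longrightarrow> y \<in> carrier A \<Longrightarrow> nrm A (x \<oplus> y) \<le> nrm A x + nrm A y"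
    and nrm_mult: "\<And>x y. x \<in> carrier A \<Longrightarrow> y \<in> carrier A \<Longrightarrow> nrm A (x \<otimes> y) \<le> nrm A x * nrm A y"
    and nrm_cstar: "\<And>x. x \<in> carrier A \<Longrightarrow> nrm A (adj A x \<otimes> x) = (nrm A x)\<^sup>2"

lemma cstar_algebra_pre_cstar: "cstar_algebra A \<Longrightarrow> pre_cstar A"
proof -
  assume "cstar_algebra A"
  note A = this[unfolded cstar_algebra_def]
  note c1 = conjunct1[OF A] and t1 = conjunct2[OF A]
  note c2 = conjunct1[OF t1] and t2 = conjunct2[OF t1]
  note c3 = conjunct1[OF t2, rule_format] and t3 = conjunct2[OF t2]
  note c4 = conjunct1[OF t3, rule_format] and t4 = conjunct2[OF t3]
  note c5 = conjunct1[OF t4, rule_format] and t5 = conjunct2[OF t4]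
  note c6 = conjunct1[OF t5, rule_format] and t6 = conjunct2[OF t5]
  note c7 = conjunct1[OF t6, rule_format] and t7 = conjunct2[OF t6]
  note c8 = conjunct1[OF t7, rule_format] and t8 = conjunct2[OF t7]
  note c9 = conjunct1[OF t8, rule_format] and t9 = conjunct2[OF t8]
  note c10 = conjunct1[OF t9, rule_format]
  show ?thesis
    by (intro pre_cstar.intro cmodule.intro pre_cstar_axioms.intro c1 c2 c6 c8 c10
        conjunct1[OF c3, symmetric] conjunct2[OF c3, symmetric] conjunct1[OF c4] conjunct2[OF c4]
        conjunct1[OF c5] conjunct2[OF c5] conjunct1[OF c7] conjunct2[OF c7] conjunct1[OF c9] conjunct2[OF c9])
qed

context pre_cstar begin

lemma adj_zero [simp]: "adj A \<zero> = \<zero>"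
  using adj_smult[of \<zero> 0] by simp

lemma adj_one [simp]: "adj A \<one> = \<one>"
  by (metis adj_adj adj_closed adj_mult l_one one_closed r_one)

lemma adj_uminus: "x \<in> carrier A \<Longrightarrow> adj A (\<ominus> x) = \<ominus> adj A x"
  by (simp add: uminus_eq_smult adj_smult)

lemma adj_minus: "x \<in> carrier A \<Longrightarrow> y \<in> carrier A \<Longrightarrow> adj A (x \<ominus> y) = adj A x \<ominus> adj A y"
  by (simp add: minus_eq adj_add adj_uminus)

lemma nrm_zero [simp]: "nrm A \<zero> = 0" by (simp add: nrm_eq_0)

text \<open>The C*-identity and submultiplicativity give
  \<open>(nrm A x)\<^sup>2 \<le> nrm A (adj A x) * nrm A x\<close>; the same for
  \<open>adj A x\<close> gives equality.\<close>

lemma nrm_adj: "x \<in> carrier A \<Longrightarrow> nrm A (adj A x) = nrm A x"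
proof -
  have le: "nrm A x \<le> nrm A (adj A x)" if x: "x \<in> carrier A" for x
  proof (cases "nrm A x = 0")
    case False
    have "nrm A x * nrm A x \<le> nrm A (adj A x) * nrm A x"
      using nrm_cstar[OF x] nrm_mult[of "adj A x" x] x by (simp add: power2_eq_square)
    then show ?thesis using False nrm_nonneg[OF x] by (simp add: mult_le_cancel_right)
  qed (use x in auto)
  show "x \<in> carrier A \<Longrightarrow> ?thesis" using le[of x] le[of "adj A x"] by simp
qed

lemma adj_mult_eq_0: "x \<in> carrier A \<Longrightarrow> adj A x \<otimes> x = \<zero> \<Longrightarrow> x = \<zero>"
  using nrm_cstar[of x] by (simp add: nrm_eq_0)

lemma adj_finsum: "finite I \<Longrightarrow> f \<in> I \<rightarrow> carrier A \<Longrightarrow> adj A (\<Oplus>i\<in>I. f i) = (\<Oplus>i\<in>I. adj A (f i))"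
proof (induction I rule: finite_induct)
  case (insert i I)
  then have "(\<Oplus>i\<in>insert i I. f i) = f i \<oplus> (\<Oplus>i\<in>I. f i)"
    "(\<Oplus>i\<in>insert i I. adj A (f i)) = adj A (f i) \<oplus> (\<Oplus>i\<in>I. adj A (f i))"
    by (auto intro!: finsum_insert)
  then show ?case using insert by (auto simp: adj_add)
qed simp

lemma projD: "p \<in> projections A \<Longrightarrow> p \<in> carrier A" "p \<in> projections A \<Longrightarrow> adj A p = p"
  "p \<in> projections A \<Longrightarrow> p \<otimes> p = p"
  by (auto simp: projections_def)

lemma nrm_proj: "p \<in> projections A \<Longrightarrow> p \<noteq> \<zero> \<Longrightarrow> nrm A p = 1"
  using nrm_cstar[of p] projD[of p] nrm_eq_0[of p] by (simp add: power2_eq_square)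

lemma nrm_proj_le: "p \<in> projections A \<Longrightarrow> nrm A p \<le> 1"
  by (cases "p = \<zero>") (auto simp: nrm_proj)

lemma zero_proj [simp]: "\<zero> \<in> projections A" by (simp add: projections_def)

lemma combs_closed: "s \<in> combs A n \<Longrightarrow> s \<in> carrier A"
  by (induction n arbitrary: s) (auto simp: projD)

lemma combs_Suc: "s \<in> combs A n \<Longrightarrow> s \<in> combs A (Suc n)"
proof -
  assume s: "s \<in> combs A n"
  then have "s = 0 \<odot> \<zero> \<oplus> s \<and> \<zero> \<in> projections A \<and> s \<in> combs A n \<and> \<zero> \<otimes> s = \<zero> \<and> s \<otimes> \<zero> = \<zero>"
    using combs_closed by simp
  then show ?thesis unfolding combs.simps by blast
qed

lemma combs_mono: "m \<le> n \<Longrightarrow> s \<in> combs A m \<Longrightarrow> s \<in> combs A n"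
  by (induction n rule: dec_induct) (auto intro: combs_Suc simp del: combs.simps)

lemma many_projectionsI:
  assumes I: "finite I" "n \<le> card I"
    and p: "\<And>i. i \<in> I \<Longrightarrow> p i \<in> projections A" "\<And>i. i \<in> I \<Longrightarrow> p i \<noteq> \<zero>"
    and orth: "\<And>i j. i \<in> I \<Longrightarrow> j \<in> I \<Longrightarrow> i \<noteq> j \<Longrightarrow> p i \<otimes> p j = \<zero>"
  shows "many_projections A n"
proof -
  obtain g where g: "bij_betw g {0..<card I} I" using ex_bij_betw_nat_finite[OF I(1)] by blast
  define f where "f = g"
  have f: "f k \<in> I" if "k < n" for k using g that I(2) by (auto simp: bij_betw_def f_def)
  have inj: "k = l" if "f k = f l" "k < n" "l < n" for k l
    using g that I(2) unfolding bij_betw_def inj_on_def f_def by auto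
  define a where "a = (\<Oplus>k\<in>{..<n}. of_nat k \<odot> p (f k))"
  have cl: "p (f k) \<in> carrier A" if "k < n" for k using f p that projD by blast
  have fin: "(\<lambda>k. of_nat k \<odot> p (f k)) \<in> {..<n} \<rightarrow> carrier A" using cl by auto
  have a: "a \<in> carrier A" unfolding a_def using fin by (intro finsum_closed) auto
  have "adj A a = (\<Oplus>k\<in>{..<n}. adj A (of_nat k \<odot> p (f k)))"
    unfolding a_def using fin by (intro adj_finsum) auto
  also have "\<dots> = a" unfolding a_def using fin cl f p projD
    by (intro finsum_cong') (auto simp: adj_smult)
  finally have "adj A a = a" .
  moreover have "a \<otimes> p (f k) = of_nat k \<odot> p (f k)" if k: "k < n" for k
  proof -
    have "a \<otimes> p (f k) = (\<Oplus>l\<in>{..<n}. (of_nat l \<odot> p (f l)) \<otimes> p (f k))"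
      unfolding a_def using fin cl k by (intro finsum_ldistr) auto
    also have "\<dots> = (\<Oplus>l\<in>{..<n}. if k = l then of_nat l \<odot> p (f l) else \<zero>)"
    proof (intro finsum_cong')
      fix l assume l: "l \<in> {..<n}"
      show "(of_nat l \<odot> p (f l)) \<otimes> p (f k) = (if k = l then of_nat l \<odot> p (f l) else \<zero>)"
      proof (cases "k = l")
        case True
        then show ?thesis using k cl f p(1) projD(3)[of "p (f k)"] by (simp add: smult_mult_left)
      next
        case False
        then have "p (f l) \<otimes> p (f k) = \<zero>" using orth[of "f l" "f k"] inj[of l k] f l k by auto
        then show ?thesis using False l k cl by (simp add: smult_mult_left)
      qed
    qed (use cl in auto)
    also have "\<dots> = of_nat k \<odot> p (f k)" using k fin by (subst finsum_singleton) auto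
    finally show ?thesis .
  qed
  ultimately show ?thesis unfolding many_projections_def using a f p by metis
qed

text \<open>A family of orthogonal projections may contain zero any number of times, while
  \<open>many_projections\<close> speaks of nonzero ones; hence the length counts only the
  latter.\<close>

lemma combs_finsum:
  assumes "finite I" "\<And>i. i \<in> I \<Longrightarrow> p i \<in> projections A"
    and "\<And>i j. i \<in> I \<Longrightarrow> j \<in> I \<Longrightarrow> i \<noteq> j \<Longrightarrow> p i \<otimes> p j = \<zero>"
  shows "(\<Oplus>i\<in>I. \<alpha> i \<odot> p i) \<in> combs A (card {i \<in> I. p i \<noteq> \<zero>})"
  using assms
proof (induction I rule: finite_induct)
  case (insert i I)
  let ?s = "\<Oplus>i\<in>I. \<alpha> i \<odot> p i"
  have cl: "(\<lambda>i. \<alpha> i \<odot> p i) \<in> I \<rightarrow> carrier A" "p i \<in> carrier A" using insert projD by auto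
  have eq: "(\<Oplus>i\<in>insert i I. \<alpha> i \<odot> p i) = \<alpha> i \<odot> p i \<oplus> ?s"
    using insert cl by (intro finsum_insert) auto
  have s: "?s \<in> combs A (card {i \<in> I. p i \<noteq> \<zero>})" using insert by blast
  have o: "p i \<otimes> p j = \<zero>" "p j \<otimes> p i = \<zero>" "p j \<in> carrier A" if "j \<in> I" for j
    using insert.hyps insert.prems that projD(1) by (metis insertI1 insertI2)+
  have "p i \<otimes> ?s = (\<Oplus>j\<in>I. p i \<otimes> (\<alpha> j \<odot> p j))"
    using insert cl by (intro finsum_rdistr) auto
  also have "\<dots> = (\<Oplus>j\<in>I. \<zero>)"
    using o cl by (intro finsum_cong') (auto simp: smult_mult_right)
  finally have 1: "p i \<otimes> ?s = \<zero>" by simp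
  have "?s \<otimes> p i = (\<Oplus>j\<in>I. (\<alpha> j \<odot> p j) \<otimes> p i)"
    using insert cl by (intro finsum_ldistr) auto
  also have "\<dots> = (\<Oplus>j\<in>I. \<zero>)"
    using o cl by (intro finsum_cong') (auto simp: smult_mult_left)
  finally have 2: "?s \<otimes> p i = \<zero>" by simp
  show ?case
  proof (cases "p i = \<zero>")
    case True
    then have "{j \<in> insert i I. p j \<noteq> \<zero>} = {j \<in> I. p j \<noteq> \<zero>}" by auto
    then show ?thesis using True s eq combs_closed[OF s] by simp
  next
    case False
    then have "{j \<in> insert i I. p j \<noteq> \<zero>} = insert i {j \<in> I. p j \<noteq> \<zero>}" by auto
    then have "card {j \<in> insert i I. p j \<noteq> \<zero>} = Suc (card {j \<in> I. p j \<noteq> \<zero>})"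
      using insert by simp
    then show ?thesis using insert s 1 2 unfolding eq by auto
  qed
qed simp

lemma projection_combinations_combs:
  assumes "\<not> many_projections A n" "s \<in> projection_combinations A"
  shows "s \<in> combs A n"
proof -
  obtain N :: nat and \<alpha> p where s: "s = (\<Oplus>i\<in>{..N}. \<alpha> i \<odot> p i)" and p: "\<forall>i\<le>N. p i \<in> projections A"
    and o: "\<forall>i\<le>N. \<forall>j\<le>N. i \<noteq> j \<longrightarrow> p i \<otimes> p j = \<zero>"
    using assms(2) unfolding projection_combinations_def by blast
  let ?J = "{i \<in> {..N}. p i \<noteq> \<zero>}"
  have "many_projections A n" if "n \<le> card ?J"
    by (rule many_projectionsI[of ?J n p]) (use p o that in \<open>simp; blast?\<close>)+
  then have "card ?J \<le> n" using assms(1) by linarith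
  moreover have "s \<in> combs A (card ?J)" unfolding s by (rule combs_finsum) (use p o in \<open>simp; blast?\<close>)+
  ultimately show ?thesis by (rule combs_mono)
qed

end

section \<open>Algebras with boundedly many orthogonal projections\<close>

context pre_cstar begin

text \<open>The exceptional set collects the coefficients. Multiplying
  \<open>a \<otimes> p = c \<odot> p\<close> by the leading projection q gives
  \<open>\<alpha> \<odot> (q \<otimes> p) = c \<odot> (q \<otimes> p)\<close>; if c differs from
  \<alpha>, then q annihilates p, and p is an eigenvector of the shorter sum. The eigenvalue 0 is
  excluded because the empty sum annihilates everything.\<close>

lemma combs_spectrum:
  "a \<in> combs A n \<Longrightarrow> \<exists>S. finite S \<and> card S \<le> n \<and>
     (\<forall>c p. p \<in> carrier A \<longrightarrow> c \<notin> S \<longrightarrow> c \<noteq> 0 \<longrightarrow> a \<otimes> p = c \<odot> p \<longrightarrow> p = \<zero>)"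
proof (induction n arbitrary: a)
  case 0
  then have "a = \<zero>" by simp
  then have "\<forall>c p. p \<in> carrier A \<longrightarrow> c \<notin> {} \<longrightarrow> c \<noteq> 0 \<longrightarrow> a \<otimes> p = c \<odot> p \<longrightarrow> p = \<zero>"
    by (metis l_null smult_eq_zero)
  then show ?case by (intro exI[of _ "{}"]) simp
next
  case (Suc n)
  then obtain \<alpha> q s where a: "a = \<alpha> \<odot> q \<oplus> s" and q: "q \<in> projections A" and s: "s \<in> combs A n"
    and qs: "q \<otimes> s = \<zero>" by auto
  obtain S where S: "finite S" "card S \<le> n"
    "\<And>c p. p \<in> carrier A \<Longrightarrow> c \<notin> S \<Longrightarrow> c \<noteq> 0 \<Longrightarrow> s \<otimes> p = c \<odot> p \<Longrightarrow> p = \<zero>"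
    using Suc.IH[OF s] by blast
  note cl = projD(1)[OF q] combs_closed[OF s]
  have "p = \<zero>" if p: "p \<in> carrier A" "c \<notin> insert \<alpha> S" "c \<noteq> 0" "a \<otimes> p = c \<odot> p" for c p
  proof -
    have ap: "a \<otimes> p = \<alpha> \<odot> (q \<otimes> p) \<oplus> s \<otimes> p"
      unfolding a using cl p(1) by (simp add: l_distr smult_mult_left)
    have "q \<otimes> (a \<otimes> p) = \<alpha> \<odot> (q \<otimes> p)"
      unfolding ap using cl p(1) projD(3)[OF q] qs
      by (simp add: r_distr smult_mult_right m_assoc[symmetric])
    then have "\<alpha> \<odot> (q \<otimes> p) = c \<odot> (q \<otimes> p)" using p cl by (simp add: smult_mult_right)
    then have qp: "q \<otimes> p = \<zero>" using smult_cancel[of "q \<otimes> p" \<alpha> c] p cl by auto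
    then have "s \<otimes> p = c \<odot> p" using ap p cl by simp
    then show ?thesis using S(3)[of p c] p by auto
  qed
  moreover have "card (insert \<alpha> S) \<le> Suc n" using S by (metis card_insert_le_m1 Suc_le_mono card.insert card_insert_if le_SucI)
  ultimately show ?case using S(1) by (intro exI[of _ "insert \<alpha> S"]) auto
qed

text \<open>Since e absorbs h from both sides, it also absorbs the leading projection of h if its
  coefficient is nonzero; minimality then makes this projection equal to e.\<close>

lemma combs_corner:
  assumes e: "e \<in> projections A"
    and min: "\<And>q. q \<in> projections A \<Longrightarrow> e \<otimes> q = q \<Longrightarrow> q \<otimes> e = q \<Longrightarrow> q = \<zero> \<or> q = e"
  shows "h \<in> combs A n \<Longrightarrow> e \<otimes> h = h \<Longrightarrow> h \<otimes> e = h \<Longrightarrow> \<exists>c. h = c \<odot> e"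
proof (induction n arbitrary: h)
  case 0
  then have "h = 0 \<odot> e" using projD(1)[OF e] by simp
  then show ?case ..
next
  case (Suc n)
  then obtain \<alpha> q s where h: "h = \<alpha> \<odot> q \<oplus> s" and q: "q \<in> projections A" and s: "s \<in> combs A n"
    and qs: "q \<otimes> s = \<zero>" "s \<otimes> q = \<zero>" by auto
  note cl = projD(1)[OF q] combs_closed[OF s] projD(1)[OF e]
  have hc: "h \<in> carrier A" using h cl by simp
  have qh: "q \<otimes> h = \<alpha> \<odot> q" "h \<otimes> q = \<alpha> \<odot> q"
    unfolding h using cl qs projD(3)[OF q] by (simp_all add: r_distr l_distr smult_mult_right smult_mult_left)
  show ?case
  proof (cases "\<alpha> = 0 \<or> q = \<zero>")
    case True
    then have "h = s" using h cl by auto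
    then show ?thesis using Suc s by blast
  next
    case False
    \<comment> \<open>\<open>\<alpha> \<odot> q\<close> is both \<open>q \<otimes> h\<close> and
      \<open>h \<otimes> q\<close>, so it inherits the absorption by e from h; dividing by \<alpha>
      puts q below e.\<close>
    have "\<alpha> \<odot> (q \<otimes> e) = \<alpha> \<odot> q"
      by (metis Suc.prems(3) cl(1,3) hc m_assoc qh(1) smult_mult_left)
    moreover have "\<alpha> \<odot> (e \<otimes> q) = \<alpha> \<odot> q"
      by (metis Suc.prems(2) cl(1,3) hc m_assoc qh(2) smult_mult_right)
    ultimately have "inverse \<alpha> \<odot> (\<alpha> \<odot> (q \<otimes> e)) = inverse \<alpha> \<odot> (\<alpha> \<odot> q)"
      "inverse \<alpha> \<odot> (\<alpha> \<odot> (e \<otimes> q)) = inverse \<alpha> \<odot> (\<alpha> \<odot> q)" by simp_all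
    then have "q \<otimes> e = q" "e \<otimes> q = q" using False cl by simp_all
    then have "q = e" using min[OF q] False by auto
    then have "h = \<alpha> \<odot> e" using qh(1) Suc.prems(2) by simp
    then show ?thesis ..
  qed
qed

text \<open>A substitute for positivity of squares that needs no spectral theory.\<close>

lemma combs_negative_square:
  assumes g: "g \<in> projections A" and t: "t < (0::real)"
  shows "h \<in> combs A n \<Longrightarrow> adj A h = h \<Longrightarrow> h \<otimes> h = of_real t \<odot> g \<Longrightarrow> h = \<zero>"
proof (induction n arbitrary: h)
  case 0
  then show ?case by simp
next
  case (Suc n)
  then obtain \<alpha> q s where h: "h = \<alpha> \<odot> q \<oplus> s" and q: "q \<in> projections A" and s: "s \<in> combs A n"
    and qs: "q \<otimes> s = \<zero>" "s \<otimes> q = \<zero>" by auto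
  note cl = projD(1)[OF q] combs_closed[OF s] projD(1)[OF g]
  have hc: "h \<in> carrier A" using h cl by simp
  have qh: "q \<otimes> h = \<alpha> \<odot> q" "h \<otimes> q = \<alpha> \<odot> q"
    unfolding h using cl qs projD(3)[OF q] by (simp_all add: r_distr l_distr smult_mult_right smult_mult_left)
  show ?case
  proof (cases "\<alpha> = 0 \<or> q = \<zero>")
    case True
    then have "h = s" using h cl by auto
    then show ?thesis using Suc s by blast
  next
    case False
    \<comment> \<open>Comparing \<open>q \<otimes> h\<close> with its adjoint makes the coefficient
      real, so that its square cannot be negative.\<close>
    have "adj A (q \<otimes> h) = h \<otimes> q" using hc cl projD(2)[OF q] Suc.prems by (simp add: adj_mult)
    then have "cnj \<alpha> \<odot> q = \<alpha> \<odot> q" using qh cl projD(2)[OF q] by (simp add: adj_smult)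
    then have "cnj \<alpha> = \<alpha>" using smult_cancel False cl by blast
    then obtain r where r: "\<alpha> = of_real r" by (metis Reals_cases Reals_cnj_iff)
    have "q \<otimes> (h \<otimes> h) = (\<alpha> * \<alpha>) \<odot> q"
      using qh cl hc by (simp add: m_assoc[symmetric] smult_mult_left)
    \<comment> \<open>If q is not orthogonal to g, multiplying by g forces \<alpha>^2 = t,
      impossible for a real \<alpha>. If it is, the right-hand side vanishes and so does the
      multiple \<alpha>^2 of q.\<close>
    then have *: "(\<alpha> * \<alpha>) \<odot> q = of_real t \<odot> (q \<otimes> g)" using Suc.prems cl by (simp add: smult_mult_right)
    then have "((\<alpha> * \<alpha>) \<odot> q) \<otimes> g = (of_real t \<odot> (q \<otimes> g)) \<otimes> g" by simp
    then have "(\<alpha> * \<alpha>) \<odot> (q \<otimes> g) = of_real t \<odot> (q \<otimes> g)"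
      using cl projD(3)[OF g] by (simp add: smult_mult_left m_assoc)
    then have "\<alpha> * \<alpha> = of_real t \<or> q \<otimes> g = \<zero>" using smult_cancel[of "q \<otimes> g"] cl by auto
    moreover have "\<alpha> * \<alpha> \<noteq> of_real t"
    proof
      assume "\<alpha> * \<alpha> = of_real t"
      then have "r * r = t" unfolding r by (metis of_real_eq_iff of_real_mult)
      then show False using t by (smt (verit) zero_le_square)
    qed
    ultimately have "(\<alpha> * \<alpha>) \<odot> q = \<zero>" using * by simp
    then show ?thesis using False cl smult_eq_zero by auto
  qed
qed

definition orth_family :: "'a set \<Rightarrow> bool" where
  "orth_family P \<longleftrightarrow> finite P \<and> P \<subseteq> projections A - {\<zero>} \<and> (\<forall>p\<in>P. \<forall>q\<in>P. p \<noteq> q \<longrightarrow> p \<otimes> q = \<zero>)"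

end

text \<open>The decomposition of a finite-dimensional algebra along a maximal family of orthogonal
  projections. The last assumption is positivity of \<open>y\<^sup>*y\<close> on matrix units.\<close>

locale matrix_frame = pre_cstar +
  fixes P :: "'a set"
  assumes fam: "orth_family P"
    and sum_P: "(\<Oplus>p\<in>P. p) = \<one>"
    and corner: "\<And>e y. e \<in> P \<Longrightarrow> y \<in> carrier A \<Longrightarrow> \<exists>c. e \<otimes> y \<otimes> e = c \<odot> e"
    and unit_pos: "\<And>e f y c. e \<in> P \<Longrightarrow> f \<in> P \<Longrightarrow> y \<in> carrier A \<Longrightarrow> f \<otimes> y = y \<Longrightarrow> y \<otimes> e = y \<Longrightarrow>
      adj A y \<otimes> y = c \<odot> e \<Longrightarrow> Im c = 0 \<and> 0 \<le> Re c"

text \<open>Exact combinations of bounded length, with no approximation left: this is what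
  saturation gives for the hull in the bounded case.\<close>

locale bounded_combs = pre_cstar +
  fixes n :: nat
  assumes combs_all: "\<And>h. h \<in> carrier A \<Longrightarrow> adj A h = h \<Longrightarrow> h \<in> combs A n"
begin

text \<open>The eigenvalues 1, ..., k - 1 all lie in a set of at most n scalars. The eigenvalue 0 is
  not controlled by \<open>combs_spectrum\<close>, whence n + 1.\<close>

lemma many_projections_le: "many_projections A k \<Longrightarrow> k \<le> n + 1"
proof -
  assume "many_projections A k"
  then obtain a where a: "a \<in> carrier A" "adj A a = a"
    and ev: "\<And>j. j < k \<Longrightarrow> \<exists>p\<in>projections A. p \<noteq> \<zero> \<and> a \<otimes> p = of_nat j \<odot> p"
    unfolding many_projections_def by blast
  obtain S where S: "finite S" "card S \<le> n"
    "\<And>c p. p \<in> carrier A \<Longrightarrow> c \<notin> S \<Longrightarrow> c \<noteq> 0 \<Longrightarrow> a \<otimes> p = c \<odot> p \<Longrightarrow> p = \<zero>"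
    using combs_spectrum[OF combs_all[OF a]] by blast
  have "of_nat ` {1..<k} \<subseteq> S"
  proof safe
    fix j assume "j \<in> {1..<k}"
    then obtain p where "p \<in> projections A" "p \<noteq> \<zero>" "a \<otimes> p = of_nat j \<odot> p" "(of_nat j :: complex) \<noteq> 0"
      using ev[of j] by auto
    then show "of_nat j \<in> S" using S(3)[of p "of_nat j"] projD(1) by blast
  qed
  then have "card ((of_nat :: nat \<Rightarrow> complex) ` {1..<k}) \<le> n"
    using card_mono[OF S(1)] S(2) order_trans by blast
  moreover have "card ((of_nat :: nat \<Rightarrow> complex) ` {1..<k}) = k - 1" by (subst card_image) (auto simp: inj_on_def)
  ultimately show ?thesis by simp
qed

lemma orth_family_card: "orth_family P \<Longrightarrow> card P \<le> n + 1"
  by (rule many_projections_le, rule many_projectionsI[of P _ "\<lambda>p. p"])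
    (auto simp: orth_family_def)

text \<open>Sizes of orthogonal families are bounded, so one of greatest size exists. Its maximality
  is used twice: adjoining the complement of the sum shows that the sum is 1, and splitting a member
  e into q and \<open>e \<ominus> q\<close> shows that members are minimal.\<close>

lemma frame_exists: "\<exists>P. matrix_frame A P"
proof -
  have "orth_family {}" by (simp add: orth_family_def)
  then have "\<exists>P. orth_family P \<and> (\<forall>Q. orth_family Q \<longrightarrow> card Q \<le> card P)"
    by (rule ex_has_greatest_nat[of orth_family "{}" card "n + 2"]) (use orth_family_card in fastforce)
  then obtain P where P: "orth_family P" and max: "\<And>Q. orth_family Q \<Longrightarrow> card Q \<le> card P"
    by metis
  have finP: "finite P" and Pp: "\<And>p. p \<in> P \<Longrightarrow> p \<in> projections A" "\<And>p. p \<in> P \<Longrightarrow> p \<noteq> \<zero>"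
    and orth: "\<And>p q. p \<in> P \<Longrightarrow> q \<in> P \<Longrightarrow> p \<noteq> q \<Longrightarrow> p \<otimes> q = \<zero>"
    using P unfolding orth_family_def by auto
  have Pc: "(\<lambda>p. p) \<in> P \<rightarrow> carrier A" using Pp projD(1) by auto
  have sum1: "(\<Oplus>p\<in>P. p) = \<one>"
  proof (rule ccontr)
    let ?s = "\<Oplus>p\<in>P. p"
    assume ne: "?s \<noteq> \<one>"
    have s: "?s \<in> carrier A" using Pc by (intro finsum_closed) auto
    have "adj A ?s = (\<Oplus>p\<in>P. adj A p)" using Pc finP by (intro adj_finsum) auto
    also have "\<dots> = ?s" using Pc Pp projD by (intro finsum_cong') auto
    finally have sa: "adj A ?s = ?s" .
    have ps: "p \<otimes> ?s = p" if p: "p \<in> P" for p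
    proof -
      have "p \<otimes> ?s = (\<Oplus>q\<in>P. p \<otimes> q)" using Pc finP p by (intro finsum_rdistr) auto
      also have "\<dots> = (\<Oplus>q\<in>P. if p = q then q else \<zero>)"
        using Pc p orth Pp(1) projD(3) by (intro finsum_cong') auto
      also have "\<dots> = p" using p finP Pc by (subst finsum_singleton) auto
      finally show ?thesis .
    qed
    have sp: "?s \<otimes> p = p" if p: "p \<in> P" for p
    proof -
      have "adj A (p \<otimes> ?s) = ?s \<otimes> p" using p s sa Pp(1) projD by (simp add: adj_mult)
      then show ?thesis using ps[OF p] p Pp(1) projD by simp
    qed
    have "?s \<otimes> ?s = (\<Oplus>p\<in>P. p \<otimes> ?s)" using Pc finP s by (intro finsum_ldistr) auto
    also have "\<dots> = ?s" using Pc ps by (intro finsum_cong') auto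
    finally have ss: "?s \<otimes> ?s = ?s" .
    define r where "r = \<one> \<ominus> ?s"
    have r: "r \<in> projections A" using s sa ss
      unfolding projections_def r_def by (simp add: minus_eq adj_add adj_uminus r_distr l_distr l_minus r_minus r_neg)
    have r0: "r \<noteq> \<zero>" using ne s unfolding r_def by (simp add: minus_eq_zero_iff)
    have rp: "r \<otimes> p = \<zero>" "p \<otimes> r = \<zero>" if "p \<in> P" for p
      using s that ps sp Pc unfolding r_def by (auto simp: minus_eq r_distr l_distr l_minus r_minus r_neg Pi_def)
    have "r \<notin> P" using rp(1)[of r] projD(3)[OF r] r0 by auto
    moreover have "orth_family (insert r P)"
      unfolding orth_family_def using finP Pp orth r r0 rp by auto
    ultimately show False using max[of "insert r P"] finP by simp
  qed
  have min: "q = \<zero> \<or> q = e" if e: "e \<in> P" and q: "q \<in> projections A" "e \<otimes> q = q" "q \<otimes> e = q" for e q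
  proof (rule ccontr)
    assume ne: "\<not> ?thesis"
    note cl = projD(1)[OF q(1)] projD(1)[OF Pp(1)[OF e]]
    let ?r = "e \<ominus> q"
    have r: "?r \<in> projections A" using cl q projD[OF Pp(1)[OF e]] projD[OF q(1)]
      unfolding projections_def
      by (simp add: minus_eq adj_add adj_uminus r_distr l_distr l_minus r_minus r_neg minus_add a_assoc)
    have r0: "?r \<noteq> \<zero>" using ne cl by (auto simp: minus_eq_zero_iff)
    have qr: "q \<otimes> ?r = \<zero>" "?r \<otimes> q = \<zero>" using cl q projD[OF q(1)]
      by (simp_all add: minus_eq r_distr l_distr l_minus r_minus r_neg)
    have fq: "f \<otimes> q = \<zero>" "q \<otimes> f = \<zero>" "f \<otimes> ?r = \<zero>" "?r \<otimes> f = \<zero>" if f: "f \<in> P" "f \<noteq> e" for f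
    proof -
      have fc: "f \<in> carrier A" using f Pp projD by blast
      have fe: "f \<otimes> e = \<zero>" "e \<otimes> f = \<zero>" using orth f e by auto
      show 1: "f \<otimes> q = \<zero>" by (metis cl fc fe(1) l_null m_assoc q(2))
      show 2: "q \<otimes> f = \<zero>" by (metis cl fc fe(2) r_null m_assoc q(3))
      show "f \<otimes> ?r = \<zero>" "?r \<otimes> f = \<zero>" using 1 2 fe cl fc
        by (simp_all add: minus_eq r_distr l_distr l_minus r_minus r_neg)
    qed
    have q_notin: "q \<notin> P - {e}" using fq(1)[of q] projD(3)[OF q(1)] ne by auto
    have r_notin: "?r \<notin> P - {e}" using fq(3)[of ?r] projD(3)[OF r] r0 by auto
    have qr_ne: "q \<noteq> ?r" using qr projD(3)[OF q(1)] ne by auto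
    let ?Q = "insert q (insert ?r (P - {e}))"
    have "orth_family ?Q"
      unfolding orth_family_def using finP Pp orth r r0 q ne qr fq by auto
    moreover have "card ?Q = Suc (card P)"
      using q_notin r_notin qr_ne finP e by (simp add: card_Diff_singleton_if card_gt_0_iff) (metis Suc_pred card_gt_0_iff empty_iff)
    ultimately show False using max[of ?Q] by simp
  qed
  have corner_sa: "\<exists>c. h = c \<odot> e"
    if "e \<in> P" "h \<in> carrier A" "adj A h = h" "e \<otimes> h = h" "h \<otimes> e = h" for e h
    using combs_corner[OF Pp(1)[OF that(1)] min[OF that(1)] combs_all] that by blast
  have corner: "\<exists>c. e \<otimes> y \<otimes> e = c \<odot> e" if e: "e \<in> P" and y: "y \<in> carrier A" for e y
  proof -
    define z where "z = e \<otimes> y \<otimes> e"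
    note E = projD[OF Pp(1)[OF e]]
    have z: "z \<in> carrier A" "e \<otimes> z = z" "z \<otimes> e = z"
      unfolding z_def using y E by (auto simp: m_assoc) (simp add: m_assoc[symmetric])
    have az: "e \<otimes> adj A z = adj A z" "adj A z \<otimes> e = adj A z"
      using adj_mult[of z e] adj_mult[of e z] z E by auto
    \<comment> \<open>Twice the real part and minus twice the imaginary part of z. Both are
      self-adjoint and lie in the corner, so both are multiples of e, and z is recovered from
      them.\<close>
    let ?h = "z \<oplus> adj A z" and ?k = "\<i> \<odot> (z \<oplus> (-1) \<odot> adj A z)"
    obtain c where c: "?h = c \<odot> e"
      using corner_sa[OF e, of ?h] z E az by (auto simp: adj_add r_distr l_distr a_comm)
    have "\<i> \<odot> (adj A z \<oplus> (-1) \<odot> z) = (- \<i>) \<odot> z \<oplus> \<i> \<odot> adj A z"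
      using z by (simp add: smult_add_right a_comm)
    then obtain d where d: "?k = d \<odot> e"
      using corner_sa[OF e, of ?k] z E az
      by (auto simp: adj_add adj_smult r_distr l_distr a_comm smult_mult_left smult_mult_right smult_add_right)
    have "(1/2) \<odot> ?h \<oplus> (- \<i> / 2) \<odot> ?k = ((1/2) \<odot> z \<oplus> (1/2) \<odot> adj A z) \<oplus> ((1/2) \<odot> z \<oplus> (-1/2) \<odot> adj A z)"
      using z by (simp add: smult_add_right)
    also have "\<dots> = ((1/2) \<odot> z \<oplus> (1/2) \<odot> z) \<oplus> ((1/2) \<odot> adj A z \<oplus> (-1/2) \<odot> adj A z)"
      using z by (simp add: a_ac)
    also have "\<dots> = z" using z by (simp add: smult_add_left[symmetric])
    finally have "z = (1/2 * c) \<odot> e \<oplus> (- \<i> / 2 * d) \<odot> e" unfolding c d using E by simp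
    then have "z = (1/2 * c - \<i> / 2 * d) \<odot> e" using smult_add_left[of e "1/2 * c" "- \<i> / 2 * d"] E by simp
    then show ?thesis unfolding z_def ..
  qed
  \<comment> \<open>On the diagonal y is a multiple of e and the sign is clear. Off the diagonal the
    self-adjoint element \<open>y \<oplus> adj A y\<close> has square
    \<open>c \<odot> (f \<oplus> e)\<close>, so a negative c would contradict
    \<open>combs_negative_square\<close>.\<close>
  have pos: "Im c = 0 \<and> 0 \<le> Re c"
    if e: "e \<in> P" and f: "f \<in> P" and y: "y \<in> carrier A" "f \<otimes> y = y" "y \<otimes> e = y" "adj A y \<otimes> y = c \<odot> e" for e f y c
  proof -
    note E = projD[OF Pp(1)[OF e]] and F = projD[OF Pp(1)[OF f]]
    have ay: "adj A y \<otimes> f = adj A y" "e \<otimes> adj A y = adj A y"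
      using adj_mult[of f y] adj_mult[of y e] y E F by auto
    have "adj A (adj A y \<otimes> y) = adj A y \<otimes> y" using y(1) by (simp add: adj_mult)
    then have "cnj c \<odot> e = c \<odot> e" using y E by (simp add: adj_smult)
    then have "cnj c = c" using smult_cancel E Pp(2)[OF e] by blast
    then have im: "Im c = 0" by (simp add: complex_eq_iff)
    then have cr: "c = of_real (Re c)" by (simp add: complex_eq_iff)
    have "0 \<le> Re c"
    proof (cases "e = f")
      case True
      obtain l where "e \<otimes> y \<otimes> e = l \<odot> e" using corner[OF e y(1)] by blast
      then have l: "y = l \<odot> e" using y True by simp
      have "c \<odot> e = (cnj l * l) \<odot> e"
        using y(4) E unfolding l by (simp add: adj_smult smult_mult_left smult_mult_right mult.commute)
      then have "c = cnj l * l" using smult_cancel E Pp(2)[OF e] by blast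
      then show ?thesis by (simp add: mult.commute)
    next
      case False
      show ?thesis
      proof (rule ccontr)
        assume neg: "\<not> 0 \<le> Re c"
        then have y0: "y \<noteq> \<zero>" using y(4) smult_eq_zero[of e c] E Pp(2)[OF e] by auto
        obtain d where "f \<otimes> (y \<otimes> adj A y) \<otimes> f = d \<odot> f" using corner[OF f, of "y \<otimes> adj A y"] y by auto
        then have d: "y \<otimes> adj A y = d \<odot> f"
          using y F ay by (metis adj_closed m_assoc m_closed)
        \<comment> \<open>Bracketing the product of y, its adjoint and y in the two possible ways
          shows that both partial products carry the same scalar.\<close>
        have "y \<otimes> (adj A y \<otimes> y) = c \<odot> y" unfolding y(4) using y E by (simp add: smult_mult_right)
        moreover have "(y \<otimes> adj A y) \<otimes> y = d \<odot> y" unfolding d using y F by (simp add: smult_mult_left)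
        ultimately have "c \<odot> y = d \<odot> y" using y by (simp add: m_assoc)
        then have cd: "d = c" using smult_cancel[OF y(1) y0] by auto
        have ef: "e \<otimes> f = \<zero>" using orth[OF e f False] .
        \<comment> \<open>y leads from e to f, and e and f are orthogonal, so y and its adjoint
          square to zero and only the mixed products contribute to the square of their sum.\<close>
        have yy: "y \<otimes> y = \<zero>" by (metis E(1) F(1) ef l_null m_assoc m_closed r_null y(1,2,3))
        then have ayy: "adj A y \<otimes> adj A y = \<zero>" using adj_mult[of y y] y by simp
        let ?h = "y \<oplus> adj A y"
        have fe: "f \<oplus> e \<in> projections A"
          using E F ef orth[OF f e] False unfolding projections_def
          by (auto simp: adj_add r_distr l_distr)
        have "?h \<otimes> ?h = (y \<otimes> y \<oplus> y \<otimes> adj A y) \<oplus> (adj A y \<otimes> y \<oplus> adj A y \<otimes> adj A y)"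
          using y(1) by (simp add: r_distr l_distr a_ac)
        then have hh: "?h \<otimes> ?h = of_real (Re c) \<odot> (f \<oplus> e)"
          unfolding yy ayy d cd y(4) using E F cr by (simp add: smult_add_right)
        have "?h = \<zero>"
        proof (rule combs_negative_square[OF fe _ _ _ hh])
          show "adj A ?h = ?h" using y by (simp add: adj_add a_comm)
          then show "?h \<in> combs A n" using y by (intro combs_all) auto
        qed (use neg in simp)
        then have "of_real (Re c) \<odot> (f \<oplus> e) = \<zero>" using hh by simp
        then have "f \<oplus> e = \<zero>" using neg smult_eq_zero[of "f \<oplus> e" "of_real (Re c)"] E F by auto
        then have "e \<otimes> (f \<oplus> e) = \<zero>" using E by simp
        then have "e = \<zero>" using E F ef by (simp add: r_distr)
        then show False using Pp(2)[OF e] by simp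
      qed
    qed
    then show ?thesis using im by simp
  qed
  have "matrix_frame A P"
    by (intro matrix_frame.intro matrix_frame_axioms.intro pre_cstar_axioms P sum1 corner; (rule pos; assumption)?)
  then show ?thesis ..
qed

end

section \<open>Matrix units and a faithful positive functional\<close>

context matrix_frame begin

lemma finite_P: "finite P" and P_proj: "p \<in> P \<Longrightarrow> p \<in> projections A" and P_nz: "p \<in> P \<Longrightarrow> p \<noteq> \<zero>"
  and P_orth: "p \<in> P \<Longrightarrow> q \<in> P \<Longrightarrow> p \<noteq> q \<Longrightarrow> p \<otimes> q = \<zero>"
  using fam unfolding orth_family_def by auto

lemma P_carrier [simp]: "p \<in> P \<Longrightarrow> p \<in> carrier A" and P_adj: "p \<in> P \<Longrightarrow> adj A p = p"
  and P_idem: "p \<in> P \<Longrightarrow> p \<otimes> p = p"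
  using P_proj projD by auto

lemma sum_left: "x \<in> carrier A \<Longrightarrow> (\<Oplus>p\<in>P. p \<otimes> x) = x"
  using finsum_ldistr[OF finite_P, of x "\<lambda>p. p"] by (simp add: sum_P Pi_def)

lemma sum_right: "x \<in> carrier A \<Longrightarrow> (\<Oplus>p\<in>P. x \<otimes> p) = x"
  using finsum_rdistr[OF finite_P, of x "\<lambda>p. p"] by (simp add: sum_P Pi_def)

text \<open>If the corner contains some v \<noteq> 0, then
  \<open>adj A v \<otimes> v = c \<odot> f\<close> with c \<noteq> 0, and every z in the corner
  satisfies \<open>c \<odot> z = (z \<otimes> adj A v) \<otimes> v\<close>. The bracket lies in the
  diagonal corner of e, so z is a multiple of v.\<close>

lemma unit_exists:
  assumes e: "e \<in> P" and f: "f \<in> P"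
  shows "\<exists>v\<in>carrier A. \<forall>x\<in>carrier A. \<exists>c. e \<otimes> x \<otimes> f = c \<odot> v"
proof (cases "\<forall>x\<in>carrier A. e \<otimes> x \<otimes> f = \<zero>")
  case True
  then show ?thesis by (intro bexI[of _ \<zero>]) auto
next
  case False
  then obtain x where x: "x \<in> carrier A" "e \<otimes> x \<otimes> f \<noteq> \<zero>" by blast
  define v where "v = e \<otimes> x \<otimes> f"
  have v: "v \<in> carrier A" "v \<noteq> \<zero>" "v \<otimes> f = v"
    using x e f P_idem unfolding v_def by (auto simp: m_assoc)
  have av: "f \<otimes> adj A v = adj A v" using adj_mult[of v f] v f P_adj by simp
  obtain c where c: "f \<otimes> (adj A v \<otimes> v) \<otimes> f = c \<odot> f" using corner[OF f, of "adj A v \<otimes> v"] v by auto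
  have "f \<otimes> (adj A v \<otimes> v) \<otimes> f = (f \<otimes> adj A v) \<otimes> (v \<otimes> f)" using v f by (simp add: m_assoc)
  then have vv: "adj A v \<otimes> v = c \<odot> f" using c av v by simp
  have c0: "c \<noteq> 0" using vv v adj_mult_eq_0[of v] f by auto
  have "\<exists>d. e \<otimes> y \<otimes> f = d \<odot> v" if y: "y \<in> carrier A" for y
  proof -
    define z where "z = e \<otimes> y \<otimes> f"
    have z: "z \<in> carrier A" "z \<otimes> f = z" using y e f P_idem unfolding z_def by (auto simp: m_assoc)
    have "z \<otimes> adj A v = e \<otimes> (y \<otimes> f \<otimes> (adj A (x \<otimes> f))) \<otimes> e"
      unfolding z_def v_def using x y e f P_adj by (simp add: m_assoc adj_mult)
    then obtain d where d: "z \<otimes> adj A v = d \<odot> e"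
      using corner[OF e, of "y \<otimes> f \<otimes> adj A (x \<otimes> f)"] x y f by auto
    have "c \<odot> z = z \<otimes> (adj A v \<otimes> v)" unfolding vv using z f by (simp add: smult_mult_right)
    also have "\<dots> = d \<odot> (e \<otimes> v)" using z v d e by (simp add: m_assoc[symmetric] smult_mult_left)
    also have "e \<otimes> v = v" unfolding v_def using e f x P_idem by (simp add: m_assoc[symmetric])
    finally have "inverse c \<odot> (c \<odot> z) = inverse c \<odot> (d \<odot> v)" by simp
    then have "z = (inverse c * d) \<odot> v" using c0 z v by simp
    then show ?thesis unfolding z_def ..
  qed
  then show ?thesis using v by blast
qed

text \<open>Inserting the decomposition of 1 on both sides writes x as the sum of its corners, each
  a multiple of one matrix unit.\<close>

lemma finite_dimensional: "finite_dimensional A"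
proof -
  have "\<forall>e f. \<exists>v. e \<in> P \<and> f \<in> P \<longrightarrow> v \<in> carrier A \<and> (\<forall>x\<in>carrier A. \<exists>c. e \<otimes> x \<otimes> f = c \<odot> v)"
    using unit_exists by blast
  then obtain v where v: "\<And>e f. e \<in> P \<Longrightarrow> f \<in> P \<Longrightarrow> v e f \<in> carrier A"
    "\<And>e f x. e \<in> P \<Longrightarrow> f \<in> P \<Longrightarrow> x \<in> carrier A \<Longrightarrow> \<exists>c. e \<otimes> x \<otimes> f = c \<odot> v e f"
    by metis
  define B where "B = (\<lambda>(e, f). v e f) ` (P \<times> P)"
  have B: "finite B" "B \<subseteq> carrier A" unfolding B_def using finite_P v(1) by auto
  have "x \<in> lspan B" if x: "x \<in> carrier A" for x
  proof -
    have exf: "e \<otimes> x \<otimes> f \<in> lspan B" if ef: "e \<in> P" "f \<in> P" for e f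
    proof -
      obtain c where "e \<otimes> x \<otimes> f = c \<odot> v e f" using v(2)[OF ef x] by blast
      moreover have "v e f \<in> lspan B" using ef by (intro lspan_gen[OF B]) (auto simp: B_def)
      ultimately show ?thesis using lspan_smult[OF B] by simp
    qed
    have "x \<otimes> f \<in> lspan B" if f: "f \<in> P" for f
    proof -
      have "(\<Oplus>e\<in>P. e \<otimes> (x \<otimes> f)) \<in> lspan B"
        using exf f x by (intro lspan_finsum[OF B finite_P]) (auto simp: m_assoc)
      then show ?thesis using sum_left[of "x \<otimes> f"] x f by simp
    qed
    then have "(\<Oplus>f\<in>P. x \<otimes> f) \<in> lspan B"
      using x by (intro lspan_finsum[OF B finite_P]) auto
    then show ?thesis using sum_right x by simp
  qed
  then show ?thesis unfolding finite_dimensional_iff using B by blast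
qed

text \<open>The scalar exists by \<open>corner\<close> and is unique because e is nonzero. In a
  matrix algebra with the diagonal frame it is a diagonal entry.\<close>

definition coef :: "'a \<Rightarrow> 'a \<Rightarrow> complex" where
  "coef e y = (SOME c. e \<otimes> y \<otimes> e = c \<odot> e)"

lemma coef: "e \<in> P \<Longrightarrow> y \<in> carrier A \<Longrightarrow> e \<otimes> y \<otimes> e = coef e y \<odot> e"
  unfolding coef_def by (rule someI_ex) (rule corner)

lemma coef_eqI: "e \<in> P \<Longrightarrow> y \<in> carrier A \<Longrightarrow> e \<otimes> y \<otimes> e = c \<odot> e \<Longrightarrow> coef e y = c"
  using coef smult_cancel P_nz P_carrier by metis

lemma coef_add: "e \<in> P \<Longrightarrow> x \<in> carrier A \<Longrightarrow> y \<in> carrier A \<Longrightarrow> coef e (x \<oplus> y) = coef e x + coef e y"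
  by (rule coef_eqI) (auto simp: r_distr l_distr coef smult_add_left)

lemma coef_smult: "e \<in> P \<Longrightarrow> x \<in> carrier A \<Longrightarrow> coef e (c \<odot> x) = c * coef e x"
  by (rule coef_eqI) (auto simp: smult_mult_left smult_mult_right coef)

lemma coef_zero: "e \<in> P \<Longrightarrow> coef e \<zero> = 0"
  by (rule coef_eqI) auto

lemma coef_adj: "e \<in> P \<Longrightarrow> x \<in> carrier A \<Longrightarrow> coef e (adj A x) = cnj (coef e x)"
proof (rule coef_eqI)
  assume e: "e \<in> P" and x: "x \<in> carrier A"
  have "e \<otimes> adj A x \<otimes> e = adj A (e \<otimes> x \<otimes> e)" using e x P_adj by (simp add: adj_mult m_assoc)
  then show "e \<otimes> adj A x \<otimes> e = cnj (coef e x) \<odot> e" using e x P_adj by (simp add: coef adj_smult)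
qed auto

lemma coef_finsum:
  assumes "e \<in> P" shows "finite I \<Longrightarrow> f \<in> I \<rightarrow> carrier A \<Longrightarrow> coef e (\<Oplus>i\<in>I. f i) = (\<Sum>i\<in>I. coef e (f i))"
proof (induction I rule: finite_induct)
  case (insert i I)
  then have "(\<Oplus>i\<in>insert i I. f i) = f i \<oplus> (\<Oplus>i\<in>I. f i)" by (intro finsum_insert) auto
  then show ?case using insert assms by (auto simp: coef_add)
qed (use assms coef_zero in simp)

text \<open>Inserting the sum over f \<in> P between the adjoint of x and x splits the coefficient
  into those of \<open>adj A (f \<otimes> x \<otimes> e) \<otimes> (f \<otimes> x \<otimes>
  e)\<close>, to which \<open>unit_pos\<close> applies.\<close>

lemma coef_square:
  assumes e: "e \<in> P" and x: "x \<in> carrier A"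
  shows "Im (coef e (adj A x \<otimes> x)) = 0 \<and> 0 \<le> Re (coef e (adj A x \<otimes> x))"
proof -
  have 1: "Im (coef e (adj A x \<otimes> (f \<otimes> x))) = 0 \<and> 0 \<le> Re (coef e (adj A x \<otimes> (f \<otimes> x)))" if f: "f \<in> P" for f
  proof (rule unit_pos[OF e f, of "f \<otimes> x \<otimes> e"])
    have "adj A (f \<otimes> x \<otimes> e) \<otimes> (f \<otimes> x \<otimes> e) = e \<otimes> (adj A x \<otimes> (f \<otimes> f \<otimes> x)) \<otimes> e"
      using e f x P_adj by (simp add: adj_mult m_assoc)
    then show "adj A (f \<otimes> x \<otimes> e) \<otimes> (f \<otimes> x \<otimes> e) = coef e (adj A x \<otimes> (f \<otimes> x)) \<odot> e"
      using e f x P_idem coef[OF e, of "adj A x \<otimes> (f \<otimes> x)"] by simp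
    show "f \<otimes> (f \<otimes> x \<otimes> e) = f \<otimes> x \<otimes> e" using e f x P_idem[OF f] by (simp add: m_assoc[symmetric])
    show "f \<otimes> x \<otimes> e \<otimes> e = f \<otimes> x \<otimes> e" using e f x P_idem[OF e] by (simp add: m_assoc)
  qed (use e f x in auto)
  have "adj A x \<otimes> x = adj A x \<otimes> (\<Oplus>f\<in>P. f \<otimes> x)" using sum_left x by simp
  also have "\<dots> = (\<Oplus>f\<in>P. adj A x \<otimes> (f \<otimes> x))" using x finite_P by (intro finsum_rdistr) auto
  finally have "coef e (adj A x \<otimes> x) = (\<Sum>f\<in>P. coef e (adj A x \<otimes> (f \<otimes> x)))"
    using coef_finsum[OF e finite_P, of "\<lambda>f. adj A x \<otimes> (f \<otimes> x)"] x by auto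
  then show ?thesis using 1 by (auto intro: sum_nonneg)
qed

text \<open>For a matrix algebra with its diagonal frame this is the trace.\<close>

definition faithful_functional :: "'a \<Rightarrow> complex" where
  "faithful_functional y = (\<Sum>e\<in>P. coef e y)"

lemma functional_add: "x \<in> carrier A \<Longrightarrow> y \<in> carrier A \<Longrightarrow>
    faithful_functional (x \<oplus> y) = faithful_functional x + faithful_functional y"
  unfolding faithful_functional_def by (simp add: coef_add sum.distrib)

lemma functional_smult: "x \<in> carrier A \<Longrightarrow> faithful_functional (c \<odot> x) = c * faithful_functional x"
  unfolding faithful_functional_def by (simp add: coef_smult sum_distrib_left)

lemma functional_adj: "x \<in> carrier A \<Longrightarrow> faithful_functional (adj A x) = cnj (faithful_functional x)"
  unfolding faithful_functional_def by (simp add: coef_adj)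

lemma functional_nonneg: "x \<in> carrier A \<Longrightarrow> 0 \<le> Re (faithful_functional (adj A x \<otimes> x))"
  unfolding faithful_functional_def using coef_square by (auto intro: sum_nonneg)

text \<open>The coefficients of \<open>adj A x \<otimes> x\<close> are nonnegative and sum to 0, so
  each vanishes. The C*-identity then gives \<open>x \<otimes> e = \<zero>\<close> for every e \<in>
  P, and the e sum to 1.\<close>

lemma functional_faithful:
  assumes x: "x \<in> carrier A" and 0: "faithful_functional (adj A x \<otimes> x) = 0"
  shows "x = \<zero>"
proof -
  have "(\<Sum>e\<in>P. Re (coef e (adj A x \<otimes> x))) = 0"
    using arg_cong[OF 0, of Re] by (simp add: faithful_functional_def)
  then have "\<forall>e\<in>P. Re (coef e (adj A x \<otimes> x)) = 0"
    using coef_square[OF _ x] finite_P by (subst (asm) sum_nonneg_eq_0_iff) auto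
  then have c: "coef e (adj A x \<otimes> x) = 0" if "e \<in> P" for e
    using that coef_square[OF that x] by (simp add: complex_eq_iff)
  have "x \<otimes> e = \<zero>" if e: "e \<in> P" for e
  proof (rule adj_mult_eq_0)
    have "adj A (x \<otimes> e) \<otimes> (x \<otimes> e) = e \<otimes> (adj A x \<otimes> x) \<otimes> e"
      using x e P_adj by (simp add: adj_mult m_assoc)
    then show "adj A (x \<otimes> e) \<otimes> (x \<otimes> e) = \<zero>" using coef[OF e, of "adj A x \<otimes> x"] c[OF e] x e by simp
  qed (use x e in auto)
  then have "(\<Oplus>e\<in>P. x \<otimes> e) = (\<Oplus>e\<in>P. \<zero>)" by (intro finsum_cong') auto
  then show ?thesis using sum_right[OF x] by simp
qed

end

section \<open>Pre-Hilbert spaces and finite-dimensional operator algebras\<close>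

text \<open>The functions in a finite-dimensional space of functions on X are recovered linearly
  from their values at finitely many points, by means of functions h k of the same space. With inner
  products as evaluation this yields coordinates; with matrix coefficients it yields the equations
  of an operator algebra. The points are found by elimination along a spanning set.\<close>

lemma (in cmodule) interpolation:
  fixes ev :: "'a \<Rightarrow> 'x \<Rightarrow> complex"
  assumes fd: "finite_dimensional V"
    and add: "\<And>v w t. v \<in> carrier V \<Longrightarrow> w \<in> carrier V \<Longrightarrow> t \<in> X \<Longrightarrow> ev (v \<oplus> w) t = ev v t + ev w t"
    and smult: "\<And>c v t. v \<in> carrier V \<Longrightarrow> t \<in> X \<Longrightarrow> ev (c \<odot> v) t = c * ev v t"
  shows "\<exists>(m :: nat) x h. (\<forall>k<m. x k \<in> X \<and> h k \<in> carrier V) \<and>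
    (\<forall>v\<in>carrier V. \<forall>t\<in>X. ev v t = (\<Sum>k<m. ev v (x k) * ev (h k) t))"
proof -
  obtain B where B: "finite B" "B \<subseteq> carrier V" "carrier V \<subseteq> lspan B"
    using fd finite_dimensional_iff by blast
  have zero: "ev \<zero> t = 0" if "t \<in> X" for t using smult[of \<zero> t 0] that by simp
  have ev_sum: "ev (\<Oplus>i\<in>I. f i) t = (\<Sum>i\<in>I. ev (f i) t)"
    if "finite I" "f \<in> I \<rightarrow> carrier V" "t \<in> X" for f and I :: "nat set" and t
    using that(1,2)
  proof (induction I rule: finite_induct)
    case (insert i I)
    then have "(\<Oplus>i\<in>insert i I. f i) = f i \<oplus> (\<Oplus>i\<in>I. f i)" by (intro M.finsum_insert) auto
    then show ?case using insert add that(3) by auto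
  qed (use zero that in simp)
  have "\<exists>(m :: nat) x h. (\<forall>k<m. x k \<in> X \<and> h k \<in> carrier V) \<and>
    (\<forall>v\<in>lspan B. \<forall>t\<in>X. ev v t = (\<Sum>k<m. ev v (x k) * ev (h k) t))"
    using B(1,2)
  proof (induction B rule: finite_induct)
    case empty
    then show ?case using zero by (intro exI[of _ 0]) (auto simp: lspan_def)
  next
    case (insert b B)
    then have B: "finite B" "B \<subseteq> carrier V" and b: "b \<in> carrier V" by auto
    obtain m :: nat and x h where *: "(\<forall>k<m. x k \<in> X \<and> h k \<in> carrier V) \<and>
        (\<forall>v\<in>lspan B. \<forall>t\<in>X. ev v t = (\<Sum>k<m. ev v (x k) * ev (h k) t))"
      using insert.IH[OF B(2)] by blast
    have xh: "\<And>k. k < m \<Longrightarrow> x k \<in> X" "\<And>k. k < m \<Longrightarrow> h k \<in> carrier V"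
      and ev: "\<And>v t. v \<in> lspan B \<Longrightarrow> t \<in> X \<Longrightarrow> ev v t = (\<Sum>k<m. ev v (x k) * ev (h k) t)"
      using * by blast+
    \<comment> \<open>\<open>Q v\<close> interpolates v from the points found so far and reproduces
      the span of B; d is what it misses of b.\<close>
    define Q where "Q v t = (\<Sum>k<m. ev v (x k) * ev (h k) t)" for v t
    define d where "d = b \<oplus> (-1) \<odot> (\<Oplus>k\<in>{..<m}. ev b (x k) \<odot> h k)"
    have hs: "(\<lambda>k. ev b (x k) \<odot> h k) \<in> {..<m} \<rightarrow> carrier V" using xh by auto
    then have s: "(\<Oplus>k\<in>{..<m}. ev b (x k) \<odot> h k) \<in> carrier V" by (intro M.finsum_closed) auto
    have d: "d \<in> carrier V" unfolding d_def using b s by auto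
    have evd: "ev d t = ev b t - Q b t" if t: "t \<in> X" for t
    proof -
      have "ev d t = ev b t - ev (\<Oplus>k\<in>{..<m}. ev b (x k) \<odot> h k) t"
        unfolding d_def using b s t by (simp add: add smult)
      also have "ev (\<Oplus>k\<in>{..<m}. ev b (x k) \<odot> h k) t = Q b t"
        unfolding Q_def using hs t xh by (subst ev_sum) (auto simp: smult)
      finally show ?thesis .
    qed
    \<comment> \<open>On the larger span the interpolation error is always a multiple of the one
      function d.\<close>
    have key: "\<exists>c. \<forall>t\<in>X. ev w t - Q w t = c * ev d t" if w: "w \<in> lspan (insert b B)" for w
    proof -
      obtain c where "w = (\<Oplus>b'\<in>insert b B. c b' \<odot> b')" using w by (auto simp: lspan_def)
      moreover have "(\<Oplus>b'\<in>insert b B. c b' \<odot> b') = c b \<odot> b \<oplus> (\<Oplus>b'\<in>B. c b' \<odot> b')"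
        using insert.hyps B b by (intro M.finsum_insert) auto
      moreover define v where "v = (\<Oplus>b'\<in>B. c b' \<odot> b')"
      ultimately have w: "w = c b \<odot> b \<oplus> v" by simp
      have v: "v \<in> lspan B" "v \<in> carrier V" unfolding v_def lspan_def using B by (auto intro!: M.finsum_closed)
      have evw: "ev w t = c b * ev b t + ev v t" if "t \<in> X" for t
        unfolding w using b v that by (simp add: add smult)
      have Qw: "Q w t = c b * Q b t + ev v t" if "t \<in> X" for t
        unfolding ev[OF v(1) that] Q_def using xh
        by (simp add: evw sum_distrib_left sum.distrib algebra_simps)
      then have "ev w t - Q w t = c b * ev d t" if "t \<in> X" for t
        by (simp add: evw[OF that] Qw[OF that] evd[OF that] right_diff_distrib)
      then show ?thesis by blast
    qed
    show ?case
    proof (cases "\<forall>t\<in>X. ev d t = 0")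
      case True
      then have "\<forall>w\<in>lspan (insert b B). \<forall>t\<in>X. ev w t = (\<Sum>k<m. ev w (x k) * ev (h k) t)"
        using key unfolding Q_def by fastforce
      then show ?thesis using xh by blast
    next
      case False
      then obtain t0 where t0: "t0 \<in> X" "ev d t0 \<noteq> 0" by blast
      \<comment> \<open>The new point is one where d does not vanish. d is normalised to 1 there,
        and the old functions are corrected so as to vanish there.\<close>
      define x' where "x' = x(m := t0)"
      define h' where "h' k = (if k < m then h k \<oplus> (- ev (h k) t0 / ev d t0) \<odot> d else (1 / ev d t0) \<odot> d)" for k
      have "ev w t = (\<Sum>k<Suc m. ev w (x' k) * ev (h' k) t)" if w: "w \<in> lspan (insert b B)" and t: "t \<in> X" for w t
      proof -
        obtain c where c: "\<And>t. t \<in> X \<Longrightarrow> ev w t - Q w t = c * ev d t" using key[OF w] by blast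
        have "(\<Sum>k<Suc m. ev w (x' k) * ev (h' k) t) =
            (\<Sum>k<m. ev w (x k) * (ev (h k) t - ev (h k) t0 / ev d t0 * ev d t)) + ev w t0 * (ev d t / ev d t0)"
          unfolding x'_def h'_def using d xh t by (simp add: add smult)
        also have "(\<Sum>k<m. ev w (x k) * (ev (h k) t - ev (h k) t0 / ev d t0 * ev d t)) =
            Q w t - Q w t0 * (ev d t / ev d t0)"
          unfolding Q_def by (simp add: sum_subtractf sum_distrib_right right_diff_distrib sum_divide_distrib mult.assoc)
        also have "Q w t - Q w t0 * (ev d t / ev d t0) + ev w t0 * (ev d t / ev d t0) =
            Q w t + (ev w t0 - Q w t0) * (ev d t / ev d t0)" by (simp add: algebra_simps diff_divide_distrib)
        also have "\<dots> = Q w t + c * ev d t" using c[OF t0(1)] t0(2) by simp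
        also have "\<dots> = ev w t" using c[OF t] by (simp add: algebra_simps)
        finally show ?thesis by simp
      qed
      moreover have "\<forall>k<Suc m. x' k \<in> X \<and> h' k \<in> carrier V"
        unfolding x'_def h'_def using xh d t0 by (auto simp: less_Suc_eq)
      ultimately show ?thesis by blast
    qed
  qed
  then show ?thesis using B(3) by blast
qed

locale pre_hilbert = cmodule K for K :: "'h hilb" (structure) +
  assumes ip_add_left: "\<And>x y z. x \<in> carrier K \<Longrightarrow> y \<in> carrier K \<Longrightarrow> z \<in> carrier K \<Longrightarrow>
      ip K (x \<oplus> y) z = ip K x z + ip K y z"
    and ip_smult_left: "\<And>c x y. x \<in> carrier K \<Longrightarrow> y \<in> carrier K \<Longrightarrow> ip K (c \<odot> x) y = c * ip K x y"
    and ip_cnj: "\<And>x y. x \<in> carrier K \<Longrightarrow> y \<in> carrier K \<Longrightarrow> ip K y x = cnj (ip K x y)"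
    and ip_nonneg: "\<And>x. x \<in> carrier K \<Longrightarrow> 0 \<le> Re (ip K x x)"
    and ip_eq_0: "\<And>x. x \<in> carrier K \<Longrightarrow> ip K x x = 0 \<longleftrightarrow> x = \<zero>"

lemma hilbert_space_pre_hilbert: "hilbert_space K \<Longrightarrow> pre_hilbert K"
  unfolding hilbert_space_def pre_hilbert_def cmodule_def pre_hilbert_axioms_def
  by (elim conjE, intro conjI) blast+

lemma hilbert_space_iff:
  "hilbert_space K \<longleftrightarrow> pre_hilbert K \<and> (\<forall>s :: nat \<Rightarrow> 'h. range s \<subseteq> carrier K \<longrightarrow>
        (\<forall>e>0. \<exists>N. \<forall>m\<ge>N. \<forall>n\<ge>N. hnorm K (s m \<ominus>\<^bsub>K\<^esub> s n) < e) \<longrightarrow>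
        (\<exists>l\<in>carrier K. (\<lambda>n. hnorm K (s n \<ominus>\<^bsub>K\<^esub> l)) \<longlonglongrightarrow> 0))" for K :: "'h hilb"
  unfolding hilbert_space_def pre_hilbert_def cmodule_def pre_hilbert_axioms_def
  by (intro iffI conjI; elim conjE; blast)

context pre_hilbert begin

lemma ip_add_right: "x \<in> carrier K \<Longrightarrow> y \<in> carrier K \<Longrightarrow> z \<in> carrier K \<Longrightarrow>
    ip K z (x \<oplus> y) = ip K z x + ip K z y"
  using ip_cnj[of "x \<oplus> y" z] ip_cnj[of x z] ip_cnj[of y z] by (simp add: ip_add_left)

lemma ip_smult_right: "x \<in> carrier K \<Longrightarrow> y \<in> carrier K \<Longrightarrow> ip K x (c \<odot> y) = cnj c * ip K x y"
  using ip_cnj[of "c \<odot> y" x] ip_cnj[of y x] by (simp add: ip_smult_left)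

lemma ip_zero [simp]: "x \<in> carrier K \<Longrightarrow> ip K \<zero> x = 0" "x \<in> carrier K \<Longrightarrow> ip K x \<zero> = 0"
  using ip_smult_left[of \<zero> x 0] ip_smult_right[of x \<zero> 0] by auto

lemma ip_minus_left: "x \<in> carrier K \<Longrightarrow> y \<in> carrier K \<Longrightarrow> z \<in> carrier K \<Longrightarrow>
    ip K (x \<ominus> y) z = ip K x z - ip K y z"
  by (simp add: minus_eq_smult ip_add_left ip_smult_left)

lemma ip_minus_right: "x \<in> carrier K \<Longrightarrow> y \<in> carrier K \<Longrightarrow> z \<in> carrier K \<Longrightarrow>
    ip K z (x \<ominus> y) = ip K z x - ip K z y"
  by (simp add: minus_eq_smult ip_add_right ip_smult_right)

lemma hnorm_sq: "x \<in> carrier K \<Longrightarrow> (hnorm K x)\<^sup>2 = Re (ip K x x)"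
  by (simp add: hnorm_def ip_nonneg)

lemma ip_self: "x \<in> carrier K \<Longrightarrow> ip K x x = of_real ((hnorm K x)\<^sup>2)"
  using ip_cnj[of x x] by (simp add: hnorm_sq complex_eq_iff)

lemma hnorm_nonneg [simp]: "x \<in> carrier K \<Longrightarrow> 0 \<le> hnorm K x"
  by (simp add: hnorm_def ip_nonneg)

lemma hnorm_eq_0: "x \<in> carrier K \<Longrightarrow> hnorm K x = 0 \<longleftrightarrow> x = \<zero>"
  using ip_self[of x] ip_eq_0[of x] by auto

lemma hnorm_zero [simp]: "hnorm K \<zero> = 0" by (simp add: hnorm_eq_0)

lemma hnorm_smult: "x \<in> carrier K \<Longrightarrow> hnorm K (c \<odot> x) = cmod c * hnorm K x"
proof -
  assume x: "x \<in> carrier K"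
  have "ip K (c \<odot> x) (c \<odot> x) = (c * cnj c) * of_real ((hnorm K x)\<^sup>2)"
    using x by (simp add: ip_smult_left ip_smult_right ip_self[OF x])
  also have "\<dots> = of_real ((cmod c * hnorm K x)\<^sup>2)"
    unfolding complex_norm_square[symmetric] by (simp add: power_mult_distrib)
  finally have "(hnorm K (c \<odot> x))\<^sup>2 = (cmod c * hnorm K x)\<^sup>2"
    using x by (simp only: hnorm_sq smult_cl Re_complex_of_real)
  then show ?thesis using x by (subst (asm) power2_eq_iff_nonneg) auto
qed

lemma cauchy_schwarz: "x \<in> carrier K \<Longrightarrow> y \<in> carrier K \<Longrightarrow> cmod (ip K x y) \<le> hnorm K x * hnorm K y"
proof -
  assume x: "x \<in> carrier K" and y: "y \<in> carrier K"
  show ?thesis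
  proof (cases "y = \<zero>")
    case False
    define r where "r = (hnorm K y)\<^sup>2"
    have r: "r > 0" using False y hnorm_eq_0[of y] by (simp add: r_def)
    define c where "c = ip K x y"
    \<comment> \<open>The component of x orthogonal to y, multiplied by r to avoid a
      division.\<close>
    let ?z = "of_real r \<odot> x \<oplus> (- c) \<odot> y"
    have yy: "ip K y y = of_real r" using ip_self[OF y] by (simp add: r_def)
    have "ip K ?z ?z = of_real r * (of_real r * ip K x x - c * cnj c)"
      using x y ip_cnj[OF x y]
      by (simp add: ip_add_left ip_add_right ip_smult_left ip_smult_right yy c_def[symmetric] algebra_simps)
    also have "\<dots> = of_real (r * (r * (hnorm K x)\<^sup>2 - (cmod c)\<^sup>2))"
      unfolding ip_self[OF x] complex_norm_square[symmetric] by simp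
    finally have "0 \<le> r * (r * (hnorm K x)\<^sup>2 - (cmod c)\<^sup>2)"
      using ip_nonneg[of ?z] x y by (metis Re_complex_of_real M.a_closed smult_cl)
    then have "(cmod c)\<^sup>2 \<le> r * (hnorm K x)\<^sup>2" using r by (simp add: zero_le_mult_iff)
    then have "(cmod c)\<^sup>2 \<le> (hnorm K x * hnorm K y)\<^sup>2" by (simp add: r_def power_mult_distrib mult.commute)
    then show ?thesis unfolding c_def by (rule power2_le_imp_le) (use x y in simp)
  qed (use x in simp)
qed

lemma hnorm_add: "x \<in> carrier K \<Longrightarrow> y \<in> carrier K \<Longrightarrow> hnorm K (x \<oplus> y) \<le> hnorm K x + hnorm K y"
proof -
  assume x: "x \<in> carrier K" and y: "y \<in> carrier K"
  have "(hnorm K (x \<oplus> y))\<^sup>2 = (hnorm K x)\<^sup>2 + (hnorm K y)\<^sup>2 + 2 * Re (ip K x y)"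
    using x y ip_cnj[OF x y] by (simp add: hnorm_sq ip_add_left ip_add_right)
  also have "Re (ip K x y) \<le> hnorm K x * hnorm K y"
    using cauchy_schwarz[OF x y] complex_Re_le_cmod order_trans by blast
  finally have "(hnorm K (x \<oplus> y))\<^sup>2 \<le> (hnorm K x + hnorm K y)\<^sup>2" by (simp add: power2_sum)
  then show ?thesis by (rule power2_le_imp_le) (use x y in simp)
qed

lemma hnorm_minus_commute: "x \<in> carrier K \<Longrightarrow> y \<in> carrier K \<Longrightarrow> hnorm K (x \<ominus> y) = hnorm K (y \<ominus> x)"
proof -
  assume xy: "x \<in> carrier K" "y \<in> carrier K"
  have "y \<ominus> x = (-1) \<odot> (x \<ominus> y)" using xy by (simp add: minus_eq_smult smult_add_right M.a_comm)
  then show ?thesis using hnorm_smult[of "x \<ominus> y" "-1"] xy by simp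
qed

lemma ip_right_cancel:
  "x \<in> carrier K \<Longrightarrow> y \<in> carrier K \<Longrightarrow> (\<And>z. z \<in> carrier K \<Longrightarrow> ip K x z = ip K y z) \<Longrightarrow> x = y"
  using ip_eq_0[of "x \<ominus> y"] minus_eq_zero_iff[of x y] by (simp add: ip_minus_left)

lemma ip_finsum:
  assumes "finite I" "f \<in> I \<rightarrow> carrier K" "z \<in> carrier K"
  shows "ip K (\<Oplus>i\<in>I. f i) z = (\<Sum>i\<in>I. ip K (f i) z)"
  using assms(1,2)
proof (induction I rule: finite_induct)
  case (insert i I)
  then have "(\<Oplus>i\<in>insert i I. f i) = f i \<oplus> (\<Oplus>i\<in>I. f i)" by (intro M.finsum_insert) auto
  then show ?case using insert assms by (auto simp: ip_add_left)
qed (use assms in simp)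

lemma hnorm_finsum:
  assumes "finite I" "f \<in> I \<rightarrow> carrier K"
  shows "hnorm K (\<Oplus>i\<in>I. f i) \<le> (\<Sum>i\<in>I. hnorm K (f i))"
  using assms
proof (induction I rule: finite_induct)
  case (insert i I)
  then have "(\<Oplus>i\<in>insert i I. f i) = f i \<oplus> (\<Oplus>i\<in>I. f i)" by (intro M.finsum_insert) auto
  moreover have "hnorm K (f i \<oplus> (\<Oplus>i\<in>I. f i)) \<le> hnorm K (f i) + hnorm K (\<Oplus>i\<in>I. f i)"
    using insert by (intro hnorm_add) auto
  ultimately show ?case using insert by auto
qed simp

lemma pre_hilbert_axioms_self: "pre_hilbert K" ..

end

section \<open>Bounded operators and finite-dimensional inner product spaces\<close>

context pre_hilbert begin

lemma bounded_opsD: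
  assumes "T \<in> carrier (bounded_ops K)"
  shows "T \<in> extensional (carrier K)" "x \<in> carrier K \<Longrightarrow> T x \<in> carrier K"
    "x \<in> carrier K \<Longrightarrow> y \<in> carrier K \<Longrightarrow> T (x \<oplus> y) = T x \<oplus> T y"
    "x \<in> carrier K \<Longrightarrow> T (c \<odot> x) = c \<odot> T x"
    "\<exists>b\<ge>0. \<forall>x\<in>carrier K. hnorm K (T x) \<le> b * hnorm K x"
proof -
  note T = assms[unfolded bounded_ops_def, simplified]
  show "T \<in> extensional (carrier K)" "x \<in> carrier K \<Longrightarrow> T x \<in> carrier K"
    "x \<in> carrier K \<Longrightarrow> y \<in> carrier K \<Longrightarrow> T (x \<oplus> y) = T x \<oplus> T y"
    "x \<in> carrier K \<Longrightarrow> T (c \<odot> x) = c \<odot> T x"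
    using T by auto
  obtain b where b: "\<forall>x\<in>carrier K. hnorm K (T x) \<le> b * hnorm K x" using T by auto
  have "hnorm K (T x) \<le> \<bar>b\<bar> * hnorm K x" if "x \<in> carrier K" for x
    using b that mult_right_mono[of b "\<bar>b\<bar>" "hnorm K x"] by fastforce
  then show "\<exists>b\<ge>0. \<forall>x\<in>carrier K. hnorm K (T x) \<le> b * hnorm K x" by (intro exI[of _ "\<bar>b\<bar>"]) auto
qed

lemma bounded_opsI:
  assumes "T \<in> extensional (carrier K)" "\<And>x. x \<in> carrier K \<Longrightarrow> T x \<in> carrier K"
    "\<And>x y. x \<in> carrier K \<Longrightarrow> y \<in> carrier K \<Longrightarrow> T (x \<oplus> y) = T x \<oplus> T y"
    "\<And>c x. x \<in> carrier K \<Longrightarrow> T (c \<odot> x) = c \<odot> T x"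
    "\<And>x. x \<in> carrier K \<Longrightarrow> hnorm K (T x) \<le> b * hnorm K x"
  shows "T \<in> carrier (bounded_ops K)"
  using assms unfolding bounded_ops_def by (auto intro!: exI[of _ b])

text \<open>The interpolation lemma for the inner product, with \<open>carrier K\<close> as the set
  of points. The coordinates are inner products with fixed vectors, hence bounded, which yields
  completeness and the boundedness of linear maps.\<close>

lemma finite_dimensional_coordinates:
  assumes "finite_dimensional K"
  obtains m :: nat and x h where "\<And>k. k < m \<Longrightarrow> x k \<in> carrier K" "\<And>k. k < m \<Longrightarrow> h k \<in> carrier K"
    "\<And>v. v \<in> carrier K \<Longrightarrow> v = (\<Oplus>k\<in>{..<m}. ip K v (x k) \<odot> h k)"
proof -
  have "\<exists>(m :: nat) x h. (\<forall>k<m. x k \<in> carrier K \<and> h k \<in> carrier K) \<and>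
    (\<forall>v\<in>carrier K. \<forall>t\<in>carrier K. ip K v t = (\<Sum>k<m. ip K v (x k) * ip K (h k) t))"
    by (rule interpolation[OF assms]) (auto simp: ip_add_left ip_smult_left)
  then obtain m :: nat and x h where **: "(\<forall>k<m. x k \<in> carrier K \<and> h k \<in> carrier K) \<and>
    (\<forall>v\<in>carrier K. \<forall>t\<in>carrier K. ip K v t = (\<Sum>k<m. ip K v (x k) * ip K (h k) t))" by blast
  have *: "x k \<in> carrier K" "h k \<in> carrier K" if "k < m" for k using conjunct1[OF **] that by blast+
  note ev = bspec[OF bspec[OF conjunct2[OF **]]]
  have coords: "v = (\<Oplus>k\<in>{..<m}. ip K v (x k) \<odot> h k)" if v: "v \<in> carrier K" for v
  proof (rule ip_right_cancel)
    have cl: "(\<lambda>k. ip K v (x k) \<odot> h k) \<in> {..<m} \<rightarrow> carrier K" using * by auto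
    then show "(\<Oplus>k\<in>{..<m}. ip K v (x k) \<odot> h k) \<in> carrier K" by (intro M.finsum_closed)
    fix z assume z: "z \<in> carrier K"
    show "ip K v z = ip K (\<Oplus>k\<in>{..<m}. ip K v (x k) \<odot> h k) z"
      unfolding ip_finsum[OF finite_lessThan cl z] ev[OF v z]
      using * z by (intro sum.cong) (auto simp: ip_smult_left)
  qed (use v in auto)
  show ?thesis by (rule that[OF * coords])
qed

lemma finite_dimensional_complete:
  assumes "finite_dimensional K" shows "hilbert_space K"
  unfolding hilbert_space_iff
proof (intro conjI allI impI)
  show "pre_hilbert K" by (rule pre_hilbert_axioms_self)
  fix s :: "nat \<Rightarrow> 'h" assume s: "range s \<subseteq> carrier K"
    and C: "\<forall>e>0. \<exists>N. \<forall>m\<ge>N. \<forall>n\<ge>N. hnorm K (s m \<ominus> s n) < e"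
  have sc: "s n \<in> carrier K" for n using s by auto
  obtain m :: nat and x h where *: "\<And>k. k < m \<Longrightarrow> x k \<in> carrier K" "\<And>k. k < m \<Longrightarrow> h k \<in> carrier K"
    "\<And>v. v \<in> carrier K \<Longrightarrow> v = (\<Oplus>k\<in>{..<m}. ip K v (x k) \<odot> h k)"
    by (rule finite_dimensional_coordinates[OF assms], rule that)
  have "\<exists>c. (\<lambda>n. ip K (s n) (x k)) \<longlonglongrightarrow> c" if k: "k < m" for k
  proof -
    have "Cauchy (\<lambda>n. ip K (s n) (x k))"
    proof (rule metric_CauchyI)
      fix e :: real assume e: "e > 0"
      \<comment> \<open>One is added because \<open>x k\<close> may be the zero vector.\<close>
      let ?d = "e / (hnorm K (x k) + 1)"
      have x0: "hnorm K (x k) \<ge> 0" using * k by simp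
      then have "?d > 0" using e by simp
      then obtain N where N: "\<forall>m\<ge>N. \<forall>n\<ge>N. hnorm K (s m \<ominus> s n) < ?d" using C by blast
      have "dist (ip K (s i) (x k)) (ip K (s j) (x k)) < e" if ij: "i \<ge> N" "j \<ge> N" for i j
      proof -
        have "dist (ip K (s i) (x k)) (ip K (s j) (x k)) = cmod (ip K (s i \<ominus> s j) (x k))"
          using *(1)[OF k] sc by (simp add: dist_norm ip_minus_left)
        also have "\<dots> \<le> hnorm K (s i \<ominus> s j) * hnorm K (x k)"
          using *(1)[OF k] sc by (intro cauchy_schwarz) auto
        also have "\<dots> \<le> hnorm K (s i \<ominus> s j) * (hnorm K (x k) + 1)"
          using sc by (intro mult_left_mono) auto
        also have "\<dots> < ?d * (hnorm K (x k) + 1)"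
          using N ij x0 by (intro mult_strict_right_mono) auto
        also have "\<dots> = e" using x0 by simp
        finally show ?thesis .
      qed
      then show "\<exists>M. \<forall>m\<ge>M. \<forall>n\<ge>M. dist (ip K (s m) (x k)) (ip K (s n) (x k)) < e" by blast
    qed
    then show ?thesis using Cauchy_convergent convergent_def by blast
  qed
  then obtain c where c: "\<And>k. k < m \<Longrightarrow> (\<lambda>n. ip K (s n) (x k)) \<longlonglongrightarrow> c k" by metis
  define l where "l = (\<Oplus>k\<in>{..<m}. c k \<odot> h k)"
  have l: "l \<in> carrier K" unfolding l_def using * by (intro M.finsum_closed) auto
  have le: "hnorm K (s n \<ominus> l) \<le> (\<Sum>k<m. cmod (ip K (s n) (x k) - c k) * hnorm K (h k))" for n
  proof -
    have "s n \<ominus> l = (\<Oplus>k\<in>{..<m}. (ip K (s n) (x k) - c k) \<odot> h k)"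
    proof (rule ip_right_cancel)
      show "s n \<ominus> l \<in> carrier K" using sc l by simp
      have cl: "(\<lambda>k. (ip K (s n) (x k) - c k) \<odot> h k) \<in> {..<m} \<rightarrow> carrier K"
        "(\<lambda>k. c k \<odot> h k) \<in> {..<m} \<rightarrow> carrier K" "(\<lambda>k. ip K (s n) (x k) \<odot> h k) \<in> {..<m} \<rightarrow> carrier K"
        using * by auto
      then show "(\<Oplus>k\<in>{..<m}. (ip K (s n) (x k) - c k) \<odot> h k) \<in> carrier K" by (intro M.finsum_closed)
      fix z assume z: "z \<in> carrier K"
      have sn: "ip K (s n) z = ip K (\<Oplus>k\<in>{..<m}. ip K (s n) (x k) \<odot> h k) z" using *(3)[OF sc] by simp
      show "ip K (s n \<ominus> l) z = ip K (\<Oplus>k\<in>{..<m}. (ip K (s n) (x k) - c k) \<odot> h k) z"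
        unfolding ip_minus_left[OF sc l z] sn unfolding l_def
        unfolding ip_finsum[OF finite_lessThan cl(1) z] ip_finsum[OF finite_lessThan cl(2) z] ip_finsum[OF finite_lessThan cl(3) z]
        unfolding sum_subtractf[symmetric] using * z by (intro sum.cong) (auto simp: ip_smult_left left_diff_distrib)
    qed
    then show ?thesis
      using hnorm_finsum[of "{..<m}" "\<lambda>k. (ip K (s n) (x k) - c k) \<odot> h k"] * by (simp add: hnorm_smult Pi_def)
  qed
  have "(\<lambda>n. \<Sum>k<m. cmod (ip K (s n) (x k) - c k) * hnorm K (h k)) \<longlonglongrightarrow> (\<Sum>k<m. cmod (c k - c k) * hnorm K (h k))"
    using c by (intro tendsto_intros) auto
  then have "(\<lambda>n. \<Sum>k<m. cmod (ip K (s n) (x k) - c k) * hnorm K (h k)) \<longlonglongrightarrow> 0" by simp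
  then have "(\<lambda>n. hnorm K (s n \<ominus> l)) \<longlonglongrightarrow> 0"
    by (rule tendsto_sandwich[OF _ _ tendsto_const, rotated 2]) (use le sc l in auto)
  then show "\<exists>l\<in>carrier K. (\<lambda>n. hnorm K (s n \<ominus> l)) \<longlonglongrightarrow> 0" using l by blast
qed

lemma finite_dimensional_bounded:
  assumes "finite_dimensional K" and T: "\<And>x. x \<in> carrier K \<Longrightarrow> T x \<in> carrier K"
    "\<And>x y. x \<in> carrier K \<Longrightarrow> y \<in> carrier K \<Longrightarrow> T (x \<oplus> y) = T x \<oplus> T y"
    "\<And>c x. x \<in> carrier K \<Longrightarrow> T (c \<odot> x) = c \<odot> T x"
  shows "\<exists>b. \<forall>x\<in>carrier K. hnorm K (T x) \<le> b * hnorm K x"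
proof -
  obtain m :: nat and x h where *: "\<And>k. k < m \<Longrightarrow> x k \<in> carrier K" "\<And>k. k < m \<Longrightarrow> h k \<in> carrier K"
    "\<And>v. v \<in> carrier K \<Longrightarrow> v = (\<Oplus>k\<in>{..<m}. ip K v (x k) \<odot> h k)"
    by (rule finite_dimensional_coordinates[OF assms(1)], rule that)
  have Tsum: "T (\<Oplus>i\<in>I. f i) = (\<Oplus>i\<in>I. T (f i))" if "finite I" "f \<in> I \<rightarrow> carrier K" for f and I :: "nat set"
    using that
  proof (induction I rule: finite_induct)
    case empty
    show ?case using T(3)[of \<zero> 0] T(1)[of \<zero>] by simp
  next
    case (insert i I)
    then have "(\<Oplus>i\<in>insert i I. f i) = f i \<oplus> (\<Oplus>i\<in>I. f i)" "(\<Oplus>i\<in>insert i I. T (f i)) = T (f i) \<oplus> (\<Oplus>i\<in>I. T (f i))"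
      using T(1) by (auto intro!: M.finsum_insert)
    then show ?case using insert T by auto
  qed
  have "hnorm K (T v) \<le> (\<Sum>k<m. hnorm K (x k) * hnorm K (T (h k))) * hnorm K v" if v: "v \<in> carrier K" for v
  proof -
    have cl: "(\<lambda>k. ip K v (x k) \<odot> h k) \<in> {..<m} \<rightarrow> carrier K" using * by auto
    have "T v = (\<Oplus>k\<in>{..<m}. T (ip K v (x k) \<odot> h k))"
      using *(3)[OF v] Tsum[OF finite_lessThan cl] by metis
    then have "hnorm K (T v) \<le> (\<Sum>k<m. hnorm K (T (ip K v (x k) \<odot> h k)))"
      using hnorm_finsum[of "{..<m}" "\<lambda>k. T (ip K v (x k) \<odot> h k)"] * T(1) by (auto simp: Pi_def)
    also have "\<dots> \<le> (\<Sum>k<m. (hnorm K v * hnorm K (x k)) * hnorm K (T (h k)))"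
      using * v T cauchy_schwarz by (intro sum_mono) (auto simp: hnorm_smult intro!: mult_right_mono)
    also have "\<dots> = (\<Sum>k<m. hnorm K (x k) * hnorm K (T (h k))) * hnorm K v"
      by (simp add: sum_distrib_left sum_distrib_right mult_ac)
    finally show ?thesis .
  qed
  then show ?thesis by blast
qed

end

text \<open>The condition on the image makes all of S the space of the pullback, so that complements
  in S are preimages of complements in the space of T.\<close>

lemma closedin_pullback_topology:
  "closedin (pullback_topology S f T) N \<longleftrightarrow> (\<exists>C. closedin T C \<and> N = f -` C \<inter> S)"
  if "f ` S \<subseteq> topspace T"
proof
  have ts: "topspace (pullback_topology S f T) = S" using that by (auto simp: topspace_pullback_topology)
  assume N: "closedin (pullback_topology S f T) N"
  then obtain O' where O: "openin T O'" "S - N = f -` O' \<inter> S"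
    unfolding closedin_def ts openin_pullback_topology by blast
  have "N \<subseteq> S" using N ts closedin_subset by metis
  then have "N = f -` (topspace T - O') \<inter> S" using O that by blast
  then show "\<exists>C. closedin T C \<and> N = f -` C \<inter> S" using O by blast
next
  have ts: "topspace (pullback_topology S f T) = S" using that by (auto simp: topspace_pullback_topology)
  assume "\<exists>C. closedin T C \<and> N = f -` C \<inter> S"
  then obtain C where C: "closedin T C" "N = f -` C \<inter> S" by blast
  have "S - N = f -` (topspace T - C) \<inter> S" using C that by blast
  then show "closedin (pullback_topology S f T) N"
    unfolding closedin_def ts openin_pullback_topology using C by blast
qed

section \<open>The weak operator topology through matrix coefficients\<close>

context pre_hilbert begin

abbreviation matrix_coefs :: "('h \<Rightarrow> 'h) \<Rightarrow> 'h \<times> 'h \<Rightarrow> complex" where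
  "matrix_coefs T \<equiv> \<lambda>(x, y)\<in>carrier K \<times> carrier K. ip K (T x) y"

lemma closedin_wot:
  "closedin (weak_operator_topology K) N \<longleftrightarrow>
    (\<exists>C. closedin (product_topology (\<lambda>_. euclidean) (carrier K \<times> carrier K)) C \<and>
      N = matrix_coefs -` C \<inter> carrier (bounded_ops K))"
  unfolding weak_operator_topology_def
  by (subst closedin_pullback_topology) (auto simp: PiE_def)

lemma operator_eqI:
  assumes "S \<in> carrier (bounded_ops K)" "T \<in> carrier (bounded_ops K)"
    and "\<And>x y. x \<in> carrier K \<Longrightarrow> y \<in> carrier K \<Longrightarrow> ip K (S x) y = ip K (T x) y"
  shows "S = T"
  by (rule extensionalityI[OF bounded_opsD(1)[OF assms(1)] bounded_opsD(1)[OF assms(2)]])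
    (use assms bounded_opsD(2) in \<open>auto intro: ip_right_cancel\<close>)

lemma bounded_ops_simps:
  "x \<in> carrier K \<Longrightarrow> (S \<oplus>\<^bsub>bounded_ops K\<^esub> T) x = S x \<oplus> T x"
  "x \<in> carrier K \<Longrightarrow> (S \<otimes>\<^bsub>bounded_ops K\<^esub> T) x = S (T x)"
  "x \<in> carrier K \<Longrightarrow> (c \<odot>\<^bsub>bounded_ops K\<^esub> T) x = c \<odot> T x"
  "x \<in> carrier K \<Longrightarrow> \<one>\<^bsub>bounded_ops K\<^esub> x = x"
  by (auto simp: bounded_ops_def compose_def)

end

lemma star_representationD:
  assumes "star_representation A K \<pi>"
  shows "a \<in> carrier A \<Longrightarrow> \<pi> a \<in> carrier (bounded_ops K)"
    "a \<in> carrier A \<Longrightarrow> b \<in> carrier A \<Longrightarrow> \<pi> (a \<oplus>\<^bsub>A\<^esub> b) = \<pi> a \<oplus>\<^bsub>bounded_ops K\<^esub> \<pi> b"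
    "a \<in> carrier A \<Longrightarrow> b \<in> carrier A \<Longrightarrow> \<pi> (a \<otimes>\<^bsub>A\<^esub> b) = \<pi> a \<otimes>\<^bsub>bounded_ops K\<^esub> \<pi> b"
    "\<pi> \<one>\<^bsub>A\<^esub> = \<one>\<^bsub>bounded_ops K\<^esub>"
    "a \<in> carrier A \<Longrightarrow> \<pi> (c \<odot>\<^bsub>A\<^esub> a) = c \<odot>\<^bsub>bounded_ops K\<^esub> \<pi> a"
    "a \<in> carrier A \<Longrightarrow> is_adjoint K (\<pi> a) (\<pi> (adj A a))"
  using assms unfolding star_representation_def
  by (auto simp: ring_hom_closed ring_hom_add ring_hom_mult ring_hom_one)

text \<open>By interpolation, membership in the algebra amounts to one linear equation for each pair
  t, between the value at t and finitely many fixed values. Each equation is a closed condition in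
  the product topology, even when K has infinite dimension.\<close>

theorem finite_dimensional_von_neumann:
  assumes A: "pre_cstar A" "finite_dimensional A" and K: "hilbert_space K" and rep: "star_representation A K \<pi>"
  shows "von_neumann_on K (\<pi> ` carrier A)"
proof -
  interpret A: pre_cstar A by fact
  interpret pre_hilbert K using K by (rule hilbert_space_pre_hilbert)
  note \<pi> = star_representationD[OF rep]
  let ?N = "\<pi> ` carrier A" and ?X = "carrier K \<times> carrier K"
  note B = bounded_opsD(1,2)[OF \<pi>(1)]
  have "\<exists>(m :: nat) x h. (\<forall>k<m. x k \<in> ?X \<and> h k \<in> carrier A) \<and>
    (\<forall>a\<in>carrier A. \<forall>t\<in>?X. matrix_coefs (\<pi> a) t = (\<Sum>k<m. matrix_coefs (\<pi> a) (x k) * matrix_coefs (\<pi> (h k)) t))"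
    by (rule A.interpolation[OF A(2)])
      (auto simp: \<pi>(2,5) bounded_ops_simps B(2) ip_add_left ip_smult_left)
  then obtain m :: nat and x h where *: "(\<forall>k<m. x k \<in> ?X \<and> h k \<in> carrier A) \<and>
    (\<forall>a\<in>carrier A. \<forall>t\<in>?X. matrix_coefs (\<pi> a) t = (\<Sum>k<m. matrix_coefs (\<pi> a) (x k) * matrix_coefs (\<pi> (h k)) t))"
    by blast
  have xh: "\<And>k. k < m \<Longrightarrow> x k \<in> ?X" "\<And>k. k < m \<Longrightarrow> h k \<in> carrier A"
    using conjunct1[OF *] by blast+
  note ev = bspec[OF bspec[OF conjunct2[OF *]]]
  let ?T = "product_topology (\<lambda>_. euclidean :: complex topology) ?X"
  define C where "C = {F \<in> topspace ?T. \<forall>t\<in>?X. F t - (\<Sum>k<m. F (x k) * matrix_coefs (\<pi> (h k)) t) \<in> {0}}"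
  define S where "S t = {F \<in> topspace ?T. F t - (\<Sum>k<m. F (x k) * matrix_coefs (\<pi> (h k)) t) \<in> {0}}" for t
  have S: "closedin ?T (S t)" if "t \<in> ?X" for t
    unfolding S_def
  proof (rule closedin_continuous_map_preimage)
    have proj: "continuous_map ?T euclidean (\<lambda>F. F s)" if "s \<in> ?X" for s
      using that by (rule continuous_map_product_projection)
    have "continuous_map ?T euclidean (\<lambda>F. F (x k) * c)" if "k < m" for k c
      using continuous_map_compose[OF proj[OF xh(1)[OF that]], of euclidean "\<lambda>z. z * c"]
      by (simp add: o_def continuous_intros)
    then show "continuous_map ?T euclidean (\<lambda>F. F t - (\<Sum>k<m. F (x k) * matrix_coefs (\<pi> (h k)) t))"
      using proj[OF that] by (intro continuous_map_diff continuous_map_sum) auto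
  qed auto
  have "closedin ?T (topspace ?T \<inter> (\<Inter>t\<in>?X. S t))"
  proof (cases "?X = {}")
    case True
    then show ?thesis by (simp only: INT_empty Int_UNIV_right closedin_topspace)
  next
    case False
    then show ?thesis using S by (intro closedin_Int closedin_topspace closedin_Inter) auto
  qed
  also have "topspace ?T \<inter> (\<Inter>t\<in>?X. S t) = C"
    unfolding C_def S_def by blast
  finally have C: "closedin ?T C" .
  have "?N = matrix_coefs -` C \<inter> carrier (bounded_ops K)"
  proof
    show "?N \<subseteq> matrix_coefs -` C \<inter> carrier (bounded_ops K)"
    proof (rule image_subsetI, rule IntI, rule vimageI2)
      fix a assume a: "a \<in> carrier A"
      show "\<pi> a \<in> carrier (bounded_ops K)" using \<pi>(1) a .
      have "matrix_coefs (\<pi> a) t - (\<Sum>k<m. matrix_coefs (\<pi> a) (x k) * matrix_coefs (\<pi> (h k)) t) \<in> {0}"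
        if "t \<in> ?X" for t using ev[OF a that] by (simp only: diff_self singleton_iff)
      moreover have "matrix_coefs (\<pi> a) \<in> topspace ?T" by (simp add: PiE_def)
      ultimately show "matrix_coefs (\<pi> a) \<in> C" unfolding C_def by blast
    qed
    show "matrix_coefs -` C \<inter> carrier (bounded_ops K) \<subseteq> ?N"
    proof safe
      fix T assume T: "T \<in> carrier (bounded_ops K)" and TC: "matrix_coefs T \<in> C"
      \<comment> \<open>The interpolant of T: the equations say that its image has the matrix
        coefficients of T.\<close>
      define a where "a = (\<Oplus>\<^bsub>A\<^esub>k\<in>{..<m}. matrix_coefs T (x k) \<odot>\<^bsub>A\<^esub> h k)"
      have a: "a \<in> carrier A" unfolding a_def using xh by (intro A.M.finsum_closed) auto
      have zero: "\<pi> \<zero>\<^bsub>A\<^esub> v = \<zero>\<^bsub>K\<^esub>" if "v \<in> carrier K" for v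
        using \<pi>(5)[of "\<zero>\<^bsub>A\<^esub>" 0] B(2)[of "\<zero>\<^bsub>A\<^esub>"] that bounded_ops_simps(3)[of v 0 "\<pi> \<zero>\<^bsub>A\<^esub>"] by simp
      have sum: "ip K (\<pi> (\<Oplus>\<^bsub>A\<^esub>k\<in>I. f k) v) w = (\<Sum>k\<in>I. ip K (\<pi> (f k) v) w)"
        if "finite I" "f \<in> I \<rightarrow> carrier A" "v \<in> carrier K" "w \<in> carrier K" for I :: "nat set" and f v w
        using that(1,2)
      proof (induction I rule: finite_induct)
        case empty then show ?case using zero that by simp
      next
        case (insert i I)
        then have "(\<Oplus>\<^bsub>A\<^esub>i\<in>insert i I. f i) = f i \<oplus>\<^bsub>A\<^esub> (\<Oplus>\<^bsub>A\<^esub>i\<in>I. f i)" by (intro A.M.finsum_insert) auto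
        moreover have "(\<Oplus>\<^bsub>A\<^esub>i\<in>I. f i) \<in> carrier A" "f i \<in> carrier A" using insert by auto
        ultimately show ?case using insert that by (simp add: \<pi>(2) bounded_ops_simps ip_add_left B(2))
      qed
      have "\<pi> a = T"
      proof (rule operator_eqI[OF \<pi>(1)[OF a] T])
        fix v w assume vw: "v \<in> carrier K" "w \<in> carrier K"
        have "ip K (\<pi> a v) w = (\<Sum>k<m. ip K (\<pi> (matrix_coefs T (x k) \<odot>\<^bsub>A\<^esub> h k) v) w)"
          unfolding a_def using xh vw by (subst sum) auto
        also have "\<dots> = (\<Sum>k<m. matrix_coefs T (x k) * matrix_coefs (\<pi> (h k)) (v, w))"
          using xh vw by (intro sum.cong) (auto simp: \<pi>(5) bounded_ops_simps ip_smult_left B(2))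
        also have "\<dots> = matrix_coefs T (v, w)" using TC vw unfolding C_def by auto
        also have "\<dots> = ip K (T v) w" using vw by simp
        finally show "ip K (\<pi> a v) w = ip K (T v) w" .
      qed
      then show "T \<in> ?N" using a by blast
    qed
  qed
  then have "closedin (weak_operator_topology K) ?N" unfolding closedin_wot using C by blast
  moreover have "\<forall>T\<in>?N. \<exists>S\<in>?N. is_adjoint K T S" by (auto intro!: \<pi>(6) bexI)
  moreover have "\<one>\<^bsub>bounded_ops K\<^esub> \<in> ?N" using \<pi>(4) by force
  moreover have "\<forall>S\<in>?N. \<forall>T\<in>?N. S \<oplus>\<^bsub>bounded_ops K\<^esub> T \<in> ?N \<and> S \<otimes>\<^bsub>bounded_ops K\<^esub> T \<in> ?N"
    by (auto simp: \<pi>(2,3)[symmetric])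
  moreover have "\<forall>c. \<forall>T\<in>?N. c \<odot>\<^bsub>bounded_ops K\<^esub> T \<in> ?N" by (auto simp: \<pi>(5)[symmetric])
  moreover have "?N \<subseteq> carrier (bounded_ops K)" using \<pi>(1) by auto
  ultimately show ?thesis unfolding von_neumann_on_def using K by simp
qed

section \<open>Representing a finite-dimensional algebra\<close>

text \<open>The Hilbert space has to consist of functions \<open>'c \<Rightarrow> complex\<close>, where \<open>'c\<close> may have only one
  element, so finitely many complex coordinates are packed into one.\<close>

lemma finite_coordinates_inject:
  assumes "finite I"
  shows "\<exists>f :: ('i \<Rightarrow> complex) \<Rightarrow> complex. \<forall>c d. f c = f d \<longrightarrow> (\<forall>i\<in>I. c i = d i)"
proof -
  have "infinite (UNIV :: complex set)" by (rule infinite_UNIV_char_0)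
  then have "(card_of (UNIV \<times> UNIV :: (complex \<times> complex) set), card_of (UNIV :: complex set)) \<in> ordIso"
    by (rule card_of_Times_same_infinite)
  then have "(card_of (UNIV \<times> UNIV :: (complex \<times> complex) set), card_of (UNIV :: complex set)) \<in> ordLeq"
    by (rule ordIso_imp_ordLeq)
  then have "\<exists>g :: complex \<times> complex \<Rightarrow> complex. inj_on g (UNIV \<times> UNIV) \<and> g ` (UNIV \<times> UNIV) \<subseteq> UNIV"
    by (rule iffD2[OF card_of_ordLeq])
  then obtain g :: "complex \<times> complex \<Rightarrow> complex" where "inj_on g (UNIV \<times> UNIV)" by blast
  then have g: "inj g" by simp
  show ?thesis
    using assms
  proof (induction I rule: finite_induct)
    case (insert i I)
    obtain f :: "('i \<Rightarrow> complex) \<Rightarrow> complex" where f: "\<forall>c d. f c = f d \<longrightarrow> (\<forall>i\<in>I. c i = d i)"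
      using insert.IH ..
    show ?case
    proof (intro exI[of _ "\<lambda>c. g (c i, f c)"] allI impI)
      fix c d assume "g (c i, f c) = g (d i, f d)"
      then have "(c i, f c) = (d i, f d)" by (rule injD[OF g])
      moreover from this have "\<forall>j\<in>I. c j = d j" using f[rule_format, of c d] by blast
      ultimately show "\<forall>j\<in>insert i I. c j = d j" by blast
    qed
  qed simp
qed

text \<open>The packed coordinate tuple is placed as a constant function, so that even a one-element
  'c has room for the space.\<close>

lemma (in cmodule) finite_dimensional_inject:
  assumes "finite_dimensional V"
  shows "\<exists>\<phi> :: 'a \<Rightarrow> ('c \<Rightarrow> complex). inj_on \<phi> (carrier V)"
proof -
  obtain B where B: "finite B" "B \<subseteq> carrier V" "carrier V \<subseteq> lspan B"
    using assms finite_dimensional_iff by blast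
  obtain f :: "('a \<Rightarrow> complex) \<Rightarrow> complex" where f: "\<forall>c d. f c = f d \<longrightarrow> (\<forall>i\<in>B. c i = d i)"
    using finite_coordinates_inject[OF B(1)] ..
  have "\<forall>x\<in>carrier V. \<exists>c. x = (\<Oplus>b\<in>B. c b \<odot> b)" using B(3) by (auto simp: lspan_def)
  then obtain c where c: "\<And>x. x \<in> carrier V \<Longrightarrow> x = (\<Oplus>b\<in>B. c x b \<odot> b)" by metis
  have "x = y" if "x \<in> carrier V" "y \<in> carrier V" "f (c x) = f (c y)" for x y
  proof -
    have "\<forall>i\<in>B. c x i = c y i" using f[rule_format, OF that(3)] by blast
    then have "(\<Oplus>b\<in>B. c x b \<odot> b) = (\<Oplus>b\<in>B. c y b \<odot> b)"
      using B(2) by (intro M.finsum_cong') auto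
    then show ?thesis using c that by metis
  qed
  then have "inj_on (\<lambda>x (_ :: 'c). f (c x)) (carrier V)" by (auto simp: inj_on_def fun_eq_iff)
  then show ?thesis by blast
qed

text \<open>The GNS construction for \<open>faithful_functional\<close>. Faithfulness makes the form
  definite without a quotient, and finite dimension makes the space complete. The algebra acts on
  itself by left multiplication, transported along \<phi> to the prescribed type.\<close>

theorem (in matrix_frame) von_neumann: "von_neumann_algebra TYPE('c) A"
proof -
  obtain \<phi> :: "'a \<Rightarrow> ('c \<Rightarrow> complex)" where inj: "inj_on \<phi> (carrier A)"
    using finite_dimensional_inject[OF finite_dimensional] by blast
  define g where "g = inv_into (carrier A) \<phi>"
  have g [simp]: "g (\<phi> x) = x" if "x \<in> carrier A" for x using inj that by (simp add: g_def)
  define K :: "('c \<Rightarrow> complex) hilb" where "K = \<lparr> carrier = \<phi> ` carrier A, mult = undefined, one = undefined,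
    zero = \<phi> \<zero>, add = (\<lambda>u v. \<phi> (g u \<oplus> g v)), smult = (\<lambda>c u. \<phi> (c \<odot> g u)),
    ip = (\<lambda>u v. faithful_functional (adj A (g v) \<otimes> g u)) \<rparr>"
  have K: "carrier K = \<phi> ` carrier A" "\<zero>\<^bsub>K\<^esub> = \<phi> \<zero>" by (simp_all add: K_def)
  have K': "\<phi> x \<oplus>\<^bsub>K\<^esub> \<phi> y = \<phi> (x \<oplus> y)" "c \<odot>\<^bsub>K\<^esub> \<phi> x = \<phi> (c \<odot> x)"
    "ip K (\<phi> x) (\<phi> y) = faithful_functional (adj A y \<otimes> x)"
    if "x \<in> carrier A" "y \<in> carrier A" for x y c using that by (simp_all add: K_def)
  have "Module.module CC K"
  proof (intro moduleI cring_CC abelian_groupI)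
    fix u assume "u \<in> carrier K"
    then obtain x where x: "x \<in> carrier A" "u = \<phi> x" by (auto simp: K)
    then show "\<exists>v\<in>carrier K. v \<oplus>\<^bsub>K\<^esub> u = \<zero>\<^bsub>K\<^esub>"
      by (intro bexI[of _ "\<phi> (\<ominus> x)"]) (auto simp: K K' l_neg)
  qed (auto simp: K K' a_ac smult_add_left smult_add_right)
  then interpret K: cmodule K by (simp add: cmodule_def)
  interpret K: pre_hilbert K
  proof unfold_locales
    fix u v w assume "u \<in> carrier K" "v \<in> carrier K" "w \<in> carrier K"
    then show "ip K (u \<oplus>\<^bsub>K\<^esub> v) w = ip K u w + ip K v w"
      by (auto simp: K K' r_distr functional_add)
  next
    fix c u v assume "u \<in> carrier K" "v \<in> carrier K"
    then show "ip K (c \<odot>\<^bsub>K\<^esub> u) v = c * ip K u v"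
      by (auto simp: K K' smult_mult_right functional_smult)
  next
    fix u v assume "u \<in> carrier K" "v \<in> carrier K"
    then show "ip K v u = cnj (ip K u v)"
      by (auto simp: K K' functional_adj[symmetric] adj_mult)
  next
    fix u assume "u \<in> carrier K"
    then obtain x where x: "x \<in> carrier A" "u = \<phi> x" by (auto simp: K)
    then show "0 \<le> Re (ip K u u)" by (simp add: K' functional_nonneg)
    have "x = \<zero> \<longleftrightarrow> \<phi> x = \<phi> \<zero>" using inj x by (auto simp: inj_on_def)
    moreover have "faithful_functional \<zero> = 0" using functional_smult[of \<zero> 0] by simp
    moreover have "faithful_functional (adj A x \<otimes> x) = 0 \<Longrightarrow> x = \<zero>" by (rule functional_faithful[OF x(1)])
    ultimately have "faithful_functional (adj A x \<otimes> x) = 0 \<longleftrightarrow> \<phi> x = \<phi> \<zero>" by auto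
    then show "ip K u u = 0 \<longleftrightarrow> u = \<zero>\<^bsub>K\<^esub>" by (simp add: x K K')
  qed
  have fdK: "finite_dimensional K"
  proof -
    obtain B where B: "finite B" "B \<subseteq> carrier A" "carrier A \<subseteq> lspan B"
      using finite_dimensional finite_dimensional_iff by blast
    have B': "finite (\<phi> ` B)" "\<phi> ` B \<subseteq> carrier K" using B by (auto simp: K)
    have "\<phi> (\<Oplus>b\<in>I. c b \<odot> b) \<in> K.lspan (\<phi> ` B)" if "finite I" "I \<subseteq> B" for c I
      using that
    proof (induction I rule: finite_induct)
      case empty
      then show ?case using K.lspan_zero[OF B'] by (simp add: K)
    next
      case (insert b I)
      then have b: "b \<in> carrier A" "b \<in> B" "I \<subseteq> carrier A" using B by auto
      have "(\<Oplus>b\<in>insert b I. c b \<odot> b) = c b \<odot> b \<oplus> (\<Oplus>b\<in>I. c b \<odot> b)"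
        using insert b by (intro finsum_insert) auto
      moreover have "(\<Oplus>b\<in>I. c b \<odot> b) \<in> carrier A" using b by (intro finsum_closed) auto
      ultimately have "\<phi> (\<Oplus>b\<in>insert b I. c b \<odot> b) = c b \<odot>\<^bsub>K\<^esub> \<phi> b \<oplus>\<^bsub>K\<^esub> \<phi> (\<Oplus>b\<in>I. c b \<odot> b)"
        using b by (simp add: K')
      then show ?case using insert b by (simp add: K.lspan_add[OF B'] K.lspan_smult[OF B'] K.lspan_gen[OF B'])
    qed
    note span = this[OF B(1) order_refl]
    have "carrier K \<subseteq> K.lspan (\<phi> ` B)"
    proof
      fix u assume "u \<in> carrier K"
      then obtain x where x: "x \<in> lspan B" "u = \<phi> x" using B(3) by (auto simp: K)
      then show "u \<in> K.lspan (\<phi> ` B)" using span by (auto simp: lspan_def)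
    qed
    then show ?thesis unfolding K.finite_dimensional_iff using B' by blast
  qed
  define \<pi> where "\<pi> a = (\<lambda>u\<in>carrier K. \<phi> (a \<otimes> g u))" for a
  have \<pi>: "\<pi> a (\<phi> x) = \<phi> (a \<otimes> x)" if "x \<in> carrier A" for a x using that by (simp add: \<pi>_def K)
  have cl: "\<pi> a \<in> carrier (bounded_ops K)" if a: "a \<in> carrier A" for a
  proof -
    have *: "\<pi> a u \<in> carrier K" "v \<in> carrier K \<Longrightarrow> \<pi> a (u \<oplus>\<^bsub>K\<^esub> v) = \<pi> a u \<oplus>\<^bsub>K\<^esub> \<pi> a v"
      "\<pi> a (c \<odot>\<^bsub>K\<^esub> u) = c \<odot>\<^bsub>K\<^esub> \<pi> a u" if "u \<in> carrier K" for u v c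
      using that a by (auto simp: K K' \<pi> r_distr smult_mult_right)
    obtain b where "\<forall>u\<in>carrier K. hnorm K (\<pi> a u) \<le> b * hnorm K u"
      using K.finite_dimensional_bounded[OF fdK, of "\<pi> a"] * by blast
    then show ?thesis using * by (intro K.bounded_opsI) (auto simp: \<pi>_def)
  qed
  have rep: "star_representation A K \<pi>"
    unfolding star_representation_def
  proof (intro conjI allI ballI ring_hom_memI)
    fix a b assume ab: "a \<in> carrier A" "b \<in> carrier A"
    show "\<pi> (a \<otimes> b) = \<pi> a \<otimes>\<^bsub>bounded_ops K\<^esub> \<pi> b"
      using ab by (auto simp: bounded_ops_def compose_def fun_eq_iff \<pi>_def K m_assoc)
    show "\<pi> (a \<oplus> b) = \<pi> a \<oplus>\<^bsub>bounded_ops K\<^esub> \<pi> b"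
      using ab by (auto simp: bounded_ops_def fun_eq_iff \<pi>_def K K' l_distr)
  next
    show "\<pi> \<one> = \<one>\<^bsub>bounded_ops K\<^esub>"
      by (auto simp: bounded_ops_def fun_eq_iff \<pi>_def K)
  next
    fix c a assume "a \<in> carrier A"
    then show "\<pi> (c \<odot> a) = c \<odot>\<^bsub>bounded_ops K\<^esub> \<pi> a"
      by (auto simp: bounded_ops_def fun_eq_iff \<pi>_def K K' smult_mult_left)
  next
    fix a assume "a \<in> carrier A"
    then show "is_adjoint K (\<pi> a) (\<pi> (adj A a))"
      unfolding is_adjoint_def by (auto simp: \<pi> K K' adj_mult m_assoc)
  qed (use cl in auto)
  have "inj_on \<pi> (carrier A)"
  proof (rule inj_onI)
    fix a b assume ab: "a \<in> carrier A" "b \<in> carrier A" "\<pi> a = \<pi> b"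
    \<comment> \<open>Left multiplications are told apart by their values at the unit.\<close>
    then have "\<phi> a = \<phi> b" using \<pi>[of \<one> a] \<pi>[of \<one> b] by simp
    then show "a = b" using inj ab by (auto simp: inj_on_def)
  qed
  moreover have "von_neumann_on K (\<pi> ` carrier A)"
    by (rule finite_dimensional_von_neumann[OF pre_cstar_axioms finite_dimensional K.finite_dimensional_complete[OF fdK] rep])
  ultimately show ?thesis
    unfolding von_neumann_algebra_def by (intro exI[of _ K] exI[of _ \<pi>] conjI rep)
qed

section \<open>Suprema of orthogonal projections in von Neumann algebras\<close>

context pre_hilbert begin

definition tends :: "(nat \<Rightarrow> 'h) \<Rightarrow> 'h \<Rightarrow> bool" where
  "tends s l \<longleftrightarrow> l \<in> carrier K \<and> (\<forall>n. s n \<in> carrier K) \<and> (\<lambda>n. hnorm K (s n \<ominus> l)) \<longlonglongrightarrow> 0"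

lemma tendsI:
  assumes "l \<in> carrier K" "\<And>n. s n \<in> carrier K" "\<And>n. hnorm K (s n \<ominus> l) \<le> f n" "f \<longlonglongrightarrow> 0"
  shows "tends s l"
  unfolding tends_def using assms(1,2)
  by (auto intro!: tendsto_sandwich[OF _ _ tendsto_const assms(4)] always_eventually assms(3))

lemma tends_const: "l \<in> carrier K \<Longrightarrow> tends (\<lambda>_. l) l"
  by (simp add: tends_def M.r_neg M.minus_eq)

lemma tends_ip: "tends s l \<Longrightarrow> y \<in> carrier K \<Longrightarrow> (\<lambda>n. ip K (s n) y) \<longlonglongrightarrow> ip K l y"
proof -
  assume s: "tends s l" and y: "y \<in> carrier K"
  then have 0: "(\<lambda>n. hnorm K (s n \<ominus> l) * hnorm K y) \<longlonglongrightarrow> 0"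
    unfolding tends_def using tendsto_mult_left_zero by blast
  have "norm (ip K (s n) y - ip K l y) \<le> hnorm K (s n \<ominus> l) * hnorm K y" for n
    using s y cauchy_schwarz[of "s n \<ominus> l" y] unfolding tends_def by (simp add: ip_minus_left)
  then have "(\<lambda>n. ip K (s n) y - ip K l y) \<longlonglongrightarrow> 0"
    by (intro Lim_null_comparison[OF always_eventually 0] allI)
  then show ?thesis by (simp add: LIM_zero_iff)
qed

lemma tends_unique: "tends s l \<Longrightarrow> tends s l' \<Longrightarrow> l = l'"
proof (rule ip_right_cancel)
  assume "tends s l" "tends s l'"
  then show "ip K l z = ip K l' z" if "z \<in> carrier K" for z
    using tends_ip[OF _ that] LIMSEQ_unique by blast
qed (auto simp: tends_def)

lemma tends_add: "tends s l \<Longrightarrow> tends t m \<Longrightarrow> tends (\<lambda>n. s n \<oplus> t n) (l \<oplus> m)"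
proof (rule tendsI)
  assume s: "tends s l" and t: "tends t m"
  fix n
  have "(s n \<oplus> t n) \<ominus> (l \<oplus> m) = (s n \<ominus> l) \<oplus> (t n \<ominus> m)"
    using s t unfolding tends_def by (simp add: minus_eq_smult smult_add_right M.a_ac)
  then show "hnorm K ((s n \<oplus> t n) \<ominus> (l \<oplus> m)) \<le> hnorm K (s n \<ominus> l) + hnorm K (t n \<ominus> m)"
    using s t unfolding tends_def by (simp add: hnorm_add)
  show "(\<lambda>n. hnorm K (s n \<ominus> l) + hnorm K (t n \<ominus> m)) \<longlonglongrightarrow> 0"
    using s t unfolding tends_def by (auto intro: tendsto_add_zero)
qed (auto simp: tends_def)

lemma tends_linear:
  assumes "tends s l" "T \<in> carrier (bounded_ops K)"
  shows "tends (\<lambda>n. T (s n)) (T l)"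
proof -
  obtain b where b: "\<And>x. x \<in> carrier K \<Longrightarrow> hnorm K (T x) \<le> b * hnorm K x"
    using bounded_opsD(5)[OF assms(2)] by blast
  note T = bounded_opsD[OF assms(2)]
  show ?thesis
  proof (rule tendsI)
    fix n
    have "T (s n) \<ominus> T l = T (s n \<ominus> l)"
      using assms(1) T unfolding tends_def by (simp add: minus_eq_smult)
    then show "hnorm K (T (s n) \<ominus> T l) \<le> b * hnorm K (s n \<ominus> l)"
      using b assms(1) unfolding tends_def by simp
    show "(\<lambda>n. b * hnorm K (s n \<ominus> l)) \<longlonglongrightarrow> 0"
      using assms(1) unfolding tends_def by (auto intro: tendsto_mult_right_zero)
  qed (use assms(1) T in \<open>auto simp: tends_def\<close>)
qed

lemma tends_smult: "tends s l \<Longrightarrow> tends (\<lambda>n. c \<odot> s n) (c \<odot> l)"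
proof (rule tendsI)
  assume s: "tends s l"
  fix n
  have "c \<odot> s n \<ominus> c \<odot> l = c \<odot> (s n \<ominus> l)"
    using s unfolding tends_def by (simp add: minus_eq_smult smult_add_right mult.commute)
  then show "hnorm K (c \<odot> s n \<ominus> c \<odot> l) \<le> cmod c * hnorm K (s n \<ominus> l)"
    using s unfolding tends_def by (simp add: hnorm_smult)
  show "(\<lambda>n. cmod c * hnorm K (s n \<ominus> l)) \<longlonglongrightarrow> 0"
    using s unfolding tends_def by (auto intro: tendsto_mult_right_zero)
qed (auto simp: tends_def)

lemma tends_hnorm_le:
  assumes "tends s l" "\<And>n. hnorm K (s n) \<le> C"
  shows "hnorm K l \<le> C"
proof (rule LIMSEQ_le_const)
  show "(\<lambda>n. hnorm K (s n \<ominus> l) + C) \<longlonglongrightarrow> C"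
    using assms(1) unfolding tends_def by (auto intro!: tendsto_eq_intros)
  have "hnorm K l \<le> hnorm K (s n \<ominus> l) + C" for n
  proof -
    have sl: "s n \<in> carrier K" "l \<in> carrier K" using assms(1) unfolding tends_def by auto
    have "l = (l \<ominus> s n) \<oplus> s n" using sl by (simp add: M.minus_eq M.a_assoc M.l_neg)
    then have "hnorm K l \<le> hnorm K (l \<ominus> s n) + hnorm K (s n)" using sl hnorm_add[of "l \<ominus> s n" "s n"] by simp
    then show ?thesis using assms(2)[of n] hnorm_minus_commute[OF sl] by simp
  qed
  then show "\<exists>N. \<forall>n\<ge>N. hnorm K l \<le> hnorm K (s n \<ominus> l) + C" by blast
qed

end

lemma (in pre_hilbert) star_representation_zero:
  assumes A: "pre_cstar A" and rep: "star_representation A K \<pi>" and x: "x \<in> carrier K"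
  shows "\<pi> \<zero>\<^bsub>A\<^esub> x = \<zero>"
proof -
  interpret A: pre_cstar A by fact
  have c: "\<pi> \<zero>\<^bsub>A\<^esub> x \<in> carrier K"
    by (rule bounded_opsD(2)[OF star_representationD(1)[OF rep A.zero_closed] x])
  have eq: "\<pi> (0 \<odot>\<^bsub>A\<^esub> \<zero>\<^bsub>A\<^esub>) = 0 \<odot>\<^bsub>bounded_ops K\<^esub> \<pi> \<zero>\<^bsub>A\<^esub>"
    by (rule star_representationD(5)[OF rep A.zero_closed])
  have "\<pi> (0 \<odot>\<^bsub>A\<^esub> \<zero>\<^bsub>A\<^esub>) x = \<zero>"
    unfolding eq bounded_ops_simps(3)[OF x] by (rule smult_0[OF c])
  then show ?thesis by (simp only: A.smult_zero)
qed

text \<open>q plays the role of the supremum, but is described by products in A alone, so that the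
  conclusion no longer mentions the representation. It comes from the strong limit of the partial
  sums of the p j; a strong limit is a weak limit and therefore stays in the algebra.\<close>

theorem von_neumann_supremum:
  assumes A: "pre_cstar A" and p: "\<And>j :: nat. p j \<in> projections A"
    and orth: "\<And>i j. i \<noteq> j \<Longrightarrow> p i \<otimes>\<^bsub>A\<^esub> p j = \<zero>\<^bsub>A\<^esub>"
    and rep: "star_representation A K \<pi>" and inj: "inj_on \<pi> (carrier A)"
    and vn: "von_neumann_on K (\<pi> ` carrier A)"
  shows "\<exists>q\<in>carrier A. (\<forall>j. p j \<otimes>\<^bsub>A\<^esub> q = p j) \<and>
    (\<forall>e\<in>carrier A. (\<forall>j. e \<otimes>\<^bsub>A\<^esub> p j = \<zero>\<^bsub>A\<^esub>) \<longrightarrow> e \<otimes>\<^bsub>A\<^esub> q = \<zero>\<^bsub>A\<^esub>)"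
proof -
  interpret A: pre_cstar A by fact
  have H: "hilbert_space K" using vn by (simp add: von_neumann_on_def)
  then interpret pre_hilbert K by (rule hilbert_space_pre_hilbert)
  have complete: "\<exists>l. tends s l" if sc: "\<And>n. s n \<in> carrier K"
    and Cy: "\<And>e. e > 0 \<Longrightarrow> \<exists>N. \<forall>m\<ge>N. \<forall>n\<ge>N. hnorm K (s m \<ominus>\<^bsub>K\<^esub> s n) < e" for s :: "nat \<Rightarrow> 'b"
  proof -
    have "range s \<subseteq> carrier K" using sc by auto
    then obtain l where "l \<in> carrier K" "(\<lambda>n. hnorm K (s n \<ominus>\<^bsub>K\<^esub> l)) \<longlonglongrightarrow> 0"
      using conjunct2[OF H[unfolded hilbert_space_iff], rule_format, of s] Cy by blast
    then have "tends s l" using sc by (simp add: tends_def)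
    then show ?thesis ..
  qed
  note \<pi> = star_representationD[OF rep]
  note B = bounded_opsD(1-4)[OF \<pi>(1)]
  note pc = A.projD[OF p]
  \<comment> \<open>\<open>r n\<close> sums the p k with k < n; the strict inequality is the origin
    of the shift by \<open>Suc j\<close> used later.\<close>
  define r where "r = rec_nat \<zero>\<^bsub>A\<^esub> (\<lambda>n s. s \<oplus>\<^bsub>A\<^esub> p n)"
  have r0: "r 0 = \<zero>\<^bsub>A\<^esub>" and rS: "r (Suc n) = r n \<oplus>\<^bsub>A\<^esub> p n" for n by (simp_all add: r_def)
  have rc: "r n \<in> carrier A" for n by (induction n) (auto simp: r0 rS pc)
  have rp: "r n \<otimes>\<^bsub>A\<^esub> p k = (if k < n then p k else \<zero>\<^bsub>A\<^esub>) \<and> p k \<otimes>\<^bsub>A\<^esub> r n = (if k < n then p k else \<zero>\<^bsub>A\<^esub>)" for n k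
  proof (induction n)
    case (Suc n)
    then show ?case
      by (cases "n = k") (simp_all add: rS A.l_distr A.r_distr rc pc(1,3) orth less_Suc_eq)
  qed (simp add: r0 pc(1))
  have rproj: "r n \<in> projections A" for n
  proof (induction n)
    case (Suc n)
    show ?case
      by (simp add: rS projections_def A.adj_add A.l_distr A.r_distr rc pc rp A.projD[OF Suc])
  qed (simp add: r0)
  have rr: "r m \<otimes>\<^bsub>A\<^esub> r n = r m" if "m \<le> n" for m n
    using that
  proof (induction n rule: dec_induct)
    case base then show ?case using A.projD[OF rproj] by simp
  next
    case (step n)
    then show ?case by (simp add: rS A.r_distr rc pc(1) rp)
  qed
  have proj: "ip K (\<pi> s x) y = ip K x (\<pi> s y)" "\<pi> s (\<pi> s x) = \<pi> s x" "(hnorm K (\<pi> s x))\<^sup>2 = Re (ip K x (\<pi> s x))"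
      "hnorm K (\<pi> s x) \<le> hnorm K x"
    if s: "s \<in> projections A" and x: "x \<in> carrier K" and y: "y \<in> carrier K" for s x y
  proof -
    note S = A.projD[OF s]
    have 1: "ip K (\<pi> s x) y = ip K x (\<pi> s y)" if "x \<in> carrier K" "y \<in> carrier K" for x y
      using \<pi>(6)[OF S(1)] S(2) that unfolding is_adjoint_def by simp
    show "ip K (\<pi> s x) y = ip K x (\<pi> s y)" using 1 x y .
    show 2: "\<pi> s (\<pi> s x) = \<pi> s x" using \<pi>(3)[OF S(1) S(1)] S(3) bounded_ops_simps(2)[OF x, of "\<pi> s" "\<pi> s"] by simp
    show 3: "(hnorm K (\<pi> s x))\<^sup>2 = Re (ip K x (\<pi> s x))"
      using 1[OF x, of "\<pi> s x"] 2 x B S by (simp add: hnorm_sq)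
    have "hnorm K (\<pi> s x) * hnorm K (\<pi> s x) \<le> hnorm K x * hnorm K (\<pi> s x)"
      using 3 cauchy_schwarz[of x "\<pi> s x"] x B S complex_Re_le_cmod[of "ip K x (\<pi> s x)"]
      by (simp add: power2_eq_square)
    then show "hnorm K (\<pi> s x) \<le> hnorm K x"
      using hnorm_nonneg[of "\<pi> s x"] hnorm_nonneg[OF x] x B S by (cases "hnorm K (\<pi> s x) = 0") (auto simp: mult_le_cancel_right)
  qed
  have "\<exists>l. tends (\<lambda>n. \<pi> (r n) x) l" if x: "x \<in> carrier K" for x
  proof (rule complete)
    show Rc: "\<pi> (r n) x \<in> carrier K" for n by (rule B(2)[OF rc x])
    define a where "a n = Re (ip K x (\<pi> (r n) x))" for n
    \<comment> \<open>For nested projections the squared distance between the images of x is the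
      difference of the quadratic forms at x. These form a bounded increasing sequence, so the
      images are Cauchy.\<close>
    have diff: "(hnorm K (\<pi> (r n) x \<ominus>\<^bsub>K\<^esub> \<pi> (r m) x))\<^sup>2 = a n - a m" if "m \<le> n" for m n
    proof -
      have mn: "\<pi> (r m) (\<pi> (r n) x) = \<pi> (r m) x"
        using rr[OF that] \<pi>(3)[OF rc rc, of m n] bounded_ops_simps(2)[OF x, of "\<pi> (r m)" "\<pi> (r n)"] by simp
      have 1: "ip K (\<pi> (r n) x) (\<pi> (r n) x) = ip K x (\<pi> (r n) x)"
        "ip K (\<pi> (r m) x) (\<pi> (r m) x) = ip K x (\<pi> (r m) x)"
        using proj(1,2)[OF rproj] x Rc by simp_all
      have 2: "ip K (\<pi> (r m) x) (\<pi> (r n) x) = ip K x (\<pi> (r m) x)"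
        using proj(1)[OF rproj x Rc, of m n] mn by simp
      have 3: "Re (ip K (\<pi> (r n) x) (\<pi> (r m) x)) = Re (ip K x (\<pi> (r m) x))"
        using ip_cnj[OF Rc Rc, of m n] 2 by simp
      show ?thesis using Rc 1 2 3 by (simp add: hnorm_sq ip_minus_left ip_minus_right a_def)
    qed
    have "a m \<le> a n" if "m \<le> n" for m n
      using diff[OF that] zero_le_power2[of "hnorm K (\<pi> (r n) x \<ominus>\<^bsub>K\<^esub> \<pi> (r m) x)"] by linarith
    then have "incseq a" by (simp add: incseq_def)
    moreover have "a n \<le> (hnorm K x)\<^sup>2" for n
      using proj(3)[OF rproj x x, of n] power_mono[OF proj(4)[OF rproj x x] hnorm_nonneg[OF Rc], of n 2]
      by (simp add: a_def)
    ultimately obtain L where "a \<longlonglongrightarrow> L" using incseq_convergent[of a "(hnorm K x)\<^sup>2"] by blast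
    then have "Cauchy a" by (rule LIMSEQ_imp_Cauchy)
    fix e :: real assume e: "e > 0"
    then obtain N where N: "\<And>m n. m \<ge> N \<Longrightarrow> n \<ge> N \<Longrightarrow> \<bar>a m - a n\<bar> < e\<^sup>2"
      using metric_CauchyD[OF \<open>Cauchy a\<close>, of "e\<^sup>2"] by (auto simp: dist_real_def)
    have mono: "a m \<le> a n" if "m \<le> n" for m n using \<open>incseq a\<close> that by (rule incseqD)
    have sq: "(hnorm K (\<pi> (r m) x \<ominus>\<^bsub>K\<^esub> \<pi> (r n) x))\<^sup>2 = \<bar>a m - a n\<bar>" for m n
    proof (cases "n \<le> m")
      case True then show ?thesis using diff[OF True] mono[OF True] by simp
    next
      case False
      then have "m \<le> n" by simp
      then show ?thesis using diff mono hnorm_minus_commute[OF Rc Rc, of m n] by simp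
    qed
    have "hnorm K (\<pi> (r m) x \<ominus>\<^bsub>K\<^esub> \<pi> (r n) x) < e" if "m \<ge> N" "n \<ge> N" for m n
      by (rule power_less_imp_less_base[of _ 2]) (use N[OF that] sq[of m n] e in simp_all)
    then show "\<exists>N. \<forall>m\<ge>N. \<forall>n\<ge>N. hnorm K (\<pi> (r m) x \<ominus>\<^bsub>K\<^esub> \<pi> (r n) x) < e" by blast
  qed
  then obtain Q0 where Q0: "\<And>x. x \<in> carrier K \<Longrightarrow> tends (\<lambda>n. \<pi> (r n) x) (Q0 x)" by metis
  define Q where "Q = restrict Q0 (carrier K)"
  have Q: "tends (\<lambda>n. \<pi> (r n) x) (Q x)" if "x \<in> carrier K" for x using Q0 that by (simp add: Q_def)
  have QB: "Q \<in> carrier (bounded_ops K)"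
  proof (rule bounded_opsI)
    show "Q \<in> extensional (carrier K)" by (simp add: Q_def)
    fix x assume x: "x \<in> carrier K"
    show "Q x \<in> carrier K" using Q[OF x] by (simp add: tends_def)
    show "hnorm K (Q x) \<le> 1 * hnorm K x"
      using tends_hnorm_le[OF Q[OF x], of "hnorm K x"] proj(4)[OF rproj x x] by simp
    show "Q (c \<odot>\<^bsub>K\<^esub> x) = c \<odot>\<^bsub>K\<^esub> Q x" for c
      using tends_unique[OF Q[of "c \<odot>\<^bsub>K\<^esub> x"]] tends_smult[OF Q[OF x], of c] x B(4)[OF rc x] by simp
    fix y assume y: "y \<in> carrier K"
    show "Q (x \<oplus>\<^bsub>K\<^esub> y) = Q x \<oplus>\<^bsub>K\<^esub> Q y"
      using tends_unique[OF Q[of "x \<oplus>\<^bsub>K\<^esub> y"]] tends_add[OF Q[OF x] Q[OF y]] x y B(3)[OF rc x y] by simp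
  qed
  obtain C where C: "closedin (product_topology (\<lambda>_. euclidean :: complex topology) (carrier K \<times> carrier K)) C"
      "\<pi> ` carrier A = matrix_coefs -` C \<inter> carrier (bounded_ops K)"
    using vn unfolding von_neumann_on_def closedin_wot by blast
  \<comment> \<open>Vectorwise convergence gives convergence of all matrix coefficients, so Q
    remains in the closed set C.\<close>
  have "limitin (product_topology (\<lambda>_. euclidean) (carrier K \<times> carrier K)) (\<lambda>n. matrix_coefs (\<pi> (r n))) (matrix_coefs Q) sequentially"
    unfolding limitin_componentwise using tends_ip[OF Q] by (auto simp: PiE_def)
  moreover have "matrix_coefs (\<pi> (r n)) \<in> C" for n using C(2) rc[of n] by blast
  ultimately have "matrix_coefs Q \<in> C" by (intro limitin_closedin[OF _ C(1)]) auto
  then have "Q \<in> \<pi> ` carrier A" unfolding C(2) using QB by (intro IntI vimageI2)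
  then obtain q where q: "q \<in> carrier A" "\<pi> q = Q" by (metis imageE)
  have eq: "s = t" if "s \<in> carrier A" "t \<in> carrier A" "\<And>x. x \<in> carrier K \<Longrightarrow> \<pi> s x = \<pi> t x" for s t
    using inj_onD[OF inj operator_eqI[OF \<pi>(1) \<pi>(1)]] that by simp
  have mult: "\<pi> (s \<otimes>\<^bsub>A\<^esub> t) x = \<pi> s (\<pi> t x)" if "s \<in> carrier A" "t \<in> carrier A" "x \<in> carrier K" for s t x
    using that by (simp add: \<pi>(3) bounded_ops_simps)
  have "p j \<otimes>\<^bsub>A\<^esub> q = p j" for j
  proof (rule eq)
    fix x assume x: "x \<in> carrier K"
    have "tends (\<lambda>n. \<pi> (p j) (\<pi> (r n) x)) (\<pi> (p j) (Q x))"
      by (rule tends_linear[OF Q[OF x] \<pi>(1)[OF pc(1)]])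
    \<comment> \<open>From index \<open>Suc j\<close> on the partial sums contain
      \<open>p j\<close>, so the sequence becomes constant.\<close>
    then have "tends (\<lambda>n. \<pi> (p j) (\<pi> (r (n + Suc j)) x)) (\<pi> (p j) (Q x))"
      unfolding tends_def using LIMSEQ_ignore_initial_segment by blast
    moreover have "\<pi> (p j) (\<pi> (r (n + Suc j)) x) = \<pi> (p j) x" for n
      using rp[of "n + Suc j" j] mult[OF pc(1) rc x, of j "n + Suc j"] by simp
    ultimately have "tends (\<lambda>n. \<pi> (p j) x) (\<pi> (p j) (Q x))" by simp
    then have "\<pi> (p j) (Q x) = \<pi> (p j) x"
      by (rule tends_unique[OF _ tends_const[OF B(2)[OF pc(1) x]]])
    then show "\<pi> (p j \<otimes>\<^bsub>A\<^esub> q) x = \<pi> (p j) x" using mult[OF pc(1) q(1) x] q(2) by simp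
  qed (simp_all add: pc(1) q(1))
  moreover have "e \<otimes>\<^bsub>A\<^esub> q = \<zero>\<^bsub>A\<^esub>" if e: "e \<in> carrier A" "\<forall>j. e \<otimes>\<^bsub>A\<^esub> p j = \<zero>\<^bsub>A\<^esub>" for e
  proof (rule eq)
    fix x assume x: "x \<in> carrier K"
    have zero: "\<pi> \<zero>\<^bsub>A\<^esub> x = \<zero>\<^bsub>K\<^esub>" by (rule star_representation_zero[OF A rep x])
    have er: "e \<otimes>\<^bsub>A\<^esub> r n = \<zero>\<^bsub>A\<^esub>" for n
      by (induction n) (simp_all add: r0 rS A.r_distr e rc pc(1))
    have er0: "\<pi> e (\<pi> (r n) x) = \<zero>\<^bsub>K\<^esub>" for n
      using mult[OF e(1) rc x, of n] er[of n] zero by simp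
    have "tends (\<lambda>n. \<zero>\<^bsub>K\<^esub>) (\<pi> e (Q x))"
      using tends_linear[OF Q[OF x] \<pi>(1)[OF e(1)]] by (simp only: er0)
    then have "\<pi> e (Q x) = \<zero>\<^bsub>K\<^esub>" by (rule tends_unique[OF _ tends_const[OF M.zero_closed]])
    then show "\<pi> (e \<otimes>\<^bsub>A\<^esub> q) x = \<pi> \<zero>\<^bsub>A\<^esub> x" using mult[OF e(1) q(1) x] q(2) zero by simp
  qed (simp_all add: e(1) q(1))
  ultimately show ?thesis by (intro bexI[OF _ q(1)] conjI allI ballI impI)
qed

section \<open>Internal normed spaces and their hulls\<close>

text \<open>C*-algebras and Hilbert spaces share the linear part of the hull construction. Reading
  both through the operations on objects allows this part to be done once; \<open>normed_obj\<close>
  collects what it uses.\<close>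

definition vmod :: "('a, 'h, 'w) obj \<Rightarrow> (complex, ('a, 'h, 'w) obj) module" where
  "vmod Z = \<lparr> carrier = {x. [Z, x] \<in> obj_mem}, mult = undefined, one = undefined,
     zero = obj_zero [Z], add = (\<lambda>x y. obj_add [Z, x, y]), smult = (\<lambda>c x. obj_smult [Z, Cplx c, x]) \<rparr>"

text \<open>The default 0 does not occur at members of algebras and Hilbert spaces, whose norm is
  always a \<open>Real\<close>.\<close>

definition onorm :: "('a, 'h, 'w) obj \<Rightarrow> ('a, 'h, 'w) obj \<Rightarrow> real" where
  "onorm Z x = (case obj_norm [Z, x] of Real r \<Rightarrow> r | _ \<Rightarrow> 0)"

lemma vmod_simps [simp]:
  "x \<in> carrier (vmod Z) \<longleftrightarrow> [Z, x] \<in> obj_mem" "\<zero>\<^bsub>vmod Z\<^esub> = obj_zero [Z]"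
  "x \<oplus>\<^bsub>vmod Z\<^esub> y = obj_add [Z, x, y]" "c \<odot>\<^bsub>vmod Z\<^esub> x = obj_smult [Z, Cplx c, x]"
  by (simp_all add: vmod_def)

locale normed_obj = cmodule "vmod Z" for Z :: "('a, 'h, 'w) obj" +
  assumes norm_Real: "\<And>x. [Z, x] \<in> obj_mem \<Longrightarrow> obj_norm [Z, x] = Real (onorm Z x)"
    and minus: "\<And>x y. [Z, x] \<in> obj_mem \<Longrightarrow> [Z, y] \<in> obj_mem \<Longrightarrow> obj_minus [Z, x, y] = x \<ominus>\<^bsub>vmod Z\<^esub> y"
    and onorm_nonneg: "\<And>x. [Z, x] \<in> obj_mem \<Longrightarrow> 0 \<le> onorm Z x"
    and onorm_smult: "\<And>c x. [Z, x] \<in> obj_mem \<Longrightarrow> onorm Z (obj_smult [Z, Cplx c, x]) = cmod c * onorm Z x"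
    and onorm_add: "\<And>x y. [Z, x] \<in> obj_mem \<Longrightarrow> [Z, y] \<in> obj_mem \<Longrightarrow>
      onorm Z (obj_add [Z, x, y]) \<le> onorm Z x + onorm Z y"

lemma obj_Alg_simps [simp]:
  "[Alg A, x] \<in> obj_mem \<longleftrightarrow> (\<exists>a\<in>carrier A. x = Elem a)"
  "obj_zero [Alg A] = Elem \<zero>\<^bsub>A\<^esub>" "obj_one [Alg A] = Elem \<one>\<^bsub>A\<^esub>"
  "obj_add [Alg A, Elem a, Elem b] = Elem (a \<oplus>\<^bsub>A\<^esub> b)"
  "obj_minus [Alg A, Elem a, Elem b] = Elem (a \<ominus>\<^bsub>A\<^esub> b)"
  "obj_smult [Alg A, Cplx c, Elem a] = Elem (c \<odot>\<^bsub>A\<^esub> a)"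
  "obj_mult [Alg A, Elem a, Elem b] = Elem (a \<otimes>\<^bsub>A\<^esub> b)"
  "obj_adj [Alg A, Elem a] = Elem (adj A a)" "obj_norm [Alg A, Elem a] = Real (nrm A a)"
  "onorm (Alg A) (Elem a) = nrm A a"
  by (auto simp: obj_mem_def obj_zero_def obj_one_def obj_add_def obj_minus_def obj_smult_def
      obj_mult_def obj_adj_def obj_norm_def onorm_def)

lemma obj_Hilb_simps [simp]:
  "[Hilb K, x] \<in> obj_mem \<longleftrightarrow> (\<exists>v\<in>carrier K. x = Vec v)"
  "obj_zero [Hilb K] = Vec \<zero>\<^bsub>K\<^esub>"
  "obj_add [Hilb K, Vec v, Vec w] = Vec (v \<oplus>\<^bsub>K\<^esub> w)"
  "obj_minus [Hilb K, Vec v, Vec w] = Vec (v \<ominus>\<^bsub>K\<^esub> w)"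
  "obj_smult [Hilb K, Cplx c, Vec v] = Vec (c \<odot>\<^bsub>K\<^esub> v)"
  "obj_ip [Hilb K, Vec v, Vec w] = Cplx (ip K v w)" "obj_norm [Hilb K, Vec v] = Real (hnorm K v)"
  "obj_act [Act \<pi>, Elem a, Vec v] = Vec (\<pi> a v)"
  "onorm (Hilb K) (Vec v) = hnorm K v"
  by (auto simp: obj_mem_def obj_zero_def obj_add_def obj_minus_def obj_smult_def
      obj_ip_def obj_act_def obj_norm_def onorm_def)

lemma (in pre_cstar) normed_obj_Alg: "normed_obj (Alg A :: ('a, 'h, 'w) obj)"
proof -
  let ?Z = "Alg A :: ('a, 'h, 'w) obj"
  have "Module.module CC (vmod ?Z)"
  proof (intro moduleI cring_CC abelian_groupI)
    fix x assume "x \<in> carrier (vmod ?Z)"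
    then obtain a where a: "a \<in> carrier A" "x = Elem a" by auto
    then show "\<exists>y\<in>carrier (vmod ?Z). y \<oplus>\<^bsub>vmod ?Z\<^esub> x = \<zero>\<^bsub>vmod ?Z\<^esub>"
      by (intro bexI[of _ "Elem (\<ominus> a)"]) (auto simp: l_neg)
  qed (auto simp: a_ac smult_add_left smult_add_right)
  then interpret Z: cmodule "vmod ?Z" by (simp add: cmodule_def)
  show ?thesis
  proof unfold_locales
    fix x y assume "[?Z, x] \<in> obj_mem" "[?Z, y] \<in> obj_mem"
    then show "obj_minus [?Z, x, y] = x \<ominus>\<^bsub>vmod ?Z\<^esub> y"
      by (auto simp: Z.minus_eq_smult minus_eq_smult)
  qed (auto simp: nrm_smult intro: nrm_add)
qed

lemma (in pre_hilbert) normed_obj_Hilb: "normed_obj (Hilb K :: ('a, 'h, 'w) obj)"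
proof -
  let ?Z = "Hilb K :: ('a, 'h, 'w) obj"
  have "Module.module CC (vmod ?Z)"
  proof (intro moduleI cring_CC abelian_groupI)
    fix x assume "x \<in> carrier (vmod ?Z)"
    then obtain a where a: "a \<in> carrier K" "x = Vec a" by auto
    then show "\<exists>y\<in>carrier (vmod ?Z). y \<oplus>\<^bsub>vmod ?Z\<^esub> x = \<zero>\<^bsub>vmod ?Z\<^esub>"
      by (intro bexI[of _ "Vec (\<ominus> a)"]) (auto simp: M.l_neg)
  qed (auto simp: M.a_ac smult_add_left smult_add_right)
  then interpret Z: cmodule "vmod ?Z" by (simp add: cmodule_def)
  show ?thesis
  proof unfold_locales
    fix x y assume "[?Z, x] \<in> obj_mem" "[?Z, y] \<in> obj_mem"
    then show "obj_minus [?Z, x, y] = x \<ominus>\<^bsub>vmod ?Z\<^esub> y"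
      by (auto simp: Z.minus_eq_smult minus_eq_smult)
  qed (auto simp: hnorm_smult intro: hnorm_add)
qed

section \<open>Representing nonstandard tuples by functions\<close>

context ns_transfer begin

text \<open>The coordinate functions represent \<open>ys\<close> but satisfy R only eventually.
  Where they fail they are replaced by a fixed tuple d of R, which exists because the filter is
  proper. Afterwards R holds at every index, and theorems about standard structures apply index by
  index.\<close>

lemma present:
  assumes "ys \<in> ext U R"
  shows "\<exists>fs. ys = map (val ys) fs \<and> (\<forall>us. map (\<lambda>f. f us) fs \<in> R)"
proof -
  have ev: "eventually (\<lambda>us. us \<in> R \<and> length us = length ys) (dir ys)"
    using assms eventually_dir_length[of ys] by (auto simp: ext_iff_eventually intro: eventually_conj)
  then obtain d where d: "d \<in> R" "length d = length ys"
    using eventually_happens'[OF dir_neq_bot] by blast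
  define good where "good us \<longleftrightarrow> us \<in> R \<and> length us = length ys" for us
  define fs where "fs = map (\<lambda>i us. if good us then us ! i else d ! i) [0..<length ys]"
  have "val ys (\<lambda>us. if good us then us ! i else d ! i) = ys ! i" if i: "i < length ys" for i
  proof -
    have "val ys (\<lambda>us. if good us then us ! i else d ! i) = val ys (\<lambda>us. us ! i)"
      unfolding val_eq_iff using ev by eventually_elim (simp add: good_def)
    then show ?thesis using val_nth[OF i] by simp
  qed
  then have "ys = map (val ys) fs" by (intro nth_equalityI) (auto simp: fs_def)
  moreover have "map (\<lambda>f. f us) fs \<in> R" for us
  proof (cases "good us")
    case True
    then have "map (\<lambda>f. f us) fs = us" by (intro nth_equalityI) (auto simp: fs_def good_def)
    then show ?thesis using True by (simp add: good_def)
  next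
    case False
    then have "map (\<lambda>f. f us) fs = d" using d(2) by (intro nth_equalityI) (auto simp: fs_def)
    then show ?thesis using d by simp
  qed
  ultimately show ?thesis by blast
qed

text \<open>\<open>js\<close> lists the positions in \<open>bs\<close> of the objects to which the \<open>ys\<close> are related.\<close>

lemma present_over:
  assumes bs: "bs \<in> ext U R" and len: "length js = length ys" "length Rs = length ys"
    and js: "\<And>i. i < length ys \<Longrightarrow> js ! i < length bs"
    and mem: "\<And>i. i < length ys \<Longrightarrow> [bs ! (js ! i), ys ! i] \<in> ext U (Rs ! i)"
  shows "\<exists>xs fs gs. bs = map (val xs) fs \<and> ys = map (val xs) gs \<and>
    length fs = length bs \<and> length gs = length ys \<and>
    (\<forall>us. map (\<lambda>f. f us) fs \<in> R) \<and>
    (\<forall>us. \<forall>i<length ys. [(fs ! (js ! i)) us, (gs ! i) us] \<in> Rs ! i)"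
proof -
  let ?n = "length bs" and ?m = "length ys" and ?xs = "bs @ ys"
  \<comment> \<open>All required relations are gathered into one relation on the joined tuple, so
    that a single use of \<open>present\<close> makes them hold simultaneously and
    everywhere.\<close>
  let ?R = "{us. take ?n us \<in> R \<and> length us = ?n + ?m \<and> (\<forall>i<?m. [us ! (js ! i), us ! (?n + i)] \<in> Rs ! i)}"
  have 1: "eventually (\<lambda>us. map ((!) us) [0..<?n] \<in> R) (dir ?xs)"
  proof -
    have "map ((!) ?xs) [0..<?n] = bs" by (rule nth_equalityI) (auto simp: nth_append)
    then show ?thesis using bs by (subst eventually_dir_proj) auto
  qed
  have 2: "eventually (\<lambda>us. [us ! (js ! i), us ! (?n + i)] \<in> Rs ! i) (dir ?xs)" if i: "i < ?m" for i
  proof -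
    have "eventually (\<lambda>us. map ((!) us) [js ! i, ?n + i] \<in> Rs ! i) (dir ?xs)"
      using mem[OF i] js[OF i] i by (subst eventually_dir_proj) (auto simp: nth_append)
    then show ?thesis by simp
  qed
  have "eventually (\<lambda>us. \<forall>i\<in>{..<?m}. [us ! (js ! i), us ! (?n + i)] \<in> Rs ! i) (dir ?xs)"
    by (rule eventually_ball_finite) (use 2 in auto)
  then have "eventually (\<lambda>us. us \<in> ?R) (dir ?xs)"
    using 1 eventually_dir_length[of ?xs]
  proof eventually_elim
    case (elim us)
    have "map ((!) us) [0..<?n] = take ?n us" using elim(3) by (intro nth_equalityI) auto
    then show ?case using elim by simp
  qed
  then have "?xs \<in> ext U ?R" by (simp add: ext_iff_eventually)
  from present[OF this] obtain hs where hs: "?xs = map (val ?xs) hs" and R: "\<And>us. map (\<lambda>f. f us) hs \<in> ?R"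
    by blast
  have lh: "length hs = ?n + ?m" using arg_cong[OF hs, of length] by simp
  have "bs = map (val ?xs) (take ?n hs)" "ys = map (val ?xs) (drop ?n hs)"
    using arg_cong[OF hs, of "take ?n"] arg_cong[OF hs, of "drop ?n"] by (simp_all only: take_map drop_map append_eq_conv_conj[THEN iffD1, OF refl, THEN conjunct1, symmetric]) simp_all
  moreover have "map (\<lambda>f. f us) (take ?n hs) \<in> R" for us using R[of us] by (simp add: take_map)
  moreover have "[(take ?n hs ! (js ! i)) us, (drop ?n hs ! i) us] \<in> Rs ! i" if i: "i < ?m" for us i
  proof -
    have "js ! i < ?n" using js[OF i] .
    then have "map (\<lambda>f. f us) hs ! (js ! i) = (take ?n hs ! (js ! i)) us"
      "map (\<lambda>f. f us) hs ! (?n + i) = (drop ?n hs ! i) us" using lh i by auto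
    then show ?thesis using R[of us] i by (metis (mono_tags, lifting) mem_Collect_eq)
  qed
  ultimately show ?thesis using lh by (intro exI[of _ ?xs] exI[of _ "take ?n hs"] exI[of _ "drop ?n hs"]) auto
qed

end

locale ns_objects = ns_saturated U for U :: "(('a, 'h, 'w) obj, 's) ns_universe"
begin

lemma val_args:
  "ext_fun U F [val xs f] = val xs (\<lambda>us. F [f us])"
  "ext_fun U F [val xs f, val xs g] = val xs (\<lambda>us. F [f us, g us])"
  "ext_fun U F [val xs f, val xs g, val xs k] = val xs (\<lambda>us. F [f us, g us, k us])"
  "ext_fun U F [val xs f, std U c, val xs k] = val xs (\<lambda>us. F [f us, c, k us])"
  using val_comp[of F xs "[f]"] val_comp[of F xs "[f, g]"] val_comp[of F xs "[f, g, k]"]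
    val_comp[of F xs "[f, \<lambda>_. c, k]"] by (simp_all add: val_const)

lemma tendsto_iff_inverse:
  "(r \<longlongrightarrow> l) F \<longleftrightarrow> (\<forall>n::nat. n \<ge> 1 \<longrightarrow> eventually (\<lambda>u. dist (r u) l < 1 / real n) F)"
proof
  assume R: "\<forall>n::nat. n \<ge> 1 \<longrightarrow> eventually (\<lambda>u. dist (r u) l < 1 / real n) F"
  show "(r \<longlongrightarrow> l) F"
  proof (rule tendstoI)
    fix e :: real assume "e > 0"
    then obtain n where n: "inverse (of_nat (Suc n)) < e" using reals_Archimedean by blast
    have "eventually (\<lambda>u. dist (r u) l < 1 / real (Suc n)) F" using R[rule_format, of "Suc n"] by (simp del: of_nat_Suc)
    then show "eventually (\<lambda>u. dist (r u) l < e) F"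
      by eventually_elim (use n in \<open>simp add: inverse_eq_divide\<close>)
  qed
qed (auto intro: tendstoD)

text \<open>Infinite closeness to a standard number is convergence along the ultrafilter of the
  tuple, since both ask for the bounds 1/n with standard n only.\<close>

lemma approx_val: "approx U (val xs (\<lambda>us. Real (r us))) (std U (Real t)) \<longleftrightarrow> (r \<longlongrightarrow> t) (dir xs)"
proof -
  have "[val xs (\<lambda>us. Real (r us)), std U (Real t)] \<in> ext U {[Real a, Real b] | a b. \<bar>a - b\<bar> < 1 / real n} \<longleftrightarrow>
      eventually (\<lambda>u. dist (r u) t < 1 / real n) (dir xs)" for n
    using ext_map_val[of xs "[\<lambda>us. Real (r us), \<lambda>_. Real t]" "{[Real a, Real b] | a b. \<bar>a - b\<bar> < 1 / real n}"]
    by (simp add: val_const dist_real_def)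
  then show ?thesis unfolding approx_def tendsto_iff_inverse by simp
qed

lemma approx_cplx_val:
  "approx_cplx U (val xs (\<lambda>us. Cplx (r us))) (std U (Cplx t)) \<longleftrightarrow> (r \<longlongrightarrow> t) (dir xs)"
proof -
  have "[val xs (\<lambda>us. Cplx (r us)), std U (Cplx t)] \<in> ext U {[Cplx a, Cplx b] | a b. cmod (a - b) < 1 / real n} \<longleftrightarrow>
      eventually (\<lambda>u. dist (r u) t < 1 / real n) (dir xs)" for n
    using ext_map_val[of xs "[\<lambda>us. Cplx (r us), \<lambda>_. Cplx t]" "{[Cplx a, Cplx b] | a b. cmod (a - b) < 1 / real n}"]
    by (simp add: val_const dist_norm)
  then show ?thesis unfolding approx_cplx_def tendsto_iff_inverse by simp
qed

lemma std_part_val: "(r \<longlongrightarrow> t) (dir xs) \<Longrightarrow> std_part U (val xs (\<lambda>us. Real (r us))) = t"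
  unfolding std_part_def approx_val by (rule the_equality) (auto intro: tendsto_unique[OF dir_neq_bot])

lemma std_part_cplx_val: "(r \<longlongrightarrow> t) (dir xs) \<Longrightarrow> std_part_cplx U (val xs (\<lambda>us. Cplx (r us))) = t"
  unfolding std_part_cplx_def approx_cplx_val by (rule the_equality) (auto intro: tendsto_unique[OF dir_neq_bot])

lemma finite_hyperreal_val:
  "finite_hyperreal U (val xs (\<lambda>us. Real (r us))) \<longleftrightarrow> (\<exists>n::nat. eventually (\<lambda>us. \<bar>r us\<bar> < real n) (dir xs))"
  using ext_map_val[of xs "[\<lambda>us. Real (r us)]"] by (simp add: finite_hyperreal_def)

lemma members_val: "val xs f \<in> members U (val xs Z) \<longleftrightarrow> eventually (\<lambda>us. [Z us, f us] \<in> obj_mem) (dir xs)"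
  using ext_map_val[of xs "[Z, f]"] by (simp add: members_def)

abbreviation hcl :: "'s list \<Rightarrow> (('a, 'h, 'w) obj list \<Rightarrow> ('a, 'h, 'w) obj) \<Rightarrow> (('a, 'h, 'w) obj list \<Rightarrow> ('a, 'h, 'w) obj) \<Rightarrow> 's set" where
  "hcl xs Z f \<equiv> halo U (val xs Z) (val xs f)"

lemma halo_val:
  assumes "\<And>us. normed_obj (Z us)" "\<And>us. [Z us, f us] \<in> obj_mem" "\<And>us. [Z us, g us] \<in> obj_mem"
  shows "val xs g \<in> hcl xs Z f \<longleftrightarrow> ((\<lambda>us. onorm (Z us) (obj_minus [Z us, g us, f us])) \<longlongrightarrow> 0) (dir xs)"
proof -
  have "obj_norm [Z us, obj_minus [Z us, g us, f us]] = Real (onorm (Z us) (obj_minus [Z us, g us, f us]))" for us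
  proof -
    interpret normed_obj "Z us" by (rule assms)
    have "g us \<ominus>\<^bsub>vmod (Z us)\<^esub> f us \<in> carrier (vmod (Z us))" using assms by (intro M.minus_closed) auto
    then show ?thesis using assms minus by (intro norm_Real) auto
  qed
  then show ?thesis unfolding halo_def using assms
    by (simp add: val_args members_val approx_val)
qed

text \<open>The bound is one standard constant for all indices, as for the bounded families in an
  ultraproduct of Banach spaces. Finite elements have such representatives by
  \<open>Fin_bound\<close> and \<open>present_over\<close>.\<close>

definition sec where
  "sec Z f \<longleftrightarrow> (\<forall>us. [Z us, f us] \<in> obj_mem) \<and> (\<exists>C. \<forall>us. onorm (Z us) (f us) \<le> C)"

text \<open>A finite norm lies below a standard number, and this bound is a relation that
  \<open>present_over\<close> can make hold at every index.\<close>

lemma Fin_bound: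
  assumes Z0: "[Z0] \<in> ext U {[Z] | Z. normed_obj Z}" and x: "x \<in> Fin U Z0"
  shows "\<exists>C. [Z0, x] \<in> ext U {[Z, x] | Z x. [Z, x] \<in> obj_mem \<and> onorm Z x \<le> C}"
proof -
  let ?Q = "\<lambda>xs fs gs. [Z0] = map (val xs) fs \<and> [x] = map (val xs) gs \<and>
    length fs = length [Z0] \<and> length gs = length [x] \<and>
    (\<forall>us. map (\<lambda>f. f us) fs \<in> {[Z] | Z. normed_obj Z}) \<and>
    (\<forall>us. \<forall>i<length [x]. [(fs ! ([0] ! i)) us, (gs ! i) us] \<in> [obj_mem] ! i)"
  have "\<exists>xs fs gs. ?Q xs fs gs"
    by (rule present_over) (use Z0 x in \<open>auto simp: Fin_def members_def\<close>)
  then obtain xs fs gs where Q: "?Q xs fs gs" by (elim exE) (rule that)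
  note q = conjunct1[OF Q] conjunct1[OF conjunct2[OF Q]] conjunct1[OF conjunct2[OF conjunct2[OF Q]]]
    conjunct1[OF conjunct2[OF conjunct2[OF conjunct2[OF Q]]]]
    conjunct1[OF conjunct2[OF conjunct2[OF conjunct2[OF conjunct2[OF Q]]]]]
    conjunct2[OF conjunct2[OF conjunct2[OF conjunct2[OF conjunct2[OF Q]]]]]
  note * = q(1,2)
  have l: "length fs = 1" "length gs = 1" using q(3,4) by simp_all
  have **: "map (\<lambda>f. f us) fs \<in> {[Z] | Z. normed_obj Z}" "[(fs ! 0) us, (gs ! 0) us] \<in> obj_mem" for us
    using q(5,6) by simp_all
  obtain Z f where Z: "fs = [Z]" and f: "gs = [f]" using l by (auto simp: length_Suc_conv)
  have N: "normed_obj (Z us)" and m: "[Z us, f us] \<in> obj_mem" for us using **(1,2)[of us] by (auto simp: Z f)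
  have nr: "obj_norm [Z us, f us] = Real (onorm (Z us) (f us))" for us using normed_obj.norm_Real[OF N m] .
  have "finite_hyperreal U (ext_fun U obj_norm [val xs Z, val xs f])"
    using x *(1,2) by (simp add: Fin_def Z f)
  then obtain n :: nat where "eventually (\<lambda>us. \<bar>onorm (Z us) (f us)\<bar> < real n) (dir xs)"
    by (auto simp: val_args nr finite_hyperreal_val)
  then have "eventually (\<lambda>us. map (\<lambda>f. f us) [Z, f] \<in> {[Z, x] | Z x. [Z, x] \<in> obj_mem \<and> onorm Z x \<le> real n}) (dir xs)"
    by eventually_elim (use m in auto)
  then have "map (val xs) [Z, f] \<in> ext U {[Z, x] | Z x. [Z, x] \<in> obj_mem \<and> onorm Z x \<le> real n}"
    by (simp only: ext_map_val)
  then show ?thesis using *(1,2) by (auto simp: Z f)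
qed

text \<open>Classes from the hulls of several objects are represented over one tuple;
  \<open>js\<close> tells to which object of \<open>bs\<close> a class belongs.\<close>

lemma present_sections:
  assumes bs: "bs \<in> ext U R" and len: "length js = length Ss"
    and js: "\<And>i. i < length Ss \<Longrightarrow> js ! i < length bs \<and> [bs ! (js ! i)] \<in> ext U {[Z] | Z. normed_obj Z}"
    and S: "\<And>i. i < length Ss \<Longrightarrow> Ss ! i \<in> hull_carrier U (bs ! (js ! i))"
  shows "\<exists>xs fs gs. bs = map (val xs) fs \<and> length fs = length bs \<and> length gs = length Ss \<and>
    (\<forall>us. map (\<lambda>f. f us) fs \<in> R) \<and>
    (\<forall>i<length Ss. Ss ! i = hcl xs (fs ! (js ! i)) (gs ! i) \<and> sec (fs ! (js ! i)) (gs ! i))"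
proof -
  let ?B = "\<lambda>C. {[Z, x] | Z x. [Z, x] \<in> obj_mem \<and> onorm Z x \<le> (C :: real)}"
  have "\<exists>p. i < length Ss \<longrightarrow> Ss ! i = halo U (bs ! (js ! i)) (fst p) \<and> [bs ! (js ! i), fst p] \<in> ext U (?B (snd p))" for i
  proof (cases "i < length Ss")
    case True
    obtain x where x: "x \<in> Fin U (bs ! (js ! i))" "Ss ! i = halo U (bs ! (js ! i)) x"
      using S[OF True] unfolding hull_carrier_def by (rule imageE)
    obtain C where "[bs ! (js ! i), x] \<in> ext U (?B C)"
      using Fin_bound[OF conjunct2[OF js[OF True]] x(1)] ..
    then show ?thesis using x(2) by (intro exI[of _ "(x, C)"]) simp
  qed simp
  then have "\<forall>i. \<exists>p. i < length Ss \<longrightarrow> Ss ! i = halo U (bs ! (js ! i)) (fst p) \<and> [bs ! (js ! i), fst p] \<in> ext U (?B (snd p))"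
    by (rule allI)
  from choice[OF this] obtain p where p: "\<forall>i. i < length Ss \<longrightarrow> Ss ! i = halo U (bs ! (js ! i)) (fst (p i)) \<and>
    [bs ! (js ! i), fst (p i)] \<in> ext U (?B (snd (p i)))" ..
  define x C where "x i = fst (p i)" and "C i = snd (p i)" for i
  have xC: "Ss ! i = halo U (bs ! (js ! i)) (x i)" "[bs ! (js ! i), x i] \<in> ext U (?B (C i))" if "i < length Ss" for i
    using p[rule_format, OF that] by (simp_all only: x_def C_def)
  let ?ys = "map x [0..<length Ss]"
  let ?Q = "\<lambda>xs fs gs. bs = map (val xs) fs \<and> ?ys = map (val xs) gs \<and>
    length fs = length bs \<and> length gs = length ?ys \<and> (\<forall>us. map (\<lambda>f. f us) fs \<in> R) \<and>
    (\<forall>us. \<forall>i<length ?ys. [(fs ! (js ! i)) us, (gs ! i) us] \<in> map (\<lambda>i. ?B (C i)) [0..<length Ss] ! i)"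
  have "\<exists>xs fs gs. ?Q xs fs gs"
    by (rule present_over[OF bs]) (use len js xC in auto)
  then obtain xs fs gs where Q: "?Q xs fs gs" by (elim exE) (rule that)
  note q = conjunct1[OF Q] conjunct1[OF conjunct2[OF Q]] conjunct1[OF conjunct2[OF conjunct2[OF Q]]]
    conjunct1[OF conjunct2[OF conjunct2[OF conjunct2[OF Q]]]]
    conjunct1[OF conjunct2[OF conjunct2[OF conjunct2[OF conjunct2[OF Q]]]]]
    conjunct2[OF conjunct2[OF conjunct2[OF conjunct2[OF conjunct2[OF Q]]]]]
  have l: "length gs = length Ss" using q(4) by simp
  have **: "[(fs ! (js ! i)) us, (gs ! i) us] \<in> ?B (C i)" if "i < length Ss" for us i
    using q(6) that by simp
  have "Ss ! i = hcl xs (fs ! (js ! i)) (gs ! i) \<and> sec (fs ! (js ! i)) (gs ! i)" if i: "i < length Ss" for i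
  proof
    have "x i = val xs (gs ! i)" using arg_cong[OF q(2), of "\<lambda>l. l ! i"] i l by simp
    moreover have "bs ! (js ! i) = val xs (fs ! (js ! i))"
      using arg_cong[OF q(1), of "\<lambda>l. l ! (js ! i)"] q(3) js[OF i] by simp
    ultimately show "Ss ! i = hcl xs (fs ! (js ! i)) (gs ! i)" using xC(1)[OF i] by simp
    show "sec (fs ! (js ! i)) (gs ! i)" unfolding sec_def using **[OF i] by auto
  qed
  then show ?thesis using q(1,3,5) l by (intro exI[of _ xs] exI[of _ fs] exI[of _ gs] conjI) blast+
qed

end

section \<open>Halos and the linear structure of the hull\<close>

locale hull_space = ns_objects U for U :: "(('a, 'h, 'w) obj, 's) ns_universe" +
  fixes Z0 :: 's
  assumes Z0: "[Z0] \<in> ext U {[Z] | Z. normed_obj Z}"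
begin

lemma present_members:
  assumes "set ys \<subseteq> members U Z0"
  shows "\<exists>xs Z gs. Z0 = val xs Z \<and> ys = map (val xs) gs \<and> (\<forall>us. normed_obj (Z us)) \<and>
    (\<forall>g\<in>set gs. \<forall>us. [Z us, g us] \<in> obj_mem)"
proof -
  let ?Q = "\<lambda>xs fs gs. [Z0] = map (val xs) fs \<and> ys = map (val xs) gs \<and>
    length fs = length [Z0] \<and> length gs = length ys \<and>
    (\<forall>us. map (\<lambda>f. f us) fs \<in> {[Z] | Z. normed_obj Z}) \<and>
    (\<forall>us. \<forall>i<length ys. [(fs ! (replicate (length ys) 0 ! i)) us, (gs ! i) us] \<in> replicate (length ys) obj_mem ! i)"
  have "\<exists>xs fs gs. ?Q xs fs gs"
    by (rule present_over[OF Z0]) (use assms in \<open>auto simp: members_def subset_iff\<close>)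
  then obtain xs fs gs where Q: "?Q xs fs gs" by (elim exE) (rule that)
  note q = conjunct1[OF Q] conjunct1[OF conjunct2[OF Q]] conjunct1[OF conjunct2[OF conjunct2[OF Q]]]
    conjunct1[OF conjunct2[OF conjunct2[OF conjunct2[OF Q]]]]
    conjunct1[OF conjunct2[OF conjunct2[OF conjunct2[OF conjunct2[OF Q]]]]]
    conjunct2[OF conjunct2[OF conjunct2[OF conjunct2[OF conjunct2[OF Q]]]]]
  have mem: "[(fs ! 0) us, (gs ! i) us] \<in> obj_mem" if "i < length ys" for us i using q(6) that by simp
  have "length fs = 1" using q(3) by simp
  then obtain Z where Z: "fs = [Z]" by (auto simp: length_Suc_conv)
  have "\<forall>g\<in>set gs. \<forall>us. [Z us, g us] \<in> obj_mem"
    using q(4) mem by (simp add: Z all_set_conv_all_nth)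
  moreover have "normed_obj (Z us)" for us using q(5) by (simp add: Z)
  moreover have "Z0 = val xs Z" using q(1) by (simp add: Z)
  ultimately show ?thesis using q(2) by (intro exI[of _ xs] exI[of _ Z] exI[of _ gs] conjI) blast+
qed

lemma present2:
  assumes "x \<in> members U Z0" "y \<in> members U Z0"
  obtains xs Z f g where "Z0 = val xs Z" "x = val xs f" "y = val xs g" "\<And>us. normed_obj (Z us)"
    "\<And>us. [Z us, f us] \<in> obj_mem" "\<And>us. [Z us, g us] \<in> obj_mem"
proof -
  have "set [x, y] \<subseteq> members U Z0" using assms by simp
  from present_members[OF this] obtain xs Z gs where *: "Z0 = val xs Z" "[x, y] = map (val xs) gs"
    "\<forall>us. normed_obj (Z us)" "\<forall>g\<in>set gs. \<forall>us. [Z us, g us] \<in> obj_mem" by (elim exE conjE) (rule that)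
  from *(2) obtain f g where "gs = [f, g]" "x = val xs f" "y = val xs g" by (auto simp: Cons_eq_map_conv)
  then show ?thesis using * by (intro that) auto
qed

lemma present4:
  assumes "x \<in> members U Z0" "y \<in> members U Z0" "z \<in> members U Z0" "w \<in> members U Z0"
  obtains xs Z f g h k where "Z0 = val xs Z" "x = val xs f" "y = val xs g" "z = val xs h" "w = val xs k"
    "\<And>us. normed_obj (Z us)" "\<And>us. [Z us, f us] \<in> obj_mem" "\<And>us. [Z us, g us] \<in> obj_mem"
    "\<And>us. [Z us, h us] \<in> obj_mem" "\<And>us. [Z us, k us] \<in> obj_mem"
proof -
  have "set [x, y, z, w] \<subseteq> members U Z0" using assms by simp
  from present_members[OF this] obtain xs Z gs where *: "Z0 = val xs Z" "[x, y, z, w] = map (val xs) gs"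
    "\<forall>us. normed_obj (Z us)" "\<forall>g\<in>set gs. \<forall>us. [Z us, g us] \<in> obj_mem" by (elim exE conjE) (rule that)
  from *(2) obtain f g h k where "gs = [f, g, h, k]" "x = val xs f" "y = val xs g" "z = val xs h" "w = val xs k"
    by (auto simp: Cons_eq_map_conv)
  then show ?thesis using * by (intro that) auto
qed

end

context normed_obj begin

lemma mem_add: "[Z, x] \<in> obj_mem \<Longrightarrow> [Z, y] \<in> obj_mem \<Longrightarrow> [Z, obj_add [Z, x, y]] \<in> obj_mem"
  using M.a_closed[of x y] by simp
lemma mem_smult: "[Z, x] \<in> obj_mem \<Longrightarrow> [Z, obj_smult [Z, Cplx c, x]] \<in> obj_mem"
  using smult_cl[of x c] by simp
lemma mem_zero: "[Z, obj_zero [Z]] \<in> obj_mem"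
  using M.zero_closed by simp
lemma minus_add_smult: "[Z, x] \<in> obj_mem \<Longrightarrow> [Z, y] \<in> obj_mem \<Longrightarrow>
    obj_minus [Z, x, y] = obj_add [Z, x, obj_smult [Z, Cplx (-1), y]]"
  using minus minus_eq_smult[of x y] by simp
lemma mem_minus: "[Z, x] \<in> obj_mem \<Longrightarrow> [Z, y] \<in> obj_mem \<Longrightarrow> [Z, obj_minus [Z, x, y]] \<in> obj_mem"
  by (simp add: minus_add_smult mem_add mem_smult)

lemma onorm_zero [simp]: "onorm Z (obj_zero [Z]) = 0"
  using onorm_smult[OF mem_zero, of 0] smult_0[of "\<zero>\<^bsub>vmod Z\<^esub>"] mem_zero by simp

lemma onorm_minus_self: "[Z, x] \<in> obj_mem \<Longrightarrow> onorm Z (obj_minus [Z, x, x]) = 0"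
  using minus_eq_zero_iff[of x x] minus[of x x] by simp

lemma onorm_minus_commute:
  assumes "[Z, x] \<in> obj_mem" "[Z, y] \<in> obj_mem"
  shows "onorm Z (obj_minus [Z, x, y]) = onorm Z (obj_minus [Z, y, x])"
proof -
  have xy: "x \<in> carrier (vmod Z)" "y \<in> carrier (vmod Z)" using assms by simp_all
  have "(-1) \<odot>\<^bsub>vmod Z\<^esub> (x \<ominus>\<^bsub>vmod Z\<^esub> y) = y \<ominus>\<^bsub>vmod Z\<^esub> x"
    using xy by (simp add: minus_eq_smult smult_add_right M.a_comm del: vmod_simps)
  then show ?thesis
    using onorm_smult[OF mem_minus[OF assms], of "-1"] assms by (simp add: minus)
qed

lemma onorm_minus_triangle:
  assumes x: "[Z, x] \<in> obj_mem" and y: "[Z, y] \<in> obj_mem" and z: "[Z, z] \<in> obj_mem"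
  shows "onorm Z (obj_minus [Z, x, z]) \<le> onorm Z (obj_minus [Z, x, y]) + onorm Z (obj_minus [Z, y, z])"
proof -
  have xyz: "x \<in> carrier (vmod Z)" "y \<in> carrier (vmod Z)" "z \<in> carrier (vmod Z)" using assms by simp_all
  have "x \<ominus>\<^bsub>vmod Z\<^esub> z = (x \<ominus>\<^bsub>vmod Z\<^esub> y) \<oplus>\<^bsub>vmod Z\<^esub> (y \<ominus>\<^bsub>vmod Z\<^esub> z)"
    using xyz by (simp only: M.minus_eq M.a_assoc M.a_inv_closed M.a_closed M.r_neg1 M.r_neg2)
  then show ?thesis using onorm_add[OF mem_minus[OF x y] mem_minus[OF y z]] assms by (simp add: minus)
qed

end

context normed_obj begin

lemma onorm_minus_add:
  assumes x: "[Z, x] \<in> obj_mem" "[Z, x'] \<in> obj_mem" and y: "[Z, y] \<in> obj_mem" "[Z, y'] \<in> obj_mem"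
  shows "onorm Z (obj_minus [Z, obj_add [Z, x', y'], obj_add [Z, x, y]])
    \<le> onorm Z (obj_minus [Z, x', x]) + onorm Z (obj_minus [Z, y', y])"
proof -
  have c: "x \<in> carrier (vmod Z)" "x' \<in> carrier (vmod Z)" "y \<in> carrier (vmod Z)" "y' \<in> carrier (vmod Z)"
    using assms by simp_all
  have "(x' \<oplus>\<^bsub>vmod Z\<^esub> y') \<ominus>\<^bsub>vmod Z\<^esub> (x \<oplus>\<^bsub>vmod Z\<^esub> y) = (x' \<ominus>\<^bsub>vmod Z\<^esub> x) \<oplus>\<^bsub>vmod Z\<^esub> (y' \<ominus>\<^bsub>vmod Z\<^esub> y)"
    using c by (simp add: minus_eq_smult smult_add_right M.a_ac del: vmod_simps)
  then have "obj_minus [Z, obj_add [Z, x', y'], obj_add [Z, x, y]] = obj_add [Z, obj_minus [Z, x', x], obj_minus [Z, y', y]]"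
    using assms by (simp add: minus mem_add)
  then show ?thesis using onorm_add[OF mem_minus[OF x(2,1)] mem_minus[OF y(2,1)]] by simp
qed

lemma onorm_minus_smult:
  assumes "[Z, x] \<in> obj_mem" "[Z, x'] \<in> obj_mem"
  shows "onorm Z (obj_minus [Z, obj_smult [Z, Cplx c, x'], obj_smult [Z, Cplx c, x]])
    = cmod c * onorm Z (obj_minus [Z, x', x])"
proof -
  have c: "x \<in> carrier (vmod Z)" "x' \<in> carrier (vmod Z)" using assms by simp_all
  have "(c \<odot>\<^bsub>vmod Z\<^esub> x') \<ominus>\<^bsub>vmod Z\<^esub> (c \<odot>\<^bsub>vmod Z\<^esub> x) = c \<odot>\<^bsub>vmod Z\<^esub> (x' \<ominus>\<^bsub>vmod Z\<^esub> x)"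
    using c by (simp add: minus_eq_smult smult_add_right mult.commute del: vmod_simps)
  then have "obj_minus [Z, obj_smult [Z, Cplx c, x'], obj_smult [Z, Cplx c, x]] = obj_smult [Z, Cplx c, obj_minus [Z, x', x]]"
    using assms by (simp add: minus mem_smult)
  then show ?thesis using onorm_smult[OF mem_minus[OF assms(2,1)]] by simp
qed

lemma onorm_diff_le:
  assumes x: "[Z, x] \<in> obj_mem" and y: "[Z, y] \<in> obj_mem"
  shows "\<bar>onorm Z y - onorm Z x\<bar> \<le> onorm Z (obj_minus [Z, y, x])"
proof -
  have *: "onorm Z u \<le> onorm Z v + onorm Z (obj_minus [Z, u, v])" if u: "[Z, u] \<in> obj_mem" and v: "[Z, v] \<in> obj_mem" for u v
  proof -
    have c: "u \<in> carrier (vmod Z)" "v \<in> carrier (vmod Z)" using u v by simp_all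
    have "v \<oplus>\<^bsub>vmod Z\<^esub> (u \<ominus>\<^bsub>vmod Z\<^esub> v) = u"
      using c by (simp only: M.minus_eq M.a_lcomm M.a_inv_closed M.a_closed M.r_neg M.r_zero)
    then have "obj_add [Z, v, obj_minus [Z, u, v]] = u" using u v by (simp add: minus)
    then show ?thesis using onorm_add[OF v mem_minus[OF u v]] by simp
  qed
  show ?thesis using *[OF x y] *[OF y x] onorm_minus_commute[OF x y] by linarith
qed

lemma onorm_minus_eq_0: "[Z, x] \<in> obj_mem \<Longrightarrow> [Z, y] \<in> obj_mem \<Longrightarrow> 0 \<le> onorm Z (obj_minus [Z, x, y])"
  by (intro onorm_nonneg mem_minus)

end

lemma tendsto_0_le:
  fixes f g :: "'x \<Rightarrow> real"
  assumes "(g \<longlongrightarrow> 0) F" "\<And>x. 0 \<le> f x" "\<And>x. f x \<le> g x"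
  shows "(f \<longlongrightarrow> 0) F"
  by (rule tendsto_sandwich[OF always_eventually always_eventually tendsto_const assms(1)]) (simp_all add: assms)

context ns_objects begin

lemma Fin_val:
  assumes "\<And>us. normed_obj (Z us)" "\<And>us. [Z us, f us] \<in> obj_mem"
  shows "val xs f \<in> Fin U (val xs Z) \<longleftrightarrow> (\<exists>n::nat. eventually (\<lambda>us. onorm (Z us) (f us) < real n) (dir xs))"
proof -
  have "obj_norm [Z us, f us] = Real (onorm (Z us) (f us))" "\<bar>onorm (Z us) (f us)\<bar> = onorm (Z us) (f us)" for us
    using normed_obj.norm_Real[OF assms] normed_obj.onorm_nonneg[OF assms, of us] by simp_all
  then show ?thesis by (simp add: Fin_def members_val assms val_args finite_hyperreal_val)
qed

end

context hull_space begin

lemma halo_members: "y \<in> halo U Z0 x \<Longrightarrow> y \<in> members U Z0"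
  by (simp add: halo_def)

lemma halo_self: "x \<in> members U Z0 \<Longrightarrow> x \<in> halo U Z0 x"
proof -
  assume x: "x \<in> members U Z0"
  from present2[OF x x] obtain xs Z f g where *: "Z0 = val xs Z" "x = val xs f" "\<And>us. normed_obj (Z us)"
    "\<And>us. [Z us, f us] \<in> obj_mem" by metis
  show ?thesis unfolding *(1,2) halo_val[OF *(3,4,4)]
    by (simp add: normed_obj.onorm_minus_self[OF *(3,4)])
qed

lemma halo_eq:
  assumes x: "x \<in> members U Z0" and y: "y \<in> halo U Z0 x"
  shows "halo U Z0 y = halo U Z0 x"
proof (rule Set.set_eqI)
  fix z
  show "z \<in> halo U Z0 y \<longleftrightarrow> z \<in> halo U Z0 x"
  proof (cases "z \<in> members U Z0")
    case True
    show ?thesis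
    proof (rule present4[OF x halo_members[OF y] True True])
      fix xs Z f g h k
      assume v: "Z0 = val xs Z" "x = val xs f" "y = val xs g" "z = val xs h"
        and N: "\<And>us. normed_obj (Z us)" and f: "\<And>us. [Z us, f us] \<in> obj_mem"
        and g: "\<And>us. [Z us, g us] \<in> obj_mem" and h: "\<And>us. [Z us, h us] \<in> obj_mem"
      let ?d = "\<lambda>p q us. onorm (Z us) (obj_minus [Z us, p us, q us])"
      have yx: "(?d g f \<longlongrightarrow> 0) (dir xs)" using y unfolding v halo_val[OF N f g] .
      have nn: "0 \<le> ?d p q us" if "\<And>us. [Z us, p us] \<in> obj_mem" "\<And>us. [Z us, q us] \<in> obj_mem" for p q us
        using normed_obj.onorm_minus_eq_0[OF N that] .
      have sum: "((\<lambda>us. a us + b us) \<longlongrightarrow> 0) (dir xs)" if "(a \<longlongrightarrow> 0) (dir xs)" "(b \<longlongrightarrow> 0) (dir xs)" for a b :: "_ \<Rightarrow> real"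
        using tendsto_add[OF that] by simp
      show ?thesis unfolding v halo_val[OF N g h] halo_val[OF N f h]
      proof
        assume "(?d h g \<longlongrightarrow> 0) (dir xs)"
        from tendsto_0_le[OF sum[OF this yx] nn[OF h f] normed_obj.onorm_minus_triangle[OF N h g f]]
        show "(?d h f \<longlongrightarrow> 0) (dir xs)" .
      next
        assume 1: "(?d h f \<longlongrightarrow> 0) (dir xs)"
        have "(?d f g \<longlongrightarrow> 0) (dir xs)" using yx unfolding normed_obj.onorm_minus_commute[OF N g f] .
        from tendsto_0_le[OF sum[OF 1 this] nn[OF h g] normed_obj.onorm_minus_triangle[OF N h f g]]
        show "(?d h g \<longlongrightarrow> 0) (dir xs)" .
      qed
    qed
  qed (use halo_members in blast)
qed

lemma halo_eq_iff: "x \<in> members U Z0 \<Longrightarrow> y \<in> members U Z0 \<Longrightarrow> halo U Z0 y = halo U Z0 x \<longleftrightarrow> y \<in> halo U Z0 x"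
  using halo_eq[of x y] halo_self[of y] by auto

lemma halo_add:
  assumes x: "x \<in> members U Z0" "x' \<in> halo U Z0 x" and y: "y \<in> members U Z0" "y' \<in> halo U Z0 y"
  shows "halo U Z0 (ext_fun U obj_add [Z0, x', y']) = halo U Z0 (ext_fun U obj_add [Z0, x, y])"
proof (rule present4[OF x(1) halo_members[OF x(2)] y(1) halo_members[OF y(2)]])
  fix xs Z f f' g g'
  assume v: "Z0 = val xs Z" "x = val xs f" "x' = val xs f'" "y = val xs g" "y' = val xs g'"
    and N: "\<And>us. normed_obj (Z us)" and f: "\<And>us. [Z us, f us] \<in> obj_mem" "\<And>us. [Z us, f' us] \<in> obj_mem"
    and g: "\<And>us. [Z us, g us] \<in> obj_mem" "\<And>us. [Z us, g' us] \<in> obj_mem"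
  note a = normed_obj.mem_add[OF N f(1) g(1)] normed_obj.mem_add[OF N f(2) g(2)]
  have lim: "((\<lambda>us. onorm (Z us) (obj_minus [Z us, f' us, f us])) \<longlongrightarrow> 0) (dir xs)"
    "((\<lambda>us. onorm (Z us) (obj_minus [Z us, g' us, g us])) \<longlongrightarrow> 0) (dir xs)"
    using x(2) y(2) unfolding v halo_val[OF N f] halo_val[OF N g] by blast+
  have "((\<lambda>us. onorm (Z us) (obj_minus [Z us, obj_add [Z us, f' us, g' us], obj_add [Z us, f us, g us]])) \<longlongrightarrow> 0) (dir xs)"
    by (rule tendsto_0_le[OF _ normed_obj.onorm_minus_eq_0[OF N a(2,1)] normed_obj.onorm_minus_add[OF N f g]])
      (use tendsto_add[OF lim] in simp)
  then have "val xs (\<lambda>us. obj_add [Z us, f' us, g' us]) \<in> halo U Z0 (val xs (\<lambda>us. obj_add [Z us, f us, g us]))"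
    unfolding v halo_val[OF N a] .
  moreover have "val xs (\<lambda>us. obj_add [Z us, f us, g us]) \<in> members U Z0"
    unfolding v members_val using a(1) by simp
  moreover have "ext_fun U obj_add [Z0, x', y'] = val xs (\<lambda>us. obj_add [Z us, f' us, g' us])"
    "ext_fun U obj_add [Z0, x, y] = val xs (\<lambda>us. obj_add [Z us, f us, g us])"
    unfolding v val_args by (rule refl)+
  ultimately show ?thesis by (simp only: halo_eq)
qed

lemma halo_smult:
  assumes x: "x \<in> members U Z0" "x' \<in> halo U Z0 x"
  shows "halo U Z0 (ext_fun U obj_smult [Z0, std U (Cplx c), x']) = halo U Z0 (ext_fun U obj_smult [Z0, std U (Cplx c), x])"
proof (rule present2[OF x(1) halo_members[OF x(2)]])
  fix xs Z f f'
  assume v: "Z0 = val xs Z" "x = val xs f" "x' = val xs f'"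
    and N: "\<And>us. normed_obj (Z us)" and f: "\<And>us. [Z us, f us] \<in> obj_mem" "\<And>us. [Z us, f' us] \<in> obj_mem"
  note a = normed_obj.mem_smult[OF N f(1), of _ c] normed_obj.mem_smult[OF N f(2), of _ c]
  have lim: "((\<lambda>us. onorm (Z us) (obj_minus [Z us, f' us, f us])) \<longlongrightarrow> 0) (dir xs)"
    using x(2) unfolding v halo_val[OF N f] .
  have "val xs (\<lambda>us. obj_smult [Z us, Cplx c, f' us]) \<in> halo U Z0 (val xs (\<lambda>us. obj_smult [Z us, Cplx c, f us]))"
    unfolding v halo_val[OF N a] normed_obj.onorm_minus_smult[OF N f]
    using tendsto_mult_right_zero[OF lim] .
  moreover have "val xs (\<lambda>us. obj_smult [Z us, Cplx c, f us]) \<in> members U Z0"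
    unfolding v members_val using a(1) by simp
  moreover have "ext_fun U obj_smult [Z0, std U (Cplx c), x'] = val xs (\<lambda>us. obj_smult [Z us, Cplx c, f' us])"
    "ext_fun U obj_smult [Z0, std U (Cplx c), x] = val xs (\<lambda>us. obj_smult [Z us, Cplx c, f us])"
    unfolding v val_args by (rule refl)+
  ultimately show ?thesis by (simp only: halo_eq)
qed

text \<open>The norms of infinitely close elements differ by an infinitesimal, so they are finite
  together and have the same limit.\<close>

lemma Fin_halo: "x \<in> Fin U Z0 \<Longrightarrow> y \<in> halo U Z0 x \<Longrightarrow> y \<in> Fin U Z0"
  and std_part_norm_halo: "x \<in> Fin U Z0 \<Longrightarrow> y \<in> halo U Z0 x \<Longrightarrow>
    std_part U (ext_fun U obj_norm [Z0, y]) = std_part U (ext_fun U obj_norm [Z0, x])"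
proof -
  assume x: "x \<in> Fin U Z0" and y: "y \<in> halo U Z0 x"
  have xm: "x \<in> members U Z0" using x by (simp add: Fin_def)
  have "y \<in> Fin U Z0 \<and> std_part U (ext_fun U obj_norm [Z0, y]) = std_part U (ext_fun U obj_norm [Z0, x])"
  proof (rule present2[OF xm halo_members[OF y]])
    fix xs Z f g
    assume v: "Z0 = val xs Z" "x = val xs f" "y = val xs g"
      and N: "\<And>us. normed_obj (Z us)" and f: "\<And>us. [Z us, f us] \<in> obj_mem" and g: "\<And>us. [Z us, g us] \<in> obj_mem"
    let ?nf = "\<lambda>us. onorm (Z us) (f us)" and ?ng = "\<lambda>us. onorm (Z us) (g us)"
    let ?d = "\<lambda>us. onorm (Z us) (obj_minus [Z us, g us, f us])"
    have d: "(?d \<longlongrightarrow> 0) (dir xs)" using y unfolding v halo_val[OF N f g] .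
    have le: "\<bar>?ng us - ?nf us\<bar> \<le> ?d us" for us by (rule normed_obj.onorm_diff_le[OF N f g])
    obtain n :: nat where n: "eventually (\<lambda>us. ?nf us < real n) (dir xs)"
      using x unfolding v Fin_val[OF N f] ..
    have "eventually (\<lambda>us. ?d us < 1) (dir xs)" using order_tendstoD(2)[OF d] by simp
    with n have "eventually (\<lambda>us. ?ng us < real (Suc n)) (dir xs)"
    proof eventually_elim
      case (elim us) then show ?case using le[of us] by simp
    qed
    then have F: "y \<in> Fin U Z0" unfolding v Fin_val[OF N g] by (rule exI)
    have "eventually (\<lambda>us. ?nf us \<in> {0..real n}) (dir xs)"
      using n by eventually_elim (use normed_obj.onorm_nonneg[OF N f] in auto)
    from dir_tendsto[OF this] obtain l where l: "(?nf \<longlongrightarrow> l) (dir xs)" by auto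
    have "((\<lambda>us. ?ng us - ?nf us) \<longlongrightarrow> 0) (dir xs)"
      by (rule Lim_null_comparison[OF _ d]) (use le in simp)
    from tendsto_add[OF this l] have l': "(?ng \<longlongrightarrow> l) (dir xs)" by simp
    have "ext_fun U obj_norm [Z0, x] = val xs (\<lambda>us. Real (?nf us))" "ext_fun U obj_norm [Z0, y] = val xs (\<lambda>us. Real (?ng us))"
      unfolding v val_args normed_obj.norm_Real[OF N f] normed_obj.norm_Real[OF N g] by (rule refl)+
    then show ?thesis using F std_part_val[OF l] std_part_val[OF l'] by simp
  qed
  then show "y \<in> Fin U Z0" "std_part U (ext_fun U obj_norm [Z0, y]) = std_part U (ext_fun U obj_norm [Z0, x])"
    by blast+
qed

text \<open>Hull operations are unions over all representatives. When every representative yields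
  the same set, the union is that set; the union is not over an empty index set because x represents
  its own class.\<close>

lemma UN_halo: "x \<in> members U Z0 \<Longrightarrow> (\<And>x'. x' \<in> halo U Z0 x \<Longrightarrow> h x' = c) \<Longrightarrow> (\<Union>x'\<in>halo U Z0 x. h x') = c"
  using halo_self[of x] by auto

lemma hull_add_halo:
  "x \<in> members U Z0 \<Longrightarrow> y \<in> members U Z0 \<Longrightarrow>
    hull_add U Z0 (halo U Z0 x) (halo U Z0 y) = halo U Z0 (ext_fun U obj_add [Z0, x, y])"
  unfolding hull_add_def by (intro UN_halo halo_add)

lemma hull_smult_halo:
  "x \<in> members U Z0 \<Longrightarrow> hull_smult U Z0 c (halo U Z0 x) = halo U Z0 (ext_fun U obj_smult [Z0, std U (Cplx c), x])"
  unfolding hull_smult_def by (intro UN_halo halo_smult)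

lemma the_norm_halo: "x \<in> Fin U Z0 \<Longrightarrow>
    the_elem ((\<lambda>x. std_part U (ext_fun U obj_norm [Z0, x])) ` halo U Z0 x) = std_part U (ext_fun U obj_norm [Z0, x])"
proof -
  assume x: "x \<in> Fin U Z0"
  have self: "x \<in> halo U Z0 x" using x by (intro halo_self) (simp add: Fin_def)
  show ?thesis
  proof (rule the_elem_image_unique)
    show "halo U Z0 x \<noteq> {}" using self by blast
    fix y assume "y \<in> halo U Z0 x"
    then show "std_part U (ext_fun U obj_norm [Z0, y]) = std_part U (ext_fun U obj_norm [Z0, x])"
      by (rule std_part_norm_halo[OF x])
  qed
qed

end

text \<open>One presentation of the space as a family of standard spaces. Inside it the hull is an
  ultraproduct: operations act pointwise on sections, and equality of classes is convergence of
  distances to 0.\<close>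

locale hull_pres = hull_space U Z0 for U :: "(('a, 'h, 'w) obj, 's) ns_universe" and Z0 :: 's +
  fixes xs :: "'s list" and Z :: "('a, 'h, 'w) obj list \<Rightarrow> ('a, 'h, 'w) obj"
  assumes Z0_val: "Z0 = val xs Z" and N: "\<And>us. normed_obj (Z us)"
begin

abbreviation hc :: "(('a, 'h, 'w) obj list \<Rightarrow> ('a, 'h, 'w) obj) \<Rightarrow> 's set" where
  "hc f \<equiv> halo U Z0 (val xs f)"

lemma sec_mem: "sec Z f \<Longrightarrow> [Z us, f us] \<in> obj_mem" by (simp add: sec_def)

lemma val_members: "(\<And>us. [Z us, f us] \<in> obj_mem) \<Longrightarrow> val xs f \<in> members U Z0"
  by (simp add: Z0_val members_val)

lemma sec_members: "sec Z f \<Longrightarrow> val xs f \<in> members U Z0"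
  by (rule val_members) (rule sec_mem)

lemma sec_Fin: "sec Z f \<Longrightarrow> val xs f \<in> Fin U Z0"
proof -
  assume f: "sec Z f"
  then obtain C where C: "\<And>us. onorm (Z us) (f us) \<le> C" by (auto simp: sec_def)
  obtain n :: nat where "C < real n" using reals_Archimedean2 by blast
  then have "\<forall>us. onorm (Z us) (f us) < real n" using C le_less_trans by blast
  then have "eventually (\<lambda>us. onorm (Z us) (f us) < real n) (dir xs)" by (rule always_eventually)
  then show ?thesis unfolding Z0_val Fin_val[OF N sec_mem[OF f]] by (rule exI)
qed

lemma hc_carrier: "sec Z f \<Longrightarrow> hc f \<in> hull_carrier U Z0"
  unfolding hull_carrier_def by (rule imageI) (rule sec_Fin)

lemma hc_eq_iff:
  "sec Z f \<Longrightarrow> sec Z g \<Longrightarrow> hc g = hc f \<longleftrightarrow> ((\<lambda>us. onorm (Z us) (obj_minus [Z us, g us, f us])) \<longlongrightarrow> 0) (dir xs)"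
proof -
  assume f: "sec Z f" and g: "sec Z g"
  show ?thesis
    using halo_val[OF N sec_mem[OF f] sec_mem[OF g]] halo_eq_iff[OF sec_members[OF f] sec_members[OF g]]
    by (simp add: Z0_val)
qed

lemma hc_add: "sec Z f \<Longrightarrow> sec Z g \<Longrightarrow> hull_add U Z0 (hc f) (hc g) = hc (\<lambda>us. obj_add [Z us, f us, g us])"
  using hull_add_halo[OF sec_members sec_members, of f g] by (simp add: Z0_val val_args)

lemma hc_smult: "sec Z f \<Longrightarrow> hull_smult U Z0 c (hc f) = hc (\<lambda>us. obj_smult [Z us, Cplx c, f us])"
  using hull_smult_halo[OF sec_members, of f c] by (simp add: Z0_val val_args)

lemma hc_zero: "halo U Z0 (ext_fun U obj_zero [Z0]) = hc (\<lambda>us. obj_zero [Z us])"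
  by (simp add: Z0_val val_args)

lemma sec_add: "sec Z f \<Longrightarrow> sec Z g \<Longrightarrow> sec Z (\<lambda>us. obj_add [Z us, f us, g us])"
proof -
  assume f: "sec Z f" and g: "sec Z g"
  obtain C D where "\<And>us. onorm (Z us) (f us) \<le> C" "\<And>us. onorm (Z us) (g us) \<le> D"
    using f g by (auto simp: sec_def)
  then have "onorm (Z us) (obj_add [Z us, f us, g us]) \<le> C + D" for us
    using normed_obj.onorm_add[OF N sec_mem[OF f] sec_mem[OF g]] add_mono order_trans by meson
  then show ?thesis unfolding sec_def using normed_obj.mem_add[OF N sec_mem[OF f] sec_mem[OF g]] by blast
qed

lemma sec_smult: "sec Z f \<Longrightarrow> sec Z (\<lambda>us. obj_smult [Z us, Cplx c, f us])"
proof -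
  assume f: "sec Z f"
  obtain C where "\<And>us. onorm (Z us) (f us) \<le> C" using f by (auto simp: sec_def)
  then have "onorm (Z us) (obj_smult [Z us, Cplx c, f us]) \<le> cmod c * C" for us
    unfolding normed_obj.onorm_smult[OF N sec_mem[OF f]] by (simp add: mult_left_mono)
  then show ?thesis unfolding sec_def using normed_obj.mem_smult[OF N sec_mem[OF f]] by blast
qed

lemma sec_zero: "sec Z (\<lambda>us. obj_zero [Z us])"
  unfolding sec_def using normed_obj.mem_zero[OF N] normed_obj.onorm_zero[OF N] by auto

text \<open>The norm of the hull is a standard part, hence the limit of the pointwise norms, which
  exists because they are bounded.\<close>

lemma sec_norm_limit:
  assumes f: "sec Z f"
  shows "((\<lambda>us. onorm (Z us) (f us)) \<longlongrightarrow>
    the_elem ((\<lambda>x. std_part U (ext_fun U obj_norm [Z0, x])) ` hc f)) (dir xs)"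
proof -
  obtain C where "\<And>us. onorm (Z us) (f us) \<le> C" using f by (auto simp: sec_def)
  then have "eventually (\<lambda>us. onorm (Z us) (f us) \<in> {0..C}) (dir xs)"
    using normed_obj.onorm_nonneg[OF N sec_mem[OF f]] by (intro always_eventually) auto
  from dir_tendsto[OF this] obtain l where l: "((\<lambda>us. onorm (Z us) (f us)) \<longlongrightarrow> l) (dir xs)" by auto
  have "ext_fun U obj_norm [Z0, val xs f] = val xs (\<lambda>us. Real (onorm (Z us) (f us)))"
    unfolding Z0_val val_args normed_obj.norm_Real[OF N sec_mem[OF f]] by (rule refl)
  then have "the_elem ((\<lambda>x. std_part U (ext_fun U obj_norm [Z0, x])) ` hc f) = l"
    unfolding the_norm_halo[OF sec_Fin[OF f]] using std_part_val[OF l] by simp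
  then show ?thesis using l by simp
qed

end

context hull_space begin

lemma present_hull:
  assumes "set Ss \<subseteq> hull_carrier U Z0"
  shows "\<exists>xs Z gs. hull_pres U Z0 xs Z \<and> Ss = map (\<lambda>f. halo U Z0 (val xs f)) gs \<and> (\<forall>g\<in>set gs. sec Z g)"
proof -
  let ?js = "replicate (length Ss) 0"
  let ?Q = "\<lambda>xs fs gs. [Z0] = map (val xs) fs \<and> length fs = length [Z0] \<and> length gs = length Ss \<and>
    (\<forall>us. map (\<lambda>f. f us) fs \<in> {[Z] | Z. normed_obj Z}) \<and>
    (\<forall>i<length Ss. Ss ! i = hcl xs (fs ! (?js ! i)) (gs ! i) \<and> sec (fs ! (?js ! i)) (gs ! i))"
  have "\<exists>xs fs gs. ?Q xs fs gs"
    by (rule present_sections[OF Z0]) (use Z0 assms in \<open>auto simp: subset_iff\<close>)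
  then obtain xs fs gs where Q: "?Q xs fs gs" by (elim exE) (rule that)
  note q = conjunct1[OF Q] conjunct1[OF conjunct2[OF Q]] conjunct1[OF conjunct2[OF conjunct2[OF Q]]]
    conjunct1[OF conjunct2[OF conjunct2[OF conjunct2[OF Q]]]]
    conjunct2[OF conjunct2[OF conjunct2[OF conjunct2[OF Q]]]]
  have "length fs = 1" using q(2) by simp
  then obtain Z where Z: "fs = [Z]" by (auto simp: length_Suc_conv)
  have v: "Z0 = val xs Z" using q(1) by (simp add: Z)
  have N: "normed_obj (Z us)" for us using q(4) by (simp add: Z)
  have s: "Ss ! i = halo U Z0 (val xs (gs ! i)) \<and> sec Z (gs ! i)" if "i < length Ss" for i
    using q(5) that by (simp add: Z v)
  have "hull_pres U Z0 xs Z" by (intro hull_pres.intro hull_space_axioms hull_pres_axioms.intro v N)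
  moreover have "Ss = map (\<lambda>f. halo U Z0 (val xs f)) gs"
    by (rule nth_equalityI) (use q(3) s in simp_all)
  moreover have "\<forall>g\<in>set gs. sec Z g" using q(3) s by (simp add: all_set_conv_all_nth)
  ultimately show ?thesis by (intro exI[of _ xs] exI[of _ Z] exI[of _ gs] conjI)
qed

lemma present_hull3:
  assumes "S \<in> hull_carrier U Z0" "T \<in> hull_carrier U Z0" "R \<in> hull_carrier U Z0"
  obtains xs Z f g h where "hull_pres U Z0 xs Z" "sec Z f" "sec Z g" "sec Z h"
    "S = halo U Z0 (val xs f)" "T = halo U Z0 (val xs g)" "R = halo U Z0 (val xs h)"
proof -
  have "set [S, T, R] \<subseteq> hull_carrier U Z0" using assms by simp
  from present_hull[OF this] obtain xs Z gs where *: "hull_pres U Z0 xs Z" "[S, T, R] = map (\<lambda>f. halo U Z0 (val xs f)) gs"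
    "\<forall>g\<in>set gs. sec Z g" by (elim exE conjE) (rule that)
  from *(2) obtain f g h where fgh: "gs = [f, g, h]" "S = halo U Z0 (val xs f)" "T = halo U Z0 (val xs g)" "R = halo U Z0 (val xs h)"
    by (auto simp: Cons_eq_map_conv)
  show ?thesis by (rule that[OF *(1) _ _ _ fgh(2-4)]) (use *(3) fgh(1) in simp_all)
qed

text \<open>Stated for any record with these four fields, so that it serves the hull of an algebra
  as well as the hull of a Hilbert space.\<close>

lemma hull_module:
  fixes V :: "(complex, 's set, 'm) module_scheme"
  assumes V: "carrier V = hull_carrier U Z0" "add V = hull_add U Z0" "smult V = hull_smult U Z0"
    "zero V = halo U Z0 (ext_fun U obj_zero [Z0])"
  shows "Module.module CC V"
proof -
  \<comment> \<open>The laws are proved in one conjunction, so that three classes have to be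
    presented only once; each law then holds pointwise.\<close>
  have main: "x \<oplus>\<^bsub>V\<^esub> y \<in> carrier V \<and> \<zero>\<^bsub>V\<^esub> \<in> carrier V \<and> x \<oplus>\<^bsub>V\<^esub> y \<oplus>\<^bsub>V\<^esub> z = x \<oplus>\<^bsub>V\<^esub> (y \<oplus>\<^bsub>V\<^esub> z) \<and>
      x \<oplus>\<^bsub>V\<^esub> y = y \<oplus>\<^bsub>V\<^esub> x \<and> \<zero>\<^bsub>V\<^esub> \<oplus>\<^bsub>V\<^esub> x = x \<and> (-1) \<odot>\<^bsub>V\<^esub> x \<oplus>\<^bsub>V\<^esub> x = \<zero>\<^bsub>V\<^esub> \<and> a \<odot>\<^bsub>V\<^esub> x \<in> carrier V \<and>
      (a + b) \<odot>\<^bsub>V\<^esub> x = a \<odot>\<^bsub>V\<^esub> x \<oplus>\<^bsub>V\<^esub> b \<odot>\<^bsub>V\<^esub> x \<and> a \<odot>\<^bsub>V\<^esub> (x \<oplus>\<^bsub>V\<^esub> y) = a \<odot>\<^bsub>V\<^esub> x \<oplus>\<^bsub>V\<^esub> a \<odot>\<^bsub>V\<^esub> y \<and>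
      (a * b) \<odot>\<^bsub>V\<^esub> x = a \<odot>\<^bsub>V\<^esub> (b \<odot>\<^bsub>V\<^esub> x) \<and> 1 \<odot>\<^bsub>V\<^esub> x = x"
    if xyz: "x \<in> carrier V" "y \<in> carrier V" "z \<in> carrier V" for x y z a b
  proof (rule present_hull3[OF xyz[unfolded V]])
    fix xs Z f g h
    assume P: "hull_pres U Z0 xs Z" and s: "sec Z f" "sec Z g" "sec Z h"
      and v: "x = halo U Z0 (val xs f)" "y = halo U Z0 (val xs g)" "z = halo U Z0 (val xs h)"
    interpret hull_pres U Z0 xs Z by fact
    have W: "cmodule (vmod (Z us))" for us using N[of us] by (simp add: normed_obj_def)
    note m = sec_mem[OF s(1)] sec_mem[OF s(2)] sec_mem[OF s(3)]
    have Wm: "f us \<in> carrier (vmod (Z us))" "g us \<in> carrier (vmod (Z us))" "h us \<in> carrier (vmod (Z us))" for us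
      using m by simp_all
    have p: "obj_add [Z us, obj_add [Z us, f us, g us], h us] = obj_add [Z us, f us, obj_add [Z us, g us, h us]]"
      "obj_add [Z us, f us, g us] = obj_add [Z us, g us, f us]" "obj_add [Z us, obj_zero [Z us], f us] = f us"
      "obj_add [Z us, obj_smult [Z us, Cplx (-1), f us], f us] = obj_zero [Z us]"
      "obj_smult [Z us, Cplx (a + b), f us] = obj_add [Z us, obj_smult [Z us, Cplx a, f us], obj_smult [Z us, Cplx b, f us]]"
      "obj_smult [Z us, Cplx a, obj_add [Z us, f us, g us]] = obj_add [Z us, obj_smult [Z us, Cplx a, f us], obj_smult [Z us, Cplx a, g us]]"
      "obj_smult [Z us, Cplx (a * b), f us] = obj_smult [Z us, Cplx a, obj_smult [Z us, Cplx b, f us]]"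
      "obj_smult [Z us, Cplx 1, f us] = f us" for us
    proof -
      interpret W: cmodule "vmod (Z us)" by (rule W)
      note w = Wm[of us]
      show "obj_add [Z us, obj_add [Z us, f us, g us], h us] = obj_add [Z us, f us, obj_add [Z us, g us, h us]]"
        using W.M.a_assoc[OF w] by simp
      show "obj_add [Z us, f us, g us] = obj_add [Z us, g us, f us]" using W.M.a_comm[OF w(1,2)] by simp
      show "obj_add [Z us, obj_zero [Z us], f us] = f us" using W.M.l_zero[OF w(1)] by simp
      show "obj_add [Z us, obj_smult [Z us, Cplx (-1), f us], f us] = obj_zero [Z us]"
        using W.M.l_neg[OF w(1)] W.uminus_eq_smult[OF w(1)] by simp
      show "obj_smult [Z us, Cplx (a + b), f us] = obj_add [Z us, obj_smult [Z us, Cplx a, f us], obj_smult [Z us, Cplx b, f us]]"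
        using W.smult_add_left[OF w(1), of a b] by simp
      show "obj_smult [Z us, Cplx a, obj_add [Z us, f us, g us]] = obj_add [Z us, obj_smult [Z us, Cplx a, f us], obj_smult [Z us, Cplx a, g us]]"
        using W.smult_add_right[OF w(1,2), of a] by simp
      show "obj_smult [Z us, Cplx (a * b), f us] = obj_smult [Z us, Cplx a, obj_smult [Z us, Cplx b, f us]]"
        using W.smult_smult[OF w(1), of a b] by simp
      show "obj_smult [Z us, Cplx 1, f us] = f us" using W.smult_1[OF w(1)] by simp
    qed
    note hs = hc_add hc_smult hc_zero sec_add sec_smult sec_zero s
    show ?thesis
      unfolding V v
      by (intro conjI; (simp only: hs hc_carrier p(1,3-8); fail | simp only: hs p(2)))
  qed
  have zero: "\<zero>\<^bsub>V\<^esub> \<in> carrier V"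
  proof -
    \<comment> \<open>\<open>main\<close> presupposes elements of the carrier. Presenting the empty
      list provides a family of spaces, whose zeros form a section.\<close>
    from present_hull[of "[]"] obtain xs Z where P: "hull_pres U Z0 xs Z" by auto
    then interpret hull_pres U Z0 xs Z .
    show ?thesis unfolding V hc_zero by (rule hc_carrier[OF sec_zero])
  qed
  note c1 = main[THEN conjunct1] and t1 = main[THEN conjunct2, THEN conjunct2]
  note c3 = t1[THEN conjunct1] and t3 = t1[THEN conjunct2]
  note c4 = t3[THEN conjunct1] and t4 = t3[THEN conjunct2]
  note c5 = t4[THEN conjunct1] and t5 = t4[THEN conjunct2]
  note c6 = t5[THEN conjunct1] and t6 = t5[THEN conjunct2]
  note c7 = t6[THEN conjunct1] and t7 = t6[THEN conjunct2]
  note c8 = t7[THEN conjunct1] and t8 = t7[THEN conjunct2]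
  note c9 = t8[THEN conjunct1] and t9 = t8[THEN conjunct2]
  note c10 = t9[THEN conjunct1] and c11 = t9[THEN conjunct2]
  show ?thesis
  proof (intro moduleI cring_CC abelian_groupI)
    fix x y z :: "'s set" and a b :: complex
    assume x: "x \<in> carrier V"
    show "\<exists>y\<in>carrier V. y \<oplus>\<^bsub>V\<^esub> x = \<zero>\<^bsub>V\<^esub>"
      by (rule bexI[of _ "(-1) \<odot>\<^bsub>V\<^esub> x"]) (rule c6[OF x x x], rule c7[OF x x x])
    show "\<zero>\<^bsub>V\<^esub> \<oplus>\<^bsub>V\<^esub> x = x" by (rule c5[OF x x x])
    show "a \<odot>\<^bsub>V\<^esub> x \<in> carrier V" by (rule c7[OF x x x])
    show "(a \<oplus>\<^bsub>CC\<^esub> b) \<odot>\<^bsub>V\<^esub> x = a \<odot>\<^bsub>V\<^esub> x \<oplus>\<^bsub>V\<^esub> b \<odot>\<^bsub>V\<^esub> x"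
      unfolding CC_simps by (rule c8[OF x x x])
    show "(a \<otimes>\<^bsub>CC\<^esub> b) \<odot>\<^bsub>V\<^esub> x = a \<odot>\<^bsub>V\<^esub> (b \<odot>\<^bsub>V\<^esub> x)"
      unfolding CC_simps by (rule c10[OF x x x])
    show "\<one>\<^bsub>CC\<^esub> \<odot>\<^bsub>V\<^esub> x = x" unfolding CC_simps by (rule c11[OF x x x])
    assume y: "y \<in> carrier V"
    show "x \<oplus>\<^bsub>V\<^esub> y \<in> carrier V" by (rule c1[OF x y y])
    show "x \<oplus>\<^bsub>V\<^esub> y = y \<oplus>\<^bsub>V\<^esub> x" by (rule c4[OF x y y])
    show "a \<odot>\<^bsub>V\<^esub> (x \<oplus>\<^bsub>V\<^esub> y) = a \<odot>\<^bsub>V\<^esub> x \<oplus>\<^bsub>V\<^esub> a \<odot>\<^bsub>V\<^esub> y" by (rule c9[OF x y y])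
    assume z: "z \<in> carrier V"
    show "x \<oplus>\<^bsub>V\<^esub> y \<oplus>\<^bsub>V\<^esub> z = x \<oplus>\<^bsub>V\<^esub> (y \<oplus>\<^bsub>V\<^esub> z)" by (rule c3[OF x y z])
  qed (rule zero)
qed

end

section \<open>The hull of an internal C*-algebra\<close>

lemma (in pre_cstar) nrm_mult_diff:
  assumes "x \<in> carrier A" "x' \<in> carrier A" "y \<in> carrier A" "y' \<in> carrier A"
  shows "nrm A (x' \<otimes> y' \<ominus> x \<otimes> y) \<le> nrm A x' * nrm A (y' \<ominus> y) + nrm A (x' \<ominus> x) * nrm A y"
proof -
  have "x' \<otimes> y' \<ominus> x \<otimes> y = x' \<otimes> (y' \<ominus> y) \<oplus> (x' \<ominus> x) \<otimes> y"
    using assms by (simp add: minus_eq r_distr l_distr r_minus l_minus a_assoc r_neg1)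
  then have "nrm A (x' \<otimes> y' \<ominus> x \<otimes> y) \<le> nrm A (x' \<otimes> (y' \<ominus> y)) + nrm A ((x' \<ominus> x) \<otimes> y)"
    using assms by (simp add: nrm_add)
  then show ?thesis using nrm_mult[of x' "y' \<ominus> y"] nrm_mult[of "x' \<ominus> x" y] assms by simp
qed

text \<open>The predicate P is a parameter because the presenting algebras must keep whatever
  transferred property is at hand: the axioms alone for the structure of the hull, boundedly many
  projections for the decomposition of its elements.\<close>

locale alg_hull = ns_objects U for U :: "(('a, 'h, 'w) obj, 's) ns_universe" +
  fixes M :: 's and P :: "'a cstar \<Rightarrow> bool"
  assumes M: "[M] \<in> ext U {[Alg A] | A. P A}" and P: "\<And>A. P A \<Longrightarrow> pre_cstar A"
begin

lemma M_normed: "[M] \<in> ext U {[Z] | Z. normed_obj Z}"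
proof (rule ext_mono[OF M])
  fix us assume "us \<in> {[Alg A] | A. P A}"
  then obtain A where "us = [Alg A]" "P A" by blast
  then show "us \<in> {[Z] | Z. normed_obj Z}" using pre_cstar.normed_obj_Alg[OF P] by simp
qed

end

sublocale alg_hull \<subseteq> hull_space U M
  by (intro hull_space.intro ns_objects_axioms hull_space_axioms.intro M_normed)

text \<open>The counterpart of \<open>sec\<close> for elements stripped of the constructor
  \<open>Elem\<close>, so that the ring syntax of the presenting algebras applies.\<close>

definition asec :: "('x \<Rightarrow> 'a cstar) \<Rightarrow> ('x \<Rightarrow> 'a) \<Rightarrow> bool" where
  "asec A a \<longleftrightarrow> (\<forall>us. a us \<in> carrier (A us)) \<and> (\<exists>C. \<forall>us. nrm (A us) (a us) \<le> C)"

lemma (in ns_objects) sec_Elem: "sec (\<lambda>us. Alg (A us)) (\<lambda>us. Elem (a us)) \<longleftrightarrow> asec A a"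
  unfolding sec_def asec_def by simp

locale alg_pres = alg_hull U M P for U :: "(('a, 'h, 'w) obj, 's) ns_universe" and M :: 's and P +
  fixes xs :: "'s list" and A :: "('a, 'h, 'w) obj list \<Rightarrow> 'a cstar"
  assumes M_val: "M = val xs (\<lambda>us. Alg (A us))" and PA: "\<And>us. P (A us)"

sublocale alg_pres \<subseteq> hull_pres U M xs "\<lambda>us. Alg (A us)"
  by (intro hull_pres.intro hull_space_axioms hull_pres_axioms.intro M_val pre_cstar.normed_obj_Alg P PA)

context alg_hull begin

lemma present_alg:
  assumes "set ys \<subseteq> Fin U M"
  shows "\<exists>xs A as. alg_pres U M P xs A \<and> ys = map (\<lambda>a. val xs (\<lambda>us. Elem (a us))) as \<and> (\<forall>a\<in>set as. asec A a)"
proof -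
  let ?B = "\<lambda>C. {[Z, x] | Z x. [Z, x] \<in> obj_mem \<and> onorm Z x \<le> (C :: real)}"
  have "\<forall>y. \<exists>C. y \<in> Fin U M \<longrightarrow> [M, y] \<in> ext U (?B C)" using Fin_bound[OF M_normed] by blast
  from choice[OF this] obtain C where C: "\<forall>y. y \<in> Fin U M \<longrightarrow> [M, y] \<in> ext U (?B (C y))" ..
  let ?js = "replicate (length ys) 0" and ?Rs = "map (\<lambda>y. ?B (C y)) ys"
  let ?Q = "\<lambda>xs fs gs. [M] = map (val xs) fs \<and> ys = map (val xs) gs \<and>
    length fs = length [M] \<and> length gs = length ys \<and>
    (\<forall>us. map (\<lambda>f. f us) fs \<in> {[Alg A] | A. P A}) \<and>
    (\<forall>us. \<forall>i<length ys. [(fs ! (?js ! i)) us, (gs ! i) us] \<in> ?Rs ! i)"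
  have "\<exists>xs fs gs. ?Q xs fs gs"
  proof (rule present_over[OF M])
    fix i assume i: "i < length ys"
    then have "ys ! i \<in> Fin U M" using assms nth_mem by blast
    then show "[[M] ! (?js ! i), ys ! i] \<in> ext U (?Rs ! i)" using C i by simp
  qed simp_all
  then obtain xs fs gs where Q: "?Q xs fs gs" by (elim exE) (rule that)
  note q = conjunct1[OF Q] conjunct1[OF conjunct2[OF Q]] conjunct1[OF conjunct2[OF conjunct2[OF Q]]]
    conjunct1[OF conjunct2[OF conjunct2[OF conjunct2[OF Q]]]]
    conjunct1[OF conjunct2[OF conjunct2[OF conjunct2[OF conjunct2[OF Q]]]]]
    conjunct2[OF conjunct2[OF conjunct2[OF conjunct2[OF conjunct2[OF Q]]]]]
  have "length fs = 1" using q(3) by simp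
  then obtain Z where Z: "fs = [Z]" by (auto simp: length_Suc_conv)
  have "\<forall>us. \<exists>A. Z us = Alg A \<and> P A" using q(5) by (simp add: Z)
  from choice[OF this] obtain A where A: "\<forall>us. Z us = Alg (A us) \<and> P (A us)" ..
  then have ZA: "Z = (\<lambda>us. Alg (A us))" by (intro ext) simp
  \<comment> \<open>The default is never met, since members of an algebra are of the form
    \<open>Elem a\<close>.\<close>
  define el where "el x = (case x of Elem a \<Rightarrow> a | _ \<Rightarrow> undefined)" for x :: "('a, 'h, 'w) obj"
  define as where "as = map (\<lambda>g us. el (g us)) gs"
  have g: "gs ! i = (\<lambda>us. Elem ((as ! i) us)) \<and> asec A (as ! i)" if i: "i < length ys" for i
  proof -
    have "[Z us, (gs ! i) us] \<in> ?B (C (ys ! i))" for us using q(6)[rule_format, OF i, of us] i by (simp add: Z)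
    then have *: "[Alg (A us), (gs ! i) us] \<in> obj_mem \<and> onorm (Alg (A us)) ((gs ! i) us) \<le> C (ys ! i)" for us
      using ZA by auto
    have as: "(as ! i) us = el ((gs ! i) us)" for us using i q(4) by (simp add: as_def)
    have **: "(gs ! i) us = Elem ((as ! i) us) \<and> (as ! i) us \<in> carrier (A us)" for us
      using conjunct1[OF *[of us]] unfolding as by (auto simp: el_def)
    then have "nrm (A us) ((as ! i) us) \<le> C (ys ! i)" for us using conjunct2[OF *[of us]] by simp
    then have "asec A (as ! i)" unfolding asec_def using ** by blast
    moreover have "gs ! i = (\<lambda>us. Elem ((as ! i) us))" using ** by (intro ext) blast
    ultimately show ?thesis by blast
  qed
  have las: "length as = length ys" using q(4) by (simp add: as_def)
  have "alg_pres U M P xs A"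
    by (intro alg_pres.intro alg_hull_axioms alg_pres_axioms.intro) (use q(1) A in \<open>simp_all add: Z ZA\<close>)
  moreover have "ys = map (\<lambda>a. val xs (\<lambda>us. Elem (a us))) as"
  proof (rule nth_equalityI)
    show "length ys = length (map (\<lambda>a. val xs (\<lambda>us. Elem (a us))) as)" using las by simp
    fix i assume i: "i < length ys"
    have "ys ! i = val xs (gs ! i)" using arg_cong[OF q(2), of "\<lambda>l. l ! i"] i q(4) by simp
    also have "gs ! i = (\<lambda>us. Elem ((as ! i) us))" by (rule conjunct1[OF g[OF i]])
    also have "val xs (\<lambda>us. Elem ((as ! i) us)) = map (\<lambda>a. val xs (\<lambda>us. Elem (a us))) as ! i"
      using i las by simp
    finally show "ys ! i = map (\<lambda>a. val xs (\<lambda>us. Elem (a us))) as ! i" .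
  qed
  moreover have "\<forall>a\<in>set as. asec A a" using g las by (simp add: all_set_conv_all_nth)
  ultimately show ?thesis by (intro exI[of _ xs] exI[of _ A] exI[of _ as] conjI)
qed

lemma present_alg4:
  assumes "x \<in> Fin U M" "y \<in> Fin U M" "z \<in> Fin U M" "w \<in> Fin U M"
  obtains xs A a b c d where "alg_pres U M P xs A" "asec A a" "asec A b" "asec A c" "asec A d"
    "x = val xs (\<lambda>us. Elem (a us))" "y = val xs (\<lambda>us. Elem (b us))"
    "z = val xs (\<lambda>us. Elem (c us))" "w = val xs (\<lambda>us. Elem (d us))"
proof -
  have "set [x, y, z, w] \<subseteq> Fin U M" using assms by simp
  from present_alg[OF this] obtain xs A as where *: "alg_pres U M P xs A"
    "[x, y, z, w] = map (\<lambda>a. val xs (\<lambda>us. Elem (a us))) as" "\<forall>a\<in>set as. asec A a" by (elim exE conjE) (rule that)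
  from *(2) obtain a b c d where l: "as = [a, b, c, d]" and v: "x = val xs (\<lambda>us. Elem (a us))" "y = val xs (\<lambda>us. Elem (b us))"
    "z = val xs (\<lambda>us. Elem (c us))" "w = val xs (\<lambda>us. Elem (d us))" by (auto simp: Cons_eq_map_conv)
  show ?thesis by (rule that[OF *(1) _ _ _ _ v]) (use *(3) l in simp_all)
qed

end

context alg_pres begin

lemma A: "pre_cstar (A us)" by (rule P[OF PA])

abbreviation ac :: "(('a, 'h, 'w) obj list \<Rightarrow> 'a) \<Rightarrow> 's set" where
  "ac a \<equiv> halo U M (val xs (\<lambda>us. Elem (a us)))"

lemma asecD: "asec A a \<Longrightarrow> a us \<in> carrier (A us)" by (simp add: asec_def)

lemma ac_eq_iff: "asec A a \<Longrightarrow> asec A b \<Longrightarrow>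
    ac b = ac a \<longleftrightarrow> ((\<lambda>us. nrm (A us) (b us \<ominus>\<^bsub>A us\<^esub> a us)) \<longlongrightarrow> 0) (dir xs)"
  using hc_eq_iff[of "\<lambda>us. Elem (a us)" "\<lambda>us. Elem (b us)"] by (simp add: sec_Elem)

lemma ac_add: "asec A a \<Longrightarrow> asec A b \<Longrightarrow> hull_add U M (ac a) (ac b) = ac (\<lambda>us. a us \<oplus>\<^bsub>A us\<^esub> b us)"
  using hc_add[of "\<lambda>us. Elem (a us)" "\<lambda>us. Elem (b us)"] by (simp add: sec_Elem)

lemma ac_smult: "asec A a \<Longrightarrow> hull_smult U M c (ac a) = ac (\<lambda>us. c \<odot>\<^bsub>A us\<^esub> a us)"
  using hc_smult[of "\<lambda>us. Elem (a us)" c] by (simp add: sec_Elem)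

lemma ac_zero: "halo U M (ext_fun U obj_zero [M]) = ac (\<lambda>us. \<zero>\<^bsub>A us\<^esub>)"
  unfolding hc_zero by simp

lemma ac_carrier: "asec A a \<Longrightarrow> ac a \<in> hull_carrier U M"
  using hc_carrier[of "\<lambda>us. Elem (a us)"] by (simp add: sec_Elem)

lemma asec_Fin: "asec A a \<Longrightarrow> val xs (\<lambda>us. Elem (a us)) \<in> Fin U M"
  using sec_Fin[of "\<lambda>us. Elem (a us)"] by (simp add: sec_Elem)

lemma asec_add: "asec A a \<Longrightarrow> asec A b \<Longrightarrow> asec A (\<lambda>us. a us \<oplus>\<^bsub>A us\<^esub> b us)"
  using sec_add[of "\<lambda>us. Elem (a us)" "\<lambda>us. Elem (b us)"] by (simp add: sec_Elem)

lemma asec_smult: "asec A a \<Longrightarrow> asec A (\<lambda>us. c \<odot>\<^bsub>A us\<^esub> a us)"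
  using sec_smult[of "\<lambda>us. Elem (a us)" c] by (simp add: sec_Elem)

lemma asec_zero: "asec A (\<lambda>us. \<zero>\<^bsub>A us\<^esub>)"
  using sec_zero by (simp add: sec_Elem)

lemma asec_mult: "asec A a \<Longrightarrow> asec A b \<Longrightarrow> asec A (\<lambda>us. a us \<otimes>\<^bsub>A us\<^esub> b us)"
proof -
  assume a: "asec A a" and b: "asec A b"
  obtain C D where CD: "\<And>us. nrm (A us) (a us) \<le> C" "\<And>us. nrm (A us) (b us) \<le> D" using a b by (auto simp: asec_def)
  have "nrm (A us) (a us \<otimes>\<^bsub>A us\<^esub> b us) \<le> \<bar>C\<bar> * \<bar>D\<bar>" for us
  proof -
    interpret A: pre_cstar "A us" by (rule A)
    have "nrm (A us) (a us \<otimes>\<^bsub>A us\<^esub> b us) \<le> nrm (A us) (a us) * nrm (A us) (b us)"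
      by (rule A.nrm_mult[OF asecD[OF a] asecD[OF b]])
    also have "\<dots> \<le> \<bar>C\<bar> * \<bar>D\<bar>"
      using CD[of us] A.nrm_nonneg[OF asecD[OF b]] by (intro mult_mono) linarith+
    finally show ?thesis .
  qed
  moreover have "a us \<otimes>\<^bsub>A us\<^esub> b us \<in> carrier (A us)" for us
    using pre_cstar.axioms(2)[OF A] asecD[OF a] asecD[OF b] by (simp add: ring.ring_simprules)
  ultimately show ?thesis unfolding asec_def by blast
qed

lemma asec_adj: "asec A a \<Longrightarrow> asec A (\<lambda>us. adj (A us) (a us))"
  unfolding asec_def using pre_cstar.nrm_adj[OF A] pre_cstar.adj_closed[OF A] by simp

lemma asec_one: "asec A (\<lambda>us. \<one>\<^bsub>A us\<^esub>)"
proof -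
  have "\<one>\<^bsub>A us\<^esub> \<in> carrier (A us) \<and> nrm (A us) \<one>\<^bsub>A us\<^esub> \<le> 1" for us
  proof -
    interpret A: pre_cstar "A us" by (rule A)
    have "\<one>\<^bsub>A us\<^esub> \<in> projections (A us)" by (simp add: projections_def)
    from A.nrm_proj_le[OF this] show ?thesis by simp
  qed
  then show ?thesis unfolding asec_def by blast
qed

lemma asec_norm_limit: "asec A a \<Longrightarrow> ((\<lambda>us. nrm (A us) (a us)) \<longlongrightarrow> nrm (ns_hull U M) (ac a)) (dir xs)"
  using sec_norm_limit[of "\<lambda>us. Elem (a us)"] by (simp add: sec_Elem ns_hull_def)

end

context alg_hull begin

text \<open>Multiplication is uniformly continuous only on bounded sets, which is why x and y are
  finite here, while membership suffices for addition.\<close>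

lemma halo_mult:
  assumes x: "x \<in> Fin U M" "x' \<in> halo U M x" and y: "y \<in> Fin U M" "y' \<in> halo U M y"
  shows "halo U M (ext_fun U obj_mult [M, x', y']) = halo U M (ext_fun U obj_mult [M, x, y])"
proof (rule present_alg4[OF x(1) Fin_halo[OF x] y(1) Fin_halo[OF y]])
  fix xs A a a' b b'
  assume pres: "alg_pres U M P xs A" and s: "asec A a" "asec A a'" "asec A b" "asec A b'"
    and v: "x = val xs (\<lambda>us. Elem (a us))" "x' = val xs (\<lambda>us. Elem (a' us))"
      "y = val xs (\<lambda>us. Elem (b us))" "y' = val xs (\<lambda>us. Elem (b' us))"
  interpret alg_pres U M P xs A by fact
  have eqs: "ac a' = ac a" "ac b' = ac b"
    using halo_eq[of x x'] halo_eq[of y y'] x y unfolding v Fin_def by blast+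
  note lim = eqs(1)[unfolded ac_eq_iff[OF s(1,2)]] eqs(2)[unfolded ac_eq_iff[OF s(3,4)]]
  obtain C D where CD: "\<And>us. nrm (A us) (a' us) \<le> C" "\<And>us. nrm (A us) (b us) \<le> D"
    using s by (auto simp: asec_def)
  let ?d = "\<lambda>a b us. nrm (A us) (a us \<ominus>\<^bsub>A us\<^esub> b us)"
  have "((\<lambda>us. C * ?d b' b us + ?d a' a us * D) \<longlongrightarrow> 0) (dir xs)"
    using tendsto_add[OF tendsto_mult_right_zero[OF lim(2), of C] tendsto_mult_left_zero[OF lim(1), of D]] by simp
  then have "(?d (\<lambda>us. a' us \<otimes>\<^bsub>A us\<^esub> b' us) (\<lambda>us. a us \<otimes>\<^bsub>A us\<^esub> b us) \<longlongrightarrow> 0) (dir xs)"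
  proof (rule tendsto_0_le)
    fix us
    interpret A: pre_cstar "A us" by (rule A)
    note c = asecD[OF s(1), of us] asecD[OF s(2), of us] asecD[OF s(3), of us] asecD[OF s(4), of us]
    show "0 \<le> ?d (\<lambda>us. a' us \<otimes>\<^bsub>A us\<^esub> b' us) (\<lambda>us. a us \<otimes>\<^bsub>A us\<^esub> b us) us"
      using c by (intro A.nrm_nonneg A.minus_closed A.m_closed)
    have "nrm (A us) (a' us) * ?d b' b us \<le> C * ?d b' b us"
      by (intro mult_right_mono CD A.nrm_nonneg A.minus_closed c)
    moreover have "?d a' a us * nrm (A us) (b us) \<le> ?d a' a us * D"
      by (intro mult_left_mono CD A.nrm_nonneg A.minus_closed c)
    ultimately show "?d (\<lambda>us. a' us \<otimes>\<^bsub>A us\<^esub> b' us) (\<lambda>us. a us \<otimes>\<^bsub>A us\<^esub> b us) us \<le> C * ?d b' b us + ?d a' a us * D"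
      using A.nrm_mult_diff[OF c] by linarith
  qed
  then have "ac (\<lambda>us. a' us \<otimes>\<^bsub>A us\<^esub> b' us) = ac (\<lambda>us. a us \<otimes>\<^bsub>A us\<^esub> b us)"
    unfolding ac_eq_iff[OF asec_mult[OF s(1,3)] asec_mult[OF s(2,4)]] .
  moreover have "ext_fun U obj_mult [M, x', y'] = val xs (\<lambda>us. Elem (a' us \<otimes>\<^bsub>A us\<^esub> b' us))"
    "ext_fun U obj_mult [M, x, y] = val xs (\<lambda>us. Elem (a us \<otimes>\<^bsub>A us\<^esub> b us))"
    unfolding v M_val val_args by simp_all
  ultimately show ?thesis by simp
qed

lemma halo_adj:
  assumes x: "x \<in> Fin U M" "x' \<in> halo U M x"
  shows "halo U M (ext_fun U obj_adj [M, x']) = halo U M (ext_fun U obj_adj [M, x])"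
proof (rule present_alg4[OF x(1) Fin_halo[OF x] x(1) x(1)])
  fix xs A a a'
  assume pres: "alg_pres U M P xs A" and s: "asec A a" "asec A a'"
    and v: "x = val xs (\<lambda>us. Elem (a us))" "x' = val xs (\<lambda>us. Elem (a' us))"
  interpret alg_pres U M P xs A by fact
  have "ac a' = ac a" using halo_eq[of x x'] x unfolding v Fin_def by blast
  note lim = this[unfolded ac_eq_iff[OF s]]
  have "nrm (A us) (adj (A us) (a' us) \<ominus>\<^bsub>A us\<^esub> adj (A us) (a us)) = nrm (A us) (a' us \<ominus>\<^bsub>A us\<^esub> a us)" for us
  proof -
    interpret A: pre_cstar "A us" by (rule A)
    note c = asecD[OF s(1), of us] asecD[OF s(2), of us]
    show ?thesis using A.adj_minus[OF c(2,1)] A.nrm_adj[OF A.minus_closed[OF c(2,1)]] by simp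
  qed
  with lim have "((\<lambda>us. nrm (A us) (adj (A us) (a' us) \<ominus>\<^bsub>A us\<^esub> adj (A us) (a us))) \<longlongrightarrow> 0) (dir xs)" by simp
  then have "ac (\<lambda>us. adj (A us) (a' us)) = ac (\<lambda>us. adj (A us) (a us))"
    unfolding ac_eq_iff[OF asec_adj[OF s(1)] asec_adj[OF s(2)]] .
  moreover have "ext_fun U obj_adj [M, x'] = val xs (\<lambda>us. Elem (adj (A us) (a' us)))"
    "ext_fun U obj_adj [M, x] = val xs (\<lambda>us. Elem (adj (A us) (a us)))"
    unfolding v M_val val_args by simp_all
  ultimately show ?thesis by simp
qed

lemma Fin_members: "x \<in> Fin U M \<Longrightarrow> x \<in> members U M" by (simp add: Fin_def)

lemma present_hull_alg:
  assumes "S \<in> hull_carrier U M" "T \<in> hull_carrier U M" "R \<in> hull_carrier U M"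
  obtains xs A a b c where "alg_pres U M P xs A" "asec A a" "asec A b" "asec A c"
    "S = halo U M (val xs (\<lambda>us. Elem (a us)))" "T = halo U M (val xs (\<lambda>us. Elem (b us)))"
    "R = halo U M (val xs (\<lambda>us. Elem (c us)))"
proof -
  obtain x y z where f: "x \<in> Fin U M" "y \<in> Fin U M" "z \<in> Fin U M" and S: "S = halo U M x" "T = halo U M y" "R = halo U M z"
    using assms unfolding hull_carrier_def by (elim imageE)
  show ?thesis
  proof (rule present_alg4[OF f f(3)])
    fix xs A a b c d
    assume p: "alg_pres U M P xs A" and s: "asec A a" "asec A b" "asec A c"
      and v: "x = val xs (\<lambda>us. Elem (a us))" "y = val xs (\<lambda>us. Elem (b us))" "z = val xs (\<lambda>us. Elem (c us))"
    show thesis by (rule that[OF p s]) (simp_all only: S v)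
  qed
qed

end

lemma ns_hull_simps:
  "carrier (ns_hull U M) = hull_carrier U M" "add (ns_hull U M) = hull_add U M"
  "smult (ns_hull U M) = hull_smult U M" "zero (ns_hull U M) = halo U M (ext_fun U obj_zero [M])"
  "one (ns_hull U M) = halo U M (ext_fun U obj_one [M])"
  "S \<otimes>\<^bsub>ns_hull U M\<^esub> T = (\<Union>x\<in>S. \<Union>y\<in>T. halo U M (ext_fun U obj_mult [M, x, y]))"
  "adj (ns_hull U M) S = (\<Union>x\<in>S. halo U M (ext_fun U obj_adj [M, x]))"
  by (simp_all add: ns_hull_def)

context alg_pres begin

lemma ac_mult: "asec A a \<Longrightarrow> asec A b \<Longrightarrow>
    ac a \<otimes>\<^bsub>ns_hull U M\<^esub> ac b = ac (\<lambda>us. a us \<otimes>\<^bsub>A us\<^esub> b us)"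
proof -
  assume a: "asec A a" and b: "asec A b"
  have "ac a \<otimes>\<^bsub>ns_hull U M\<^esub> ac b = halo U M (ext_fun U obj_mult [M, val xs (\<lambda>us. Elem (a us)), val xs (\<lambda>us. Elem (b us))])"
    unfolding ns_hull_simps
    by (intro UN_halo halo_mult asec_Fin Fin_members a b)
  also have "ext_fun U obj_mult [M, val xs (\<lambda>us. Elem (a us)), val xs (\<lambda>us. Elem (b us))] = val xs (\<lambda>us. Elem (a us \<otimes>\<^bsub>A us\<^esub> b us))"
    unfolding M_val val_args by simp
  finally show ?thesis .
qed

lemma ac_adj: "asec A a \<Longrightarrow> adj (ns_hull U M) (ac a) = ac (\<lambda>us. adj (A us) (a us))"
proof -
  assume a: "asec A a"
  have "adj (ns_hull U M) (ac a) = halo U M (ext_fun U obj_adj [M, val xs (\<lambda>us. Elem (a us))])"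
    unfolding ns_hull_simps
    by (intro UN_halo halo_adj asec_Fin Fin_members a)
  also have "ext_fun U obj_adj [M, val xs (\<lambda>us. Elem (a us))] = val xs (\<lambda>us. Elem (adj (A us) (a us)))"
    unfolding M_val val_args by simp
  finally show ?thesis .
qed

lemma ac_one: "\<one>\<^bsub>ns_hull U M\<^esub> = ac (\<lambda>us. \<one>\<^bsub>A us\<^esub>)"
  unfolding ns_hull_simps M_val val_args by simp

lemmas ac_simps = ac_add ac_smult ac_zero ac_mult ac_adj ac_one asec_add asec_smult asec_zero asec_mult asec_adj asec_one ac_carrier

end

context alg_hull begin

text \<open>Identities hold at each index and norm relations survive limits. Definiteness is of
  another kind: norm 0 means that the pointwise norms tend to 0, which is equality with the class of
  zero.\<close>

theorem hull_pre_cstar: "pre_cstar (ns_hull U M)"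
proof -
  let ?H = "ns_hull U M"
  have mod: "Module.module CC ?H" by (rule hull_module) (rule ns_hull_simps)+
  interpret H: cmodule ?H by (simp add: cmodule_def mod)
  have main: "S \<otimes>\<^bsub>?H\<^esub> T \<in> carrier ?H \<and> \<one>\<^bsub>?H\<^esub> \<in> carrier ?H \<and> adj ?H S \<in> carrier ?H \<and>
      S \<otimes>\<^bsub>?H\<^esub> T \<otimes>\<^bsub>?H\<^esub> R = S \<otimes>\<^bsub>?H\<^esub> (T \<otimes>\<^bsub>?H\<^esub> R) \<and> \<one>\<^bsub>?H\<^esub> \<otimes>\<^bsub>?H\<^esub> S = S \<and> S \<otimes>\<^bsub>?H\<^esub> \<one>\<^bsub>?H\<^esub> = S \<and>
      (S \<oplus>\<^bsub>?H\<^esub> T) \<otimes>\<^bsub>?H\<^esub> R = S \<otimes>\<^bsub>?H\<^esub> R \<oplus>\<^bsub>?H\<^esub> T \<otimes>\<^bsub>?H\<^esub> R \<and>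
      R \<otimes>\<^bsub>?H\<^esub> (S \<oplus>\<^bsub>?H\<^esub> T) = R \<otimes>\<^bsub>?H\<^esub> S \<oplus>\<^bsub>?H\<^esub> R \<otimes>\<^bsub>?H\<^esub> T \<and>
      (k \<odot>\<^bsub>?H\<^esub> S) \<otimes>\<^bsub>?H\<^esub> T = k \<odot>\<^bsub>?H\<^esub> (S \<otimes>\<^bsub>?H\<^esub> T) \<and> S \<otimes>\<^bsub>?H\<^esub> (k \<odot>\<^bsub>?H\<^esub> T) = k \<odot>\<^bsub>?H\<^esub> (S \<otimes>\<^bsub>?H\<^esub> T) \<and>
      adj ?H (adj ?H S) = S \<and> adj ?H (S \<oplus>\<^bsub>?H\<^esub> T) = adj ?H S \<oplus>\<^bsub>?H\<^esub> adj ?H T \<and>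
      adj ?H (S \<otimes>\<^bsub>?H\<^esub> T) = adj ?H T \<otimes>\<^bsub>?H\<^esub> adj ?H S \<and> adj ?H (k \<odot>\<^bsub>?H\<^esub> S) = cnj k \<odot>\<^bsub>?H\<^esub> adj ?H S \<and>
      0 \<le> nrm ?H S \<and> (nrm ?H S = 0 \<longleftrightarrow> S = \<zero>\<^bsub>?H\<^esub>) \<and> nrm ?H (k \<odot>\<^bsub>?H\<^esub> S) = cmod k * nrm ?H S \<and>
      nrm ?H (S \<oplus>\<^bsub>?H\<^esub> T) \<le> nrm ?H S + nrm ?H T \<and> nrm ?H (S \<otimes>\<^bsub>?H\<^esub> T) \<le> nrm ?H S * nrm ?H T \<and>
      nrm ?H (adj ?H S \<otimes>\<^bsub>?H\<^esub> S) = (nrm ?H S)\<^sup>2"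
    if STR: "S \<in> carrier ?H" "T \<in> carrier ?H" "R \<in> carrier ?H" for S T R k
  proof (rule present_hull_alg[OF STR[unfolded ns_hull_simps]])
    fix xs A a b c
    assume pres: "alg_pres U M P xs A" and s: "asec A a" "asec A b" "asec A c"
      and v: "S = halo U M (val xs (\<lambda>us. Elem (a us)))" "T = halo U M (val xs (\<lambda>us. Elem (b us)))"
        "R = halo U M (val xs (\<lambda>us. Elem (c us)))"
    interpret alg_pres U M P xs A by (rule pres)
    note m = asecD[OF s(1)] asecD[OF s(2)] asecD[OF s(3)]
    have p: "a us \<otimes>\<^bsub>A us\<^esub> b us \<otimes>\<^bsub>A us\<^esub> c us = a us \<otimes>\<^bsub>A us\<^esub> (b us \<otimes>\<^bsub>A us\<^esub> c us)"
      "\<one>\<^bsub>A us\<^esub> \<otimes>\<^bsub>A us\<^esub> a us = a us" "a us \<otimes>\<^bsub>A us\<^esub> \<one>\<^bsub>A us\<^esub> = a us"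
      "(a us \<oplus>\<^bsub>A us\<^esub> b us) \<otimes>\<^bsub>A us\<^esub> c us = a us \<otimes>\<^bsub>A us\<^esub> c us \<oplus>\<^bsub>A us\<^esub> b us \<otimes>\<^bsub>A us\<^esub> c us"
      "c us \<otimes>\<^bsub>A us\<^esub> (a us \<oplus>\<^bsub>A us\<^esub> b us) = c us \<otimes>\<^bsub>A us\<^esub> a us \<oplus>\<^bsub>A us\<^esub> c us \<otimes>\<^bsub>A us\<^esub> b us"
      "(k \<odot>\<^bsub>A us\<^esub> a us) \<otimes>\<^bsub>A us\<^esub> b us = k \<odot>\<^bsub>A us\<^esub> (a us \<otimes>\<^bsub>A us\<^esub> b us)"
      "a us \<otimes>\<^bsub>A us\<^esub> (k \<odot>\<^bsub>A us\<^esub> b us) = k \<odot>\<^bsub>A us\<^esub> (a us \<otimes>\<^bsub>A us\<^esub> b us)"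
      "adj (A us) (adj (A us) (a us)) = a us"
      "adj (A us) (a us \<oplus>\<^bsub>A us\<^esub> b us) = adj (A us) (a us) \<oplus>\<^bsub>A us\<^esub> adj (A us) (b us)"
      "adj (A us) (a us \<otimes>\<^bsub>A us\<^esub> b us) = adj (A us) (b us) \<otimes>\<^bsub>A us\<^esub> adj (A us) (a us)"
      "adj (A us) (k \<odot>\<^bsub>A us\<^esub> a us) = cnj k \<odot>\<^bsub>A us\<^esub> adj (A us) (a us)" for us
    proof -
      interpret A: pre_cstar "A us" by (rule A)
      note w = m[of us]
      show "a us \<otimes>\<^bsub>A us\<^esub> b us \<otimes>\<^bsub>A us\<^esub> c us = a us \<otimes>\<^bsub>A us\<^esub> (b us \<otimes>\<^bsub>A us\<^esub> c us)" by (rule A.m_assoc[OF w])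
      show "\<one>\<^bsub>A us\<^esub> \<otimes>\<^bsub>A us\<^esub> a us = a us" by (rule A.l_one[OF w(1)])
      show "a us \<otimes>\<^bsub>A us\<^esub> \<one>\<^bsub>A us\<^esub> = a us" by (rule A.r_one[OF w(1)])
      show "(a us \<oplus>\<^bsub>A us\<^esub> b us) \<otimes>\<^bsub>A us\<^esub> c us = a us \<otimes>\<^bsub>A us\<^esub> c us \<oplus>\<^bsub>A us\<^esub> b us \<otimes>\<^bsub>A us\<^esub> c us" by (rule A.l_distr[OF w])
      show "c us \<otimes>\<^bsub>A us\<^esub> (a us \<oplus>\<^bsub>A us\<^esub> b us) = c us \<otimes>\<^bsub>A us\<^esub> a us \<oplus>\<^bsub>A us\<^esub> c us \<otimes>\<^bsub>A us\<^esub> b us" by (rule A.r_distr[OF w])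
      show "(k \<odot>\<^bsub>A us\<^esub> a us) \<otimes>\<^bsub>A us\<^esub> b us = k \<odot>\<^bsub>A us\<^esub> (a us \<otimes>\<^bsub>A us\<^esub> b us)" by (rule A.smult_mult_left[OF w(1,2)])
      show "a us \<otimes>\<^bsub>A us\<^esub> (k \<odot>\<^bsub>A us\<^esub> b us) = k \<odot>\<^bsub>A us\<^esub> (a us \<otimes>\<^bsub>A us\<^esub> b us)" by (rule A.smult_mult_right[OF w(1,2)])
      show "adj (A us) (adj (A us) (a us)) = a us" by (rule A.adj_adj[OF w(1)])
      show "adj (A us) (a us \<oplus>\<^bsub>A us\<^esub> b us) = adj (A us) (a us) \<oplus>\<^bsub>A us\<^esub> adj (A us) (b us)" by (rule A.adj_add[OF w(1,2)])
      show "adj (A us) (a us \<otimes>\<^bsub>A us\<^esub> b us) = adj (A us) (b us) \<otimes>\<^bsub>A us\<^esub> adj (A us) (a us)" by (rule A.adj_mult[OF w(1,2)])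
      show "adj (A us) (k \<odot>\<^bsub>A us\<^esub> a us) = cnj k \<odot>\<^bsub>A us\<^esub> adj (A us) (a us)" by (rule A.adj_smult[OF w(1)])
    qed
    note lim = asec_norm_limit
    note uniq = tendsto_unique[OF dir_neq_bot]
    have n1: "0 \<le> nrm ?H (ac a)"
      by (rule tendsto_lowerbound[OF lim[OF s(1)] always_eventually dir_neq_bot]) (intro allI pre_cstar.nrm_nonneg[OF A m(1)])
    have e: "nrm (A us) (a us \<ominus>\<^bsub>A us\<^esub> \<zero>\<^bsub>A us\<^esub>) = nrm (A us) (a us)" for us
    proof -
      interpret A: pre_cstar "A us" by (rule A)
      show ?thesis using m(1)[of us] by (simp add: A.minus_eq)
    qed
    have n2: "nrm ?H (ac a) = 0 \<longleftrightarrow> ac a = ac (\<lambda>us. \<zero>\<^bsub>A us\<^esub>)"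
      unfolding ac_eq_iff[OF asec_zero s(1)] e
    proof
      assume "nrm ?H (ac a) = 0"
      then show "((\<lambda>us. nrm (A us) (a us)) \<longlongrightarrow> 0) (dir xs)" using lim[OF s(1)] by simp
    next
      assume "((\<lambda>us. nrm (A us) (a us)) \<longlongrightarrow> 0) (dir xs)"
      then show "nrm ?H (ac a) = 0" by (rule uniq[OF lim[OF s(1)]])
    qed
    have n3: "nrm ?H (ac (\<lambda>us. k \<odot>\<^bsub>A us\<^esub> a us)) = cmod k * nrm ?H (ac a)"
      by (rule uniq[OF lim[OF asec_smult[OF s(1)]]])
        (use tendsto_mult_left[OF lim[OF s(1)], of "cmod k"] pre_cstar.nrm_smult[OF A m(1)] in simp)
    have n4: "nrm ?H (ac (\<lambda>us. a us \<oplus>\<^bsub>A us\<^esub> b us)) \<le> nrm ?H (ac a) + nrm ?H (ac b)"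
      by (rule tendsto_le[OF dir_neq_bot tendsto_add[OF lim[OF s(1)] lim[OF s(2)]] lim[OF asec_add[OF s(1,2)]] always_eventually])
        (intro allI pre_cstar.nrm_add[OF A m(1,2)])
    have n5: "nrm ?H (ac (\<lambda>us. a us \<otimes>\<^bsub>A us\<^esub> b us)) \<le> nrm ?H (ac a) * nrm ?H (ac b)"
      by (rule tendsto_le[OF dir_neq_bot tendsto_mult[OF lim[OF s(1)] lim[OF s(2)]] lim[OF asec_mult[OF s(1,2)]] always_eventually])
        (intro allI pre_cstar.nrm_mult[OF A m(1,2)])
    have n6: "nrm ?H (ac (\<lambda>us. adj (A us) (a us) \<otimes>\<^bsub>A us\<^esub> a us)) = (nrm ?H (ac a))\<^sup>2"
      by (rule uniq[OF lim[OF asec_mult[OF asec_adj[OF s(1)] s(1)]]])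
        (use tendsto_power[OF lim[OF s(1)], of 2] pre_cstar.nrm_cstar[OF A m(1)] in simp)
    show ?thesis
      unfolding v
      by (intro conjI; simp only: ns_hull_simps(1-4) ac_simps s p n1 n2 n3 n4 n5 n6)
  qed
  have zero: "\<zero>\<^bsub>?H\<^esub> \<in> carrier ?H" by simp
  note c1 = main[THEN conjunct1] and t1 = main[THEN conjunct2]
  note c2 = t1[THEN conjunct1] and t2 = t1[THEN conjunct2]
  note c3 = t2[THEN conjunct1] and t3 = t2[THEN conjunct2]
  note c4 = t3[THEN conjunct1] and t4 = t3[THEN conjunct2]
  note c5 = t4[THEN conjunct1] and t5 = t4[THEN conjunct2]
  note c6 = t5[THEN conjunct1] and t6 = t5[THEN conjunct2]
  note c7 = t6[THEN conjunct1] and t7 = t6[THEN conjunct2]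
  note c8 = t7[THEN conjunct1] and t8 = t7[THEN conjunct2]
  note c9 = t8[THEN conjunct1] and t9 = t8[THEN conjunct2]
  note c10 = t9[THEN conjunct1] and t10 = t9[THEN conjunct2]
  note c11 = t10[THEN conjunct1] and t11 = t10[THEN conjunct2]
  note c12 = t11[THEN conjunct1] and t12 = t11[THEN conjunct2]
  note c13 = t12[THEN conjunct1] and t13 = t12[THEN conjunct2]
  note c14 = t13[THEN conjunct1] and t14 = t13[THEN conjunct2]
  note c15 = t14[THEN conjunct1] and t15 = t14[THEN conjunct2]
  note c16 = t15[THEN conjunct1] and t16 = t15[THEN conjunct2]
  note c17 = t16[THEN conjunct1] and t17 = t16[THEN conjunct2]
  note c18 = t17[THEN conjunct1] and t18 = t17[THEN conjunct2]
  note c19 = t18[THEN conjunct1] and c20 = t18[THEN conjunct2]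
  have ring: "ring ?H"
    by (intro ringI H.M.abelian_group_axioms monoidI; (rule c1 c2 c4 c5 c6 c7 c8; assumption | rule c2[OF zero zero zero]))
  show ?thesis
    by (intro pre_cstar.intro H.cmodule_axioms ring pre_cstar_axioms.intro;
      (rule c9 c10 c3 c11 c12 c13 c14 c15 c16 c17 c18 c19 c20; assumption))
qed

end

section \<open>Saturation for sequences of conditions\<close>

context ns_transfer begin

text \<open>Internal sets take their variable in front of the parameters, whereas existential
  witnesses were appended at the end. Rotating the tuple reconciles the two conventions.\<close>

lemma eventually_dir_Cons:
  "eventually (\<lambda>us. y_us (us ! length xs) (take (length xs) us)) (dir (xs @ [y])) \<longleftrightarrow>
   eventually (\<lambda>us. y_us (hd us) (tl us)) (dir (y # xs))"
proof -
  let ?n = "length xs"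
  let ?is = "?n # [0..<?n]"
  have m: "map ((!) (xs @ [y])) ?is = y # xs" by (intro nth_equalityI) (auto simp: nth_append nth_Cons split: nat.splits)
  have "eventually (\<lambda>us. map ((!) us) ?is \<in> {us. y_us (hd us) (tl us)}) (dir (xs @ [y])) \<longleftrightarrow>
      y # xs \<in> ext U {us. y_us (hd us) (tl us)}"
    unfolding m[symmetric] by (rule eventually_dir_proj) auto
  moreover have "eventually (\<lambda>us. map ((!) us) ?is \<in> {us. y_us (hd us) (tl us)} \<longleftrightarrow>
      y_us (us ! ?n) (take ?n us)) (dir (xs @ [y]))"
    using eventually_dir_length[of "xs @ [y]"]
  proof eventually_elim
    case (elim us)
    then have "map ((!) us) [0..<?n] = take ?n us" by (intro nth_equalityI) auto
    then show ?case by simp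
  qed
  ultimately show ?thesis by (simp add: eventually_subst eventually_dir[of _ "y # xs"])
qed

lemma skolem_Cons: "(\<exists>y. y # xs \<in> ext U R) \<longleftrightarrow> eventually (\<lambda>us. \<exists>u. u # us \<in> R) (dir xs)"
proof -
  have "y # xs \<in> ext U R \<longleftrightarrow> xs @ [y] \<in> ext U {us @ [u] | u us. u # us \<in> R}" for y
  proof -
    have 1: "y # xs \<in> ext U R \<longleftrightarrow> eventually (\<lambda>us. hd us # tl us \<in> R) (dir (y # xs))"
      unfolding ext_iff_eventually
      by (rule eventually_subst, rule eventually_mono[OF eventually_dir_length[of "y # xs"]]) (auto simp: length_Suc_conv)
    have 2: "xs @ [y] \<in> ext U {us @ [u] | u us. u # us \<in> R} \<longleftrightarrow>
        eventually (\<lambda>us. us ! length xs # take (length xs) us \<in> R) (dir (xs @ [y]))"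
      unfolding ext_iff_eventually
    proof (rule eventually_subst, rule eventually_mono[OF eventually_dir_length[of "xs @ [y]"]])
      fix us :: "'v list" assume "length us = length (xs @ [y])"
      then obtain vs v where us: "us = vs @ [v]" "length vs = length xs" by (auto simp: length_Suc_conv_rev)
      then show "us \<in> {us @ [u] | u us. u # us \<in> R} \<longleftrightarrow> us ! length xs # take (length xs) us \<in> R"
        by (auto simp: nth_append)
    qed
    show ?thesis unfolding 1 2 using eventually_dir_Cons[of "\<lambda>u us. u # us \<in> R" xs y] by simp
  qed
  then show ?thesis unfolding skolem by (simp add: skolem)
qed

end

context ns_saturated begin

text \<open>The parameters \<open>qs m\<close> may change with m. A finite subfamily is contained in
  an initial segment of the conditions.\<close>

lemma saturation_lists:
  assumes "\<And>n. \<exists>x. \<forall>m\<le>n. x # qs m \<in> ext U (R m)"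
  shows "\<exists>x. \<forall>m :: nat. x # qs m \<in> ext U (R m)"
proof -
  define A where "A m = {x. x # qs m \<in> ext U (R m)}" for m
  have "\<Inter>(range A) \<noteq> {}"
  proof (rule countably_saturated)
    show "range A \<subseteq> internal_sets U" unfolding A_def internal_sets_def by blast
    fix G assume "G \<subseteq> range A" "finite G"
    then obtain I where I: "finite I" "G = A ` I" by (metis finite_subset_image)
    \<comment> \<open>The inserted 0 covers an empty I.\<close>
    obtain x where "\<forall>m\<le>Max (insert 0 I). x # qs m \<in> ext U (R m)" using assms by blast
    then have "x \<in> \<Inter>G" using I by (auto simp: A_def)
    then show "\<Inter>G \<noteq> {}" by blast
  qed auto
  then show ?thesis by (auto simp: A_def)
qed

text \<open>For decreasing conditions on one parameter tuple, a witness of the n-th condition serves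
  for all earlier ones.\<close>

lemma saturation_decreasing:
  assumes "\<And>n. eventually (\<lambda>us. \<exists>u. u # us \<in> R n) (dir xs)" and "\<And>m n. m \<le> n \<Longrightarrow> R n \<subseteq> R m"
  shows "\<exists>x. \<forall>m :: nat. x # xs \<in> ext U (R m)"
proof (rule saturation_lists)
  fix n
  obtain x where x: "x # xs \<in> ext U (R n)" using assms(1)[of n] skolem_Cons[of xs "R n"] by blast
  have "x # xs \<in> ext U (R m)" if "m \<le> n" for m
    by (rule ext_mono[OF x]) (use assms(2)[OF that] in blast)
  then show "\<exists>x. \<forall>m\<le>n. x # xs \<in> ext U (R m)" by blast
qed

end

context alg_pres begin

lemma ac_cong: "eventually (\<lambda>us. a us = b us) (dir xs) \<Longrightarrow> ac a = ac b"
proof -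
  assume "eventually (\<lambda>us. a us = b us) (dir xs)"
  then have "val xs (\<lambda>us. Elem (a us)) = val xs (\<lambda>us. Elem (b us))"
    unfolding val_eq_iff by eventually_elim simp
  then show ?thesis by simp
qed

text \<open>The scalars of a bounded internal combination of orthogonal projections may be chosen
  bounded, and then replaced by their standard parts.\<close>

lemma ac_combs:
  "asec A s \<Longrightarrow> (\<And>us. s us \<in> combs (A us) n) \<Longrightarrow> ac s \<in> combs (ns_hull U M) n"
proof (induction n arbitrary: s)
  case 0
  then have "s = (\<lambda>us. \<zero>\<^bsub>A us\<^esub>)" by (intro ext) simp
  then show ?case by (simp only: combs.simps ns_hull_simps ac_zero singleton_iff)
next
  case (Suc n)
  let ?H = "ns_hull U M"
  have "\<exists>d. s us = fst d \<odot>\<^bsub>A us\<^esub> fst (snd d) \<oplus>\<^bsub>A us\<^esub> snd (snd d) \<and> fst (snd d) \<in> projections (A us) \<and>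
      snd (snd d) \<in> combs (A us) n \<and> fst (snd d) \<otimes>\<^bsub>A us\<^esub> snd (snd d) = \<zero>\<^bsub>A us\<^esub> \<and>
      snd (snd d) \<otimes>\<^bsub>A us\<^esub> fst (snd d) = \<zero>\<^bsub>A us\<^esub> \<and> (fst (snd d) = \<zero>\<^bsub>A us\<^esub> \<longrightarrow> fst d = 0)" for us
  proof -
    interpret A: pre_cstar "A us" by (rule A)
    obtain \<alpha> p t where d: "s us = \<alpha> \<odot>\<^bsub>A us\<^esub> p \<oplus>\<^bsub>A us\<^esub> t" "p \<in> projections (A us)" "t \<in> combs (A us) n"
      "p \<otimes>\<^bsub>A us\<^esub> t = \<zero>\<^bsub>A us\<^esub>" "t \<otimes>\<^bsub>A us\<^esub> p = \<zero>\<^bsub>A us\<^esub>"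
      using Suc.prems(2)[of us] unfolding combs.simps by blast
    show ?thesis
    proof (cases "p = \<zero>\<^bsub>A us\<^esub>")
      case True
      \<comment> \<open>A zero projection could carry an arbitrarily large scalar, so its scalar is
        reset to 0.\<close>
      have "s us = 0 \<odot>\<^bsub>A us\<^esub> p \<oplus>\<^bsub>A us\<^esub> t" using d(1) True by simp
      then show ?thesis using d by (intro exI[of _ "(0, p, t)"]) simp
    next
      case False
      then show ?thesis using d by (intro exI[of _ "(\<alpha>, p, t)"]) simp
    qed
  qed
  then have "\<forall>us. \<exists>d. s us = fst d \<odot>\<^bsub>A us\<^esub> fst (snd d) \<oplus>\<^bsub>A us\<^esub> snd (snd d) \<and> fst (snd d) \<in> projections (A us) \<and>
      snd (snd d) \<in> combs (A us) n \<and> fst (snd d) \<otimes>\<^bsub>A us\<^esub> snd (snd d) = \<zero>\<^bsub>A us\<^esub> \<and>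
      snd (snd d) \<otimes>\<^bsub>A us\<^esub> fst (snd d) = \<zero>\<^bsub>A us\<^esub> \<and> (fst (snd d) = \<zero>\<^bsub>A us\<^esub> \<longrightarrow> fst d = 0)" by (rule allI)
  from choice[OF this] obtain d where d: "\<forall>us. s us = fst (d us) \<odot>\<^bsub>A us\<^esub> fst (snd (d us)) \<oplus>\<^bsub>A us\<^esub> snd (snd (d us)) \<and>
      fst (snd (d us)) \<in> projections (A us) \<and>
      snd (snd (d us)) \<in> combs (A us) n \<and> fst (snd (d us)) \<otimes>\<^bsub>A us\<^esub> snd (snd (d us)) = \<zero>\<^bsub>A us\<^esub> \<and>
      snd (snd (d us)) \<otimes>\<^bsub>A us\<^esub> fst (snd (d us)) = \<zero>\<^bsub>A us\<^esub> \<and>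
      (fst (snd (d us)) = \<zero>\<^bsub>A us\<^esub> \<longrightarrow> fst (d us) = 0)" ..
  define \<alpha> p t where "\<alpha> us = fst (d us)" and "p us = fst (snd (d us))" and "t us = snd (snd (d us))" for us
  have d: "s us = \<alpha> us \<odot>\<^bsub>A us\<^esub> p us \<oplus>\<^bsub>A us\<^esub> t us" "p us \<in> projections (A us)" "t us \<in> combs (A us) n"
    "p us \<otimes>\<^bsub>A us\<^esub> t us = \<zero>\<^bsub>A us\<^esub>" "t us \<otimes>\<^bsub>A us\<^esub> p us = \<zero>\<^bsub>A us\<^esub>" "p us = \<zero>\<^bsub>A us\<^esub> \<Longrightarrow> \<alpha> us = 0" for us
    using d[rule_format, of us] by (simp_all only: \<alpha>_def p_def t_def)
  obtain C where C: "\<And>us. nrm (A us) (s us) \<le> C" using Suc.prems(1) by (auto simp: asec_def)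
  have pc: "p us \<in> carrier (A us)" and tc: "t us \<in> carrier (A us)" for us
    using pre_cstar.projD(1)[OF A d(2)] pre_cstar.combs_closed[OF A d(3)] .
  have bnd: "cmod (\<alpha> us) \<le> C \<and> nrm (A us) (p us) \<le> 1 \<and> nrm (A us) (t us) \<le> C + C" for us
  proof -
    interpret A: pre_cstar "A us" by (rule A)
    have sc: "s us \<in> carrier (A us)" by (rule asecD[OF Suc.prems(1)])
    have C0: "0 \<le> C" using C[of us] A.nrm_nonneg[OF sc] by linarith
    have p1: "nrm (A us) (p us) \<le> 1" by (rule A.nrm_proj_le[OF d(2)])
    have \<alpha>: "cmod (\<alpha> us) \<le> C"
    proof (cases "p us = \<zero>\<^bsub>A us\<^esub>")
      case True then show ?thesis using d(6) C0 by simp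
    next
      case False
      \<comment> \<open>Multiplication by the leading projection isolates its scalar, which is
        thereby bounded by the norm of s.\<close>
      have "p us \<otimes>\<^bsub>A us\<^esub> s us = \<alpha> us \<odot>\<^bsub>A us\<^esub> p us"
        unfolding d(1) using pc tc d(4) A.projD(3)[OF d(2)] by (simp add: A.r_distr A.smult_mult_right)
      then have "cmod (\<alpha> us) * nrm (A us) (p us) = nrm (A us) (p us \<otimes>\<^bsub>A us\<^esub> s us)" using A.nrm_smult[OF pc] by simp
      also have "\<dots> \<le> nrm (A us) (p us) * nrm (A us) (s us)" by (rule A.nrm_mult[OF pc sc])
      finally show ?thesis using A.nrm_proj[OF d(2) False] C[of us] by simp
    qed
    have "t us = s us \<oplus>\<^bsub>A us\<^esub> (- \<alpha> us) \<odot>\<^bsub>A us\<^esub> p us"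
    proof -
      have "s us \<oplus>\<^bsub>A us\<^esub> (- \<alpha> us) \<odot>\<^bsub>A us\<^esub> p us = t us \<oplus>\<^bsub>A us\<^esub> (\<alpha> us \<odot>\<^bsub>A us\<^esub> p us \<oplus>\<^bsub>A us\<^esub> (- \<alpha> us) \<odot>\<^bsub>A us\<^esub> p us)"
        unfolding d(1) using pc tc by (simp add: A.a_ac)
      also have "\<alpha> us \<odot>\<^bsub>A us\<^esub> p us \<oplus>\<^bsub>A us\<^esub> (- \<alpha> us) \<odot>\<^bsub>A us\<^esub> p us = \<zero>\<^bsub>A us\<^esub>"
        using A.smult_add_left[OF pc, of "\<alpha> us" "- \<alpha> us"] pc by simp
      finally show ?thesis using tc by simp
    qed
    then have "nrm (A us) (t us) \<le> nrm (A us) (s us) + cmod (\<alpha> us) * nrm (A us) (p us)"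
      using A.nrm_add[OF sc A.smult_cl[OF pc], of "- \<alpha> us"] A.nrm_smult[OF pc, of "- \<alpha> us"] by simp
    also have "\<dots> \<le> C + C * 1"
      using C[of us] \<alpha> p1 C0 A.nrm_nonneg[OF pc] by (intro add_mono mult_mono)
    finally show ?thesis using \<alpha> p1 by simp
  qed
  have ps: "asec A p" and ts: "asec A t" unfolding asec_def using pc tc bnd by blast+
  \<comment> \<open>Bounded scalars converge along the ultrafilter. Replacing them by the limit c
    costs at most \<open>cmod (\<alpha> us - c)\<close>, as projections have norm at most 1.\<close>
  have "eventually (\<lambda>us. \<alpha> us \<in> cball 0 C) (dir xs)" using bnd by (intro always_eventually) simp
  from dir_tendsto[OF this compact_cball] obtain c where c: "(\<alpha> \<longlongrightarrow> c) (dir xs)" by blast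
  have "ac s = ac (\<lambda>us. c \<odot>\<^bsub>A us\<^esub> p us \<oplus>\<^bsub>A us\<^esub> t us)"
    unfolding ac_eq_iff[OF asec_add[OF asec_smult[OF ps] ts] Suc.prems(1)]
  proof (rule tendsto_0_le)
    have "((\<lambda>us. \<alpha> us - c) \<longlongrightarrow> 0) (dir xs)" using c by (simp add: LIM_zero_iff)
    then show "((\<lambda>us. cmod (\<alpha> us - c)) \<longlongrightarrow> 0) (dir xs)" by (rule tendsto_norm_zero)
    fix us
    interpret A: pre_cstar "A us" by (rule A)
    have sc: "s us \<in> carrier (A us)" by (rule asecD[OF Suc.prems(1)])
    have cl: "c \<odot>\<^bsub>A us\<^esub> p us \<oplus>\<^bsub>A us\<^esub> t us \<in> carrier (A us)" using pc tc by simp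
    show "0 \<le> nrm (A us) (s us \<ominus>\<^bsub>A us\<^esub> (c \<odot>\<^bsub>A us\<^esub> p us \<oplus>\<^bsub>A us\<^esub> t us))"
      by (rule A.nrm_nonneg[OF A.minus_closed[OF sc cl]])
    have "s us \<ominus>\<^bsub>A us\<^esub> (c \<odot>\<^bsub>A us\<^esub> p us \<oplus>\<^bsub>A us\<^esub> t us) =
        (\<alpha> us \<odot>\<^bsub>A us\<^esub> p us \<oplus>\<^bsub>A us\<^esub> (- c) \<odot>\<^bsub>A us\<^esub> p us) \<oplus>\<^bsub>A us\<^esub> (t us \<oplus>\<^bsub>A us\<^esub> (-1) \<odot>\<^bsub>A us\<^esub> t us)"
      unfolding d(1) using pc tc by (simp add: A.minus_eq_smult A.smult_add_right A.a_ac)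
    also have "\<alpha> us \<odot>\<^bsub>A us\<^esub> p us \<oplus>\<^bsub>A us\<^esub> (- c) \<odot>\<^bsub>A us\<^esub> p us = (\<alpha> us - c) \<odot>\<^bsub>A us\<^esub> p us"
      using A.smult_add_left[OF pc, of "\<alpha> us" "- c"] by simp
    also have "t us \<oplus>\<^bsub>A us\<^esub> (-1) \<odot>\<^bsub>A us\<^esub> t us = \<zero>\<^bsub>A us\<^esub>"
      using A.minus_eq_smult[OF tc tc] A.minus_eq_zero_iff[OF tc tc] by simp
    finally have "nrm (A us) (s us \<ominus>\<^bsub>A us\<^esub> (c \<odot>\<^bsub>A us\<^esub> p us \<oplus>\<^bsub>A us\<^esub> t us)) = cmod (\<alpha> us - c) * nrm (A us) (p us)"
      using A.nrm_smult[OF pc] pc by simp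
    also have "\<dots> \<le> cmod (\<alpha> us - c) * 1" using bnd[of us] by (intro mult_left_mono) simp_all
    finally show "nrm (A us) (s us \<ominus>\<^bsub>A us\<^esub> (c \<odot>\<^bsub>A us\<^esub> p us \<oplus>\<^bsub>A us\<^esub> t us)) \<le> cmod (\<alpha> us - c)" by simp
  qed
  also have "\<dots> = c \<odot>\<^bsub>?H\<^esub> ac p \<oplus>\<^bsub>?H\<^esub> ac t"
    by (simp only: ns_hull_simps ac_simps ps ts)
  finally have eq: "ac s = c \<odot>\<^bsub>?H\<^esub> ac p \<oplus>\<^bsub>?H\<^esub> ac t" .
  have "ac p \<in> projections ?H"
    unfolding projections_def mem_Collect_eq
    using pre_cstar.projD[OF A d(2)] by (simp only: ns_hull_simps(1) ac_simps ps simp_thms)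
  moreover have "ac p \<otimes>\<^bsub>?H\<^esub> ac t = \<zero>\<^bsub>?H\<^esub>" "ac t \<otimes>\<^bsub>?H\<^esub> ac p = \<zero>\<^bsub>?H\<^esub>"
    by (simp_all only: ns_hull_simps(4) ac_simps ps ts d(4,5))
  ultimately show ?case
    unfolding combs.simps mem_Collect_eq using eq Suc.IH[OF ts d(3)] by blast
qed

end

text \<open>In the absence of n orthogonal nonzero projections, the combinations given by the
  definition of a P*-algebra have fewer than n nonzero projections, however long they are.\<close>

lemma (in pre_cstar) P_star_combs:
  assumes "P_star_algebra A" "\<not> many_projections A n" "a \<in> carrier A" "adj A a = a" "e > 0"
  shows "\<exists>s\<in>combs A n. nrm A (s \<ominus> a) < e"
proof -
  obtain s :: "nat \<Rightarrow> 'a" where s: "range s \<subseteq> projection_combinations A" "(\<lambda>k. nrm A (s k \<ominus> a)) \<longlonglongrightarrow> 0"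
    using assms(1,3,4) unfolding P_star_algebra_def by blast
  have "eventually (\<lambda>k. nrm A (s k \<ominus> a) < e) sequentially" using order_tendstoD(2)[OF s(2) assms(5)] .
  then obtain k where "nrm A (s k \<ominus> a) < e" by (auto simp: eventually_sequentially)
  moreover have "s k \<in> combs A n" using projection_combinations_combs[OF assms(2)] s(1) by blast
  ultimately show ?thesis by blast
qed

text \<open>For every standard m there is a combination of length n within 1/(m+1) of a given
  self-adjoint element. Saturation provides one that is infinitely close, so it has the same class,
  and \<open>ac_combs\<close> decomposes this class.\<close>

lemma (in ns_objects) bounded_combs_hull:
  assumes M: "[M] \<in> ext U {[Alg A] | A. P_star_algebra A \<and> \<not> many_projections A n}"
  shows "bounded_combs (ns_hull U M) n"
proof -
  let ?P = "\<lambda>A. P_star_algebra A \<and> \<not> many_projections A n" and ?H = "ns_hull U M"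
  interpret alg_hull U M ?P
    by (intro alg_hull.intro ns_objects_axioms alg_hull_axioms.intro M cstar_algebra_pre_cstar) (simp add: P_star_algebra_def)
  interpret H: pre_cstar ?H by (rule hull_pre_cstar)
  have "S \<in> combs ?H n" if S: "S \<in> carrier ?H" "adj ?H S = S" for S
  proof (rule present_hull_alg[OF S(1)[unfolded ns_hull_simps] S(1)[unfolded ns_hull_simps] S(1)[unfolded ns_hull_simps]])
    fix xs A a0
    assume pres: "alg_pres U M ?P xs A" and a0: "asec A a0" and v: "S = halo U M (val xs (\<lambda>us. Elem (a0 us)))"
    interpret alg_pres U M ?P xs A by (rule pres)
    \<comment> \<open>A representative of S is self-adjoint only up to an infinitesimal. Its real
      part is self-adjoint at every index and has the same class.\<close>
    define a where "a us = (1/2) \<odot>\<^bsub>A us\<^esub> (a0 us \<oplus>\<^bsub>A us\<^esub> adj (A us) (a0 us))" for us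
    have a: "asec A a" unfolding a_def by (intro asec_smult asec_add asec_adj a0)
    have asa: "adj (A us) (a us) = a us" for us
    proof -
      interpret A: pre_cstar "A us" by (rule A)
      show ?thesis unfolding a_def using asecD[OF a0, of us] by (simp add: A.adj_smult A.adj_add A.a_comm)
    qed
    have "ac a = (1/2) \<odot>\<^bsub>?H\<^esub> (S \<oplus>\<^bsub>?H\<^esub> adj ?H S)"
      unfolding v a_def by (simp only: ns_hull_simps(2,3) ac_simps a0)
    also have "\<dots> = S" unfolding S(2) using S(1)
      by (simp add: H.smult_add_right H.smult_add_left[symmetric])
    finally have aS: "ac a = S" .
    obtain C where C: "\<And>us. nrm (A us) (a us) \<le> C" using a by (auto simp: asec_def)
    \<comment> \<open>The relation also records the algebra and the bound C, so that the tuple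
      enlarged by the combination can be presented again with bounded sections.\<close>
    define R :: "nat \<Rightarrow> ('a, 'h, 'w) obj list set" where "R m = {[Elem s, Alg A, Elem a] | s A a. ?P A \<and> a \<in> carrier A \<and> nrm A a \<le> C \<and>
      s \<in> combs A n \<and> nrm A (s \<ominus>\<^bsub>A\<^esub> a) < 1 / real (Suc m)}" for m
    let ?x = "val xs (\<lambda>us. Elem (a us))"
    have "\<exists>s. \<forall>m. s # [M, ?x] \<in> ext U (R m)"
    proof (rule saturation_decreasing)
      fix m
      have "\<exists>u. u # [Alg (A us), Elem (a us)] \<in> R m" for us
      proof -
        interpret A: pre_cstar "A us" by (rule A)
        have "\<exists>s\<in>combs (A us) n. nrm (A us) (s \<ominus>\<^bsub>A us\<^esub> a us) < 1 / real (Suc m)"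
          using PA[of us] by (intro A.P_star_combs asecD[OF a] asa) simp_all
        then obtain s where s: "s \<in> combs (A us) n" "nrm (A us) (s \<ominus>\<^bsub>A us\<^esub> a us) < 1 / real (Suc m)" ..
        show ?thesis unfolding R_def
          by (intro exI[of _ "Elem s"] CollectI exI[of _ s] exI[of _ "A us"] exI[of _ "a us"] conjI refl PA[THEN conjunct1]
            PA[THEN conjunct2] asecD[OF a] C s)
      qed
      then have "map (val xs) [\<lambda>us. Alg (A us), \<lambda>us. Elem (a us)] \<in> ext U {us. \<exists>u. u # us \<in> R m}"
        unfolding ext_map_val by (intro always_eventually) simp
      then show "eventually (\<lambda>us. \<exists>u. u # us \<in> R m) (dir [M, ?x])"
        unfolding eventually_dir using M_val by simp
    next
      fix k m :: nat assume "k \<le> m"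
      then have "1 / real (Suc m) \<le> 1 / real (Suc k)" by (simp add: frac_le)
      then have "\<And>t. t < 1 / real (Suc m) \<Longrightarrow> t < 1 / real (Suc k)" by linarith
      then show "R m \<subseteq> R k" unfolding R_def by (intro Collect_mono impI) (elim exE conjE, intro exI conjI)
    qed
    then obtain s where s: "\<And>m. [s, M, ?x] \<in> ext U (R m)" by blast
    \<comment> \<open>The combination need not be a value at the first tuple. Presenting the triple
      gives new algebras and representatives over a tuple that contains it.\<close>
    from present[OF s[of 0]] obtain fs where fs: "[s, M, ?x] = map (val [s, M, ?x]) fs"
      "\<forall>us. map (\<lambda>f. f us) fs \<in> R 0" by (elim exE conjE) (rule that)
    define ys where "ys = [s, M, ?x]"
    have "length fs = 3" using arg_cong[OF fs(1), of length] by simp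
    then obtain f g h where fgh: "fs = [f, g, h]" by (auto simp: length_Suc_conv numeral_3_eq_3)
    have "[s, M, ?x] = [val ys f, val ys g, val ys h]" using fs(1) by (simp only: ys_def fgh list.map)
    then have val: "s = val ys f" "M = val ys g" "?x = val ys h" by simp_all
    have "\<forall>us. \<exists>d. f us = Elem (fst d) \<and> g us = Alg (fst (snd d)) \<and> h us = Elem (snd (snd d)) \<and> ?P (fst (snd d)) \<and>
      snd (snd d) \<in> carrier (fst (snd d)) \<and> nrm (fst (snd d)) (snd (snd d)) \<le> C \<and>
      fst d \<in> combs (fst (snd d)) n \<and> nrm (fst (snd d)) (fst d \<ominus>\<^bsub>fst (snd d)\<^esub> snd (snd d)) < 1"
    proof
      fix us
      have "[f us, g us, h us] \<in> R 0" using fs(2)[rule_format, of us] by (simp add: fgh)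
      then obtain s A a where d: "f us = Elem s" "g us = Alg A" "h us = Elem a" "?P A" "a \<in> carrier A" "nrm A a \<le> C"
        "s \<in> combs A n" "nrm A (s \<ominus>\<^bsub>A\<^esub> a) < 1 / real (Suc 0)" unfolding R_def by blast
      then show "\<exists>d. f us = Elem (fst d) \<and> g us = Alg (fst (snd d)) \<and> h us = Elem (snd (snd d)) \<and> ?P (fst (snd d)) \<and>
        snd (snd d) \<in> carrier (fst (snd d)) \<and> nrm (fst (snd d)) (snd (snd d)) \<le> C \<and>
        fst d \<in> combs (fst (snd d)) n \<and> nrm (fst (snd d)) (fst d \<ominus>\<^bsub>fst (snd d)\<^esub> snd (snd d)) < 1"
        by (intro exI[of _ "(s, A, a)"]) simp
    qed
    from choice[OF this] obtain d where d: "\<forall>us. f us = Elem (fst (d us)) \<and> g us = Alg (fst (snd (d us))) \<and>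
      h us = Elem (snd (snd (d us))) \<and> ?P (fst (snd (d us))) \<and>
      snd (snd (d us)) \<in> carrier (fst (snd (d us))) \<and> nrm (fst (snd (d us))) (snd (snd (d us))) \<le> C \<and>
      fst (d us) \<in> combs (fst (snd (d us))) n \<and>
      nrm (fst (snd (d us))) (fst (d us) \<ominus>\<^bsub>fst (snd (d us))\<^esub> snd (snd (d us))) < 1" ..
    define \<sigma> A' a' where "\<sigma> us = fst (d us)" and "A' us = fst (snd (d us))" and "a' us = snd (snd (d us))" for us
    have d: "f us = Elem (\<sigma> us)" "g us = Alg (A' us)" "h us = Elem (a' us)" "?P (A' us)"
      "a' us \<in> carrier (A' us)" "nrm (A' us) (a' us) \<le> C" "\<sigma> us \<in> combs (A' us) n"
      "nrm (A' us) (\<sigma> us \<ominus>\<^bsub>A' us\<^esub> a' us) < 1" for us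
      using d[rule_format, of us] by (simp_all only: \<sigma>_def A'_def a'_def simp_thms)
    have fe: "f = (\<lambda>us. Elem (\<sigma> us))" "g = (\<lambda>us. Alg (A' us))" "h = (\<lambda>us. Elem (a' us))"
      by (intro ext d(1-3))+
    interpret Y: alg_pres U M ?P ys A'
      by (intro alg_pres.intro alg_hull_axioms alg_pres_axioms.intro val(2)[unfolded fe] d(4))
    have a's: "asec A' a'" unfolding asec_def using d(5,6) by blast
    have \<sigma>s: "asec A' \<sigma>"
    proof -
      \<comment> \<open>The condition for m = 0 keeps the combination within distance 1 of the given
        element, hence bounded.\<close>
      have "\<sigma> us \<in> carrier (A' us) \<and> nrm (A' us) (\<sigma> us) \<le> 1 + C" for us
      proof -
        interpret A: pre_cstar "A' us" by (rule Y.A)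
        have \<sigma>: "\<sigma> us \<in> carrier (A' us)" by (rule A.combs_closed[OF d(7)])
        have "(\<sigma> us \<ominus>\<^bsub>A' us\<^esub> a' us) \<oplus>\<^bsub>A' us\<^esub> a' us = \<sigma> us"
          using \<sigma> d(5) by (simp add: A.minus_eq A.a_assoc A.l_neg)
        then have "nrm (A' us) (\<sigma> us) \<le> nrm (A' us) (\<sigma> us \<ominus>\<^bsub>A' us\<^esub> a' us) + nrm (A' us) (a' us)"
          using A.nrm_add[OF A.minus_closed[OF \<sigma> d(5)] d(5)] by simp
        then show ?thesis using \<sigma> d(6,8)[of us] by simp
      qed
      then show ?thesis unfolding asec_def by blast
    qed
    have "((\<lambda>us. nrm (A' us) (\<sigma> us \<ominus>\<^bsub>A' us\<^esub> a' us)) \<longlongrightarrow> 0) (dir ys)"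
      unfolding tendsto_iff_inverse
    proof (intro allI impI)
      fix m :: nat assume "m \<ge> 1"
      then have "Suc (m - 1) = m" by simp
      have "map (val ys) [f, g, h] \<in> ext U (R (m - 1))" using s[of "m - 1"] val by simp
      then have "eventually (\<lambda>us. [Elem (\<sigma> us), Alg (A' us), Elem (a' us)] \<in> R (m - 1)) (dir ys)"
        unfolding ext_map_val fe by simp
      then show "eventually (\<lambda>us. dist (nrm (A' us) (\<sigma> us \<ominus>\<^bsub>A' us\<^esub> a' us)) 0 < 1 / real m) (dir ys)"
      proof eventually_elim
        case (elim us)
        then have "nrm (A' us) (\<sigma> us \<ominus>\<^bsub>A' us\<^esub> a' us) < 1 / real m"
          unfolding R_def \<open>Suc (m - 1) = m\<close> by blast
        moreover have "0 \<le> nrm (A' us) (\<sigma> us \<ominus>\<^bsub>A' us\<^esub> a' us)"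
        proof -
          interpret A: pre_cstar "A' us" by (rule Y.A)
          show ?thesis by (rule A.nrm_nonneg[OF A.minus_closed[OF Y.asecD[OF \<sigma>s] d(5)]])
        qed
        ultimately show ?case by simp
      qed
    qed
    then have "Y.ac \<sigma> = Y.ac a'" unfolding Y.ac_eq_iff[OF a's \<sigma>s] .
    also have "\<dots> = S" using aS val(3) unfolding fe by simp
    finally show ?thesis using Y.ac_combs[OF \<sigma>s d(7)] by simp
  qed
  then show ?thesis
    by (intro bounded_combs.intro bounded_combs_axioms.intro H.pre_cstar_axioms)
qed

lemma (in ns_transfer) ext_proj:
  assumes "xs \<in> ext U R" "set is \<subseteq> {..<length xs}"
    and "\<And>us. us \<in> R \<Longrightarrow> length us = length xs \<Longrightarrow> map ((!) us) is \<in> S"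
  shows "map ((!) xs) is \<in> ext U S"
proof -
  have "eventually (\<lambda>us. us \<in> R) (dir xs)" using assms(1) by (simp add: ext_iff_eventually)
  then have "eventually (\<lambda>us. map ((!) us) is \<in> S) (dir xs)"
    using eventually_dir_length[of xs] by eventually_elim (rule assms(3))
  then show ?thesis using eventually_dir_proj[OF assms(2)] by blast
qed

context ns_objects begin

text \<open>The sequence consists of eigenprojections of one internal element provided by saturation. A second
  use of saturation turns the \<open>p n\<close>, for large \<open>n\<close>, into \<open>e\<close>.\<close>

theorem infinite_hull:
  assumes M0: "[M] \<in> ext U {[Alg A] | A. pre_cstar A}"
    and many: "\<And>n. [M] \<in> ext U {[Alg A] | A. pre_cstar A \<and> many_projections A n}"
  shows "\<exists>p :: nat \<Rightarrow> 's set. (\<forall>j. p j \<in> projections (ns_hull U M) \<and> p j \<noteq> \<zero>\<^bsub>ns_hull U M\<^esub>) \<and>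
    (\<forall>i j. i \<noteq> j \<longrightarrow> p i \<otimes>\<^bsub>ns_hull U M\<^esub> p j = \<zero>\<^bsub>ns_hull U M\<^esub>) \<and>
    (\<forall>q\<in>carrier (ns_hull U M). (\<forall>j. p j \<otimes>\<^bsub>ns_hull U M\<^esub> q = p j) \<longrightarrow>
      (\<exists>e\<in>carrier (ns_hull U M). e \<noteq> \<zero>\<^bsub>ns_hull U M\<^esub> \<and> e \<otimes>\<^bsub>ns_hull U M\<^esub> q = e \<and>
        (\<forall>j. e \<otimes>\<^bsub>ns_hull U M\<^esub> p j = \<zero>\<^bsub>ns_hull U M\<^esub>)))"
proof -
  let ?H = "ns_hull U M"
  interpret alg_hull U M pre_cstar by (intro alg_hull.intro ns_objects_axioms alg_hull_axioms.intro M0)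
  interpret H: pre_cstar ?H by (rule hull_pre_cstar)
  define R :: "nat \<Rightarrow> ('a, 'h, 'w) obj list set" where
    "R k = {[Elem a, Alg A] | a A. pre_cstar A \<and> a \<in> carrier A \<and> adj A a = a \<and>
      (\<forall>l\<le>k. \<exists>p\<in>projections A. p \<noteq> \<zero>\<^bsub>A\<^esub> \<and> a \<otimes>\<^bsub>A\<^esub> p = of_nat l \<odot>\<^bsub>A\<^esub> p)}" for k
  define T :: "nat \<Rightarrow> ('a, 'h, 'w) obj list set" where
    "T k = {[Elem a, Alg A, Elem p] | a A p. pre_cstar A \<and> a \<in> carrier A \<and> adj A a = a \<and>
      p \<in> projections A \<and> p \<noteq> \<zero>\<^bsub>A\<^esub> \<and> a \<otimes>\<^bsub>A\<^esub> p = of_nat k \<odot>\<^bsub>A\<^esub> p}" for k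
  define Pr :: "('a, 'h, 'w) obj list set" where
    "Pr = {[Alg A, Elem p] | A p. pre_cstar A \<and> p \<in> projections A \<and> p \<noteq> \<zero>\<^bsub>A\<^esub>}"
  define Or :: "('a, 'h, 'w) obj list set" where
    "Or = {[Alg A, Elem p, Elem q] | A p q. p \<otimes>\<^bsub>A\<^esub> q = \<zero>\<^bsub>A\<^esub>}"
  have "\<exists>a. \<forall>m. a # [M] \<in> ext U (R m)"
  proof (rule saturation_decreasing)
    fix n
    have "eventually (\<lambda>us. us \<in> {[Alg A] | A. pre_cstar A \<and> many_projections A (Suc n)}) (dir [M])"
      using many[of "Suc n"] by (simp add: ext_iff_eventually)
    then show "eventually (\<lambda>us. \<exists>u. u # us \<in> R n) (dir [M])"
    proof eventually_elim
      case (elim us)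
      then obtain A where A: "us = [Alg A]" "pre_cstar A" "many_projections A (Suc n)" by blast
      then obtain a where "a \<in> carrier A" "adj A a = a"
        "\<forall>k<Suc n. \<exists>p\<in>projections A. p \<noteq> \<zero>\<^bsub>A\<^esub> \<and> a \<otimes>\<^bsub>A\<^esub> p = of_nat k \<odot>\<^bsub>A\<^esub> p"
        unfolding many_projections_def by blast
      then show ?case unfolding R_def using A(1,2) by (intro exI[of _ "Elem a"]) (simp add: less_Suc_eq_le)
    qed
  next
    fix m n :: nat assume "m \<le> n"
    show "R n \<subseteq> R m"
    proof
      fix us assume "us \<in> R n"
      then obtain a A where A: "us = [Elem a, Alg A]" "pre_cstar A" "a \<in> carrier A" "adj A a = a"
        and l: "\<forall>l\<le>n. \<exists>p\<in>projections A. p \<noteq> \<zero>\<^bsub>A\<^esub> \<and> a \<otimes>\<^bsub>A\<^esub> p = of_nat l \<odot>\<^bsub>A\<^esub> p"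
        unfolding R_def mem_Collect_eq by (elim exE conjE) (rule that)
      have "\<forall>l\<le>m. \<exists>p\<in>projections A. p \<noteq> \<zero>\<^bsub>A\<^esub> \<and> a \<otimes>\<^bsub>A\<^esub> p = of_nat l \<odot>\<^bsub>A\<^esub> p"
        using l order_trans[OF _ \<open>m \<le> n\<close>] by (intro allI impI) (rule l[rule_format])
      then show "us \<in> R m" unfolding R_def mem_Collect_eq using A by (intro exI[of _ a] exI[of _ A] conjI)
    qed
  qed
  then obtain a where a: "\<And>m. [a, M] \<in> ext U (R m)" by blast
  \<comment> \<open>The eigenprojections are picked one by one for standard k. Their sequence is
    external; only the properties of single members and of pairs are internal.\<close>
  have "\<exists>y. [a, M] @ [y] \<in> ext U (T k)" for k
    unfolding skolem
  proof -
    have "eventually (\<lambda>us. us \<in> R k) (dir [a, M])" using a[of k] by (simp add: ext_iff_eventually)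
    then show "eventually (\<lambda>us. \<exists>u. us @ [u] \<in> T k) (dir [a, M])"
    proof eventually_elim
      case (elim us)
      then obtain a A where A: "us = [Elem a, Alg A]" "pre_cstar A" "a \<in> carrier A" "adj A a = a"
        "\<forall>l\<le>k. \<exists>p\<in>projections A. p \<noteq> \<zero>\<^bsub>A\<^esub> \<and> a \<otimes>\<^bsub>A\<^esub> p = of_nat l \<odot>\<^bsub>A\<^esub> p"
        unfolding R_def mem_Collect_eq by (elim exE conjE) (rule that)
      then obtain p where "p \<in> projections A" "p \<noteq> \<zero>\<^bsub>A\<^esub>" "a \<otimes>\<^bsub>A\<^esub> p = of_nat k \<odot>\<^bsub>A\<^esub> p" by blast
      then show ?case unfolding T_def using A(1-4) by (intro exI[of _ "Elem p"]) simp
    qed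
  qed
  then have "\<forall>k. \<exists>y. [a, M, y] \<in> ext U (T k)" by simp
  from choice[OF this] obtain pp where pp: "\<forall>k. [a, M, pp k] \<in> ext U (T k)" ..
  have Pr: "[M, pp k] \<in> ext U Pr" for k
  proof -
    have "map ((!) [a, M, pp k]) [1, 2] \<in> ext U Pr"
      by (rule ext_proj[OF pp[rule_format]]) (auto simp: T_def Pr_def)
    then show ?thesis by (simp add: numeral_2_eq_2)
  qed
  have Or: "[M, pp i, pp j] \<in> ext U Or" if ij: "i \<noteq> j" for i j
  proof -
    let ?x = "[a, M, pp i, pp j]"
    have "map ((!) ?x) [0, 1, 2] \<in> ext U (T i)" "map ((!) ?x) [0, 1, 3] \<in> ext U (T j)"
      using pp by (simp_all add: numeral_2_eq_2 numeral_3_eq_3)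
    then have "eventually (\<lambda>us. map ((!) us) [0, 1, 2] \<in> T i) (dir ?x)" "eventually (\<lambda>us. map ((!) us) [0, 1, 3] \<in> T j) (dir ?x)"
      by (subst eventually_dir_proj; simp)+
    then have "eventually (\<lambda>us. map ((!) us) [1, 2, 3] \<in> Or) (dir ?x)"
    proof eventually_elim
      case (elim us)
      then obtain b A p q where e: "us ! 0 = Elem b" "us ! 1 = Alg A" "us ! 2 = Elem p" "us ! 3 = Elem q" "pre_cstar A"
        "b \<in> carrier A" "adj A b = b" "p \<in> projections A" "q \<in> projections A"
        "b \<otimes>\<^bsub>A\<^esub> p = of_nat i \<odot>\<^bsub>A\<^esub> p" "b \<otimes>\<^bsub>A\<^esub> q = of_nat j \<odot>\<^bsub>A\<^esub> q"
        unfolding T_def by auto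
      interpret A: pre_cstar A by (rule e(5))
      note p = A.projD[OF e(8)] and q = A.projD[OF e(9)]
      \<comment> \<open>Taking adjoints moves the eigenvalue equation of p to the other side. The
        product of p, b and q is then evaluated with both eigenvalues.\<close>
      have "adj A (b \<otimes>\<^bsub>A\<^esub> p) = p \<otimes>\<^bsub>A\<^esub> b" using A.adj_mult[OF e(6) p(1)] e(7) p(2) by simp
      then have pb: "p \<otimes>\<^bsub>A\<^esub> b = of_nat i \<odot>\<^bsub>A\<^esub> p" unfolding e(10) using A.adj_smult[OF p(1)] p(2) by simp
      have "of_nat i \<odot>\<^bsub>A\<^esub> (p \<otimes>\<^bsub>A\<^esub> q) = (p \<otimes>\<^bsub>A\<^esub> b) \<otimes>\<^bsub>A\<^esub> q"
        unfolding pb using A.smult_mult_left[OF p(1) q(1)] by simp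
      also have "\<dots> = of_nat j \<odot>\<^bsub>A\<^esub> (p \<otimes>\<^bsub>A\<^esub> q)"
        unfolding A.m_assoc[OF p(1) e(6) q(1)] e(11) by (rule A.smult_mult_right[OF p(1) q(1)])
      finally have "p \<otimes>\<^bsub>A\<^esub> q = \<zero>\<^bsub>A\<^esub>"
        using A.smult_cancel[of "p \<otimes>\<^bsub>A\<^esub> q" "of_nat i" "of_nat j"] p(1) q(1) ij by auto
      then show ?case unfolding Or_def using e(2-4) by simp
    qed
    then have "map ((!) ?x) [1, 2, 3] \<in> ext U Or" by (subst (asm) eventually_dir_proj) auto
    then show ?thesis by (simp add: numeral_2_eq_2 numeral_3_eq_3)
  qed
  have projI: "x \<in> Fin U M \<and> halo U M x \<in> projections ?H \<and> halo U M x \<noteq> \<zero>\<^bsub>?H\<^esub>" if x: "[M, x] \<in> ext U Pr" for x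
  proof -
    from present[OF x] obtain fs where fs: "[M, x] = map (val [M, x]) fs" "\<forall>us. map (\<lambda>f. f us) fs \<in> Pr"
      by (elim exE conjE) (rule that)
    define ys where "ys = [M, x]"
    have "length fs = 2" using arg_cong[OF fs(1), of length] by simp
    then obtain g f where gf: "fs = [g, f]" by (auto simp: length_Suc_conv numeral_2_eq_2)
    have "[M, x] = [val ys g, val ys f]" using fs(1) by (simp only: ys_def gf list.map)
    then have val: "M = val ys g" "x = val ys f" by simp_all
    have "\<forall>us. \<exists>d. g us = Alg (fst d) \<and> f us = Elem (snd d) \<and> pre_cstar (fst d) \<and> snd d \<in> projections (fst d) \<and>
      snd d \<noteq> \<zero>\<^bsub>fst d\<^esub>"
      using fs(2) unfolding gf Pr_def by simp
    from choice[OF this] obtain d where d: "\<forall>us. g us = Alg (fst (d us)) \<and> f us = Elem (snd (d us)) \<and>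
      pre_cstar (fst (d us)) \<and> snd (d us) \<in> projections (fst (d us)) \<and> snd (d us) \<noteq> \<zero>\<^bsub>fst (d us)\<^esub>" ..
    define A p where "A us = fst (d us)" and "p us = snd (d us)" for us
    have d: "g us = Alg (A us)" "f us = Elem (p us)" "pre_cstar (A us)" "p us \<in> projections (A us)" "p us \<noteq> \<zero>\<^bsub>A us\<^esub>" for us
      using d[rule_format, of us] by (simp_all only: A_def p_def simp_thms)
    have fe: "g = (\<lambda>us. Alg (A us))" "f = (\<lambda>us. Elem (p us))" by (intro ext d(1,2))+
    interpret Y: alg_pres U M pre_cstar ys A
      by (intro alg_pres.intro alg_hull_axioms alg_pres_axioms.intro val(1)[unfolded fe] d(3))
    \<comment> \<open>A nonzero projection has norm exactly 1, so it cannot be infinitesimal and its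
      class is nonzero.\<close>
    have n1: "nrm (A us) (p us) = 1" for us using pre_cstar.nrm_proj[OF d(3,4,5)] .
    have ps: "asec A p" unfolding asec_def using pre_cstar.projD(1)[OF d(3,4)] n1 by auto
    have xe: "x = val ys (\<lambda>us. Elem (p us))" using val(2) unfolding fe .
    have "nrm ?H (Y.ac p) = 1"
      by (rule tendsto_unique[OF dir_neq_bot Y.asec_norm_limit[OF ps]]) (simp add: n1)
    then have "halo U M x \<noteq> \<zero>\<^bsub>?H\<^esub>" unfolding xe using H.nrm_zero by auto
    moreover have "halo U M x \<in> projections ?H"
      unfolding projections_def mem_Collect_eq xe
      using pre_cstar.projD[OF d(3,4)] by (simp only: ns_hull_simps(1) Y.ac_simps ps simp_thms)
    ultimately show ?thesis using Y.asec_Fin[OF ps] xe by simp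
  qed
  have orthI: "halo U M x \<otimes>\<^bsub>?H\<^esub> halo U M y = \<zero>\<^bsub>?H\<^esub>"
    if x: "x \<in> Fin U M" and y: "y \<in> Fin U M" and xy: "[M, x, y] \<in> ext U Or" for x y
  proof (rule present_alg4[OF x y y y])
    fix xs A e f
    assume pres: "alg_pres U M pre_cstar xs A" and s: "asec A e" "asec A f"
      and v: "x = val xs (\<lambda>us. Elem (e us))" "y = val xs (\<lambda>us. Elem (f us))"
    interpret alg_pres U M pre_cstar xs A by (rule pres)
    have "map (val xs) [\<lambda>us. Alg (A us), \<lambda>us. Elem (e us), \<lambda>us. Elem (f us)] \<in> ext U Or"
      using xy M_val v by simp
    then have "eventually (\<lambda>us. e us \<otimes>\<^bsub>A us\<^esub> f us = \<zero>\<^bsub>A us\<^esub>) (dir xs)"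
      unfolding ext_map_val Or_def by simp
    from ac_cong[OF this] show ?thesis unfolding v by (simp only: ns_hull_simps(4) ac_simps s)
  qed
  have "\<exists>e\<in>carrier ?H. e \<noteq> \<zero>\<^bsub>?H\<^esub> \<and> e \<otimes>\<^bsub>?H\<^esub> q = e \<and> (\<forall>j. e \<otimes>\<^bsub>?H\<^esub> halo U M (pp j) = \<zero>\<^bsub>?H\<^esub>)"
    if q: "q \<in> carrier ?H" and pq: "\<And>j. halo U M (pp j) \<otimes>\<^bsub>?H\<^esub> q = halo U M (pp j)" for q
  proof -
    obtain Q where Q: "Q \<in> Fin U M" "q = halo U M Q"
      using q unfolding ns_hull_simps hull_carrier_def by (rule imageE)
    \<comment> \<open>The m-th condition speaks only of the m-th projection, which enters as the
      changing parameter that \<open>saturation_lists\<close> permits.\<close>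
    define S :: "nat \<Rightarrow> ('a, 'h, 'w) obj list set" where
      "S m = {[Elem e, Alg A, Elem q, Elem p] | e A q p. pre_cstar A \<and> e \<in> projections A \<and> e \<noteq> \<zero>\<^bsub>A\<^esub> \<and>
        e \<otimes>\<^bsub>A\<^esub> p = \<zero>\<^bsub>A\<^esub> \<and> nrm A (e \<otimes>\<^bsub>A\<^esub> q \<ominus>\<^bsub>A\<^esub> e) < 1 / real (Suc m)}" for m
    have ppF: "pp k \<in> Fin U M" for k using projI[OF Pr] by blast
    have "\<exists>x. \<forall>m. x # [M, Q, pp m] \<in> ext U (S m)"
    proof (rule saturation_lists)
      fix n
      \<comment> \<open>The witness for the conditions up to n is the next projection: it is
        orthogonal to all earlier ones and is absorbed by q up to an infinitesimal.\<close>
      have "pp (Suc n) # [M, Q, pp m] \<in> ext U (S m)" if mn: "m \<le> n" for m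
      proof (rule present_alg4[OF ppF[of "Suc n"] Q(1) ppF[of m] ppF[of m]])
        fix xs A e f p
        assume pres: "alg_pres U M pre_cstar xs A" and s: "asec A e" "asec A f" "asec A p"
          and v: "pp (Suc n) = val xs (\<lambda>us. Elem (e us))" "Q = val xs (\<lambda>us. Elem (f us))" "pp m = val xs (\<lambda>us. Elem (p us))"
        interpret alg_pres U M pre_cstar xs A by (rule pres)
        have "map (val xs) [\<lambda>us. Alg (A us), \<lambda>us. Elem (e us)] \<in> ext U Pr"
          using Pr[of "Suc n"] M_val v(1) by simp
        then have 1: "eventually (\<lambda>us. e us \<in> projections (A us) \<and> e us \<noteq> \<zero>\<^bsub>A us\<^esub>) (dir xs)"
          unfolding ext_map_val Pr_def by eventually_elim auto
        have "[M, pp (Suc n), pp m] \<in> ext U Or" by (rule Or) (use mn in simp)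
        then have "map (val xs) [\<lambda>us. Alg (A us), \<lambda>us. Elem (e us), \<lambda>us. Elem (p us)] \<in> ext U Or"
          using M_val v(1,3) by simp
        then have 2: "eventually (\<lambda>us. e us \<otimes>\<^bsub>A us\<^esub> p us = \<zero>\<^bsub>A us\<^esub>) (dir xs)"
          unfolding ext_map_val Or_def by simp
        have "ac (\<lambda>us. e us \<otimes>\<^bsub>A us\<^esub> f us) = ac e"
          using pq[of "Suc n"] unfolding Q(2) v(1,2) by (simp only: ac_simps s)
        then have "((\<lambda>us. nrm (A us) (e us \<otimes>\<^bsub>A us\<^esub> f us \<ominus>\<^bsub>A us\<^esub> e us)) \<longlongrightarrow> 0) (dir xs)"
          unfolding ac_eq_iff[OF s(1) asec_mult[OF s(1,2)]] .
        then have 3: "eventually (\<lambda>us. nrm (A us) (e us \<otimes>\<^bsub>A us\<^esub> f us \<ominus>\<^bsub>A us\<^esub> e us) < 1 / real (Suc m)) (dir xs)"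
          by (rule order_tendstoD(2)) simp
        from 1 2 3 have "eventually (\<lambda>us. map (\<lambda>f. f us) [\<lambda>us. Elem (e us), \<lambda>us. Alg (A us), \<lambda>us. Elem (f us), \<lambda>us. Elem (p us)] \<in> S m) (dir xs)"
        proof eventually_elim
          case (elim us)
          then show ?case unfolding S_def list.map using A[of us]
            by (intro CollectI exI[of _ "e us"] exI[of _ "A us"] exI[of _ "f us"] exI[of _ "p us"]) simp
        qed
        then have "map (val xs) [\<lambda>us. Elem (e us), \<lambda>us. Alg (A us), \<lambda>us. Elem (f us), \<lambda>us. Elem (p us)] \<in> ext U (S m)"
          unfolding ext_map_val .
        then show ?thesis using M_val v by simp
      qed
      then show "\<exists>x. \<forall>m\<le>n. x # [M, Q, pp m] \<in> ext U (S m)" by blast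
    qed
    then obtain E where E: "\<And>m. [E, M, Q, pp m] \<in> ext U (S m)" by blast
    have "map ((!) [E, M, Q, pp 0]) [1, 0] \<in> ext U Pr"
      by (rule ext_proj[OF E]) (auto simp: S_def Pr_def)
    then have "[M, E] \<in> ext U Pr" by simp
    note EP = projI[OF this]
    have "[M, E, pp m] \<in> ext U Or" for m
    proof -
      have "map ((!) [E, M, Q, pp m]) [1, 0, 3] \<in> ext U Or"
        by (rule ext_proj[OF E]) (auto simp: S_def Or_def numeral_3_eq_3)
      then show ?thesis by (simp add: numeral_3_eq_3)
    qed
    note Eorth = orthI[OF conjunct1[OF EP] ppF this]
    \<comment> \<open>The absorption bounds hold for every m with the same E; without the changing
      parameter they say that E is absorbed by q in the hull.\<close>
    define L :: "nat \<Rightarrow> ('a, 'h, 'w) obj list set" where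
      "L m = {[Alg A, Elem e, Elem q] | A e q. nrm A (e \<otimes>\<^bsub>A\<^esub> q \<ominus>\<^bsub>A\<^esub> e) < 1 / real (Suc m)}" for m
    have L: "[M, E, Q] \<in> ext U (L m)" for m
    proof -
      have "map ((!) [E, M, Q, pp m]) [1, 0, 2] \<in> ext U (L m)"
        by (rule ext_proj[OF E]) (auto simp: S_def L_def numeral_2_eq_2)
      then show ?thesis by (simp add: numeral_2_eq_2)
    qed
    have "halo U M E \<otimes>\<^bsub>?H\<^esub> halo U M Q = halo U M E"
    proof (rule present_alg4[OF conjunct1[OF EP] Q(1) Q(1) Q(1)])
      fix xs A e f
      assume pres: "alg_pres U M pre_cstar xs A" and s: "asec A e" "asec A f"
        and v: "E = val xs (\<lambda>us. Elem (e us))" "Q = val xs (\<lambda>us. Elem (f us))"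
      interpret alg_pres U M pre_cstar xs A by (rule pres)
      have "((\<lambda>us. nrm (A us) (e us \<otimes>\<^bsub>A us\<^esub> f us \<ominus>\<^bsub>A us\<^esub> e us)) \<longlongrightarrow> 0) (dir xs)"
        unfolding tendsto_iff_inverse
      proof (intro allI impI)
        fix m :: nat assume "m \<ge> 1"
        then have m: "Suc (m - 1) = m" by simp
        have "map (val xs) [\<lambda>us. Alg (A us), \<lambda>us. Elem (e us), \<lambda>us. Elem (f us)] \<in> ext U (L (m - 1))"
          using L[of "m - 1"] M_val v by simp
        then have "eventually (\<lambda>us. nrm (A us) (e us \<otimes>\<^bsub>A us\<^esub> f us \<ominus>\<^bsub>A us\<^esub> e us) < 1 / real m) (dir xs)"
          unfolding ext_map_val L_def m by simp
        then show "eventually (\<lambda>us. dist (nrm (A us) (e us \<otimes>\<^bsub>A us\<^esub> f us \<ominus>\<^bsub>A us\<^esub> e us)) 0 < 1 / real m) (dir xs)"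
        proof eventually_elim
          case (elim us)
          interpret A: pre_cstar "A us" by (rule A)
          have "0 \<le> nrm (A us) (e us \<otimes>\<^bsub>A us\<^esub> f us \<ominus>\<^bsub>A us\<^esub> e us)"
            by (intro A.nrm_nonneg A.minus_closed A.m_closed asecD[OF s(1)] asecD[OF s(2)])
          then show ?case using elim by simp
        qed
      qed
      then have "ac (\<lambda>us. e us \<otimes>\<^bsub>A us\<^esub> f us) = ac e"
        unfolding ac_eq_iff[OF s(1) asec_mult[OF s(1,2)]] .
      then show ?thesis unfolding v by (simp only: ac_simps s)
    qed
    then show ?thesis unfolding Q(2) using Eorth EP H.projD(1)
      by (intro bexI[of _ "halo U M E"] conjI allI) blast+
  qed
  then show ?thesis
    using projI[OF Pr] orthI[OF conjunct1[OF projI[OF Pr]] conjunct1[OF projI[OF Pr]] Or]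
    by (intro exI[of _ "\<lambda>j. halo U M (pp j)"] conjI allI impI ballI) blast+
qed

end

section \<open>The hull of an internal operator algebra\<close>

text \<open>Boundedness of the operator makes the supremum in \<open>op_norm\<close> an upper bound
  over the unit ball; scaling x into the ball gives the estimate.\<close>

lemma operator_algebra_bound:
  assumes "operator_algebra A K \<pi>" "a \<in> carrier A" "x \<in> carrier K"
  shows "hnorm K (\<pi> a x) \<le> nrm A a * hnorm K x"
proof -
  have rep: "star_representation A K \<pi>" and K: "hilbert_space K" and nrm: "op_norm K (\<pi> a) = nrm A a"
    using assms by (auto simp: operator_algebra_def)
  interpret K: pre_hilbert K by (rule hilbert_space_pre_hilbert[OF K])
  note T = K.bounded_opsD[OF star_representationD(1)[OF rep assms(2)]]
  obtain b where b: "b \<ge> 0" "\<forall>x\<in>carrier K. hnorm K (\<pi> a x) \<le> b * hnorm K x" using T(5) by (elim exE conjE) (rule that)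
  let ?S = "{hnorm K (\<pi> a x) | x. x \<in> carrier K \<and> hnorm K x \<le> 1}"
  have bdd: "bdd_above ?S"
  proof (rule bdd_aboveI[of _ b])
    fix t assume "t \<in> ?S"
    then obtain y where y: "t = hnorm K (\<pi> a y)" "y \<in> carrier K" "hnorm K y \<le> 1" by blast
    have "t \<le> b * hnorm K y" using b(2) y(1,2) by simp
    also have "\<dots> \<le> b * 1" by (intro mult_left_mono y b)
    finally show "t \<le> b" by simp
  qed
  show ?thesis
  proof (cases "hnorm K x = 0")
    case True
    then show ?thesis using b(2) assms(3) by fastforce
  next
    case False
    define r where "r = hnorm K x"
    have r: "r > 0" using False K.hnorm_nonneg[OF assms(3)] by (simp add: r_def)
    let ?y = "of_real (1 / r) \<odot>\<^bsub>K\<^esub> x"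
    have y: "?y \<in> carrier K" "hnorm K ?y = 1"
      using K.hnorm_smult[OF assms(3), of "of_real (1 / r)"] r assms(3) by (simp_all add: r_def norm_divide)
    have "hnorm K (\<pi> a ?y) \<le> nrm A a" unfolding nrm[symmetric] op_norm_def
      using y by (intro cSup_upper bdd) auto
    moreover have "hnorm K (\<pi> a ?y) = hnorm K (\<pi> a x) / r"
      using T(4)[OF assms(3), of "of_real (1 / r)"] K.hnorm_smult[OF T(2)[OF assms(3)], of "of_real (1 / r)"] r
      by (simp add: norm_divide)
    ultimately show ?thesis using r by (simp add: r_def divide_le_eq)
  qed
qed

text \<open>The supremum need not be attained, and the factor 2 leaves room for that. Such vectors
  separate the classes of operators in the hull.\<close>

lemma operator_algebra_attained:
  assumes "operator_algebra A K \<pi>" "a \<in> carrier A"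
  shows "\<exists>v\<in>carrier K. hnorm K v \<le> 1 \<and> nrm A a \<le> 2 * hnorm K (\<pi> a v)"
proof -
  have rep: "star_representation A K \<pi>" and K: "hilbert_space K" and nrm: "op_norm K (\<pi> a) = nrm A a"
    using assms by (auto simp: operator_algebra_def)
  interpret K: pre_hilbert K by (rule hilbert_space_pre_hilbert[OF K])
  note T = K.bounded_opsD[OF star_representationD(1)[OF rep assms(2)]]
  let ?S = "{hnorm K (\<pi> a x) | x. x \<in> carrier K \<and> hnorm K x \<le> 1}"
  have ne: "hnorm K (\<pi> a \<zero>\<^bsub>K\<^esub>) \<in> ?S" by (auto intro!: exI[of _ "\<zero>\<^bsub>K\<^esub>"])
  show ?thesis
  proof (cases "nrm A a \<le> 0")
    case True
    have "0 \<le> hnorm K (\<pi> a \<zero>\<^bsub>K\<^esub>)" by (rule K.hnorm_nonneg[OF T(2)]) simp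
    then show ?thesis using True by (intro bexI[of _ "\<zero>\<^bsub>K\<^esub>"]) auto
  next
    case False
    then have "nrm A a / 2 < Sup ?S" unfolding nrm[symmetric] op_norm_def by simp
    then obtain t where t: "t \<in> ?S" "nrm A a / 2 < t" using less_cSupD[of ?S] ne by blast
    then obtain v where "v \<in> carrier K" "hnorm K v \<le> 1" "t = hnorm K (\<pi> a v)" by blast
    then show ?thesis using t(2) by (intro bexI[of _ v]) auto
  qed
qed

locale op_hull = ns_objects U for U :: "(('a, 'h, 'w) obj, 's) ns_universe" +
  fixes M H \<rho> :: 's
  assumes MH: "[M, H, \<rho>] \<in> ext U {[Alg A, Hilb K, Act \<pi>] | A K \<pi>. operator_algebra A K \<pi>}"
begin

lemma M_alg: "[M] \<in> ext U {[Alg A] | A. pre_cstar A}"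
proof -
  have "map ((!) [M, H, \<rho>]) [0] \<in> ext U {[Alg A] | A. pre_cstar A}"
    by (rule ext_proj[OF MH]) (auto simp: operator_algebra_def intro: cstar_algebra_pre_cstar)
  then show ?thesis by simp
qed

lemma H_normed: "[H] \<in> ext U {[Z] | Z. normed_obj Z}"
proof -
  have "map ((!) [M, H, \<rho>]) [1] \<in> ext U {[Z] | Z. normed_obj Z}"
  proof (rule ext_proj[OF MH])
    fix us :: "('a, 'h, 'w) obj list"
    assume "us \<in> {[Alg A, Hilb K, Act \<pi>] | A K \<pi>. operator_algebra A K \<pi>}"
    then obtain A K \<pi> where us: "us = [Alg A, Hilb K, Act \<pi>]" "operator_algebra A K \<pi>" by blast
    then have "pre_hilbert K" by (simp add: operator_algebra_def hilbert_space_pre_hilbert)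
    from pre_hilbert.normed_obj_Hilb[OF this] show "map ((!) us) [1] \<in> {[Z] | Z. normed_obj Z}" using us by simp
  qed simp
  then show ?thesis by simp
qed

end

sublocale op_hull \<subseteq> alg_hull U M pre_cstar
  by (intro alg_hull.intro ns_objects_axioms alg_hull_axioms.intro M_alg)

sublocale op_hull \<subseteq> H: hull_space U H
  by (intro hull_space.intro ns_objects_axioms hull_space_axioms.intro H_normed)

definition vsec :: "('x \<Rightarrow> 'h hilb) \<Rightarrow> ('x \<Rightarrow> 'h) \<Rightarrow> bool" where
  "vsec K v \<longleftrightarrow> (\<forall>us. v us \<in> carrier (K us)) \<and> (\<exists>C. \<forall>us. hnorm (K us) (v us) \<le> C)"

lemma (in ns_objects) sec_Vec: "sec (\<lambda>us. Hilb (K us)) (\<lambda>us. Vec (v us)) \<longleftrightarrow> vsec K v"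
  unfolding sec_def vsec_def by simp

locale op_pres = op_hull U M H \<rho> for U :: "(('a, 'h, 'w) obj, 's) ns_universe" and M H \<rho> :: 's +
  fixes xs :: "'s list" and A :: "('a, 'h, 'w) obj list \<Rightarrow> 'a cstar" and K :: "('a, 'h, 'w) obj list \<Rightarrow> 'h hilb"
    and \<pi> :: "('a, 'h, 'w) obj list \<Rightarrow> 'a \<Rightarrow> 'h \<Rightarrow> 'h"
  assumes M_val': "M = val xs (\<lambda>us. Alg (A us))" and H_val: "H = val xs (\<lambda>us. Hilb (K us))"
    and \<rho>_val: "\<rho> = val xs (\<lambda>us. Act (\<pi> us))" and OA: "\<And>us. operator_algebra (A us) (K us) (\<pi> us)"
begin

lemma A': "pre_cstar (A us)" using OA[of us] by (simp add: operator_algebra_def cstar_algebra_pre_cstar)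
lemma K: "pre_hilbert (K us)" using OA[of us] by (simp add: operator_algebra_def hilbert_space_pre_hilbert)
lemma rep: "star_representation (A us) (K us) (\<pi> us)" using OA[of us] by (simp add: operator_algebra_def)

end

sublocale op_pres \<subseteq> alg_pres U M pre_cstar xs A
  by (intro alg_pres.intro alg_hull_axioms alg_pres_axioms.intro M_val' A')

sublocale op_pres \<subseteq> H: hull_pres U H xs "\<lambda>us. Hilb (K us)"
  by (intro hull_pres.intro H.hull_space_axioms hull_pres_axioms.intro H_val pre_hilbert.normed_obj_Hilb K)

context op_hull begin

text \<open>The algebra, the space and the action have to come from one presentation for the action
  to be evaluated pointwise, so elements of both kinds are presented together.\<close>

lemma present_op:
  assumes ys: "set ys \<subseteq> Fin U M" and zs: "set zs \<subseteq> Fin U H"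
  shows "\<exists>xs A K \<pi> as vs. op_pres U M H \<rho> xs A K \<pi> \<and> ys = map (\<lambda>a. val xs (\<lambda>us. Elem (a us))) as \<and>
    zs = map (\<lambda>v. val xs (\<lambda>us. Vec (v us))) vs \<and> (\<forall>a\<in>set as. asec A a) \<and> (\<forall>v\<in>set vs. vsec K v)"
proof -
  let ?B = "\<lambda>C. {[Z, x] | Z x. [Z, x] \<in> obj_mem \<and> onorm Z x \<le> (C :: real)}"
  let ?n = "length ys" and ?m = "length zs"
  \<comment> \<open>Position 0 of \<open>[M, H, \<rho>]\<close> is the algebra, to which the
    \<open>ys\<close> belong, and position 1 the Hilbert space, to which the \<open>zs\<close>
    belong.\<close>
  define Zs js where "Zs = replicate ?n M @ replicate ?m H" and "js = replicate ?n 0 @ replicate ?m (1 :: nat)"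
  let ?ws = "ys @ zs"
  have len: "length js = ?n + ?m" by (simp add: js_def)
  have js: "js ! i = (if i < ?n then 0 else 1)" if "i < ?n + ?m" for i using that by (simp add: js_def nth_append)
  have "\<forall>i. \<exists>C. i < ?n + ?m \<longrightarrow> [[M, H, \<rho>] ! (js ! i), ?ws ! i] \<in> ext U (?B C)"
  proof
    fix i
    show "\<exists>C. i < ?n + ?m \<longrightarrow> [[M, H, \<rho>] ! (js ! i), ?ws ! i] \<in> ext U (?B C)"
    proof (cases "i < ?n")
      case True
      then have "ys ! i \<in> Fin U M" using ys nth_mem by blast
      from Fin_bound[OF M_normed this] show ?thesis using True js[of i] by (simp add: nth_append)
    next
      case False
      show ?thesis
      proof (cases "i < ?n + ?m")
        case True
        then have "zs ! (i - ?n) \<in> Fin U H" using False zs nth_mem[of "i - ?n" zs] by auto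
        from Fin_bound[OF H_normed this] show ?thesis using True False js[of i] by (simp add: nth_append)
      qed simp
    qed
  qed
  from choice[OF this] obtain C where C: "\<forall>i. i < ?n + ?m \<longrightarrow> [[M, H, \<rho>] ! (js ! i), ?ws ! i] \<in> ext U (?B (C i))" ..
  let ?Rs = "map (\<lambda>i. ?B (C i)) [0..<?n + ?m]" and ?R = "{[Alg A, Hilb K, Act \<pi>] | A K \<pi>. operator_algebra A K \<pi>}"
  let ?Q = "\<lambda>xs fs gs. [M, H, \<rho>] = map (val xs) fs \<and> ?ws = map (val xs) gs \<and>
    length fs = length [M, H, \<rho>] \<and> length gs = length ?ws \<and>
    (\<forall>us. map (\<lambda>f. f us) fs \<in> ?R) \<and>
    (\<forall>us. \<forall>i<length ?ws. [(fs ! (js ! i)) us, (gs ! i) us] \<in> ?Rs ! i)"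
  have "\<exists>xs fs gs. ?Q xs fs gs"
    by (rule present_over[OF MH]) (use C len js in simp_all)
  then obtain xs fs gs where Q: "?Q xs fs gs" by (elim exE) (rule that)
  note q = conjunct1[OF Q] conjunct1[OF conjunct2[OF Q]] conjunct1[OF conjunct2[OF conjunct2[OF Q]]]
    conjunct1[OF conjunct2[OF conjunct2[OF conjunct2[OF Q]]]]
    conjunct1[OF conjunct2[OF conjunct2[OF conjunct2[OF conjunct2[OF Q]]]]]
    conjunct2[OF conjunct2[OF conjunct2[OF conjunct2[OF conjunct2[OF Q]]]]]
  have "length fs = 3" using q(3) by simp
  then obtain f1 f2 f3 where Z: "fs = [f1, f2, f3]" by (auto simp: length_Suc_conv numeral_3_eq_3)
  have "\<forall>us. \<exists>d. f1 us = Alg (fst d) \<and> f2 us = Hilb (fst (snd d)) \<and> f3 us = Act (snd (snd d)) \<and>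
    operator_algebra (fst d) (fst (snd d)) (snd (snd d))"
    using q(5) by (simp add: Z)
  from choice[OF this] obtain d where d: "\<forall>us. f1 us = Alg (fst (d us)) \<and> f2 us = Hilb (fst (snd (d us))) \<and>
    f3 us = Act (snd (snd (d us))) \<and> operator_algebra (fst (d us)) (fst (snd (d us))) (snd (snd (d us)))" ..
  define A K \<pi> where "A us = fst (d us)" and "K us = fst (snd (d us))" and "\<pi> us = snd (snd (d us))" for us
  have d: "f1 us = Alg (A us)" "f2 us = Hilb (K us)" "f3 us = Act (\<pi> us)" "operator_algebra (A us) (K us) (\<pi> us)" for us
    using d[rule_format, of us] by (simp_all only: A_def K_def \<pi>_def simp_thms)
  have fe: "f1 = (\<lambda>us. Alg (A us))" "f2 = (\<lambda>us. Hilb (K us))" "f3 = (\<lambda>us. Act (\<pi> us))" by (intro ext d(1-3))+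
  have v: "M = val xs (\<lambda>us. Alg (A us))" "H = val xs (\<lambda>us. Hilb (K us))" "\<rho> = val xs (\<lambda>us. Act (\<pi> us))"
    using q(1) by (simp_all add: Z fe)
  have pres: "op_pres U M H \<rho> xs A K \<pi>"
    by (intro op_pres.intro op_hull_axioms op_pres_axioms.intro v d(4))
  define el where "el x = (case x of Elem a \<Rightarrow> a | _ \<Rightarrow> undefined)" for x :: "('a, 'h, 'w) obj"
  define ve where "ve x = (case x of Vec a \<Rightarrow> a | _ \<Rightarrow> undefined)" for x :: "('a, 'h, 'w) obj"
  define as vs where "as = map (\<lambda>g us. el (g us)) (take ?n gs)" and "vs = map (\<lambda>g us. ve (g us)) (drop ?n gs)"
  have lg: "length gs = ?n + ?m" using q(4) by simp
  have las: "length as = ?n" "length vs = ?m" using lg by (simp_all add: as_def vs_def)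
  have B: "[(fs ! (js ! i)) us, (gs ! i) us] \<in> ?B (C i)" if "i < ?n + ?m" for us i
    using q(6)[rule_format, of i us] that by simp
  have w: "?ws ! i = val xs (gs ! i)" if "i < ?n + ?m" for i
    using arg_cong[OF q(2), of "\<lambda>l. l ! i"] that lg by simp
  have g1: "ys ! i = val xs (\<lambda>us. Elem ((as ! i) us)) \<and> asec A (as ! i)" if i: "i < ?n" for i
  proof -
    have *: "[Alg (A us), (gs ! i) us] \<in> obj_mem \<and> onorm (Alg (A us)) ((gs ! i) us) \<le> C i" for us
      using B[of i us] i js[of i] by (simp add: Z fe)
    have as: "(as ! i) us = el ((gs ! i) us)" for us using i lg by (simp add: as_def)
    have **: "(gs ! i) us = Elem ((as ! i) us) \<and> (as ! i) us \<in> carrier (A us)" for us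
      using conjunct1[OF *[of us]] unfolding as by (auto simp: el_def)
    then have "nrm (A us) ((as ! i) us) \<le> C i" for us using conjunct2[OF *[of us]] by simp
    then have "asec A (as ! i)" unfolding asec_def using ** by blast
    moreover have "gs ! i = (\<lambda>us. Elem ((as ! i) us))" using ** by (intro ext) blast
    ultimately show ?thesis using w[of i] i by (simp add: nth_append)
  qed
  have g2: "zs ! i = val xs (\<lambda>us. Vec ((vs ! i) us)) \<and> vsec K (vs ! i)" if i: "i < ?m" for i
  proof -
    let ?i = "?n + i"
    have *: "[Hilb (K us), (gs ! ?i) us] \<in> obj_mem \<and> onorm (Hilb (K us)) ((gs ! ?i) us) \<le> C ?i" for us
      using B[of ?i us] i js[of ?i] by (simp add: Z fe)
    have vs: "(vs ! i) us = ve ((gs ! ?i) us)" for us using i lg by (simp add: vs_def)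
    have **: "(gs ! ?i) us = Vec ((vs ! i) us) \<and> (vs ! i) us \<in> carrier (K us)" for us
      using conjunct1[OF *[of us]] unfolding vs by (auto simp: ve_def)
    then have "hnorm (K us) ((vs ! i) us) \<le> C ?i" for us using conjunct2[OF *[of us]] by simp
    then have "vsec K (vs ! i)" unfolding vsec_def using ** by blast
    moreover have "gs ! ?i = (\<lambda>us. Vec ((vs ! i) us))" using ** by (intro ext) blast
    ultimately show ?thesis using w[of ?i] i by (simp add: nth_append)
  qed
  have "ys = map (\<lambda>a. val xs (\<lambda>us. Elem (a us))) as" "zs = map (\<lambda>v. val xs (\<lambda>us. Vec (v us))) vs"
    using las g1 g2 by (auto intro!: nth_equalityI)
  moreover have "\<forall>a\<in>set as. asec A a" "\<forall>v\<in>set vs. vsec K v" using g1 g2 las by (simp_all add: all_set_conv_all_nth)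
  ultimately show ?thesis using pres by (intro exI[of _ xs] exI[of _ A] exI[of _ K] exI[of _ \<pi>] exI[of _ as] exI[of _ vs] conjI)
qed

lemma present_vecs:
  assumes "x \<in> Fin U H" "y \<in> Fin U H" "z \<in> Fin U H" "w \<in> Fin U H"
  obtains xs A K \<pi> a b c d where "op_pres U M H \<rho> xs A K \<pi>" "vsec K a" "vsec K b" "vsec K c" "vsec K d"
    "x = val xs (\<lambda>us. Vec (a us))" "y = val xs (\<lambda>us. Vec (b us))"
    "z = val xs (\<lambda>us. Vec (c us))" "w = val xs (\<lambda>us. Vec (d us))"
proof -
  have "set [] \<subseteq> Fin U M" "set [x, y, z, w] \<subseteq> Fin U H" using assms by simp_all
  from present_op[OF this] obtain xs A K \<pi> as vs where *: "op_pres U M H \<rho> xs A K \<pi>"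
    "[x, y, z, w] = map (\<lambda>v. val xs (\<lambda>us. Vec (v us))) vs" "\<forall>v\<in>set vs. vsec K v" by (elim exE conjE) (rule that)
  from *(2) obtain a b c d where l: "vs = [a, b, c, d]" and v: "x = val xs (\<lambda>us. Vec (a us))" "y = val xs (\<lambda>us. Vec (b us))"
    "z = val xs (\<lambda>us. Vec (c us))" "w = val xs (\<lambda>us. Vec (d us))" by (auto simp: Cons_eq_map_conv)
  show ?thesis by (rule that[OF *(1) _ _ _ _ v]) (use *(3) l in simp_all)
qed

lemma present_both:
  assumes "x \<in> Fin U M" "y \<in> Fin U M" "z \<in> Fin U H" "w \<in> Fin U H"
  obtains xs A K \<pi> a b c d where "op_pres U M H \<rho> xs A K \<pi>" "asec A a" "asec A b" "vsec K c" "vsec K d"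
    "x = val xs (\<lambda>us. Elem (a us))" "y = val xs (\<lambda>us. Elem (b us))"
    "z = val xs (\<lambda>us. Vec (c us))" "w = val xs (\<lambda>us. Vec (d us))"
proof -
  have "set [x, y] \<subseteq> Fin U M" "set [z, w] \<subseteq> Fin U H" using assms by simp_all
  from present_op[OF this] obtain xs A K \<pi> as vs where *: "op_pres U M H \<rho> xs A K \<pi>"
    "[x, y] = map (\<lambda>v. val xs (\<lambda>us. Elem (v us))) as" "[z, w] = map (\<lambda>v. val xs (\<lambda>us. Vec (v us))) vs"
    "\<forall>a\<in>set as. asec A a" "\<forall>v\<in>set vs. vsec K v" by (elim exE conjE) (rule that)
  from *(2) obtain a b where l: "as = [a, b]" and v: "x = val xs (\<lambda>us. Elem (a us))" "y = val xs (\<lambda>us. Elem (b us))"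
    by (auto simp: Cons_eq_map_conv)
  from *(3) obtain c d where m: "vs = [c, d]" and w: "z = val xs (\<lambda>us. Vec (c us))" "w = val xs (\<lambda>us. Vec (d us))"
    by (auto simp: Cons_eq_map_conv)
  show ?thesis by (rule that[OF *(1) _ _ _ _ v w]) (use *(4,5) l m in simp_all)
qed

end

lemma hilbert_hull_simps:
  "carrier (hilbert_hull U H) = hull_carrier U H" "add (hilbert_hull U H) = hull_add U H"
  "smult (hilbert_hull U H) = hull_smult U H" "zero (hilbert_hull U H) = halo U H (ext_fun U obj_zero [H])"
  "ip (hilbert_hull U H) S T = the_elem {std_part_cplx U (ext_fun U obj_ip [H, x, y]) | x y. x \<in> S \<and> y \<in> T}"
  by (simp_all add: hilbert_hull_def)

section \<open>Pointwise description of the Hilbert space hull\<close>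

context op_pres begin

abbreviation hv :: "(('a, 'h, 'w) obj list \<Rightarrow> 'h) \<Rightarrow> 's set" where
  "hv v \<equiv> halo U H (val xs (\<lambda>us. Vec (v us)))"

lemma vsecD: "vsec K v \<Longrightarrow> v us \<in> carrier (K us)" by (simp add: vsec_def)

lemma hv_eq_iff: "vsec K v \<Longrightarrow> vsec K w \<Longrightarrow>
    hv w = hv v \<longleftrightarrow> ((\<lambda>us. hnorm (K us) (w us \<ominus>\<^bsub>K us\<^esub> v us)) \<longlongrightarrow> 0) (dir xs)"
  using H.hc_eq_iff[of "\<lambda>us. Vec (v us)" "\<lambda>us. Vec (w us)"] by (simp add: sec_Vec)

lemma hv_add: "vsec K v \<Longrightarrow> vsec K w \<Longrightarrow> hull_add U H (hv v) (hv w) = hv (\<lambda>us. v us \<oplus>\<^bsub>K us\<^esub> w us)"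
  using H.hc_add[of "\<lambda>us. Vec (v us)" "\<lambda>us. Vec (w us)"] by (simp add: sec_Vec)

lemma hv_smult: "vsec K v \<Longrightarrow> hull_smult U H c (hv v) = hv (\<lambda>us. c \<odot>\<^bsub>K us\<^esub> v us)"
  using H.hc_smult[of "\<lambda>us. Vec (v us)" c] by (simp add: sec_Vec)

lemma hv_zero: "halo U H (ext_fun U obj_zero [H]) = hv (\<lambda>us. \<zero>\<^bsub>K us\<^esub>)"
  unfolding H.hc_zero by simp

lemma hv_carrier: "vsec K v \<Longrightarrow> hv v \<in> hull_carrier U H"
  using H.hc_carrier[of "\<lambda>us. Vec (v us)"] by (simp add: sec_Vec)

lemma vsec_Fin: "vsec K v \<Longrightarrow> val xs (\<lambda>us. Vec (v us)) \<in> Fin U H"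
  using H.sec_Fin[of "\<lambda>us. Vec (v us)"] by (simp add: sec_Vec)

lemma vsec_add: "vsec K v \<Longrightarrow> vsec K w \<Longrightarrow> vsec K (\<lambda>us. v us \<oplus>\<^bsub>K us\<^esub> w us)"
  using H.sec_add[of "\<lambda>us. Vec (v us)" "\<lambda>us. Vec (w us)"] by (simp add: sec_Vec)

lemma vsec_smult: "vsec K v \<Longrightarrow> vsec K (\<lambda>us. c \<odot>\<^bsub>K us\<^esub> v us)"
  using H.sec_smult[of "\<lambda>us. Vec (v us)" c] by (simp add: sec_Vec)

lemma vsec_zero: "vsec K (\<lambda>us. \<zero>\<^bsub>K us\<^esub>)"
  using H.sec_zero by (simp add: sec_Vec)

lemma vsec_act: "asec A a \<Longrightarrow> vsec K v \<Longrightarrow> vsec K (\<lambda>us. \<pi> us (a us) (v us))"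
proof -
  assume a: "asec A a" and v: "vsec K v"
  obtain C D where CD: "\<And>us. nrm (A us) (a us) \<le> C" "\<And>us. hnorm (K us) (v us) \<le> D"
    using a v by (auto simp: asec_def vsec_def)
  have "hnorm (K us) (\<pi> us (a us) (v us)) \<le> \<bar>C\<bar> * \<bar>D\<bar>" for us
  proof -
    have "hnorm (K us) (\<pi> us (a us) (v us)) \<le> nrm (A us) (a us) * hnorm (K us) (v us)"
      by (rule operator_algebra_bound[OF OA asecD[OF a] vsecD[OF v]])
    also have "\<dots> \<le> \<bar>C\<bar> * \<bar>D\<bar>"
      using CD[of us] pre_hilbert.hnorm_nonneg[OF K vsecD[OF v]] by (intro mult_mono) linarith+
    finally show ?thesis .
  qed
  moreover have "\<pi> us (a us) (v us) \<in> carrier (K us)" for us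
    by (rule pre_hilbert.bounded_opsD(2)[OF K star_representationD(1)[OF rep asecD[OF a]] vsecD[OF v]])
  ultimately show ?thesis unfolding vsec_def by blast
qed

lemma ip_limit_ex:
  assumes v: "vsec K v" and w: "vsec K w"
  shows "\<exists>l. ((\<lambda>us. ip (K us) (v us) (w us)) \<longlongrightarrow> l) (dir xs)"
proof -
  obtain C D where CD: "\<And>us. hnorm (K us) (v us) \<le> C" "\<And>us. hnorm (K us) (w us) \<le> D"
    using v w by (auto simp: vsec_def)
  have "cmod (ip (K us) (v us) (w us)) \<le> \<bar>C\<bar> * \<bar>D\<bar>" for us
  proof -
    interpret K: pre_hilbert "K us" by (rule K)
    have "cmod (ip (K us) (v us) (w us)) \<le> hnorm (K us) (v us) * hnorm (K us) (w us)"
      by (rule K.cauchy_schwarz[OF vsecD[OF v] vsecD[OF w]])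
    also have "\<dots> \<le> \<bar>C\<bar> * \<bar>D\<bar>"
      using CD[of us] K.hnorm_nonneg[OF vsecD[OF w]] by (intro mult_mono) linarith+
    finally show ?thesis .
  qed
  then have "eventually (\<lambda>us. ip (K us) (v us) (w us) \<in> cball 0 (\<bar>C\<bar> * \<bar>D\<bar>)) (dir xs)"
    by (intro always_eventually) simp
  from dir_tendsto[OF this] show ?thesis by auto
qed

end

lemma (in pre_hilbert) ip_diff_bound:
  assumes "x \<in> carrier K" "x' \<in> carrier K" "y \<in> carrier K" "y' \<in> carrier K"
  shows "cmod (ip K x' y' - ip K x y) \<le> hnorm K (x' \<ominus> x) * hnorm K y' + hnorm K x * hnorm K (y' \<ominus> y)"
proof -
  have "ip K x' y' - ip K x y = ip K (x' \<ominus> x) y' + ip K x (y' \<ominus> y)"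
    using assms by (simp add: ip_minus_left ip_minus_right)
  then have "cmod (ip K x' y' - ip K x y) \<le> cmod (ip K (x' \<ominus> x) y') + cmod (ip K x (y' \<ominus> y))"
    using norm_triangle_ineq by simp
  also have "\<dots> \<le> hnorm K (x' \<ominus> x) * hnorm K y' + hnorm K x * hnorm K (y' \<ominus> y)"
    using assms by (intro add_mono cauchy_schwarz M.minus_closed)
  finally show ?thesis .
qed

lemma (in pre_hilbert) star_representation_minus:
  assumes "pre_cstar A" "star_representation A K \<pi>" "a \<in> carrier A" "b \<in> carrier A" "x \<in> carrier K" "y \<in> carrier K"
  shows "\<pi> (a \<ominus>\<^bsub>A\<^esub> b) x = \<pi> a x \<ominus> \<pi> b x" "\<pi> a (x \<ominus> y) = \<pi> a x \<ominus> \<pi> a y"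
proof -
  interpret A: pre_cstar A by fact
  note r = star_representationD[OF assms(2)] and a = assms(3-)
  note c = bounded_opsD[OF r(1)]
  show "\<pi> (a \<ominus>\<^bsub>A\<^esub> b) x = \<pi> a x \<ominus> \<pi> b x"
    unfolding A.minus_eq_smult[OF a(1,2)] minus_eq_smult[OF c(2)[OF a(1,3)] c(2)[OF a(2,3)]]
      r(2)[OF a(1) A.smult_cl[OF a(2)]] r(5)[OF a(2)] using a by (simp add: bounded_ops_simps)
  show "\<pi> a (x \<ominus> y) = \<pi> a x \<ominus> \<pi> a y"
    unfolding minus_eq_smult[OF a(3,4)] minus_eq_smult[OF c(2)[OF a(1,3)] c(2)[OF a(1,4)]]
      c(3)[OF a(1) a(3) smult_cl[OF a(4)]] c(4)[OF a(1,4)] ..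
qed

lemma operator_algebra_diff_bound:
  assumes "operator_algebra A K \<pi>" "a \<in> carrier A" "a' \<in> carrier A" "x \<in> carrier K" "x' \<in> carrier K"
  shows "hnorm K (\<pi> a' x' \<ominus>\<^bsub>K\<^esub> \<pi> a x) \<le> nrm A a' * hnorm K (x' \<ominus>\<^bsub>K\<^esub> x) + nrm A (a' \<ominus>\<^bsub>A\<^esub> a) * hnorm K x"
proof -
  have rep: "star_representation A K \<pi>" and K: "hilbert_space K" and A: "cstar_algebra A"
    using assms by (auto simp: operator_algebra_def)
  interpret K: pre_hilbert K by (rule hilbert_space_pre_hilbert[OF K])
  interpret A: pre_cstar A by (rule cstar_algebra_pre_cstar[OF A])
  note c = K.bounded_opsD(2)[OF star_representationD(1)[OF rep]]
  note cc = c[OF assms(3,5)] c[OF assms(3,4)] c[OF assms(2,4)]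
  have "\<pi> a' x' \<ominus>\<^bsub>K\<^esub> \<pi> a x = (\<pi> a' x' \<ominus>\<^bsub>K\<^esub> \<pi> a' x) \<oplus>\<^bsub>K\<^esub> (\<pi> a' x \<ominus>\<^bsub>K\<^esub> \<pi> a x)"
    using cc by (simp only: K.M.minus_eq K.M.a_assoc K.M.a_inv_closed K.M.a_closed K.M.r_neg1 K.M.r_neg2)
  also have "\<dots> = \<pi> a' (x' \<ominus>\<^bsub>K\<^esub> x) \<oplus>\<^bsub>K\<^esub> \<pi> (a' \<ominus>\<^bsub>A\<^esub> a) x"
    using K.star_representation_minus[OF A.pre_cstar_axioms rep] assms by simp
  finally have "hnorm K (\<pi> a' x' \<ominus>\<^bsub>K\<^esub> \<pi> a x) \<le> hnorm K (\<pi> a' (x' \<ominus>\<^bsub>K\<^esub> x)) + hnorm K (\<pi> (a' \<ominus>\<^bsub>A\<^esub> a) x)"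
    using K.hnorm_add[OF c c] assms by simp
  also have "\<dots> \<le> nrm A a' * hnorm K (x' \<ominus>\<^bsub>K\<^esub> x) + nrm A (a' \<ominus>\<^bsub>A\<^esub> a) * hnorm K x"
    using assms by (intro add_mono operator_algebra_bound K.M.minus_closed A.minus_closed)
  finally show ?thesis .
qed

context op_hull begin

text \<open>Like multiplication, the inner product is uniformly continuous on bounded sets only; the
  bounds of the sections enter as the factors C and D.\<close>

lemma halo_ip:
  assumes x: "x \<in> Fin U H" "x' \<in> halo U H x" and y: "y \<in> Fin U H" "y' \<in> halo U H y"
  shows "std_part_cplx U (ext_fun U obj_ip [H, x', y']) = std_part_cplx U (ext_fun U obj_ip [H, x, y])"
proof (rule present_vecs[OF x(1) H.Fin_halo[OF x] y(1) H.Fin_halo[OF y]])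
  fix xs A K \<pi> v v' w w'
  assume pres: "op_pres U M H \<rho> xs A K \<pi>" and s: "vsec K v" "vsec K v'" "vsec K w" "vsec K w'"
    and e: "x = val xs (\<lambda>us. Vec (v us))" "x' = val xs (\<lambda>us. Vec (v' us))"
      "y = val xs (\<lambda>us. Vec (w us))" "y' = val xs (\<lambda>us. Vec (w' us))"
  interpret op_pres U M H \<rho> xs A K \<pi> by fact
  have eqs: "hv v' = hv v" "hv w' = hv w"
    using H.halo_eq[of x x'] H.halo_eq[of y y'] x y unfolding e Fin_def by blast+
  note lim = eqs(1)[unfolded hv_eq_iff[OF s(1,2)]] eqs(2)[unfolded hv_eq_iff[OF s(3,4)]]
  obtain C D where CD: "\<And>us. hnorm (K us) (v us) \<le> C" "\<And>us. hnorm (K us) (w' us) \<le> D"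
    using s by (auto simp: vsec_def)
  let ?d = "\<lambda>a b us. hnorm (K us) (a us \<ominus>\<^bsub>K us\<^esub> b us)"
  have 0: "((\<lambda>us. ?d v' v us * D + C * ?d w' w us) \<longlongrightarrow> 0) (dir xs)"
    using tendsto_add[OF tendsto_mult_left_zero[OF lim(1), of D] tendsto_mult_right_zero[OF lim(2), of C]] by simp
  have "((\<lambda>us. ip (K us) (v' us) (w' us) - ip (K us) (v us) (w us)) \<longlongrightarrow> 0) (dir xs)"
  proof (rule Lim_null_comparison[OF always_eventually[OF allI] 0])
    fix us
    interpret K: pre_hilbert "K us" by (rule K)
    note c = vsecD[OF s(1), of us] vsecD[OF s(2), of us] vsecD[OF s(3), of us] vsecD[OF s(4), of us]
    have "?d v' v us * hnorm (K us) (w' us) \<le> ?d v' v us * D" "hnorm (K us) (v us) * ?d w' w us \<le> C * ?d w' w us"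
      using c by (auto intro!: mult_left_mono mult_right_mono CD)
    then show "norm (ip (K us) (v' us) (w' us) - ip (K us) (v us) (w us)) \<le> ?d v' v us * D + C * ?d w' w us"
      using K.ip_diff_bound[OF c] by linarith
  qed
  moreover obtain l where l: "((\<lambda>us. ip (K us) (v us) (w us)) \<longlongrightarrow> l) (dir xs)" using ip_limit_ex[OF s(1,3)] ..
  ultimately have l': "((\<lambda>us. ip (K us) (v' us) (w' us)) \<longlongrightarrow> l) (dir xs)" using tendsto_add by fastforce
  have "ext_fun U obj_ip [H, x', y'] = val xs (\<lambda>us. Cplx (ip (K us) (v' us) (w' us)))"
    "ext_fun U obj_ip [H, x, y] = val xs (\<lambda>us. Cplx (ip (K us) (v us) (w us)))"
    unfolding e H_val val_args by simp_all
  then show ?thesis using std_part_cplx_val[OF l] std_part_cplx_val[OF l'] by simp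
qed

lemma halo_act:
  assumes x: "x \<in> Fin U M" "x' \<in> halo U M x" and y: "y \<in> Fin U H" "y' \<in> halo U H y"
  shows "halo U H (ext_fun U obj_act [\<rho>, x', y']) = halo U H (ext_fun U obj_act [\<rho>, x, y])"
proof (rule present_both[OF x(1) Fin_halo[OF x] y(1) H.Fin_halo[OF y]])
  fix xs A K \<pi> a a' v v'
  assume pres: "op_pres U M H \<rho> xs A K \<pi>" and s: "asec A a" "asec A a'" "vsec K v" "vsec K v'"
    and e: "x = val xs (\<lambda>us. Elem (a us))" "x' = val xs (\<lambda>us. Elem (a' us))"
      "y = val xs (\<lambda>us. Vec (v us))" "y' = val xs (\<lambda>us. Vec (v' us))"
  interpret op_pres U M H \<rho> xs A K \<pi> by fact
  have eqs: "ac a' = ac a" "hv v' = hv v"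
    using halo_eq[of x x'] H.halo_eq[of y y'] x y unfolding e Fin_def by blast+
  note lim = eqs(1)[unfolded ac_eq_iff[OF s(1,2)]] eqs(2)[unfolded hv_eq_iff[OF s(3,4)]]
  obtain C D where CD: "\<And>us. nrm (A us) (a' us) \<le> C" "\<And>us. hnorm (K us) (v us) \<le> D"
    using s by (auto simp: vsec_def asec_def)
  let ?d = "\<lambda>a b us. hnorm (K us) (a us \<ominus>\<^bsub>K us\<^esub> b us)" and ?e = "\<lambda>us. nrm (A us) (a' us \<ominus>\<^bsub>A us\<^esub> a us)"
  have "((\<lambda>us. C * ?d v' v us + ?e us * D) \<longlongrightarrow> 0) (dir xs)"
    using tendsto_add[OF tendsto_mult_right_zero[OF lim(2), of C] tendsto_mult_left_zero[OF lim(1), of D]] by simp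
  then have "(?d (\<lambda>us. \<pi> us (a' us) (v' us)) (\<lambda>us. \<pi> us (a us) (v us)) \<longlongrightarrow> 0) (dir xs)"
  proof (rule tendsto_0_le)
    fix us
    interpret A: pre_cstar "A us" by (rule A)
    interpret K: pre_hilbert "K us" by (rule K)
    note c = asecD[OF s(1), of us] asecD[OF s(2), of us] vsecD[OF s(3), of us] vsecD[OF s(4), of us]
    show "0 \<le> ?d (\<lambda>us. \<pi> us (a' us) (v' us)) (\<lambda>us. \<pi> us (a us) (v us)) us"
      using vsecD[OF vsec_act[OF s(1,3)]] vsecD[OF vsec_act[OF s(2,4)]] by simp
    have "nrm (A us) (a' us) * ?d v' v us \<le> C * ?d v' v us"
      using c by (intro mult_right_mono CD K.hnorm_nonneg K.M.minus_closed)
    moreover have "?e us * hnorm (K us) (v us) \<le> ?e us * D"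
      by (intro mult_left_mono CD A.nrm_nonneg A.minus_closed c)
    ultimately show "?d (\<lambda>us. \<pi> us (a' us) (v' us)) (\<lambda>us. \<pi> us (a us) (v us)) us \<le> C * ?d v' v us + ?e us * D"
      using operator_algebra_diff_bound[OF OA c] by linarith
  qed
  then have "hv (\<lambda>us. \<pi> us (a' us) (v' us)) = hv (\<lambda>us. \<pi> us (a us) (v us))"
    unfolding hv_eq_iff[OF vsec_act[OF s(1,3)] vsec_act[OF s(2,4)]] .
  moreover have "ext_fun U obj_act [\<rho>, x', y'] = val xs (\<lambda>us. Vec (\<pi> us (a' us) (v' us)))"
    "ext_fun U obj_act [\<rho>, x, y] = val xs (\<lambda>us. Vec (\<pi> us (a us) (v us)))"
    unfolding e \<rho>_val val_args by simp_all
  ultimately show ?thesis by simp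
qed

lemma Fin_members_H: "x \<in> Fin U H \<Longrightarrow> x \<in> members U H" by (simp add: Fin_def)

lemma present_hull_vecs:
  assumes "S \<in> hull_carrier U H" "T \<in> hull_carrier U H" "R \<in> hull_carrier U H"
  obtains xs A K \<pi> a b c where "op_pres U M H \<rho> xs A K \<pi>" "vsec K a" "vsec K b" "vsec K c"
    "S = halo U H (val xs (\<lambda>us. Vec (a us)))" "T = halo U H (val xs (\<lambda>us. Vec (b us)))"
    "R = halo U H (val xs (\<lambda>us. Vec (c us)))"
proof -
  obtain x y z where f: "x \<in> Fin U H" "y \<in> Fin U H" "z \<in> Fin U H" and S: "S = halo U H x" "T = halo U H y" "R = halo U H z"
    using assms unfolding hull_carrier_def by (elim imageE)
  show ?thesis
    by (rule present_vecs[OF f f(3)]) (rule that; simp only: S)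
qed

lemma present_hull_both:
  assumes "S \<in> hull_carrier U M" "T \<in> hull_carrier U M" "V \<in> hull_carrier U H" "W \<in> hull_carrier U H"
  obtains xs A K \<pi> a b c d where "op_pres U M H \<rho> xs A K \<pi>" "asec A a" "asec A b" "vsec K c" "vsec K d"
    "S = halo U M (val xs (\<lambda>us. Elem (a us)))" "T = halo U M (val xs (\<lambda>us. Elem (b us)))"
    "V = halo U H (val xs (\<lambda>us. Vec (c us)))" "W = halo U H (val xs (\<lambda>us. Vec (d us)))"
proof -
  obtain x y z w where f: "x \<in> Fin U M" "y \<in> Fin U M" "z \<in> Fin U H" "w \<in> Fin U H"
    and S: "S = halo U M x" "T = halo U M y" "V = halo U H z" "W = halo U H w"
    using assms unfolding hull_carrier_def by (elim imageE)
  show ?thesis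
    by (rule present_both[OF f]) (rule that; simp only: S)
qed

end

context op_pres begin

text \<open>\<open>the_elem\<close> is applied to a set of standard parts that all agree by
  \<open>halo_ip\<close>, so the inner product of the hull is the limit along the
  ultrafilter.\<close>

lemma ip_limit:
  assumes v: "vsec K v" and w: "vsec K w"
  shows "((\<lambda>us. ip (K us) (v us) (w us)) \<longlongrightarrow> ip (hilbert_hull U H) (hv v) (hv w)) (dir xs)"
proof -
  obtain l where l: "((\<lambda>us. ip (K us) (v us) (w us)) \<longlongrightarrow> l) (dir xs)" using ip_limit_ex[OF v w] ..
  let ?x = "val xs (\<lambda>us. Vec (v us))" and ?y = "val xs (\<lambda>us. Vec (w us))"
  have "ext_fun U obj_ip [H, ?x, ?y] = val xs (\<lambda>us. Cplx (ip (K us) (v us) (w us)))"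
    unfolding H_val val_args by simp
  then have sl: "std_part_cplx U (ext_fun U obj_ip [H, ?x, ?y]) = l" using std_part_cplx_val[OF l] by simp
  have self: "?x \<in> halo U H ?x" "?y \<in> halo U H ?y" by (intro H.halo_self Fin_members_H vsec_Fin v w)+
  have all: "std_part_cplx U (ext_fun U obj_ip [H, x, y]) = l" if "x \<in> hv v" "y \<in> hv w" for x y
    using halo_ip[OF vsec_Fin[OF v] that(1) vsec_Fin[OF w] that(2)] sl by simp
  have "{std_part_cplx U (ext_fun U obj_ip [H, x, y]) | x y. x \<in> hv v \<and> y \<in> hv w} = {l}"
  proof
    show "{l} \<subseteq> {std_part_cplx U (ext_fun U obj_ip [H, x, y]) | x y. x \<in> hv v \<and> y \<in> hv w}"
      using self sl by blast
    show "{std_part_cplx U (ext_fun U obj_ip [H, x, y]) | x y. x \<in> hv v \<and> y \<in> hv w} \<subseteq> {l}"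
      using all by blast
  qed
  then show ?thesis using l by (simp add: hilbert_hull_simps)
qed

lemma hnorm_limit:
  assumes v: "vsec K v"
  shows "((\<lambda>us. hnorm (K us) (v us)) \<longlongrightarrow> hnorm (hilbert_hull U H) (hv v)) (dir xs)"
  unfolding hnorm_def by (intro tendsto_intros ip_limit v)

lemma hull_act_hv:
  assumes a: "asec A a" and v: "vsec K v"
  shows "hull_act U H \<rho> (ac a) (hv v) = hv (\<lambda>us. \<pi> us (a us) (v us))"
proof -
  let ?x = "val xs (\<lambda>us. Elem (a us))" and ?y = "val xs (\<lambda>us. Vec (v us))"
  have "hull_act U H \<rho> (ac a) (hv v) = (\<Union>x\<in>ac a. \<Union>y\<in>hv v. halo U H (ext_fun U obj_act [\<rho>, x, y]))"
    unfolding hull_act_def using hv_carrier[OF v] by (simp add: hilbert_hull_simps)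
  also have "\<dots> = halo U H (ext_fun U obj_act [\<rho>, ?x, ?y])"
    by (intro UN_halo H.UN_halo halo_act Fin_members Fin_members_H asec_Fin vsec_Fin a v)
  also have "ext_fun U obj_act [\<rho>, ?x, ?y] = val xs (\<lambda>us. Vec (\<pi> us (a us) (v us)))"
    unfolding \<rho>_val val_args by simp
  finally show ?thesis .
qed

lemmas hv_simps = hv_add hv_smult hv_zero hv_carrier vsec_add vsec_smult vsec_zero vsec_act hull_act_hv

end

text \<open>For the limit of a Cauchy sequence, which saturation delivers only as a member of the
  internal space, at a standard distance from a finite one.\<close>

lemma (in hull_space) Fin_near:
  assumes x: "x \<in> Fin U Z0" and y: "y \<in> members U Z0"
    and near: "[Z0, y, x] \<in> ext U {[Z, y, x] | Z y x. onorm Z (obj_minus [Z, y, x]) < C}"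
  shows "y \<in> Fin U Z0"
proof -
  have xm: "x \<in> members U Z0" using x by (simp add: Fin_def)
  show ?thesis
  proof (rule present2[OF y xm])
    fix xs Z f g
    assume v: "Z0 = val xs Z" "y = val xs f" "x = val xs g" and N: "\<And>us. normed_obj (Z us)"
      and f: "\<And>us. [Z us, f us] \<in> obj_mem" and g: "\<And>us. [Z us, g us] \<in> obj_mem"
    have "map (val xs) [Z, f, g] \<in> ext U {[Z, y, x] | Z y x. onorm Z (obj_minus [Z, y, x]) < C}"
      using near v by simp
    then have d: "eventually (\<lambda>us. onorm (Z us) (obj_minus [Z us, f us, g us]) < C) (dir xs)"
      unfolding ext_map_val by simp
    obtain n :: nat where n: "eventually (\<lambda>us. onorm (Z us) (g us) < real n) (dir xs)"
      using x unfolding v Fin_val[OF N g] ..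
    obtain k :: nat where k: "real n + C < real k" using reals_Archimedean2 by blast
    from n d have "eventually (\<lambda>us. onorm (Z us) (f us) < real k) (dir xs)"
    proof eventually_elim
      case (elim us)
      then show ?case using normed_obj.onorm_diff_le[OF N g f, of us] k by linarith
    qed
    then show ?thesis unfolding v Fin_val[OF N f] by (rule exI)
  qed
qed

context op_hull begin

lemma hull_pre_hilbert: "pre_hilbert (hilbert_hull U H)"
proof -
  let ?V = "hilbert_hull U H"
  have "Module.module CC ?V" by (rule H.hull_module) (rule hilbert_hull_simps)+
  then interpret V: cmodule ?V by (simp add: cmodule_def)
  show ?thesis
  proof unfold_locales
    fix x y z assume c: "x \<in> carrier ?V" "y \<in> carrier ?V" "z \<in> carrier ?V"
    show "ip ?V (x \<oplus>\<^bsub>?V\<^esub> y) z = ip ?V x z + ip ?V y z"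
    proof (rule present_hull_vecs[OF c[unfolded hilbert_hull_simps]])
      fix xs A K \<pi> u v w
      assume pres: "op_pres U M H \<rho> xs A K \<pi>" and s: "vsec K u" "vsec K v" "vsec K w"
        and e: "x = halo U H (val xs (\<lambda>us. Vec (u us)))" "y = halo U H (val xs (\<lambda>us. Vec (v us)))"
          "z = halo U H (val xs (\<lambda>us. Vec (w us)))"
      interpret op_pres U M H \<rho> xs A K \<pi> by fact
      have eq: "ip (K us) (u us \<oplus>\<^bsub>K us\<^esub> v us) (w us) = ip (K us) (u us) (w us) + ip (K us) (v us) (w us)" for us
        by (intro pre_hilbert.ip_add_left[OF K] vsecD s)
      have "x \<oplus>\<^bsub>?V\<^esub> y = hv (\<lambda>us. u us \<oplus>\<^bsub>K us\<^esub> v us)" unfolding e by (simp only: hilbert_hull_simps(2) hv_simps s)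
      then show ?thesis unfolding e
        using tendsto_unique[OF dir_neq_bot ip_limit[OF vsec_add[OF s(1,2)] s(3)]]
          tendsto_add[OF ip_limit[OF s(1,3)] ip_limit[OF s(2,3)]] by (simp add: eq)
    qed
  next
    fix k x y assume c: "x \<in> carrier ?V" "y \<in> carrier ?V"
    have "ip ?V (k \<odot>\<^bsub>?V\<^esub> x) y = k * ip ?V x y \<and> ip ?V y x = cnj (ip ?V x y) \<and> 0 \<le> Re (ip ?V x x) \<and>
      (ip ?V x x = 0 \<longleftrightarrow> x = \<zero>\<^bsub>?V\<^esub>)"
    proof (rule present_hull_vecs[OF c[unfolded hilbert_hull_simps] c(2)[unfolded hilbert_hull_simps]])
      fix xs A K \<pi> u v
      assume pres: "op_pres U M H \<rho> xs A K \<pi>" and s: "vsec K u" "vsec K v"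
        and e: "x = halo U H (val xs (\<lambda>us. Vec (u us)))" "y = halo U H (val xs (\<lambda>us. Vec (v us)))"
      interpret op_pres U M H \<rho> xs A K \<pi> by fact
      have eq: "ip (K us) (k \<odot>\<^bsub>K us\<^esub> u us) (v us) = k * ip (K us) (u us) (v us)"
        "ip (K us) (v us) (u us) = cnj (ip (K us) (u us) (v us))" "0 \<le> Re (ip (K us) (u us) (u us))"
        "u us \<ominus>\<^bsub>K us\<^esub> \<zero>\<^bsub>K us\<^esub> = u us" "ip (K us) (u us) (u us) = of_real ((hnorm (K us) (u us))\<^sup>2)" for us
      proof -
        interpret K: pre_hilbert "K us" by (rule K)
        note c = vsecD[OF s(1), of us] vsecD[OF s(2), of us]
        show "ip (K us) (k \<odot>\<^bsub>K us\<^esub> u us) (v us) = k * ip (K us) (u us) (v us)"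
          "ip (K us) (v us) (u us) = cnj (ip (K us) (u us) (v us))" "0 \<le> Re (ip (K us) (u us) (u us))"
          "ip (K us) (u us) (u us) = of_real ((hnorm (K us) (u us))\<^sup>2)"
          by (intro K.ip_smult_left K.ip_cnj K.ip_nonneg K.ip_self c)+
        show "u us \<ominus>\<^bsub>K us\<^esub> \<zero>\<^bsub>K us\<^esub> = u us" using c by (simp add: K.minus_eq_smult)
      qed
      have "k \<odot>\<^bsub>?V\<^esub> x = hv (\<lambda>us. k \<odot>\<^bsub>K us\<^esub> u us)" unfolding e by (simp only: hilbert_hull_simps(3) hv_simps s)
      then have "ip ?V (k \<odot>\<^bsub>?V\<^esub> x) y = k * ip ?V x y" unfolding e
        using tendsto_unique[OF dir_neq_bot ip_limit[OF vsec_smult[OF s(1)] s(2)]]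
          tendsto_mult[OF tendsto_const ip_limit[OF s(1,2)], of k] by (simp add: eq)
      moreover have "ip ?V y x = cnj (ip ?V x y)" unfolding e
        using tendsto_unique[OF dir_neq_bot ip_limit[OF s(2,1)]]
          tendsto_cnj[OF ip_limit[OF s(1,2)]] eq(2) by simp
      moreover have "0 \<le> Re (ip ?V x x)" unfolding e
        by (rule tendsto_lowerbound[OF tendsto_Re[OF ip_limit[OF s(1,1)]] always_eventually dir_neq_bot]) (simp add: eq(3))
      \<comment> \<open>The form at x is the limit of the squared pointwise norms, so it vanishes
        exactly when these norms tend to 0.\<close>
      moreover have "ip ?V x x = 0 \<longleftrightarrow> x = \<zero>\<^bsub>?V\<^esub>"
      proof -
        let ?n = "\<lambda>us. hnorm (K us) (u us)"
        have "x = \<zero>\<^bsub>?V\<^esub> \<longleftrightarrow> (?n \<longlongrightarrow> 0) (dir xs)"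
          unfolding e hilbert_hull_simps hv_zero hv_eq_iff[OF vsec_zero s(1)] eq(4) ..
        also have "\<dots> \<longleftrightarrow> ((\<lambda>us. ip (K us) (u us) (u us)) \<longlongrightarrow> 0) (dir xs)"
        proof
          assume "(?n \<longlongrightarrow> 0) (dir xs)"
          from tendsto_of_real[OF tendsto_power[OF this, of 2]]
          show "((\<lambda>us. ip (K us) (u us) (u us)) \<longlongrightarrow> 0) (dir xs)" by (simp add: eq(5))
        next
          assume "((\<lambda>us. ip (K us) (u us) (u us)) \<longlongrightarrow> 0) (dir xs)"
          from tendsto_real_sqrt[OF tendsto_Re[OF this]] show "(?n \<longlongrightarrow> 0) (dir xs)" by (simp add: hnorm_def)
        qed
        also have "\<dots> \<longleftrightarrow> ip ?V x x = 0"
        proof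
          assume "((\<lambda>us. ip (K us) (u us) (u us)) \<longlongrightarrow> 0) (dir xs)"
          then show "ip ?V x x = 0" unfolding e by (rule tendsto_unique[OF dir_neq_bot ip_limit[OF s(1,1)]])
        next
          assume "ip ?V x x = 0"
          then show "((\<lambda>us. ip (K us) (u us) (u us)) \<longlongrightarrow> 0) (dir xs)" using ip_limit[OF s(1,1)] unfolding e by simp
        qed
        finally show ?thesis ..
      qed
      ultimately show ?thesis by (intro conjI)
    qed
    note this[THEN conjunct1] this[THEN conjunct2, THEN conjunct1] this[THEN conjunct2, THEN conjunct2, THEN conjunct1]
      this[THEN conjunct2, THEN conjunct2, THEN conjunct2]
    then show "ip ?V (k \<odot>\<^bsub>?V\<^esub> x) y = k * ip ?V x y" "ip ?V y x = cnj (ip ?V x y)" "0 \<le> Re (ip ?V x x)"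
      "ip ?V x x = 0 \<longleftrightarrow> x = \<zero>\<^bsub>?V\<^esub>" .
  qed
qed

end

context op_pres begin

lemma vsec_minus: "vsec K v \<Longrightarrow> vsec K w \<Longrightarrow> vsec K (\<lambda>us. v us \<ominus>\<^bsub>K us\<^esub> w us)"
  and hv_minus: "vsec K v \<Longrightarrow> vsec K w \<Longrightarrow> hv v \<ominus>\<^bsub>hilbert_hull U H\<^esub> hv w = hv (\<lambda>us. v us \<ominus>\<^bsub>K us\<^esub> w us)"
proof -
  assume v: "vsec K v" and w: "vsec K w"
  interpret V: pre_hilbert "hilbert_hull U H" by (rule hull_pre_hilbert)
  have eq: "v us \<ominus>\<^bsub>K us\<^esub> w us = v us \<oplus>\<^bsub>K us\<^esub> (-1) \<odot>\<^bsub>K us\<^esub> w us" for us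
  proof -
    interpret K: pre_hilbert "K us" by (rule K)
    show ?thesis by (rule K.minus_eq_smult[OF vsecD[OF v] vsecD[OF w]])
  qed
  show "vsec K (\<lambda>us. v us \<ominus>\<^bsub>K us\<^esub> w us)" unfolding eq by (intro vsec_add vsec_smult v w)
  have "hv v \<ominus>\<^bsub>hilbert_hull U H\<^esub> hv w = hv v \<oplus>\<^bsub>hilbert_hull U H\<^esub> (-1) \<odot>\<^bsub>hilbert_hull U H\<^esub> hv w"
    using hv_carrier[OF v] hv_carrier[OF w] by (intro V.minus_eq_smult) (simp_all only: hilbert_hull_simps(1))
  then show "hv v \<ominus>\<^bsub>hilbert_hull U H\<^esub> hv w = hv (\<lambda>us. v us \<ominus>\<^bsub>K us\<^esub> w us)"
    unfolding eq by (simp only: hilbert_hull_simps(2,3) hv_simps v w)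
qed

end

lemma (in pre_hilbert) hnorm_minus_triangle:
  assumes "x \<in> carrier K" "y \<in> carrier K" "z \<in> carrier K"
  shows "hnorm K (x \<ominus> z) \<le> hnorm K (x \<ominus> y) + hnorm K (y \<ominus> z)"
proof -
  have "x \<ominus> z = (x \<ominus> y) \<oplus> (y \<ominus> z)"
    using assms by (simp only: M.minus_eq M.a_assoc M.a_inv_closed M.a_closed M.r_neg1 M.r_neg2)
  then show ?thesis using hnorm_add[of "x \<ominus> y" "y \<ominus> z"] assms by simp
qed

section \<open>Completeness of the hull and the induced representation\<close>

context op_hull begin

text \<open>Saturation makes the hull complete. The limit is an internal vector within 1/(k+1) of
  the representative \<open>x (N k)\<close> for all k, and finitely many of these conditions are met
  by a far enough member of the sequence.\<close>

lemma hull_complete: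
  fixes s :: "nat \<Rightarrow> 's set"
  assumes s: "range s \<subseteq> carrier (hilbert_hull U H)"
    and cauchy: "\<And>e. e > 0 \<Longrightarrow> \<exists>N. \<forall>m\<ge>N. \<forall>n\<ge>N. hnorm (hilbert_hull U H) (s m \<ominus>\<^bsub>hilbert_hull U H\<^esub> s n) < e"
  shows "\<exists>l\<in>carrier (hilbert_hull U H). (\<lambda>n. hnorm (hilbert_hull U H) (s n \<ominus>\<^bsub>hilbert_hull U H\<^esub> l)) \<longlonglongrightarrow> 0"
proof -
  let ?V = "hilbert_hull U H"
  interpret V: pre_hilbert ?V by (rule hull_pre_hilbert)
  have "\<forall>n. \<exists>x. x \<in> Fin U H \<and> s n = halo U H x" using s unfolding hilbert_hull_simps hull_carrier_def by blast
  from choice[OF this] obtain x where x: "\<forall>n. x n \<in> Fin U H \<and> s n = halo U H (x n)" ..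
  have xF: "x n \<in> Fin U H" and sx: "s n = halo U H (x n)" for n using x by blast+
  have "\<forall>k. \<exists>N. \<forall>m\<ge>N. \<forall>n\<ge>N. hnorm ?V (s m \<ominus>\<^bsub>?V\<^esub> s n) < 1 / real (Suc k)" using cauchy by simp
  from choice[OF this] obtain N where N0: "\<forall>k. \<forall>m\<ge>N k. \<forall>n\<ge>N k. hnorm ?V (s m \<ominus>\<^bsub>?V\<^esub> s n) < 1 / real (Suc k)" ..
  define R :: "nat \<Rightarrow> ('a, 'h, 'w) obj list set" where
    "R k = {[Vec y, Hilb K, Vec x] | y K x. y \<in> carrier K \<and> hnorm K (y \<ominus>\<^bsub>K\<^esub> x) < 1 / real (Suc k)}" for k
  have "\<exists>y. \<forall>m. y # [H, x (N m)] \<in> ext U (R m)"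
  proof (rule saturation_lists)
    fix n
    define p where "p = Max (N ` {..n})"
    have "x p # [H, x (N m)] \<in> ext U (R m)" if m: "m \<le> n" for m
    proof (rule present_vecs[OF xF[of p] xF[of "N m"] xF[of p] xF[of p]])
      fix xs A K \<pi> v w
      assume pres: "op_pres U M H \<rho> xs A K \<pi>" and vw: "vsec K v" "vsec K w"
        and e: "x p = val xs (\<lambda>us. Vec (v us))" "x (N m) = val xs (\<lambda>us. Vec (w us))"
      interpret op_pres U M H \<rho> xs A K \<pi> by fact
      have "N m \<le> p" unfolding p_def using m by (intro Max_ge) auto
      then have "hnorm ?V (s p \<ominus>\<^bsub>?V\<^esub> s (N m)) < 1 / real (Suc m)" using N0 by blast
      then have "hnorm ?V (hv (\<lambda>us. v us \<ominus>\<^bsub>K us\<^esub> w us)) < 1 / real (Suc m)" unfolding sx e hv_minus[OF vw] .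
      then have "eventually (\<lambda>us. hnorm (K us) (v us \<ominus>\<^bsub>K us\<^esub> w us) < 1 / real (Suc m)) (dir xs)"
        by (rule order_tendstoD(2)[OF hnorm_limit[OF vsec_minus[OF vw]]])
      then have "eventually (\<lambda>us. map (\<lambda>f. f us) [\<lambda>us. Vec (v us), \<lambda>us. Hilb (K us), \<lambda>us. Vec (w us)] \<in> R m) (dir xs)"
        by eventually_elim (use vsecD[OF vw(1)] in \<open>simp add: R_def\<close>)
      then have "map (val xs) [\<lambda>us. Vec (v us), \<lambda>us. Hilb (K us), \<lambda>us. Vec (w us)] \<in> ext U (R m)"
        unfolding ext_map_val .
      then show ?thesis unfolding e H_val by simp
    qed
    then show "\<exists>y. \<forall>m\<le>n. y # [H, x (N m)] \<in> ext U (R m)" by blast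
  qed
  then obtain y where y: "\<And>m. [y, H, x (N m)] \<in> ext U (R m)" by blast
  have "map ((!) [y, H, x (N 0)]) [1, 0] \<in> ext U obj_mem"
    by (rule ext_proj[OF y]) (auto simp: R_def)
  then have ym: "y \<in> members U H" by (simp add: members_def)
  have "map ((!) [y, H, x (N 0)]) [1, 0, 2] \<in> ext U {[Z, y, x] | Z y x. onorm Z (obj_minus [Z, y, x]) < 1}"
    by (rule ext_proj[OF y]) (auto simp: R_def numeral_2_eq_2)
  then have yF: "y \<in> Fin U H" by (intro H.Fin_near[OF xF[of "N 0"] ym]) (simp add: numeral_2_eq_2)
  define l where "l = halo U H y"
  have sV: "s n \<in> carrier ?V" for n using s by blast
  have lV: "l \<in> carrier ?V" unfolding l_def hilbert_hull_simps hull_carrier_def using yF by blast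
  have near: "hnorm ?V (l \<ominus>\<^bsub>?V\<^esub> s (N m)) \<le> 1 / real (Suc m)" for m
  proof (rule present_vecs[OF yF xF[of "N m"] yF yF])
    fix xs A K \<pi> v w
    assume pres: "op_pres U M H \<rho> xs A K \<pi>" and vw: "vsec K v" "vsec K w"
      and e: "y = val xs (\<lambda>us. Vec (v us))" "x (N m) = val xs (\<lambda>us. Vec (w us))"
    interpret op_pres U M H \<rho> xs A K \<pi> by fact
    have "map (val xs) [\<lambda>us. Vec (v us), \<lambda>us. Hilb (K us), \<lambda>us. Vec (w us)] \<in> ext U (R m)"
      using y[of m] unfolding e H_val by simp
    then have "eventually (\<lambda>us. hnorm (K us) (v us \<ominus>\<^bsub>K us\<^esub> w us) \<le> 1 / real (Suc m)) (dir xs)"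
      unfolding ext_map_val by eventually_elim (simp add: R_def)
    then have "hnorm ?V (hv (\<lambda>us. v us \<ominus>\<^bsub>K us\<^esub> w us)) \<le> 1 / real (Suc m)"
      by (rule tendsto_upperbound[OF hnorm_limit[OF vsec_minus[OF vw]] _ dir_neq_bot])
    then show ?thesis unfolding l_def sx e hv_minus[OF vw] .
  qed
  have "(\<lambda>n. hnorm ?V (s n \<ominus>\<^bsub>?V\<^esub> l)) \<longlonglongrightarrow> 0"
  proof (rule LIMSEQ_I)
    fix e :: real assume "e > 0"
    then obtain m where m: "inverse (of_nat (Suc m)) < e / 2" using reals_Archimedean[of "e / 2"] by auto
    have "norm (hnorm ?V (s n \<ominus>\<^bsub>?V\<^esub> l) - 0) < e" if n: "n \<ge> N m" for n
    proof -
      have "hnorm ?V (s n \<ominus>\<^bsub>?V\<^esub> s (N m)) < 1 / real (Suc m)" using N0 n by blast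
      then show ?thesis
        using V.hnorm_minus_triangle[OF sV[of n] sV[of "N m"] lV] near[of m] m
          V.hnorm_minus_commute[OF lV sV[of "N m"]] V.hnorm_nonneg[OF V.M.minus_closed[OF sV[of n] lV]]
        by (simp add: inverse_eq_divide)
    qed
    then show "\<exists>no. \<forall>n\<ge>no. norm (hnorm ?V (s n \<ominus>\<^bsub>?V\<^esub> l) - 0) < e" by blast
  qed
  then show ?thesis using lV by blast
qed

lemma hull_hilbert_space: "hilbert_space (hilbert_hull U H)"
  unfolding hilbert_space_iff using hull_pre_hilbert hull_complete by blast

lemma hull_act_extensional: "hull_act U H \<rho> S \<in> extensional (carrier (hilbert_hull U H))"
  unfolding hull_act_def by simp

lemma hull_act_bounded:
  assumes "S \<in> carrier (ns_hull U M)"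
  shows "hull_act U H \<rho> S \<in> carrier (bounded_ops (hilbert_hull U H))"
proof -
  let ?V = "hilbert_hull U H" and ?T = "hull_act U H \<rho> S"
  interpret V: pre_hilbert ?V by (rule hull_pre_hilbert)
  have main: "?T x \<in> carrier ?V \<and> ?T (x \<oplus>\<^bsub>?V\<^esub> y) = ?T x \<oplus>\<^bsub>?V\<^esub> ?T y \<and> ?T (c \<odot>\<^bsub>?V\<^esub> x) = c \<odot>\<^bsub>?V\<^esub> ?T x \<and>
      hnorm ?V (?T x) \<le> nrm (ns_hull U M) S * hnorm ?V x"
    if c: "x \<in> carrier ?V" "y \<in> carrier ?V" for x y c
  proof (rule present_hull_both[OF assms[unfolded ns_hull_simps] assms[unfolded ns_hull_simps] c[unfolded hilbert_hull_simps]])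
    fix xs A K \<pi> a v w
    assume pres: "op_pres U M H \<rho> xs A K \<pi>" and s: "asec A a" "vsec K v" "vsec K w"
      and e: "S = halo U M (val xs (\<lambda>us. Elem (a us)))" "x = halo U H (val xs (\<lambda>us. Vec (v us)))"
        "y = halo U H (val xs (\<lambda>us. Vec (w us)))"
    interpret op_pres U M H \<rho> xs A K \<pi> by fact
    have p: "\<pi> us (a us) (v us \<oplus>\<^bsub>K us\<^esub> w us) = \<pi> us (a us) (v us) \<oplus>\<^bsub>K us\<^esub> \<pi> us (a us) (w us)"
      "\<pi> us (a us) (c \<odot>\<^bsub>K us\<^esub> v us) = c \<odot>\<^bsub>K us\<^esub> \<pi> us (a us) (v us)" for us
      using pre_hilbert.bounded_opsD(3,4)[OF K star_representationD(1)[OF rep asecD[OF s(1)]]] vsecD[OF s(2)] vsecD[OF s(3)]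
      by blast+
    have "?T x \<in> carrier ?V" unfolding e by (simp only: hilbert_hull_simps(1) hv_simps s)
    moreover have "?T (x \<oplus>\<^bsub>?V\<^esub> y) = ?T x \<oplus>\<^bsub>?V\<^esub> ?T y" unfolding e
      by (simp only: hilbert_hull_simps(2) hv_simps s p)
    moreover have "?T (c \<odot>\<^bsub>?V\<^esub> x) = c \<odot>\<^bsub>?V\<^esub> ?T x" unfolding e
      by (simp only: hilbert_hull_simps(3) hv_simps s p)
    moreover have "hnorm ?V (?T x) \<le> nrm (ns_hull U M) S * hnorm ?V x"
      unfolding e hull_act_hv[OF s(1,2)]
      by (rule tendsto_le[OF dir_neq_bot tendsto_mult[OF asec_norm_limit[OF s(1)] hnorm_limit[OF s(2)]]
            hnorm_limit[OF vsec_act[OF s(1,2)]] always_eventually])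
        (intro allI operator_algebra_bound[OF OA] asecD vsecD s)
    ultimately show ?thesis by (intro conjI)
  qed
  note m1 = main[THEN conjunct1] and m2 = main[THEN conjunct2, THEN conjunct1]
    and m3 = main[THEN conjunct2, THEN conjunct2, THEN conjunct1]
    and m4 = main[THEN conjunct2, THEN conjunct2, THEN conjunct2]
  show ?thesis
    by (rule V.bounded_opsI[OF hull_act_extensional m1 m2 m3 m4])
qed

text \<open>Over a common tuple the action is a family of representations. Equations between
  operators of the hull are checked at vectors, where they hold pointwise.\<close>

lemma hull_act_representation: "star_representation (ns_hull U M) (hilbert_hull U H) (hull_act U H \<rho>)"
proof -
  let ?A = "ns_hull U M" and ?V = "hilbert_hull U H" and ?\<pi> = "hull_act U H \<rho>"
  interpret V: pre_hilbert ?V by (rule hull_pre_hilbert)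
  interpret HA: pre_cstar ?A by (rule hull_pre_cstar)
  have main: "?\<pi> (S \<oplus>\<^bsub>?A\<^esub> T) x = ?\<pi> S x \<oplus>\<^bsub>?V\<^esub> ?\<pi> T x \<and> ?\<pi> (S \<otimes>\<^bsub>?A\<^esub> T) x = ?\<pi> S (?\<pi> T x) \<and> ?\<pi> \<one>\<^bsub>?A\<^esub> x = x \<and>
      ?\<pi> (c \<odot>\<^bsub>?A\<^esub> S) x = c \<odot>\<^bsub>?V\<^esub> ?\<pi> S x \<and> ip ?V (?\<pi> S x) y = ip ?V x (?\<pi> (adj ?A S) y)"
    if S: "S \<in> carrier ?A" "T \<in> carrier ?A" and x: "x \<in> carrier ?V" "y \<in> carrier ?V" for S T x y c
  proof (rule present_hull_both[OF S[unfolded ns_hull_simps] x[unfolded hilbert_hull_simps]])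
    fix xs A K \<pi> a b v w
    assume pres: "op_pres U M H \<rho> xs A K \<pi>" and s: "asec A a" "asec A b" "vsec K v" "vsec K w"
      and e: "S = halo U M (val xs (\<lambda>us. Elem (a us)))" "T = halo U M (val xs (\<lambda>us. Elem (b us)))"
        "x = halo U H (val xs (\<lambda>us. Vec (v us)))" "y = halo U H (val xs (\<lambda>us. Vec (w us)))"
    interpret op_pres U M H \<rho> xs A K \<pi> by fact
    have p: "\<pi> us (a us \<oplus>\<^bsub>A us\<^esub> b us) (v us) = \<pi> us (a us) (v us) \<oplus>\<^bsub>K us\<^esub> \<pi> us (b us) (v us)"
      "\<pi> us (a us \<otimes>\<^bsub>A us\<^esub> b us) (v us) = \<pi> us (a us) (\<pi> us (b us) (v us))"
      "\<pi> us \<one>\<^bsub>A us\<^esub> (v us) = v us" "\<pi> us (c \<odot>\<^bsub>A us\<^esub> a us) (v us) = c \<odot>\<^bsub>K us\<^esub> \<pi> us (a us) (v us)"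
      "ip (K us) (\<pi> us (a us) (v us)) (w us) = ip (K us) (v us) (\<pi> us (adj (A us) (a us)) (w us))" for us
    proof -
      interpret K: pre_hilbert "K us" by (rule K)
      note r = star_representationD[OF rep[of us]] and i = asecD[OF s(1), of us] asecD[OF s(2), of us]
        and j = vsecD[OF s(3), of us] vsecD[OF s(4), of us]
      show "\<pi> us (a us \<oplus>\<^bsub>A us\<^esub> b us) (v us) = \<pi> us (a us) (v us) \<oplus>\<^bsub>K us\<^esub> \<pi> us (b us) (v us)"
        "\<pi> us (a us \<otimes>\<^bsub>A us\<^esub> b us) (v us) = \<pi> us (a us) (\<pi> us (b us) (v us))"
        "\<pi> us (c \<odot>\<^bsub>A us\<^esub> a us) (v us) = c \<odot>\<^bsub>K us\<^esub> \<pi> us (a us) (v us)"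
        using r(2)[OF i] r(3)[OF i] r(5)[OF i(1)] j by (simp_all add: K.bounded_ops_simps)
      show "\<pi> us \<one>\<^bsub>A us\<^esub> (v us) = v us"
        using star_representationD(4)[OF rep[of us]] j by (simp add: K.bounded_ops_simps)
      show "ip (K us) (\<pi> us (a us) (v us)) (w us) = ip (K us) (v us) (\<pi> us (adj (A us) (a us)) (w us))"
        using r(6)[OF i(1)] j unfolding is_adjoint_def by blast
    qed
    have "?\<pi> (S \<oplus>\<^bsub>?A\<^esub> T) x = ?\<pi> S x \<oplus>\<^bsub>?V\<^esub> ?\<pi> T x" unfolding e
      by (simp only: ns_hull_simps(2) hilbert_hull_simps(2) ac_simps hv_simps s p(1))
    moreover have "?\<pi> (S \<otimes>\<^bsub>?A\<^esub> T) x = ?\<pi> S (?\<pi> T x)" unfolding e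
      by (simp only: ac_simps hv_simps s p(2))
    moreover have "?\<pi> \<one>\<^bsub>?A\<^esub> x = x" unfolding e
      by (simp only: ac_simps hv_simps s p(3))
    moreover have "?\<pi> (c \<odot>\<^bsub>?A\<^esub> S) x = c \<odot>\<^bsub>?V\<^esub> ?\<pi> S x" unfolding e
      by (simp only: ns_hull_simps(3) hilbert_hull_simps(3) ac_simps hv_simps s p(4))
    moreover have "ip ?V (?\<pi> S x) y = ip ?V x (?\<pi> (adj ?A S) y)"
    proof -
      have "?\<pi> S x = hv (\<lambda>us. \<pi> us (a us) (v us))" "?\<pi> (adj ?A S) y = hv (\<lambda>us. \<pi> us (adj (A us) (a us)) (w us))"
        unfolding e by (simp_all only: ac_simps hv_simps s)
      moreover note 1 = ip_limit[OF vsec_act[OF s(1,3)] s(4)] and 2 = ip_limit[OF s(3) vsec_act[OF asec_adj[OF s(1)] s(4)]]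
      ultimately show ?thesis using tendsto_unique[OF dir_neq_bot 1[unfolded p(5)] 2] e(3,4) by simp
    qed
    ultimately show ?thesis by (intro conjI)
  qed
  note m1 = main[THEN conjunct1] and t1 = main[THEN conjunct2]
  note m2 = t1[THEN conjunct1] and t2 = t1[THEN conjunct2]
  note m3 = t2[THEN conjunct1] and t3 = t2[THEN conjunct2]
  note m4 = t3[THEN conjunct1] and m5 = t3[THEN conjunct2]
  have extB: "S \<oplus>\<^bsub>bounded_ops ?V\<^esub> T \<in> extensional (carrier ?V)" "S \<otimes>\<^bsub>bounded_ops ?V\<^esub> T \<in> extensional (carrier ?V)"
    "\<one>\<^bsub>bounded_ops ?V\<^esub> \<in> extensional (carrier ?V)" "c \<odot>\<^bsub>bounded_ops ?V\<^esub> T \<in> extensional (carrier ?V)" for S T c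
    by (simp_all add: bounded_ops_def compose_extensional)
  have "?\<pi> \<in> ring_hom ?A (bounded_ops ?V)"
  proof (rule ring_hom_memI)
    fix S T assume S: "S \<in> carrier ?A"
    show "?\<pi> S \<in> carrier (bounded_ops ?V)" by (rule hull_act_bounded[OF S])
    assume T: "T \<in> carrier ?A"
    show "?\<pi> (S \<otimes>\<^bsub>?A\<^esub> T) = ?\<pi> S \<otimes>\<^bsub>bounded_ops ?V\<^esub> ?\<pi> T"
      by (rule extensionalityI[OF hull_act_extensional extB(2)]) (simp add: V.bounded_ops_simps m2[OF S T])
    show "?\<pi> (S \<oplus>\<^bsub>?A\<^esub> T) = ?\<pi> S \<oplus>\<^bsub>bounded_ops ?V\<^esub> ?\<pi> T"
      by (rule extensionalityI[OF hull_act_extensional extB(1)]) (simp add: V.bounded_ops_simps m1[OF S T])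
  next
    show "?\<pi> \<one>\<^bsub>?A\<^esub> = \<one>\<^bsub>bounded_ops ?V\<^esub>"
      by (rule extensionalityI[OF hull_act_extensional extB(3)])
        (simp add: V.bounded_ops_simps m3[OF HA.one_closed HA.one_closed])
  qed
  moreover have "?\<pi> (c \<odot>\<^bsub>?A\<^esub> S) = c \<odot>\<^bsub>bounded_ops ?V\<^esub> ?\<pi> S" if S: "S \<in> carrier ?A" for c S
    by (rule extensionalityI[OF hull_act_extensional extB(4)]) (simp add: V.bounded_ops_simps m4[OF S S])
  moreover have "is_adjoint ?V (?\<pi> S) (?\<pi> (adj ?A S))" if S: "S \<in> carrier ?A" for S
    unfolding is_adjoint_def using m5[OF S S] by blast
  ultimately show ?thesis unfolding star_representation_def by blast
qed

text \<open>At each index a vector of the unit ball nearly attains the norm of the difference of the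
  representatives. These vectors form a bounded section, at whose class the two operators agree; so
  the norms of the differences tend to 0.\<close>

lemma hull_act_inj: "inj_on (hull_act U H \<rho>) (carrier (ns_hull U M))"
proof (rule inj_onI)
  let ?\<pi> = "hull_act U H \<rho>"
  interpret V: pre_hilbert "hilbert_hull U H" by (rule hull_pre_hilbert)
  fix S T assume S: "S \<in> carrier (ns_hull U M)" "T \<in> carrier (ns_hull U M)" and eq: "?\<pi> S = ?\<pi> T"
  show "S = T"
  proof (rule present_hull_both[OF S[unfolded ns_hull_simps]])
    \<comment> \<open>The presentation asks for two vectors; the zero class serves as both.\<close>
    show "halo U H (ext_fun U obj_zero [H]) \<in> hull_carrier U H" "halo U H (ext_fun U obj_zero [H]) \<in> hull_carrier U H"
      using V.M.zero_closed by (simp_all only: hilbert_hull_simps)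
    fix xs A K \<pi> a b
    assume pres: "op_pres U M H \<rho> xs A K \<pi>" and s: "asec A a" "asec A b"
      and e: "S = halo U M (val xs (\<lambda>us. Elem (a us)))" "T = halo U M (val xs (\<lambda>us. Elem (b us)))"
    interpret op_pres U M H \<rho> xs A K \<pi> by fact
    have d: "b us \<ominus>\<^bsub>A us\<^esub> a us \<in> carrier (A us)" for us
      using asecD[OF s(1)] asecD[OF s(2)] pre_cstar.axioms(2)[OF A] by (simp add: ring.ring_simprules)
    have "\<forall>us. \<exists>v. v \<in> carrier (K us) \<and> hnorm (K us) v \<le> 1 \<and>
        nrm (A us) (b us \<ominus>\<^bsub>A us\<^esub> a us) \<le> 2 * hnorm (K us) (\<pi> us (b us \<ominus>\<^bsub>A us\<^esub> a us) v)"
      using operator_algebra_attained[OF OA d] by blast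
    from choice[OF this] obtain v where v: "\<forall>us. v us \<in> carrier (K us) \<and> hnorm (K us) (v us) \<le> 1 \<and>
        nrm (A us) (b us \<ominus>\<^bsub>A us\<^esub> a us) \<le> 2 * hnorm (K us) (\<pi> us (b us \<ominus>\<^bsub>A us\<^esub> a us) (v us))" ..
    have vs: "vsec K v" unfolding vsec_def using v by blast
    have "hv (\<lambda>us. \<pi> us (b us) (v us)) = hv (\<lambda>us. \<pi> us (a us) (v us))"
      using fun_cong[OF eq, of "hv v"] unfolding e hull_act_hv[OF s(1) vs] hull_act_hv[OF s(2) vs] by simp
    then have "((\<lambda>us. hnorm (K us) (\<pi> us (b us) (v us) \<ominus>\<^bsub>K us\<^esub> \<pi> us (a us) (v us))) \<longlongrightarrow> 0) (dir xs)"
      unfolding hv_eq_iff[OF vsec_act[OF s(1) vs] vsec_act[OF s(2) vs]] .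
    moreover have "\<pi> us (b us) (v us) \<ominus>\<^bsub>K us\<^esub> \<pi> us (a us) (v us) = \<pi> us (b us \<ominus>\<^bsub>A us\<^esub> a us) (v us)" for us
      using pre_hilbert.star_representation_minus(1)[OF K A rep asecD[OF s(2)] asecD[OF s(1)] vsecD[OF vs] vsecD[OF vs]] by simp
    ultimately have "((\<lambda>us. 2 * hnorm (K us) (\<pi> us (b us \<ominus>\<^bsub>A us\<^esub> a us) (v us))) \<longlongrightarrow> 0) (dir xs)"
      by (intro tendsto_mult_right_zero) simp
    then have "((\<lambda>us. nrm (A us) (b us \<ominus>\<^bsub>A us\<^esub> a us)) \<longlongrightarrow> 0) (dir xs)"
      by (rule tendsto_0_le) (use v pre_cstar.nrm_nonneg[OF A d] in blast)+
    then have "ac b = ac a" unfolding ac_eq_iff[OF s] .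
    then show "S = T" unfolding e ..
  qed
qed

end

section \<open>The dichotomy\<close>

lemma (in cmodule) lspan_insert:
  assumes "finite B" "insert b B \<subseteq> carrier V" "b \<notin> B" "v \<in> lspan (insert b B)"
  shows "\<exists>x. \<exists>w\<in>lspan B. v = x \<odot> b \<oplus> w"
proof -
  obtain c where "v = (\<Oplus>d\<in>insert b B. c d \<odot> d)" using assms(4) by (auto simp: lspan_def)
  also have "\<dots> = c b \<odot> b \<oplus> (\<Oplus>d\<in>B. c d \<odot> d)"
    using assms by (intro M.finsum_insert) auto
  finally show ?thesis unfolding lspan_def by blast
qed

text \<open>Induction on \<open>B\<close>: one vector of the family is used to eliminate a coordinate from the
  later ones, which keeps the biorthogonality.\<close>

lemma (in pre_cstar) no_infinite_biorthogonal:
  fixes v e :: "nat \<Rightarrow> 'a"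
  assumes "finite B" "B \<subseteq> carrier A" "\<And>i. v i \<in> lspan B" "\<And>i. v i \<in> carrier A" "\<And>i. e i \<in> carrier A"
    "\<And>i. v i \<otimes> e i \<noteq> \<zero>" "\<And>i j. i \<noteq> j \<Longrightarrow> v i \<otimes> e j = \<zero>"
  shows False
  using assms
proof (induction B arbitrary: v e rule: finite_induct)
  case empty
  have "lspan {} = {\<zero>}" by (simp add: lspan_def)
  then have "v 0 = \<zero>" using empty.prems(2)[of 0] by simp
  then show False using empty.prems(4,5)[of 0] by simp
next
  case (insert b B)
  note v = insert.prems(3) and e = insert.prems(4) and ne = insert.prems(5) and bi = insert.prems(6)
  have b: "b \<in> carrier A" and B: "B \<subseteq> carrier A" using insert.prems(1) by simp_all
  have "\<forall>i. \<exists>d. snd d \<in> lspan B \<and> v i = fst d \<odot> b \<oplus> snd d"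
  proof
    fix i
    from lspan_insert[OF insert.hyps(1) insert.prems(1) insert.hyps(2) insert.prems(2)[of i]]
    obtain x w where "w \<in> lspan B" "v i = x \<odot> b \<oplus> w" by blast
    then show "\<exists>d. snd d \<in> lspan B \<and> v i = fst d \<odot> b \<oplus> snd d" by (intro exI[of _ "(x, w)"]) simp
  qed
  from choice[OF this] obtain d where d: "\<forall>i. snd (d i) \<in> lspan B \<and> v i = fst (d i) \<odot> b \<oplus> snd (d i)" ..
  define x w where "x i = fst (d i)" and "w i = snd (d i)" for i
  have w: "w i \<in> lspan B" and vw: "v i = x i \<odot> b \<oplus> w i" for i
    using d[rule_format, of i] by (simp_all only: x_def w_def simp_thms)
  have wc: "w i \<in> carrier A" for i
  proof -
    obtain c where "w i = (\<Oplus>d\<in>B. c d \<odot> d)" using w[of i] by (auto simp: lspan_def)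
    then show ?thesis using B by (auto intro!: M.finsum_closed)
  qed
  show False
  proof (cases "\<forall>i. x i = 0")
    case True
    then have "v i = w i" for i using vw[of i] b wc[of i] by simp
    then have "v i \<in> lspan B" for i using w[of i] by simp
    from insert.IH[OF B this v e ne bi] show False .
  next
    case False
    then obtain k where k: "x k \<noteq> 0" by blast
    \<comment> \<open>The indices after k are kept, and \<open>t i * x k = - x (s i)\<close> makes
      the coordinate at b cancel. Products with \<open>e (s j)\<close> do not change, because
      \<open>v k \<otimes> e (s j)\<close> is zero.\<close>
    define s t where "s i = Suc (k + i)" and "t i = - (x (s i) / x k)" for i
    define u where "u i = v (s i) \<oplus> t i \<odot> v k" for i
    have s: "s i \<noteq> k" "s i = s j \<longleftrightarrow> i = j" for i j by (auto simp: s_def)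
    have uc: "u i \<in> carrier A" for i unfolding u_def using v by simp
    have mult: "u i \<otimes> e (s j) = v (s i) \<otimes> e (s j)" for i j
    proof -
      have "u i \<otimes> e (s j) = v (s i) \<otimes> e (s j) \<oplus> t i \<odot> (v k \<otimes> e (s j))"
        unfolding u_def using v e by (simp add: l_distr smult_mult_left)
      also have "v k \<otimes> e (s j) = \<zero>" using bi s(1)[of j] by metis
      finally show ?thesis using v e by simp
    qed
    have "u i = w (s i) \<oplus> t i \<odot> w k" for i
    proof -
      have "u i = (x (s i) \<odot> b \<oplus> (t i * x k) \<odot> b) \<oplus> (w (s i) \<oplus> t i \<odot> w k)"
        unfolding u_def vw[of "s i"] vw[of k] using b wc by (simp add: smult_add_right a_ac)
      also have "x (s i) \<odot> b \<oplus> (t i * x k) \<odot> b = \<zero>"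
        unfolding smult_add_left[OF b, symmetric] using k b by (simp add: t_def)
      finally show ?thesis using wc by simp
    qed
    then have ul: "u i \<in> lspan B" for i
      using lspan_add[OF insert.hyps(1) B w lspan_smult[OF insert.hyps(1) B w]] by simp
    show False
    proof (rule insert.IH[OF B ul uc])
      show "e (s i) \<in> carrier A" "u i \<otimes> e (s i) \<noteq> \<zero>" for i using e ne mult by simp_all
      show "u i \<otimes> e (s j) = \<zero>" if "i \<noteq> j" for i j unfolding mult using bi s(2) that by blast
    qed
  qed
qed

text \<open>Orthogonal nonzero projections form a biorthogonal system with themselves.\<close>

lemma (in pre_cstar) not_finite_dimensional:
  fixes p :: "nat \<Rightarrow> 'a"
  assumes "\<And>j. p j \<in> projections A" "\<And>j. p j \<noteq> \<zero>" "\<And>i j. i \<noteq> j \<Longrightarrow> p i \<otimes> p j = \<zero>"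
  shows "\<not> finite_dimensional A"
proof
  assume "finite_dimensional A"
  then obtain B where B: "finite B" "B \<subseteq> carrier A" "carrier A \<subseteq> lspan B" using finite_dimensional_iff by blast
  show False
    by (rule no_infinite_biorthogonal[OF B(1,2), of p p])
      (use assms projD(1)[OF assms(1)] projD(3)[OF assms(1)] B(3) in auto)
qed

theorem corollary29:
  fixes U :: "(('a, 'h, 'w) obj, 's) ns_universe"
    and \<kappa> :: "'k rel"
    and M :: 's
  assumes "nonstandard_universe \<kappa> U"
    and "internal_P_star_algebra U M"
  shows "(von_neumann_algebra TYPE('c) (ns_hull U M) \<longleftrightarrow> finite_dimensional (ns_hull U M)) \<and>
         (\<forall>H \<rho>. internal_operator_algebra U M H \<rho> \<longrightarrow>
            (von_neumann_on (hilbert_hull U H) (hull_act U H \<rho> ` carrier (ns_hull U M))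
               \<longleftrightarrow> finite_dimensional (ns_hull U M)))"
proof -
  interpret ns_objects U by (rule ns_objects.intro) (rule ns_saturatedI[OF assms(1)])
  let ?A = "ns_hull U M"
  have PM: "[M] \<in> ext U {[Alg A] | A. P_star_algebra A}"
    using assms(2) by (simp add: internal_P_star_algebra_def)
  have M0: "[M] \<in> ext U {[Alg A] | A. pre_cstar A}"
    by (rule ext_mono[OF PM]) (auto simp: P_star_algebra_def intro: cstar_algebra_pre_cstar)
  interpret alg_hull U M pre_cstar by (intro alg_hull.intro ns_objects_axioms alg_hull_axioms.intro M0)
  interpret HA: pre_cstar ?A by (rule hull_pre_cstar)
  have op: "hilbert_space (hilbert_hull U H) \<and> star_representation ?A (hilbert_hull U H) (hull_act U H \<rho>) \<and>
      inj_on (hull_act U H \<rho>) (carrier ?A)" if "internal_operator_algebra U M H \<rho>" for H \<rho>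
  proof -
    interpret op_hull U M H \<rho>
      by (intro op_hull.intro ns_objects_axioms op_hull_axioms.intro) (use that in \<open>simp add: internal_operator_algebra_def\<close>)
    show ?thesis using hull_hilbert_space hull_act_representation hull_act_inj by blast
  qed
  show ?thesis
  proof (cases "\<forall>n. [M] \<in> ext U {[Alg A] | A. pre_cstar A \<and> many_projections A n}")
    case True
    then have many: "[M] \<in> ext U {[Alg A] | A. pre_cstar A \<and> many_projections A n}" for n by (rule spec)
    from infinite_hull[OF M0 many] obtain p :: "nat \<Rightarrow> 's set"
      where p: "\<forall>j. p j \<in> projections ?A \<and> p j \<noteq> \<zero>\<^bsub>?A\<^esub>" "\<forall>i j. i \<noteq> j \<longrightarrow> p i \<otimes>\<^bsub>?A\<^esub> p j = \<zero>\<^bsub>?A\<^esub>"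
        "\<forall>q\<in>carrier ?A. (\<forall>j. p j \<otimes>\<^bsub>?A\<^esub> q = p j) \<longrightarrow>
          (\<exists>e\<in>carrier ?A. e \<noteq> \<zero>\<^bsub>?A\<^esub> \<and> e \<otimes>\<^bsub>?A\<^esub> q = e \<and> (\<forall>j. e \<otimes>\<^bsub>?A\<^esub> p j = \<zero>\<^bsub>?A\<^esub>))"
      by (elim exE conjE) (rule that)
    have pj: "p j \<in> projections ?A" "p j \<noteq> \<zero>\<^bsub>?A\<^esub>" for j using p(1) by blast+
    have orth: "p i \<otimes>\<^bsub>?A\<^esub> p j = \<zero>\<^bsub>?A\<^esub>" if "i \<noteq> j" for i j using p(2) that by blast
    have nfd: "\<not> finite_dimensional ?A" by (rule HA.not_finite_dimensional[OF pj orth])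
    \<comment> \<open>The contradiction is stated for Hilbert spaces over an arbitrary type, as it
      is applied to abstract representations and to the hull of H alike. The e found below q is
      orthogonal to all p j, so \<open>e = e \<otimes> q\<close> would be zero.\<close>
    have *: False if rep: "star_representation ?A K \<pi>" "inj_on \<pi> (carrier ?A)" "von_neumann_on K (\<pi> ` carrier ?A)"
      for K :: "'z hilb" and \<pi>
    proof -
      have "\<exists>q\<in>carrier ?A. (\<forall>j. p j \<otimes>\<^bsub>?A\<^esub> q = p j) \<and>
          (\<forall>e\<in>carrier ?A. (\<forall>j. e \<otimes>\<^bsub>?A\<^esub> p j = \<zero>\<^bsub>?A\<^esub>) \<longrightarrow> e \<otimes>\<^bsub>?A\<^esub> q = \<zero>\<^bsub>?A\<^esub>)"
        by (rule von_neumann_supremum[where p = p, OF HA.pre_cstar_axioms pj(1) _ rep]) (rule orth)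
      then obtain q where q: "q \<in> carrier ?A" "\<forall>j. p j \<otimes>\<^bsub>?A\<^esub> q = p j"
        "\<forall>e\<in>carrier ?A. (\<forall>j. e \<otimes>\<^bsub>?A\<^esub> p j = \<zero>\<^bsub>?A\<^esub>) \<longrightarrow> e \<otimes>\<^bsub>?A\<^esub> q = \<zero>\<^bsub>?A\<^esub>" by (elim bexE conjE) (rule that)
      obtain e where "e \<in> carrier ?A" "e \<noteq> \<zero>\<^bsub>?A\<^esub>" "e \<otimes>\<^bsub>?A\<^esub> q = e" "\<forall>j. e \<otimes>\<^bsub>?A\<^esub> p j = \<zero>\<^bsub>?A\<^esub>"
        using bspec[OF p(3) q(1), THEN mp, OF q(2)] by (elim bexE conjE) (rule that)
      then show False using q(3) by simp
    qed
    have "\<not> von_neumann_algebra TYPE('c) ?A" unfolding von_neumann_algebra_def using * by blast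
    moreover have "\<not> von_neumann_on (hilbert_hull U H) (hull_act U H \<rho> ` carrier ?A)"
      if "internal_operator_algebra U M H \<rho>" for H \<rho> using * op[OF that] by blast
    ultimately show ?thesis using nfd by blast
  next
    case False
    then obtain n where n: "[M] \<notin> ext U {[Alg A] | A. pre_cstar A \<and> many_projections A n}" by blast
    have "eventually (\<lambda>us. us \<in> {[Alg A] | A. P_star_algebra A}) (dir [M])"
      using PM by (simp only: ext_iff_eventually)
    \<comment> \<open>Because \<open>dir [M]\<close> is an ultrafilter, the failure of a transferred
      property at M is itself transferred, and can be combined with the property of being a
      P*-algebra.\<close>
    moreover have "eventually (\<lambda>us. \<not> us \<in> {[Alg A] | A. pre_cstar A \<and> many_projections A n}) (dir [M])"
      unfolding eventually_dir_not using n by (simp add: ext_iff_eventually)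
    ultimately have "eventually (\<lambda>us. us \<in> {[Alg A] | A. P_star_algebra A \<and> \<not> many_projections A n}) (dir [M])"
      by eventually_elim (auto simp: P_star_algebra_def intro: cstar_algebra_pre_cstar)
    then have "[M] \<in> ext U {[Alg A] | A. P_star_algebra A \<and> \<not> many_projections A n}"
      by (simp add: ext_iff_eventually)
    then interpret bounded_combs ?A n by (rule bounded_combs_hull)
    obtain P where "matrix_frame ?A P" using frame_exists ..
    then interpret matrix_frame ?A P .
    have "von_neumann_algebra TYPE('c) ?A" by (rule von_neumann)
    moreover have "von_neumann_on (hilbert_hull U H) (hull_act U H \<rho> ` carrier ?A)"
      if "internal_operator_algebra U M H \<rho>" for H \<rho>
      using finite_dimensional_von_neumann[OF HA.pre_cstar_axioms finite_dimensional] op[OF that] by blast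
    ultimately show ?thesis using finite_dimensional by blast
  qed
qed

end
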